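(* Let $G_1,G_2$ be finitely presented groups and let $G_1'\leq N_1\leq G_1$ and $G_2'\leq N_2\leq G_2$ be subgroups such that $G_1/N_1\cong G_2/N_2$. Assume that there are subgroups $N_1\leq K_1\leq G_1$ and $N_2\leq K_2\leq G_2$, both finitely generated and of co-rank $m$ and $k$ respectively, such that $$k+m=\operatorname{rk}G_1/N_1=\operatorname{rk}G_2/N_2.$$ Then there is some normal finitely presented fibre product $H$ in $G_1\times G_2$ with $H\cap G_i=N_i$ for $i=1,2$.
   Context: $G'$ denotes the commutator subgroup of $G$, and $\operatorname{rk}$ denotes the torsion-free rank of a finitely generated abelian group. A subgroup $K$ with $G'\leq K\leq G$ has co-rank $\operatorname{rk}G/K$ in $G$. A fibre product in $G_1\times G_2$ is a subgroup of the form $H_\mu=\{(g_1,g_2)\in G_1\times G_2\mid \mu(g_1M_1)=g_2M_2\}$ where $M_i\lhd G_i$ and $\mu:G_1/M_1\to G_2/M_2$ is an isomorphism; then $H_\mu\cap G_i=M_i$, where $G_1,G_2$ are identified with the factors $G_1\times 1$, $1\times G_2$. It is normal in $G_1\times G_2$ if and only if $G_i'\leq M_i$ for $i=1,2$. *)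

theory Defs
  imports "HOL-Algebra.Algebra"
begin

section \<open>Free groups\<close>

text \<open>
  A letter \<open>(x, True)\<close> stands for the generator \<open>x\<close> and \<open>(x, False)\<close> for its inverse. The
  free group on \<open>S\<close> is realised on the reduced words over \<open>S\<close>; the product of two reduced words
  is the reduced form of their concatenation.
\<close>

type_synonym 'x letter = "'x \<times> bool"

definition inv_letter :: "'x letter \<Rightarrow> 'x letter" where
  "inv_letter a = (fst a, \<not> snd a)"

fun reduced :: "'x letter list \<Rightarrow> bool" where
  "reduced (a # b # w) \<longleftrightarrow> b \<noteq> inv_letter a \<and> reduced (b # w)"
| "reduced _ \<longleftrightarrow> True"

fun push :: "'x letter \<Rightarrow> 'x letter list \<Rightarrow> 'x letter list" where
  "push a [] = [a]"
| "push a (b # w) = (if b = inv_letter a then w else a # b # w)"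

definition free_group :: "'x set \<Rightarrow> 'x letter list monoid" where
  "free_group S =
    \<lparr>carrier = {w \<in> lists (S \<times> UNIV). reduced w},
     monoid.mult = (\<lambda>u v. foldr push u v),
     one = []\<rparr>"

lemma inv_letter_inv_letter [simp]: "inv_letter (inv_letter a) = a"
  by (simp add: inv_letter_def)

lemma inv_letter_neq [simp]: "inv_letter a \<noteq> a" "a \<noteq> inv_letter a"
  by (auto simp: inv_letter_def prod_eq_iff)

lemma reduced_tl: "reduced (a # w) \<Longrightarrow> reduced w"
  by (cases w) auto

lemma reduced_push: "reduced w \<Longrightarrow> reduced (push a w)"
  by (cases w) (auto dest: reduced_tl)

lemma reduced_foldr_push: "reduced v \<Longrightarrow> reduced (foldr push u v)"
  by (induction u) (auto intro: reduced_push)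

lemma push_in_lists:
  "a \<in> S \<times> UNIV \<Longrightarrow> w \<in> lists (S \<times> UNIV) \<Longrightarrow> push a w \<in> lists (S \<times> UNIV)"
  by (cases w) auto

lemma foldr_push_in_lists:
  "u \<in> lists (S \<times> UNIV) \<Longrightarrow> v \<in> lists (S \<times> UNIV) \<Longrightarrow> foldr push u v \<in> lists (S \<times> UNIV)"
proof (induction u)
  case (Cons a u)
  then show ?case using push_in_lists[of a S "foldr push u v"] by simp
qed simp

lemma push_push_inv: "reduced w \<Longrightarrow> push a (push (inv_letter a) w) = w"
proof (cases w)
  case (Cons b w')
  assume "reduced w"
  with Cons show ?thesis by (cases w') auto
qed simp

lemma foldr_push_push:
  "reduced w \<Longrightarrow> foldr push (push a u) w = push a (foldr push u w)"
proof (cases u)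
  case (Cons b u')
  assume "reduced w"
  with Cons show ?thesis
    using push_push_inv[of "foldr push u' w" a] reduced_foldr_push[of w u'] by auto
qed simp

lemma foldr_push_assoc:
  "reduced w \<Longrightarrow> foldr push (foldr push u v) w = foldr push u (foldr push v w)"
  by (induction u) (auto simp: foldr_push_push)

lemma foldr_push_Nil: "reduced u \<Longrightarrow> foldr push u [] = u"
proof (induction u)
  case (Cons a u)
  then show ?case by (cases u) auto
qed simp

lemma foldr_push_append_inv:
  "reduced v \<Longrightarrow> foldr push (rev (map inv_letter u)) (foldr push u v) = v"
proof (induction u arbitrary: v)
  case (Cons a u)
  then show ?case
    using push_push_inv[of "foldr push u v" "inv_letter a"] by (simp add: reduced_foldr_push)
qed simp

lemma group_free_group: "group (free_group S)"
proof (rule groupI)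
  fix u assume u: "u \<in> carrier (free_group S)"
  let ?i = "rev (map inv_letter u)"
  let ?v = "foldr push ?i []"
  have "?i \<in> lists (S \<times> UNIV)"
    using u by (force simp: free_group_def inv_letter_def)
  then have "?v \<in> carrier (free_group S)"
    using foldr_push_in_lists[of ?i S "[]"] reduced_foldr_push[of "[]" ?i]
    by (simp add: free_group_def)
  moreover have "?v \<otimes>\<^bsub>free_group S\<^esub> u = \<one>\<^bsub>free_group S\<^esub>"
    using u foldr_push_assoc[of u ?i "[]"] foldr_push_append_inv[of "[]" u]
    by (simp add: free_group_def foldr_push_Nil)
  ultimately show "\<exists>v\<in>carrier (free_group S). v \<otimes>\<^bsub>free_group S\<^esub> u = \<one>\<^bsub>free_group S\<^esub>"
    by blast
next
  fix u v assume "u \<in> carrier (free_group S)" "v \<in> carrier (free_group S)"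
  then show "u \<otimes>\<^bsub>free_group S\<^esub> v \<in> carrier (free_group S)"
    using foldr_push_in_lists[of u S v] reduced_foldr_push[of v u] by (simp add: free_group_def)
qed (simp_all add: free_group_def foldr_push_assoc)


section \<open>Finitely generated and finitely presented groups\<close>

definition normal_closure :: "('a, 'c) monoid_scheme \<Rightarrow> 'a set \<Rightarrow> 'a set" where
  "normal_closure G R = \<Inter>{N. N \<lhd> G \<and> R \<subseteq> N}"

definition finitely_generated :: "('a, 'c) monoid_scheme \<Rightarrow> bool" where
  "finitely_generated G \<longleftrightarrow>
    (\<exists>S. finite S \<and> S \<subseteq> carrier G \<and> generate G S = carrier G)"

definition finitely_presented :: "('a, 'c) monoid_scheme \<Rightarrow> bool" where
  "finitely_presented G \<longleftrightarrow>
    (\<exists>(n::nat) R. finite R \<and> R \<subseteq> carrier (free_group {..<n}) \<and>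
       G \<cong> free_group {..<n} Mod normal_closure (free_group {..<n}) R)"


section \<open>Torsion-free rank\<close>

text \<open>
  The torsion-free rank of an abelian group (written multiplicatively) is the largest size of a
  \<open>\<int>\<close>-linearly independent subset. The maximum exists for finitely generated groups; the value
  is unspecified if independent subsets can be arbitrarily large.
\<close>

definition int_independent :: "('a, 'c) monoid_scheme \<Rightarrow> 'a set \<Rightarrow> bool" where
  "int_independent A B \<longleftrightarrow> finite B \<and> B \<subseteq> carrier A \<and>
    (\<forall>c::'a \<Rightarrow> int. (\<Otimes>\<^bsub>A\<^esub>b\<in>B. b [^]\<^bsub>A\<^esub> c b) = \<one>\<^bsub>A\<^esub> \<longrightarrow> (\<forall>b\<in>B. c b = 0))"

definition torsion_free_rank :: "('a, 'c) monoid_scheme \<Rightarrow> nat" where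
  "torsion_free_rank A = (GREATEST n. \<exists>B. int_independent A B \<and> card B = n)"

definition co_rank :: "('a, 'c) monoid_scheme \<Rightarrow> 'a set \<Rightarrow> nat" where
  "co_rank G K = torsion_free_rank (G Mod K)"


section \<open>Fibre products\<close>

text \<open>
  \<open>G Mod M\<close> consists of the right cosets of \<open>M\<close>, which agree with the left ones as \<open>M\<close> is normal.
\<close>

definition fibre_product ::
  "('a, 'c) monoid_scheme \<Rightarrow> ('b, 'd) monoid_scheme \<Rightarrow> 'a set \<Rightarrow> 'b set \<Rightarrow>
   ('a set \<Rightarrow> 'b set) \<Rightarrow> ('a \<times> 'b) set" where
  "fibre_product G1 G2 M1 M2 \<mu> =
    {(g1, g2) \<in> carrier (G1 \<times>\<times> G2). \<mu> (M1 #>\<^bsub>G1\<^esub> g1) = M2 #>\<^bsub>G2\<^esub> g2}"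

definition is_fibre_product ::
  "('a, 'c) monoid_scheme \<Rightarrow> ('b, 'd) monoid_scheme \<Rightarrow> ('a \<times> 'b) set \<Rightarrow> bool" where
  "is_fibre_product G1 G2 H \<longleftrightarrow>
    (\<exists>M1 M2 \<mu>. M1 \<lhd> G1 \<and> M2 \<lhd> G2 \<and> \<mu> \<in> iso (G1 Mod M1) (G2 Mod M2) \<and>
       H = fibre_product G1 G2 M1 M2 \<mu>)"

end

theory Submission
  imports Defs "HOL-Library.Sublist"
begin

text \<open>
Let \<open>F\<close> be a finitely generated free group mapping onto the fibre product \<open>H\<close>, and let \<open>A\<close> and \<open>B\<close> be the
kernels of the induced maps onto the finitely presented groups \<open>G\<^sub>2\<close> and \<open>G\<^sub>1\<close>. Then \<open>A\<close> and \<open>B\<close> are normally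
finitely generated and the kernel of \<open>F \<rightarrow> H\<close> is \<open>A \<inter> B\<close>.

Modulo \<open>[A, B]\<close> the group \<open>A \<inter> B\<close> is normally finitely generated for every choice of \<open>\<mu>\<close>: since \<open>AB\<close>
is free, \<open>A'[A, B] \<inter> B'[A, B] = [A, B]\<close>, so \<open>(A \<inter> B) / [A, B]\<close> is built from two abelian sections of \<open>A\<close>
and \<open>B\<close>. As \<open>F / AB\<close> is abelian, these are modules over a commutative Noetherian ring.

It remains to choose \<open>\<mu>\<close> so that finitely many relators make \<open>A\<close> and \<open>B\<close>, which lie over \<open>N\<^sub>1\<close> and \<open>N\<^sub>2\<close>,
commute. Let \<open>p\<^sub>c\<close> (\<open>c < k\<close>) be a basis of \<open>K\<^sub>1 / N\<^sub>1\<close> modulo torsion, completed by \<open>q\<^sub>i\<close> (\<open>i < m\<close>) to a basis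
of \<open>G\<^sub>1 / N\<^sub>1\<close>. As \<open>K\<^sub>1\<close> is finitely generated, \<open>N\<^sub>1\<close> is the union of subgroups \<open>D r\<close>, generated by the
conjugates of finitely many elements under words of length at most \<open>r\<close> in the \<open>p\<^sub>c\<close>, and conjugation by
\<open>q\<^sub>i\<close> maps \<open>D r\<close> into \<open>D (r + C)\<close>; likewise for \<open>N\<^sub>2\<close> with the roles of the two parts of the basis
exchanged. Now \<open>\<mu>\<close> identifies both quotients with one lattice with basis \<open>e\<close>, where
\<open>q\<^sub>i = e\<^sub>i + s (\<Sum>c. V i c * e\<^sub>m\<^sub>+\<^sub>c)\<close> and \<open>p\<^sub>c = e\<^sub>m\<^sub>+\<^sub>c\<close> in \<open>G\<^sub>1\<close>, and \<open>p'\<^sub>c = e\<^sub>m\<^sub>+\<^sub>c - s (\<Sum>i. V i c * e\<^sub>i)\<close> and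
\<open>q'\<^sub>i = e\<^sub>i\<close> in \<open>G\<^sub>2\<close>. The matrix \<open>V\<close> is such that every orthant contains a combination of the \<open>q\<^sub>i\<close> or one
of the \<open>p'\<^sub>c\<close>; for large \<open>s\<close> such an element moves far into the orthant while it
shifts the corresponding filtration only a little. Conjugating by it replaces a long word in a
commutation relation by shorter ones, so the relations for words of bounded length suffice.
\<close>

section \<open>Sign patterns of an integer matrix\<close>

text \<open>Words with equal exponents need not act alike, so the commutation relations are indexed
  by words and not by lattice points. Exchanging two neighbouring letters is justified only once the
  relations for the pieces on either side are known; the commutator of two letters lies in
  \<open>AB\<close>, and these relations absorb its two factors. The induction therefore runs over
  boxes that bound the oscillation of every letter within a word, not just its total exponent. To
  enlarge a box by one, an exponent vector on its boundary must be brought back by a vector with the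
  same sign in every coordinate, so each orthant needs a move. The spans of the \<open>q\<close> and
  of the \<open>p'\<close> in the overview are orthogonal, of ranks \<open>m\<close> and
  \<open>k\<close>; together they fill the lattice up to finite index because \<open>k + m\<close>
  is its rank, and for suitable \<open>V\<close> every open orthant meets one of them. The shift of
  the filtration is bounded by a constant times the sum of the absolute coefficients, independently
  of \<open>s\<close>, while the coordinates in the other directions are multiples of
  \<open>s\<close>. Hence \<open>s\<close> is fixed last.\<close>

definition sg :: "bool \<Rightarrow> int" where "sg b = (if b then 1 else -1)"

lemma sg_simps [simp]: "sg True = 1" "sg False = -1" "sg (\<not> b) = - sg b" "sg b * sg b = 1" "\<bar>sg b\<bar> = 1"
  by (auto simp: sg_def)

text \<open>The vectors (\<open>\<tau>\<close>, \<open>\<tau> V\<close>) and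
  (\<open>- V \<sigma>\<close>, \<open>\<sigma>\<close>) run through lattices of ranks
  \<open>m\<close> and \<open>k\<close> that are orthogonal to each other; one of them has to meet
  the open orthant with signs \<open>\<epsilon>\<close>, \<open>\<eta>\<close>. The sizes are
  parameters because the induction passes to submatrices of one \<open>V\<close>.\<close>

definition signs_realised ::
  "(nat \<Rightarrow> nat \<Rightarrow> int) \<Rightarrow> nat \<Rightarrow> nat \<Rightarrow> (nat \<Rightarrow> bool) \<Rightarrow> (nat \<Rightarrow> bool) \<Rightarrow> bool" where
  "signs_realised V m k \<epsilon> \<eta> \<longleftrightarrow>
    (\<exists>\<tau>. (\<forall>i<m. sg (\<epsilon> i) * \<tau> i > 0) \<and> (\<forall>c<k. sg (\<eta> c) * (\<Sum>i<m. \<tau> i * V i c) > 0)) \<or>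
    (\<exists>\<sigma>. (\<forall>c<k. sg (\<eta> c) * \<sigma> c > 0) \<and> (\<forall>i<m. sg (\<epsilon> i) * (\<Sum>c<k. V i c * \<sigma> c) < 0))"

lemma signs_realised_cong:
  assumes "\<And>i c. i < m \<Longrightarrow> c < k \<Longrightarrow> V i c = V' i c"
    "\<And>i. i < m \<Longrightarrow> \<epsilon> i = \<epsilon>' i" "\<And>c. c < k \<Longrightarrow> \<eta> c = \<eta>' c"
  shows "signs_realised V m k \<epsilon> \<eta> = signs_realised V' m k \<epsilon>' \<eta>'"
  using assms by (simp add: signs_realised_def)

lemma finite_bounded_support: "finite {f :: nat \<Rightarrow> bool. \<forall>i\<ge>N. \<not> f i}"
proof (rule finite_imageD)
  show "finite (Collect ` {f :: nat \<Rightarrow> bool. \<forall>i\<ge>N. \<not> f i})"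
    by (rule finite_subset[of _ "Pow {..<N}"]) (auto simp: not_le[symmetric])
qed (auto simp: inj_on_def)

text \<open>The integer \<open>e * a\<close> is at least 1, so the term with \<open>N\<close>
  outweighs \<open>b\<close>. Below, \<open>N\<close> is either the large corner entry or a factor
  that swamps one new row or column.\<close>

lemma scaled_sign:
  fixes a b N e :: int
  assumes "e * a > 0" "\<bar>b\<bar> < N" "\<bar>e\<bar> = 1"
  shows "e * (N * a + b) > 0"
proof -
  have "N * 1 \<le> N * (e * a)" using assms by (intro mult_left_mono) auto
  moreover have "\<bar>e * b\<bar> < N" using assms by (simp add: abs_mult)
  ultimately show ?thesis by (simp add: algebra_simps)
qed

text \<open>A large corner entry decides the new sign: if \<open>\<epsilon> m = \<eta> k\<close> then \<open>\<tau>\<close> of the matrix without column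
\<open>k\<close> also serves the new column, and otherwise \<open>\<sigma>\<close> of the matrix without row \<open>m\<close> serves the new row.\<close>

lemma signs_realised_step:
  assumes "signs_realised V (Suc m) k \<epsilon> \<eta>" "signs_realised V m (Suc k) \<epsilon> \<eta>"
  shows "\<forall>\<^sub>F x in at_top. signs_realised (V(m := (V m)(k := x))) (Suc m) (Suc k) \<epsilon> \<eta>"
proof (cases "\<epsilon> m = \<eta> k")
  case True
  from assms(1) consider
    \<tau> where "\<forall>i<Suc m. sg (\<epsilon> i) * \<tau> i > 0" "\<forall>c<k. sg (\<eta> c) * (\<Sum>i<Suc m. \<tau> i * V i c) > 0"
    | \<sigma> where "\<forall>c<k. sg (\<eta> c) * \<sigma> c > 0" "\<forall>i<Suc m. sg (\<epsilon> i) * (\<Sum>c<k. V i c * \<sigma> c) < 0"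
    unfolding signs_realised_def by blast
  then show ?thesis
  proof cases
    case 1
    have "\<forall>\<^sub>F x in at_top. x > \<bar>\<Sum>i<m. \<tau> i * V i k\<bar>" by (rule eventually_gt_at_top)
    then show ?thesis
    proof eventually_elim
      case (elim x)
      have "sg (\<eta> k) * (x * \<tau> m + (\<Sum>i<m. \<tau> i * V i k)) > 0"
        using 1 True elim by (intro scaled_sign) auto
      then show ?case
        unfolding signs_realised_def using 1 by (intro disjI1 exI[of _ \<tau>]) (auto simp: less_Suc_eq algebra_simps)
    qed
  next
    case 2
    show ?thesis
    proof (intro always_eventually allI)
      fix x
      define W where "W = V(m := (V m)(k := x))"
      \<comment> \<open>The old \<open>\<sigma>\<close> is scaled by more than any entry of the new
        column, which receives a coefficient of size one; so the row sums keep their signs for every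
        \<open>x\<close>.\<close>
      define N where "N = 1 + (\<Sum>i<Suc m. \<bar>W i k\<bar>)"
      let ?\<sigma> = "(\<lambda>c. N * \<sigma> c)(k := sg (\<eta> k))"
      have N: "\<bar>W i k\<bar> < N" if "i < Suc m" for i
        using member_le_sum[of i "{..<Suc m}" "\<lambda>i. \<bar>W i k\<bar>"] that by (simp add: N_def)
      have "N > 0" using N[of m] by simp
      have "sg (\<eta> c) * ?\<sigma> c > 0" if "c < Suc k" for c
        using that 2(1) \<open>N > 0\<close> scaled_sign[of "sg (\<eta> c)" "\<sigma> c" 0 N] by (cases "c = k") auto
      moreover have "sg (\<epsilon> i) * (\<Sum>c<Suc k. W i c * ?\<sigma> c) < 0" if i: "i < Suc m" for i
      proof -
        have "sg (\<not> \<epsilon> i) * (N * (\<Sum>c<k. V i c * \<sigma> c) + W i k * sg (\<eta> k)) > 0"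
          using 2(2) i N[OF i] by (intro scaled_sign) (auto simp: abs_mult)
        moreover have "(\<Sum>c<Suc k. W i c * ?\<sigma> c) = N * (\<Sum>c<k. V i c * \<sigma> c) + W i k * sg (\<eta> k)"
          by (simp add: sum_distrib_left W_def mult_ac)
        ultimately show ?thesis by simp
      qed
      ultimately show "signs_realised (V(m := (V m)(k := x))) (Suc m) (Suc k) \<epsilon> \<eta>"
        unfolding signs_realised_def W_def by blast
    qed
  qed
next
  case False
  then have sg: "sg (\<eta> k) = - sg (\<epsilon> m)" by (auto simp: sg_def)
  from assms(2) consider
    \<tau> where "\<forall>i<m. sg (\<epsilon> i) * \<tau> i > 0" "\<forall>c<Suc k. sg (\<eta> c) * (\<Sum>i<m. \<tau> i * V i c) > 0"
    | \<sigma> where "\<forall>c<Suc k. sg (\<eta> c) * \<sigma> c > 0" "\<forall>i<m. sg (\<epsilon> i) * (\<Sum>c<Suc k. V i c * \<sigma> c) < 0"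
    unfolding signs_realised_def by blast
  then show ?thesis
  proof cases
    case 2
    have "\<forall>\<^sub>F x in at_top. x > \<bar>\<Sum>c<k. V m c * \<sigma> c\<bar>" by (rule eventually_gt_at_top)
    then show ?thesis
    proof eventually_elim
      case (elim x)
      have "sg (\<eta> k) * (x * \<sigma> k + (\<Sum>c<k. V m c * \<sigma> c)) > 0"
        using 2 elim by (intro scaled_sign) auto
      then show ?case
        unfolding signs_realised_def using 2
        by (intro disjI2 exI[of _ \<sigma>]) (auto simp: less_Suc_eq algebra_simps sg)
    qed
  next
    case 1
    show ?thesis
    proof (intro always_eventually allI)
      fix x
      define W where "W = V(m := (V m)(k := x))"
      define N where "N = 1 + (\<Sum>c<Suc k. \<bar>W m c\<bar>)"
      let ?\<tau> = "(\<lambda>i. N * \<tau> i)(m := sg (\<epsilon> m))"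
      have N: "\<bar>W m c\<bar> < N" if "c < Suc k" for c
        using member_le_sum[of c "{..<Suc k}" "\<lambda>c. \<bar>W m c\<bar>"] that by (simp add: N_def)
      have "N > 0" using N[of k] by simp
      have "sg (\<epsilon> i) * ?\<tau> i > 0" if "i < Suc m" for i
        using that 1(1) \<open>N > 0\<close> scaled_sign[of "sg (\<epsilon> i)" "\<tau> i" 0 N] by (cases "i = m") auto
      moreover have "sg (\<eta> c) * (\<Sum>i<Suc m. ?\<tau> i * W i c) > 0" if c: "c < Suc k" for c
      proof -
        have "sg (\<eta> c) * (N * (\<Sum>i<m. \<tau> i * V i c) + sg (\<epsilon> m) * W m c) > 0"
          using 1(2) c N[OF c] by (intro scaled_sign) (auto simp: abs_mult)
        moreover have "(\<Sum>i<Suc m. ?\<tau> i * W i c) = N * (\<Sum>i<m. \<tau> i * V i c) + sg (\<epsilon> m) * W m c"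
          by (simp add: sum_distrib_left W_def mult_ac)
        ultimately show ?thesis by simp
      qed
      ultimately show "signs_realised (V(m := (V m)(k := x))) (Suc m) (Suc k) \<epsilon> \<eta>"
        unfolding signs_realised_def W_def by blast
    qed
  qed
qed

lemma signs_realised_all_step:
  assumes "\<forall>\<epsilon> \<eta>. signs_realised V (Suc m) k \<epsilon> \<eta>" "\<forall>\<epsilon> \<eta>. signs_realised V m (Suc k) \<epsilon> \<eta>"
  shows "\<exists>x. \<forall>\<epsilon> \<eta>. signs_realised (V(m := (V m)(k := x))) (Suc m) (Suc k) \<epsilon> \<eta>"
proof -
  \<comment> \<open>Sign patterns cut off after the relevant indices are finitely many, so a single
    \<open>x\<close> is large enough for all of them.\<close>
  let ?P = "{f :: nat \<Rightarrow> bool. \<forall>i\<ge>Suc m. \<not> f i} \<times> {f :: nat \<Rightarrow> bool. \<forall>i\<ge>Suc k. \<not> f i}"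
  let ?Q = "\<lambda>x \<epsilon> \<eta>. signs_realised (V(m := (V m)(k := x))) (Suc m) (Suc k) \<epsilon> \<eta>"
  have "\<forall>\<^sub>F x in at_top. \<forall>p\<in>?P. ?Q x (fst p) (snd p)"
    using assms signs_realised_step finite_bounded_support
    by (intro eventually_ball_finite finite_cartesian_product) auto
  then obtain x where P: "\<forall>p\<in>?P. ?Q x (fst p) (snd p)"
    unfolding eventually_at_top_linorder by blast
  have x: "?Q x \<epsilon> \<eta>" if "\<forall>i\<ge>Suc m. \<not> \<epsilon> i" "\<forall>i\<ge>Suc k. \<not> \<eta> i" for \<epsilon> \<eta>
    using bspec[OF P, of "(\<epsilon>, \<eta>)"] that by simp
  have "?Q x \<epsilon> \<eta>" for \<epsilon> \<eta>
  proof -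
    have "?Q x (\<lambda>i. i < Suc m \<and> \<epsilon> i) (\<lambda>c. c < Suc k \<and> \<eta> c)" by (rule x) auto
    moreover have "?Q x (\<lambda>i. i < Suc m \<and> \<epsilon> i) (\<lambda>c. c < Suc k \<and> \<eta> c) = ?Q x \<epsilon> \<eta>"
      by (rule signs_realised_cong) auto
    ultimately show ?thesis by simp
  qed
  then show ?thesis by blast
qed

text \<open>Row \<open>m\<close> is filled from left to right. The entry in column \<open>k\<close>
  needs the matrix without that column, which contains the part of the new row built so far, and the
  matrix without the new row. This is why all numbers of columns up to \<open>k\<close> are carried
  along.\<close>

lemma signs_realised_new_row:
  assumes "\<And>c \<epsilon> \<eta>. c \<le> k \<Longrightarrow> signs_realised V m c \<epsilon> \<eta>"
  shows "\<exists>r. \<forall>c\<le>k. \<forall>\<epsilon> \<eta>. signs_realised (V(m := r)) (Suc m) c \<epsilon> \<eta>"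
  using assms
proof (induction k)
  case 0
  have "signs_realised V (Suc m) 0 \<epsilon> \<eta>" for \<epsilon> \<eta> V
    unfolding signs_realised_def by (intro disjI1 exI[of _ "\<lambda>i. sg (\<epsilon> i)"]) auto
  then show ?case by auto
next
  case (Suc k)
  then obtain r where r: "signs_realised (V(m := r)) (Suc m) c \<epsilon> \<eta>" if "c \<le> k" for c \<epsilon> \<eta>
    by (meson le_SucI)
  have "signs_realised (V(m := r)) m (Suc k) \<epsilon> \<eta>" for \<epsilon> \<eta>
    using Suc.prems[of "Suc k" \<epsilon> \<eta>] by (subst signs_realised_cong[where V' = V]) auto
  with r[of k] obtain x where
    x: "signs_realised ((V(m := r))(m := ((V(m := r)) m)(k := x))) (Suc m) (Suc k) \<epsilon> \<eta>" for \<epsilon> \<eta>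
    using signs_realised_all_step[of "V(m := r)" m k] by blast
  have "signs_realised (V(m := r(k := x))) (Suc m) c \<epsilon> \<eta>" if "c \<le> Suc k" for c \<epsilon> \<eta>
  proof (cases "c = Suc k")
    case True
    then show ?thesis using x by simp
  next
    case False
    then show ?thesis using r[of c \<epsilon> \<eta>] that
      by (subst signs_realised_cong[where V' = "V(m := r)"]) auto
  qed
  then show ?case by blast
qed

theorem ex_sign_matrix: "\<exists>V. \<forall>c\<le>k. \<forall>\<epsilon> \<eta>. signs_realised V m c \<epsilon> \<eta>"
proof (induction m)
  case 0
  have "signs_realised V 0 c \<epsilon> \<eta>" for \<epsilon> \<eta> V c
    unfolding signs_realised_def by (intro disjI2 exI[of _ "\<lambda>i. sg (\<eta> i)"]) auto
  then show ?case by auto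
next
  case (Suc m)
  then show ?case using signs_realised_new_row by meson
qed

section \<open>Words and their exponents\<close>

definition proj :: "nat \<Rightarrow> nat letter list \<Rightarrow> bool list" where
  "proj c w = map snd (filter (\<lambda>a. fst a = c) w)"

definition exp_sum :: "bool list \<Rightarrow> int" where
  "exp_sum l = sum_list (map (\<lambda>b. if b then 1 else -1) l)"

text \<open>This bounds the oscillation of the walk with steps \<open>l\<close> and not only its end
  point. Such a bound passes to prefixes and suffixes, which a bound on the total exponent would not
  do.\<close>

definition range_le :: "int \<Rightarrow> bool list \<Rightarrow> bool" where
  "range_le r l \<longleftrightarrow> (\<forall>q. sublist q l \<longrightarrow> \<bar>exp_sum q\<bar> \<le> r)"

definition in_box :: "int \<Rightarrow> nat letter list \<Rightarrow> bool" where
  "in_box r w \<longleftrightarrow> (\<forall>c. range_le r (proj c w))"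

definition pow_word :: "int \<Rightarrow> bool list" where
  "pow_word z = replicate (nat \<bar>z\<bar>) (z \<ge> 0)"

definition monomial :: "nat list \<Rightarrow> (nat \<Rightarrow> int) \<Rightarrow> nat letter list" where
  "monomial L z = concat (map (\<lambda>c. map (Pair c) (pow_word (z c))) L)"

text \<open>The order between different letters is left open, because the words to be moved arise as
  suffixes whose order depends on the exponent vector under consideration.\<close>

definition has_exponents :: "nat \<Rightarrow> (nat \<Rightarrow> int) \<Rightarrow> nat letter list \<Rightarrow> bool" where
  "has_exponents n z h \<longleftrightarrow> h \<in> lists ({..<n} \<times> UNIV) \<and> (\<forall>c<n. proj c h = pow_word (z c))"

text \<open>The gain of a move: a word with exponents \<open>z\<close> is traded for words whose
  oscillation is smaller by at least one in every letter, just enough for a box to grow by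
  one.\<close>

definition narrow :: "nat \<Rightarrow> (nat \<Rightarrow> int) \<Rightarrow> nat letter list set \<Rightarrow> bool" where
  "narrow n z B \<longleftrightarrow> B \<subseteq> lists ({..<n} \<times> UNIV) \<and> (\<forall>b\<in>B. \<forall>c<n. range_le (\<bar>z c\<bar> - 1) (proj c b))"

definition swap1 :: "nat letter list \<Rightarrow> nat letter list \<Rightarrow> bool" where
  "swap1 w w' \<longleftrightarrow> (\<exists>u a b v. w = u @ [a, b] @ v \<and> w' = u @ [b, a] @ v \<and> fst a \<noteq> fst b)"

lemma proj_simps [simp]:
  "proj c [] = []"
  "proj c (a # w) = (if fst a = c then snd a # proj c w else proj c w)"
  "proj c (u @ v) = proj c u @ proj c v"
  "proj c (rev w) = rev (proj c w)"
  by (simp_all add: proj_def rev_filter rev_map)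

lemma exp_sum_simps [simp]:
  "exp_sum [] = 0"
  "exp_sum (b # l) = (if b then 1 else -1) + exp_sum l"
  "exp_sum (x @ y) = exp_sum x + exp_sum y"
  by (simp_all add: exp_sum_def)

lemma exp_sum_rev [simp]: "exp_sum (rev l) = exp_sum l"
  by (induction l) auto

lemma exp_sum_replicate [simp]: "exp_sum (replicate k b) = (if b then int k else - int k)"
  by (induction k) auto

lemma exp_sum_pow_word [simp]: "exp_sum (pow_word z) = z"
  by (simp add: pow_word_def)

lemma pow_word_0 [simp]: "pow_word 0 = []"
  by (simp add: pow_word_def)

lemma length_pow_word [simp]: "length (pow_word z) = nat \<bar>z\<bar>"
  by (simp add: pow_word_def)

lemma rev_pow_word [simp]: "rev (pow_word z) = pow_word z"
  by (simp add: pow_word_def)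

lemma pow_word_add:
  assumes "(0 \<le> a \<and> 0 \<le> b) \<or> (a \<le> 0 \<and> b \<le> 0)"
  shows "pow_word a @ pow_word b = pow_word (a + b)"
proof (cases "a = 0 \<or> b = 0")
  case False
  then show ?thesis using assms
    by (auto simp: pow_word_def nat_add_distrib replicate_add [symmetric])
qed auto

lemma abs_exp_sum_le: "\<bar>exp_sum l\<bar> \<le> int (length l)"
  by (induction l) auto

lemma range_leD: "range_le r l \<Longrightarrow> \<bar>exp_sum l\<bar> \<le> r"
  by (simp add: range_le_def)

lemma range_le_mono: "range_le r l \<Longrightarrow> r \<le> s \<Longrightarrow> range_le s l"
  by (force simp: range_le_def)

lemma range_le_sublist: "range_le r l \<Longrightarrow> sublist q l \<Longrightarrow> range_le r q"
  unfolding range_le_def by (meson sublist_order.order.trans)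

lemma range_le_appendD1: "range_le r (x @ y) \<Longrightarrow> range_le r x"
  and range_le_appendD2: "range_le r (x @ y) \<Longrightarrow> range_le r y"
  by (auto intro: range_le_sublist)

lemma range_le_length: "int (length l) \<le> r \<Longrightarrow> range_le r l"
  unfolding range_le_def
  by (meson abs_exp_sum_le of_nat_le_iff order_trans sublist_length_le)

lemma range_le_pow_word: "\<bar>z\<bar> \<le> r \<Longrightarrow> range_le r (pow_word z)"
  by (rule range_le_length) simp

lemma range_le_append:
  assumes "range_le r x" "range_le s y" "0 \<le> r" "0 \<le> s"
  shows "range_le (r + s) (x @ y)"
  unfolding range_le_def
proof (intro allI impI)
  fix q assume "sublist q (x @ y)"
  then consider "sublist q x" | "sublist q y"
    | q1 q2 where "q = q1 @ q2" "suffix q1 x" "prefix q2 y"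
    by (auto simp: sublist_append)
  then show "\<bar>exp_sum q\<bar> \<le> r + s"
  proof cases
    case 3
    then have "\<bar>exp_sum q1\<bar> \<le> r" "\<bar>exp_sum q2\<bar> \<le> s"
      using assms by (auto simp: range_le_def)
    then show ?thesis using 3 by auto
  next
    case 1
    then have "\<bar>exp_sum q\<bar> \<le> r" using assms(1) by (simp add: range_le_def)
    then show ?thesis using assms(4) by linarith
  next
    case 2
    then have "\<bar>exp_sum q\<bar> \<le> s" using assms(2) by (simp add: range_le_def)
    then show ?thesis using assms(3) by linarith
  qed
qed

text \<open>A sublist that straddles the gap keeps its exponent sum when the cancelling pair is put
  back.\<close>

lemma range_le_cancel:
  assumes "range_le r (x @ [s, \<not> s] @ y)"
  shows "range_le r (x @ y)"
  unfolding range_le_def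
proof (intro allI impI)
  fix q assume "sublist q (x @ y)"
  then consider "sublist q x" | "sublist q y"
    | q1 q2 where "q = q1 @ q2" "suffix q1 x" "prefix q2 y"
    by (auto simp: sublist_append)
  then show "\<bar>exp_sum q\<bar> \<le> r"
  proof cases
    case 3
    then have "sublist (q1 @ [s, \<not> s] @ q2) (x @ [s, \<not> s] @ y)"
      unfolding suffix_def prefix_def sublist_def by force
    then have "\<bar>exp_sum (q1 @ [s, \<not> s] @ q2)\<bar> \<le> r"
      using assms unfolding range_le_def by blast
    then show ?thesis using 3 by (auto split: if_splits)
  next
    case 1
    then show ?thesis using range_le_appendD1[OF assms] by (simp add: range_le_def)
  next
    case 2
    have "range_le r y" using range_le_appendD2[OF range_le_appendD2[OF assms]] .
    then show ?thesis using 2 by (simp add: range_le_def)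
  qed
qed

lemma range_le_rev [simp]: "range_le r (rev l) = range_le r l"
proof -
  have "range_le r (rev l)" if "range_le r l" for l
    unfolding range_le_def
  proof (intro allI impI)
    fix q assume "sublist q (rev l)"
    then have "sublist (rev q) l" by (metis rev_rev_ident sublist_rev)
    then show "\<bar>exp_sum q\<bar> \<le> r" using that unfolding range_le_def by (metis exp_sum_rev)
  qed
  from this[of l] this[of "rev l"] show ?thesis by auto
qed

lemma in_box_appendD1: "in_box r (x @ y) \<Longrightarrow> in_box r x"
  and in_box_appendD2: "in_box r (x @ y) \<Longrightarrow> in_box r y"
  by (auto simp: in_box_def intro: range_le_appendD1 range_le_appendD2)

lemma in_box_cancel:
  assumes "in_box r (x @ [a, inv_letter a] @ y)"
  shows "in_box r (x @ y)"
  unfolding in_box_def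
proof
  fix c
  have *: "range_le r (proj c (x @ [a, inv_letter a] @ y))"
    using assms by (simp add: in_box_def)
  show "range_le r (proj c (x @ y))"
  proof (cases "fst a = c")
    case True
    then have "proj c [a, inv_letter a] = [snd a, \<not> snd a]" by (simp add: inv_letter_def)
    then show ?thesis
      using * range_le_cancel[of r "proj c x" "snd a" "proj c y"] by (simp only: proj_simps)
  next
    case False
    then have "proj c [a, inv_letter a] = []" by (simp add: inv_letter_def)
    then show ?thesis using * by (simp only: proj_simps append_Nil)
  qed
qed

lemma in_box_cong: "(\<And>c. proj c w = proj c w') \<Longrightarrow> in_box r w = in_box r w'"
  by (simp add: in_box_def)

lemma in_box_rev [simp]: "in_box r (rev w) = in_box r w"
  by (simp add: in_box_def)

lemma swap1_proj: "swap1 w w' \<Longrightarrow> proj c w = proj c w'"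
  by (auto simp: swap1_def)

lemma swap1_length: "swap1 w w' \<Longrightarrow> length w = length w'"
  by (auto simp: swap1_def)

lemma swap1_lists: "swap1 w w' \<Longrightarrow> w \<in> lists A \<Longrightarrow> w' \<in> lists A"
  by (auto simp: swap1_def)

lemma swap1_Cons: "swap1 w w' \<Longrightarrow> swap1 (a # w) (a # w')"
  unfolding swap1_def by (metis append_Cons)

lemma swaps_Cons: "swap1\<^sup>*\<^sup>* w w' \<Longrightarrow> swap1\<^sup>*\<^sup>* (a # w) (a # w')"
  by (induction rule: rtranclp_induct) (auto intro: swap1_Cons rtranclp.rtrancl_into_rtrancl)

lemma swaps_move_front:
  "\<forall>b\<in>set x. fst b \<noteq> fst a \<Longrightarrow> swap1\<^sup>*\<^sup>* (a # x @ y) (x @ a # y)"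
proof (induction x)
  case (Cons b x)
  have "swap1 (a # b # x @ y) (b # a # x @ y)"
    unfolding swap1_def using Cons.prems
    by (metis append_Cons append_Nil list.set_intros(1))
  moreover have "swap1\<^sup>*\<^sup>* (b # a # x @ y) (b # x @ a # y)"
    using Cons by (intro swaps_Cons) auto
  ultimately show ?case by (simp add: converse_rtranclp_into_rtranclp)
qed simp

text \<open>The first letter of \<open>w\<close> is also the first letter with its index in
  \<open>w'\<close>. All letters before it there have other indices, so it can be swapped to the
  front.\<close>

lemma swaps_if_proj_eq:
  "(\<And>c. proj c w = proj c w') \<Longrightarrow> swap1\<^sup>*\<^sup>* w w'"
proof (induction w arbitrary: w')
  case Nil
  have "w' = []"
  proof (rule ccontr)
    assume "w' \<noteq> []"
    then obtain a v where "w' = a # v" by (cases w') auto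
    then show False using Nil[of "fst a"] by simp
  qed
  then show ?case by simp
next
  case (Cons a w)
  have "snd a # proj (fst a) w = proj (fst a) w'" using Cons.prems[of "fst a"] by simp
  then have "\<exists>b\<in>set w'. fst b = fst a"
    unfolding proj_def by (metis (mono_tags, lifting) filter_False list.distinct(1) list.simps(8))
  then obtain x b y where w': "w' = x @ b # y" "fst b = fst a" "\<forall>c\<in>set x. fst c \<noteq> fst a"
    using split_list_first_prop[of w' "\<lambda>b. fst b = fst a"] by blast
  have "proj (fst a) x = []" using w' by (auto simp: proj_def)
  then have "b = a" using Cons.prems[of "fst a"] w' by (auto simp: prod_eq_iff)
  have "proj c w = proj c (x @ y)" for c
    using Cons.prems[of c] w' \<open>b = a\<close> \<open>proj (fst a) x = []\<close> by (auto split: if_splits)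
  then have "swap1\<^sup>*\<^sup>* (a # w) (a # x @ y)" by (intro swaps_Cons Cons.IH)
  also have "swap1\<^sup>*\<^sup>* (a # x @ y) w'"
    using w' \<open>b = a\<close> swaps_move_front by auto
  finally show ?case .
qed

lemma bool_list_cases:
  fixes l :: "bool list"
  obtains "l = pow_word (exp_sum l)" | x s y where "l = x @ [s, \<not> s] @ y"
proof (cases "\<exists>x s y. l = x @ [s, \<not> s] @ y")
  case False
  have "l = pow_word (exp_sum l)" using False
  proof (induction l)
    case (Cons b l)
    have IH: "l = pow_word (exp_sum l)"
    proof (rule Cons.IH)
      show "\<nexists>x s y. l = x @ [s, \<not> s] @ y"
      proof
        assume "\<exists>x s y. l = x @ [s, \<not> s] @ y"
        then obtain x s y where "b # l = (b # x) @ [s, \<not> s] @ y" by auto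
        then show False using Cons.prems by blast
      qed
    qed
    show ?case
    proof (cases l)
      case (Cons b' l')
      have "b' = b"
      proof (rule ccontr)
        assume "b' \<noteq> b"
        then have "b # l = [] @ [b, \<not> b] @ l'" using Cons by simp
        then show False using Cons.prems by blast
      qed
      have "b \<in> set l" using Cons \<open>b' = b\<close> by simp
      then have "b \<in> set (pow_word (exp_sum l))" using IH by simp
      then have "b = (exp_sum l \<ge> 0)" by (simp add: pow_word_def)
      then have "pow_word (if b then 1 else -1) @ pow_word (exp_sum l)
            = pow_word ((if b then 1 else -1) + exp_sum l)"
        by (intro pow_word_add) auto
      moreover have "pow_word (if b then 1 else -1) = [b]" by (simp add: pow_word_def)
      ultimately show ?thesis using IH by auto
    qed (simp add: pow_word_def)
  qed simp
  then show ?thesis using that by blast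
qed (use that in blast)

text \<open>A change of sign within one projection can be made adjacent in the word by swaps and
  gives a cancelling pair. Words without such a change play the part of normal forms.\<close>

lemma word_cases:
  assumes "w \<in> lists ({..<n} \<times> UNIV)"
  obtains "\<And>c. proj c w = pow_word (exp_sum (proj c w))"
  | x a y where "swap1\<^sup>*\<^sup>* w (x @ [a, inv_letter a] @ y)"
proof (cases "\<forall>c. proj c w = pow_word (exp_sum (proj c w))")
  case False
  then obtain c where c: "proj c w \<noteq> pow_word (exp_sum (proj c w))" by blast
  then obtain x s y where xy: "proj c w = x @ [s, \<not> s] @ y"
    by (cases rule: bool_list_cases[of "proj c w"]) blast+
  let ?w = "map (Pair c) x @ [(c, s), inv_letter (c, s)] @ map (Pair c) y @ filter (\<lambda>a. fst a \<noteq> c) w"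
  have p: "proj d (map (Pair c) z) = (if c = d then z else [])" for d z
    by (induction z) auto
  have q: "proj d (filter (\<lambda>a. fst a \<noteq> c) w) = (if c = d then [] else proj d w)" for d
    by (induction w) auto
  have "proj d w = proj d ?w" for d
    using xy by (cases "d = c") (simp_all add: p q inv_letter_def)
  then have "swap1\<^sup>*\<^sup>* w ?w" by (rule swaps_if_proj_eq)
  then show ?thesis using that by blast
qed (use that in blast)

lemma proj_monomial:
  "distinct L \<Longrightarrow> proj c (monomial L z) = (if c \<in> set L then pow_word (z c) else [])"
proof (induction L)
  case (Cons d L)
  have p: "proj c (map (Pair d) l) = (if c = d then l else [])" for l
    by (induction l) auto
  show ?case using Cons by (auto simp: monomial_def p)
qed (simp add: monomial_def)

lemma monomial_in_lists: "set L \<subseteq> A \<Longrightarrow> monomial L z \<in> lists (A \<times> UNIV)"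
  by (auto simp: monomial_def)

lemma swaps_lists: "swap1\<^sup>*\<^sup>* w w' \<Longrightarrow> w \<in> lists A \<Longrightarrow> w' \<in> lists A"
  by (induction rule: rtranclp_induct) (use swap1_lists in blast)+

lemma swaps_proj: "swap1\<^sup>*\<^sup>* w w' \<Longrightarrow> proj c w = proj c w'"
  by (induction rule: rtranclp_induct) (auto dest: swap1_proj)

lemma swaps_length: "swap1\<^sup>*\<^sup>* w w' \<Longrightarrow> length w = length w'"
  by (induction rule: rtranclp_induct) (auto dest: swap1_length)

text \<open>\<open>E w\<close> will say that the conjugate of \<open>P1\<close> by the value of
  \<open>w\<close> commutes with \<open>P2\<close>. Exchanging two letters produces a factor in
  \<open>P1\<close> and one in \<open>P2\<close>, and the further premises of \<open>swap\<close>
  are relations by which these factors are absorbed.\<close>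

locale word_closure =
  fixes n :: nat and E :: "nat letter list \<Rightarrow> bool"
  assumes cancel: "\<lbrakk>u \<in> lists ({..<n} \<times> UNIV); v \<in> lists ({..<n} \<times> UNIV); fst a < n\<rbrakk>
      \<Longrightarrow> E (u @ [a, inv_letter a] @ v) \<longleftrightarrow> E (u @ v)"
    and swap: "\<lbrakk>u \<in> lists ({..<n} \<times> UNIV); v \<in> lists ({..<n} \<times> UNIV); fst a < n; fst b < n;
      fst a \<noteq> fst b; E u; E v; E (u @ [b, a]); E ([b, a] @ v); E (u @ [b, a] @ v)\<rbrakk>
      \<Longrightarrow> E (u @ [a, b] @ v)"
begin

abbreviation words :: "nat letter list set" where "words \<equiv> lists ({..<n} \<times> UNIV)"

text \<open>Induction on the length. By swaps a word of the box becomes one with a cancelling pair,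
  which reduces to a shorter word, or it becomes the word that \<open>mon\<close> supplies for its
  exponents. The pieces needed for each swap stay in the box.\<close>

lemma box_closed:
  assumes mon: "\<And>\<delta>. (\<And>c. c < n \<Longrightarrow> \<bar>\<delta> c\<bar> \<le> r) \<Longrightarrow>
      \<exists>w\<in>words. E w \<and> (\<forall>c<n. proj c w = pow_word (\<delta> c))"
    and "w \<in> words" "in_box r w"
  shows "E w"
  using assms(2,3)
proof (induction "length w" arbitrary: w rule: less_induct)
  case less
  have proj_ge: "proj c v = []" if "v \<in> words" "\<not> c < n" for c v
    using that by (auto simp: proj_def filter_empty_conv)
  have swap1: "E w2" if "swap1 w2 w1" "E w1" "w1 \<in> words" "in_box r w1" "length w1 = length w" for w1 w2
  proof -
    note asm = that
    obtain u a b v where uv: "w2 = u @ [a, b] @ v" "w1 = u @ [b, a] @ v" "fst a \<noteq> fst b"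
      using asm(1) unfolding swap1_def by blast
    have IH: "E x" if "length x < length w1" "x \<in> words" "in_box r x" for x
      using less.hyps[of x] that \<open>length w1 = length w\<close> by simp
    have mem: "u \<in> words" "v \<in> words" "fst a < n" "fst b < n"
      using \<open>w1 \<in> words\<close> uv by auto
    have box: "in_box r u" "in_box r v" "in_box r (u @ [b, a])" "in_box r ([b, a] @ v)"
      using \<open>in_box r w1\<close> uv in_box_appendD1 in_box_appendD2 by (metis append_assoc)+
    have "E u" "E v" using IH mem box uv by auto
    \<comment> \<open>For empty \<open>v\<close> this is \<open>w1\<close> itself, to which the
      induction hypothesis does not apply.\<close>
    moreover have "E (u @ [b, a])"
      by (cases "v = []") (use \<open>E w1\<close> IH[of "u @ [b, a]"] mem box uv in \<open>auto simp: mem_Times_iff\<close>)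
    moreover have "E ([b, a] @ v)"
      by (cases "u = []") (use \<open>E w1\<close> IH[of "[b,a] @ v"] mem box uv in \<open>auto simp: mem_Times_iff\<close>)
    ultimately show ?thesis using swap mem uv \<open>E w1\<close> by simp
  qed
  have swaps: "E w" if "swap1\<^sup>*\<^sup>* w w1" "E w1" for w1
    using that
  proof (induction rule: rtranclp_induct)
    case (step w2 w3)
    have "w3 \<in> words" "in_box r w3" "length w3 = length w"
      using step(1,2) less.prems swaps_lists swaps_length swaps_proj in_box_cong
      by (metis rtranclp.rtrancl_into_rtrancl)+
    then show ?case using step swap1 by blast
  qed auto
  show ?case
  proof (cases rule: word_cases[OF less.prems(1)])
    case 1
    have "\<bar>exp_sum (proj c w)\<bar> \<le> r" for c
      using less.prems(2) by (auto simp: in_box_def intro: range_leD)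
    then obtain w1 where w1: "w1 \<in> words" "E w1" "\<forall>c<n. proj c w1 = pow_word (exp_sum (proj c w))"
      using mon[of "\<lambda>c. exp_sum (proj c w)"] by auto
    have "proj c w = proj c w1" for c
      using 1[of c] w1 proj_ge less.prems(1) by (cases "c < n") auto
    then show ?thesis using swaps swaps_if_proj_eq w1 by blast
  next
    case (2 x a y)
    let ?w1 = "x @ [a, inv_letter a] @ y"
    have w1: "?w1 \<in> words" "in_box r ?w1" "length ?w1 = length w"
      using 2 less.prems swaps_lists swaps_length swaps_proj in_box_cong by metis+
    have "E (x @ y)"
      using less.hyps[of "x @ y"] w1 in_box_cancel by auto
    then have "E ?w1" using cancel[of x y a] w1 by auto
    then show ?thesis using swaps 2 by blast
  qed
qed

text \<open>The whole word may leave the box. A swap inside \<open>m\<close> only needs the prefix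
  up to the exchanged pair and the suffix from that pair on; these are pieces of
  \<open>\<alpha> @ m\<close> and \<open>m @ \<zeta>\<close>, which stay in the box.\<close>

lemma middle_normal_form:
  assumes box: "\<And>w. w \<in> words \<Longrightarrow> in_box r w \<Longrightarrow> E w"
    and "\<alpha> \<in> words" "\<zeta> \<in> words"
    and "m \<in> words" "in_box r (\<alpha> @ m)" "in_box r (m @ \<zeta>)" "E (\<alpha> @ m @ \<zeta>)"
    and "m' \<in> words" "\<And>c. proj c m' = pow_word (exp_sum (proj c m))"
  shows "E (\<alpha> @ m' @ \<zeta>)"
  using assms(4-)
proof (induction "length m" arbitrary: m rule: less_induct)
  case less
  have swap1: "E (\<alpha> @ m2 @ \<zeta>)"
    if "swap1 m1 m2" "E (\<alpha> @ m1 @ \<zeta>)" "m1 \<in> words" "in_box r (\<alpha> @ m1)" "in_box r (m1 @ \<zeta>)" for m1 m2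
  proof -
    note asm = that
    obtain u a b v where uv: "m1 = u @ [a, b] @ v" "m2 = u @ [b, a] @ v" "fst a \<noteq> fst b"
      using asm(1) unfolding swap1_def by blast
    have mem: "u \<in> words" "v \<in> words" "fst a < n" "fst b < n"
      using \<open>m1 \<in> words\<close> uv by auto
    have "in_box r ((\<alpha> @ u @ [a, b]) @ v)" "in_box r (u @ ([a, b] @ v @ \<zeta>))"
      using asm uv by auto
    then have "in_box r ((\<alpha> @ u) @ [a, b])" "in_box r ([a, b] @ (v @ \<zeta>))"
      using in_box_appendD1 in_box_appendD2 by (metis append_assoc)+
    moreover from this have "in_box r (\<alpha> @ u)" "in_box r (v @ \<zeta>)"
      using in_box_appendD1 in_box_appendD2 by blast+
    ultimately have "E (\<alpha> @ u)" "E (v @ \<zeta>)" "E ((\<alpha> @ u) @ [a, b])" "E ([a, b] @ (v @ \<zeta>))"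
      using mem assms(2,3) by (auto intro!: box)
    then show ?thesis
      using swap[of "\<alpha> @ u" "v @ \<zeta>" b a] asm(2) mem assms(2,3) uv by simp
  qed
  have swaps: "E (\<alpha> @ m1 @ \<zeta>)" if "swap1\<^sup>*\<^sup>* m m1" for m1
    using that
  proof (induction rule: rtranclp_induct)
    case (step m1 m2)
    have "m1 \<in> words" using step(1) less.prems(1) swaps_lists by blast
    moreover have "in_box r (\<alpha> @ m1)" "in_box r (m1 @ \<zeta>)"
      using less.prems(2,3) swaps_proj[OF step(1)] by (simp_all add: in_box_def)
    ultimately show ?case using step swap1 by blast
  qed (use less.prems in auto)
  show ?case
  proof (cases rule: word_cases[OF less.prems(1)])
    case 1
    have "proj c m = proj c m'" for c using 1[of c] less.prems(6) by simp
    then show ?thesis using swaps swaps_if_proj_eq by blast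
  next
    case (2 x a y)
    let ?m1 = "x @ [a, inv_letter a] @ y"
    have p: "proj c m = proj c ?m1" for c using 2 swaps_proj by blast
    have m1: "?m1 \<in> words" "length ?m1 = length m"
      using 2 less.prems swaps_lists swaps_length by metis+
    have b: "in_box r (\<alpha> @ ?m1)" "in_box r (?m1 @ \<zeta>)"
      using less.prems(2,3) in_box_cong[of "\<alpha> @ m" "\<alpha> @ ?m1"] in_box_cong[of "m @ \<zeta>" "?m1 @ \<zeta>"] p
      by (simp_all only: proj_simps(3))
    have "E ((\<alpha> @ x) @ [a, inv_letter a] @ (y @ \<zeta>))" using swaps[OF 2] by simp
    then have E: "E (\<alpha> @ (x @ y) @ \<zeta>)"
      using cancel[of "\<alpha> @ x" "y @ \<zeta>" a] m1 assms(2,3) by auto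
    show ?thesis
    proof (rule less.hyps[OF _ _ _ _ E])
      show "length (x @ y) < length m" using m1 by simp
      show "x @ y \<in> words" using m1 by auto
      show "in_box r (\<alpha> @ x @ y)" using in_box_cancel[of r "\<alpha> @ x" a y] b by simp
      show "in_box r ((x @ y) @ \<zeta>)" using in_box_cancel[of r x a "y @ \<zeta>"] b by simp
      show "m' \<in> words" by (fact less.prems)
      show "proj c m' = pow_word (exp_sum (proj c (x @ y)))" for c
        using less.prems(6)[of c] p[of c] by (auto simp: inv_letter_def)
    qed
  qed
qed

text \<open>The exponents \<open>\<delta>\<close> may leave the box by one. A word with these exponents is split as \<open>\<alpha> m h\<close> where \<open>h\<close>
has exponents \<open>z\<close>, so that replacing \<open>h\<close> by the narrower words of \<open>move\<close> leads back into the box.\<close>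

lemma extend_box_right:
  fixes \<delta> z :: "nat \<Rightarrow> int" and Z :: int
  assumes box: "\<And>w. w \<in> words \<Longrightarrow> in_box r w \<Longrightarrow> E w"
    and "3 * Z \<le> r"
    and \<delta>: "\<And>c. c < n \<Longrightarrow> \<bar>\<delta> c\<bar> \<le> r + 1"
    and z: "\<And>c. c < n \<Longrightarrow> z c \<noteq> 0 \<and> (z c > 0 \<longleftrightarrow> \<delta> c \<ge> 0) \<and> \<bar>z c\<bar> \<le> Z"
    and move: "\<And>h. has_exponents n z h \<Longrightarrow>
      \<exists>B. narrow n z B \<and> (\<forall>u\<in>words. (\<forall>b\<in>B. E (u @ b)) \<longrightarrow> E (u @ h))"
    and "0 \<le> Z"
  shows "\<exists>w\<in>words. E w \<and> (\<forall>c<n. proj c w = pow_word (\<delta> c))"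
proof -
  \<comment> \<open>In the other coordinates \<open>z c\<close> cannot be split off from
    \<open>\<delta> c\<close> without overshooting. The resulting oscillation is at most
    \<open>3 * Z\<close>, which the box tolerates.\<close>
  define big where "big c \<longleftrightarrow> \<bar>\<delta> c\<bar> > Z" for c
  define L where "L = filter big [0..<n]"
  define S where "S = filter (\<lambda>c. \<not> big c) [0..<n]"
  define sg :: "nat \<Rightarrow> int" where "sg c = (if \<delta> c \<ge> 0 then 1 else -1)" for c
  have L: "distinct L" "set L = {c. c < n \<and> big c}" by (auto simp: L_def)
  have S: "distinct S" "set S = {c. c < n \<and> \<not> big c}" by (auto simp: S_def)
  \<comment> \<open>In a big coordinate \<open>?\<alpha>\<close> keeps back one letter and
    \<open>?\<zeta>\<close> the \<open>\<bar>z c\<bar>\<close> letters of the move. So both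
    \<open>?\<alpha> @ ?m\<close> and \<open>?m @ ?\<zeta>\<close> fall short of
    \<open>\<delta> c\<close> by at least one and lie in the box.\<close>
  let ?\<alpha> = "monomial L sg" and ?\<zeta> = "monomial L z"
  let ?m1 = "monomial [0..<n] (\<lambda>c. if big c then \<delta> c - z c - sg c else \<delta> c - z c)"
  let ?m = "?m1 @ monomial S z"
  let ?m' = "monomial [0..<n] (\<lambda>c. if big c then \<delta> c - z c - sg c else \<delta> c)"
  let ?h = "monomial S z @ ?\<zeta>"
  have sub: "set L \<subseteq> {..<n}" "set S \<subseteq> {..<n}" "set [0..<n] \<subseteq> {..<n}" by (auto simp: L_def S_def)
  have memL: "monomial L f \<in> words" "monomial S f \<in> words" "monomial [0..<n] f \<in> words" for f
    using sub by (simp_all only: monomial_in_lists)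
  have mem: "?\<alpha> \<in> words" "?\<zeta> \<in> words" "?m1 \<in> words" "?m \<in> words" "?m' \<in> words" "?h \<in> words"
    "monomial S z \<in> words"
    by (simp_all only: append_in_lists_conv memL simp_thms)
  note pm = proj_monomial[OF L(1)] proj_monomial[OF S(1)] proj_monomial[of "[0..<n]", simplified]
  have ge_n: "proj c w = []" if "w \<in> words" "\<not> c < n" for c w
    using that by (auto simp: proj_def filter_empty_conv)
  have "0 \<le> r" using assms by linarith
  have inbox: "in_box r w" if "w \<in> words" "\<And>c. c < n \<Longrightarrow> range_le r (proj c w)" for w
    unfolding in_box_def
  proof
    fix c show "range_le r (proj c w)"
      using that ge_n[of w c] \<open>0 \<le> r\<close> by (cases "c < n") (auto intro: range_le_length)
  qed
  have same: "pow_word (a * sg c) @ pow_word (b * sg c) = pow_word ((a + b) * sg c)" if "0 \<le> a" "0 \<le> b" for a b c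
    unfolding distrib_right using that by (intro pow_word_add) (auto simp: sg_def)
  have zs: "z c = \<bar>z c\<bar> * sg c" and ds: "\<delta> c = \<bar>\<delta> c\<bar> * sg c" if "c < n" for c
    using z[OF that] by (auto simp: sg_def)
  have abs: "\<bar>a * sg c\<bar> = \<bar>a\<bar>" for a c by (simp add: sg_def abs_mult)
  have big1: "\<bar>z c\<bar> + 1 \<le> \<bar>\<delta> c\<bar>" "\<bar>z c\<bar> \<ge> 1" "\<bar>\<delta> c\<bar> \<le> r + 1" if "c < n" "big c" for c
    using that z[of c] \<delta>[of c] by (auto simp: big_def)
  have d1: "\<delta> c - z c - sg c = (\<bar>\<delta> c\<bar> - \<bar>z c\<bar> - 1) * sg c" if "c < n" for c
    using zs[OF that] ds[OF that] by (simp add: algebra_simps)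
  have pa: "proj c ?\<alpha> @ proj c ?m1 = pow_word ((\<bar>\<delta> c\<bar> - \<bar>z c\<bar>) * sg c)" if "c < n" "big c" for c
    using that same[of 1 "\<bar>\<delta> c\<bar> - \<bar>z c\<bar> - 1" c] big1[of c] by (simp add: pm L d1)
  have pz: "proj c ?m1 @ proj c ?\<zeta> = pow_word ((\<bar>\<delta> c\<bar> - 1) * sg c)" if "c < n" "big c" for c
    using that same[of "\<bar>\<delta> c\<bar> - \<bar>z c\<bar> - 1" "\<bar>z c\<bar>" c] big1[of c] zs[of c] by (simp add: pm L d1)
  have small: "range_le (2 * Z) (proj c ?m1)" if "c < n" "\<not> big c" for c
    using that z[of c] by (auto simp: pm big_def intro!: range_le_pow_word)
  \<comment> \<open>After the move a big coordinate oscillates by at most \<open>(\<bar>\<delta>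
    c\<bar> - \<bar>z c\<bar>) + (\<bar>z c\<bar> - 1)\<close>, that is by
    \<open>\<bar>\<delta> c\<bar> - 1\<close>, which is at most \<open>r\<close>.\<close>
  have "E ((?\<alpha> @ ?m1) @ ?h)"
  proof -
    have "has_exponents n z ?h"
      unfolding has_exponents_def using mem(6) by (simp add: pm L S)
    from move[OF this] obtain B where "narrow n z B \<and> (\<forall>u\<in>words. (\<forall>b\<in>B. E (u @ b)) \<longrightarrow> E (u @ ?h))"
      by (elim exE)
    then have B: "B \<subseteq> words" "\<And>b c. b \<in> B \<Longrightarrow> c < n \<Longrightarrow> range_le (\<bar>z c\<bar> - 1) (proj c b)"
      "\<And>u. u \<in> words \<Longrightarrow> (\<forall>b\<in>B. E (u @ b)) \<Longrightarrow> E (u @ ?h)"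
      unfolding narrow_def by blast+
    have "E ((?\<alpha> @ ?m1) @ b)" if "b \<in> B" for b
    proof (rule box)
      show "(?\<alpha> @ ?m1) @ b \<in> words" using mem B(1) that by auto
      then show "in_box r ((?\<alpha> @ ?m1) @ b)"
      proof (rule inbox)
        fix c assume c: "c < n"
        show "range_le r (proj c ((?\<alpha> @ ?m1) @ b))"
        proof (cases "big c")
          case True
          have "range_le (\<bar>\<delta> c\<bar> - \<bar>z c\<bar>) (proj c ?\<alpha> @ proj c ?m1)"
            unfolding pa[OF c True] using big1[OF c True]
            by (intro range_le_pow_word) (simp add: abs)
          from range_le_append[OF this B(2)[OF that c]]
          have "range_le (\<bar>\<delta> c\<bar> - 1) (proj c ((?\<alpha> @ ?m1) @ b))"
            using big1[OF c True] by simp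
          then show ?thesis by (rule range_le_mono) (use big1[OF c True] in simp)
        next
          case False
          have "range_le (2 * Z + (\<bar>z c\<bar> - 1)) (proj c ?m1 @ proj c b)"
            using small[OF c False] B(2)[OF that c] z[OF c] \<open>0 \<le> Z\<close> by (intro range_le_append) auto
          moreover have "proj c ?\<alpha> = []" using c False by (simp add: pm L)
          ultimately have "range_le (2 * Z + (\<bar>z c\<bar> - 1)) (proj c ((?\<alpha> @ ?m1) @ b))" by simp
          then show ?thesis by (rule range_le_mono) (use z[OF c] assms(2) in linarith)
        qed
      qed
    qed
    then show ?thesis using B(3)[of "?\<alpha> @ ?m1"] mem by auto
  qed
  then have "E (?\<alpha> @ ?m @ ?\<zeta>)" by simp
  moreover have "in_box r (?\<alpha> @ ?m)"
  proof (rule inbox)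
    show "?\<alpha> @ ?m \<in> words" using mem by auto
    fix c assume c: "c < n"
    show "range_le r (proj c (?\<alpha> @ ?m))"
    proof (cases "big c")
      case True
      then have "proj c (?\<alpha> @ ?m) = pow_word ((\<bar>\<delta> c\<bar> - \<bar>z c\<bar>) * sg c)"
        using pa[OF c True] by (simp add: pm S)
      then show ?thesis using big1[OF c True] by (simp only:) (intro range_le_pow_word, simp add: abs)
    next
      case False
      have "range_le (2 * Z + Z) (proj c ?m1 @ pow_word (z c))"
        using small[OF c False] z[OF c] \<open>0 \<le> Z\<close> by (intro range_le_append range_le_pow_word) auto
      then show ?thesis using c False assms(2) by (auto simp: pm L S intro: range_le_mono)
    qed
  qed
  moreover have "in_box r (?m @ ?\<zeta>)"
  proof (rule inbox)
    show "?m @ ?\<zeta> \<in> words" using mem by auto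
    fix c assume c: "c < n"
    show "range_le r (proj c (?m @ ?\<zeta>))"
    proof (cases "big c")
      case True
      then have "proj c (?m @ ?\<zeta>) = pow_word ((\<bar>\<delta> c\<bar> - 1) * sg c)"
        using pz[OF c True] by (simp add: pm S)
      then show ?thesis using big1[OF c True] by (simp only:) (intro range_le_pow_word, simp add: abs)
    next
      case False
      have "range_le (2 * Z + Z) (proj c ?m1 @ pow_word (z c))"
        using small[OF c False] z[OF c] \<open>0 \<le> Z\<close> by (intro range_le_append range_le_pow_word) auto
      then show ?thesis using c False assms(2) by (auto simp: pm L S intro: range_le_mono)
    qed
  qed
  moreover have "proj c ?m' = pow_word (exp_sum (proj c ?m))" for c
    by (cases "c < n") (auto simp: pm S)
  \<comment> \<open>In the coordinates that are not big the middle part contains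
    \<open>\<delta> c - z c\<close> followed by \<open>z c\<close>, possibly of opposite signs; its
    normal form merges them into \<open>\<delta> c\<close>.\<close>
  ultimately have "E (?\<alpha> @ ?m' @ ?\<zeta>)"
    using middle_normal_form[OF box mem(1,2,4)] mem(5) by blast
  moreover have "proj c (?\<alpha> @ ?m' @ ?\<zeta>) = pow_word (\<delta> c)" if c: "c < n" for c
  proof (cases "big c")
    case True
    have "proj c ?\<alpha> @ proj c ?m' = pow_word ((\<bar>\<delta> c\<bar> - \<bar>z c\<bar>) * sg c)"
      using pa[OF c True] True c by (simp add: pm L)
    then have "(proj c ?\<alpha> @ proj c ?m') @ proj c ?\<zeta> = pow_word (\<delta> c)"
      using same[of "\<bar>\<delta> c\<bar> - \<bar>z c\<bar>" "\<bar>z c\<bar>" c] True c zs[OF c] ds[OF c] big1[OF c True]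
      by (simp add: pm L)
    then show ?thesis by simp
  next
    case False
    then show ?thesis using c by (simp add: pm L)
  qed
  moreover have "?\<alpha> @ ?m' @ ?\<zeta> \<in> words" using mem by auto
  ultimately show ?thesis by blast
qed

text \<open>Reading words backwards exchanges prefixes and suffixes, so that moves on the left are
  reduced to \<open>extend_box_right\<close>.\<close>

lemma reversed: "word_closure n (\<lambda>w. E (rev w))"
proof
  fix u v :: "nat letter list" and a :: "nat letter"
  assume "u \<in> words" "v \<in> words" "fst a < n"
  then show "E (rev (u @ [a, inv_letter a] @ v)) = E (rev (u @ v))"
    using cancel[of "rev v" "rev u" "inv_letter a"] by (simp add: inv_letter_def in_lists_conv_set)
next
  fix u v :: "nat letter list" and a b :: "nat letter"
  assume "u \<in> words" "v \<in> words" "fst a < n" "fst b < n" "fst a \<noteq> fst b"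
    "E (rev u)" "E (rev v)" "E (rev (u @ [b, a]))" "E (rev ([b, a] @ v))" "E (rev (u @ [b, a] @ v))"
  then show "E (rev (u @ [a, b] @ v))"
    using swap[of "rev v" "rev u" b a] by (simp add: in_lists_conv_set)
qed

text \<open>The box grows by one at a time from \<open>3 * Z\<close>, the smallest size that
  \<open>extend_box_right\<close> admits, and every word lies in the box given by its length. The
  monomials of \<open>base\<close> fill the initial box.\<close>

theorem all_words:
  fixes z :: "(nat \<Rightarrow> bool) \<Rightarrow> nat \<Rightarrow> int" and Z :: int
  assumes z: "\<And>\<epsilon> c. c < n \<Longrightarrow> z \<epsilon> c \<noteq> 0 \<and> (z \<epsilon> c > 0 \<longleftrightarrow> \<epsilon> c) \<and> \<bar>z \<epsilon> c\<bar> \<le> Z" and "0 \<le> Z"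
    and move: "\<And>\<epsilon>.
      (\<forall>h. has_exponents n (z \<epsilon>) h \<longrightarrow>
        (\<exists>B. narrow n (z \<epsilon>) B \<and> (\<forall>u\<in>words. (\<forall>b\<in>B. E (u @ b)) \<longrightarrow> E (u @ h)))) \<or>
      (\<forall>h. has_exponents n (z \<epsilon>) h \<longrightarrow>
        (\<exists>B. narrow n (z \<epsilon>) B \<and> (\<forall>u\<in>words. (\<forall>b\<in>B. E (b @ u)) \<longrightarrow> E (h @ u))))"
    and base: "\<And>\<delta>. (\<forall>c<n. \<bar>\<delta> c\<bar> \<le> 3 * Z) \<Longrightarrow> E (monomial [0..<n] \<delta>)"
    and "w \<in> words"
  shows "E w"
proof -
  have Q: "\<forall>w\<in>words. in_box (3 * Z + int k) w \<longrightarrow> E w" for k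
  proof (induction k)
    case 0
    show ?case
    proof (intro ballI impI)
      fix w assume "w \<in> words" "in_box (3 * Z + int 0) w"
      then show "E w"
      proof (rule box_closed[rotated])
        fix \<delta> :: "nat \<Rightarrow> int" assume "\<And>c. c < n \<Longrightarrow> \<bar>\<delta> c\<bar> \<le> 3 * Z + int 0"
        then have "E (monomial [0..<n] \<delta>)" using base by simp
        moreover have "monomial [0..<n] \<delta> \<in> words" by (rule monomial_in_lists) auto
        ultimately show "\<exists>w\<in>words. E w \<and> (\<forall>c<n. proj c w = pow_word (\<delta> c))"
          by (intro bexI[of _ "monomial [0..<n] \<delta>"]) (auto simp: proj_monomial)
      qed
    qed
  next
    case (Suc k)
    show ?case
    proof (intro ballI impI)
      fix w assume "w \<in> words" "in_box (3 * Z + int (Suc k)) w"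
      then show "E w"
      proof (rule box_closed[rotated])
        fix \<delta> :: "nat \<Rightarrow> int" assume "\<And>c. c < n \<Longrightarrow> \<bar>\<delta> c\<bar> \<le> 3 * Z + int (Suc k)"
        then have \<delta>: "\<bar>\<delta> c\<bar> \<le> (3 * Z + int k) + 1" if "c < n" for c using that by fastforce
        \<comment> \<open>A zero exponent counts as positive. This is harmless, as such a coordinate
          is never a big one.\<close>
        define \<epsilon> where "\<epsilon> c \<longleftrightarrow> \<delta> c \<ge> 0" for c
        have z': "z \<epsilon> c \<noteq> 0 \<and> (z \<epsilon> c > 0 \<longleftrightarrow> \<delta> c \<ge> 0) \<and> \<bar>z \<epsilon> c\<bar> \<le> Z" if "c < n" for c
          using z[OF that, of \<epsilon>] by (simp add: \<epsilon>_def)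
        from move[of \<epsilon>] show "\<exists>w\<in>words. E w \<and> (\<forall>c<n. proj c w = pow_word (\<delta> c))"
        proof
          assume *: "\<forall>h. has_exponents n (z \<epsilon>) h \<longrightarrow>
            (\<exists>B. narrow n (z \<epsilon>) B \<and> (\<forall>u\<in>words. (\<forall>b\<in>B. E (u @ b)) \<longrightarrow> E (u @ h)))"
          show ?thesis
          proof (rule extend_box_right[OF _ _ \<delta> z'])
            show "E v" if "v \<in> words" "in_box (3 * Z + int k) v" for v
              using Suc.IH that by blast
          qed (use * \<open>0 \<le> Z\<close> in auto)
        next
          assume *: "\<forall>h. has_exponents n (z \<epsilon>) h \<longrightarrow>
            (\<exists>B. narrow n (z \<epsilon>) B \<and> (\<forall>u\<in>words. (\<forall>b\<in>B. E (b @ u)) \<longrightarrow> E (h @ u)))"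
          interpret R: word_closure n "\<lambda>w. E (rev w)" by (rule reversed)
          have rev_mem: "rev v \<in> words \<longleftrightarrow> v \<in> words" for v :: "nat letter list"
            by (simp add: in_lists_conv_set)
          have "\<exists>w\<in>words. E (rev w) \<and> (\<forall>c<n. proj c w = pow_word (\<delta> c))"
          proof (rule R.extend_box_right[where r = "3 * Z + int k" and Z = Z and z = "z \<epsilon>", OF _ _ \<delta> z'])
            fix v assume "v \<in> words" "in_box (3 * Z + int k) v"
            then show "E (rev v)" using Suc.IH rev_mem by simp
          next
            fix h assume "has_exponents n (z \<epsilon>) h"
            then have "has_exponents n (z \<epsilon>) (rev h)"
              using rev_mem unfolding has_exponents_def by auto
            from *[THEN spec, THEN mp, OF this] obtain B where B: "narrow n (z \<epsilon>) B"
              "\<forall>u\<in>words. (\<forall>b\<in>B. E (b @ u)) \<longrightarrow> E (rev h @ u)"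
              by (elim exE conjE)
            have "\<forall>u\<in>words. (\<forall>b\<in>rev ` B. E (rev (u @ b))) \<longrightarrow> E (rev (u @ h))"
            proof (intro ballI impI)
              fix u assume u: "u \<in> words" "\<forall>b\<in>rev ` B. E (rev (u @ b))"
              then have "\<forall>b\<in>B. E (b @ rev u)" by simp
              then show "E (rev (u @ h))" using B(2) u rev_mem by (metis rev_append)
            qed
            moreover have "narrow n (z \<epsilon>) (rev ` B)" using B(1) rev_mem by (auto simp: narrow_def)
            ultimately show "\<exists>B. narrow n (z \<epsilon>) B \<and>
                (\<forall>u\<in>words. (\<forall>b\<in>B. E (rev (u @ b))) \<longrightarrow> E (rev (u @ h)))"
              by blast
          qed (use \<open>0 \<le> Z\<close> in auto)
          then obtain w where "w \<in> words" "E (rev w)" "\<forall>c<n. proj c w = pow_word (\<delta> c)" by blast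
          then show ?thesis by (intro bexI[of _ "rev w"]) (auto simp: rev_mem)
        qed
      qed
    qed
  qed
  have "range_le (int (length w)) (proj c w)" for c
    by (rule range_le_length) (simp add: proj_def)
  then have "in_box (3 * Z + int (length w)) w"
    unfolding in_box_def using \<open>0 \<le> Z\<close> by (force intro: range_le_mono)
  then show ?thesis using Q \<open>w \<in> words\<close> by blast
qed

end

section \<open>Conjugation, normal closures and words in groups\<close>

definition conj_by :: "('a, 'c) monoid_scheme \<Rightarrow> 'a \<Rightarrow> 'a \<Rightarrow> 'a" where
  "conj_by G g x = g \<otimes>\<^bsub>G\<^esub> x \<otimes>\<^bsub>G\<^esub> inv\<^bsub>G\<^esub> g"

context group
begin

lemma inv_cancel [simp]:
  "x \<in> carrier G \<Longrightarrow> y \<in> carrier G \<Longrightarrow> inv x \<otimes> (x \<otimes> y) = y"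
  "x \<in> carrier G \<Longrightarrow> y \<in> carrier G \<Longrightarrow> x \<otimes> (inv x \<otimes> y) = y"
  by (simp_all flip: m_assoc)

lemma conj_by_closed [simp]:
  "g \<in> carrier G \<Longrightarrow> x \<in> carrier G \<Longrightarrow> conj_by G g x \<in> carrier G"
  by (simp add: conj_by_def)

lemma conj_by_mult:
  "g \<in> carrier G \<Longrightarrow> x \<in> carrier G \<Longrightarrow> y \<in> carrier G \<Longrightarrow>
    conj_by G g (x \<otimes> y) = conj_by G g x \<otimes> conj_by G g y"
  by (simp add: conj_by_def m_assoc)

lemma conj_by_conj_by:
  "g \<in> carrier G \<Longrightarrow> h \<in> carrier G \<Longrightarrow> x \<in> carrier G \<Longrightarrow>
    conj_by G (g \<otimes> h) x = conj_by G g (conj_by G h x)"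
  by (simp add: conj_by_def m_assoc inv_mult_group)

lemma conj_by_inv:
  "g \<in> carrier G \<Longrightarrow> x \<in> carrier G \<Longrightarrow> conj_by G g (inv x) = inv (conj_by G g x)"
  by (simp add: conj_by_def m_assoc inv_mult_group)

lemma conj_by_one [simp]:
  "x \<in> carrier G \<Longrightarrow> conj_by G \<one> x = x" "g \<in> carrier G \<Longrightarrow> conj_by G g \<one> = \<one>"
  by (simp_all add: conj_by_def)

lemma conj_by_inv_conj_by [simp]:
  "g \<in> carrier G \<Longrightarrow> x \<in> carrier G \<Longrightarrow> conj_by G (inv g) (conj_by G g x) = x"
  "g \<in> carrier G \<Longrightarrow> x \<in> carrier G \<Longrightarrow> conj_by G g (conj_by G (inv g) x) = x"
  by (simp_all add: conj_by_def m_assoc)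

lemma conj_by_group_hom: "g \<in> carrier G \<Longrightarrow> group_hom G G (conj_by G g)"
  by unfold_locales (auto simp: hom_def conj_by_mult)

lemma generate_induct_subgroup:
  assumes "x \<in> generate G S" "subgroup H G" "S \<subseteq> H"
  shows "x \<in> H"
  using assms generate_subgroup_incl by blast

lemma conj_by_generate:
  assumes "g \<in> carrier G" "S \<subseteq> carrier G"
  shows "conj_by G g ` generate G S = generate G (conj_by G g ` S)"
  using group_hom.generate_img[OF conj_by_group_hom[OF assms(1)] assms(2)] by simp

lemma subgroup_setofI:
  assumes "\<And>x. P x \<Longrightarrow> x \<in> carrier G" "P \<one>" "\<And>x y. P x \<Longrightarrow> P y \<Longrightarrow> P (x \<otimes> y)" "\<And>x. P x \<Longrightarrow> P (inv x)"
  shows "subgroup {x. P x} G"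
  using assms by unfold_locales auto

lemma subgroup_normalizing:
  assumes "subgroup N G"
  shows "subgroup {g \<in> carrier G. conj_by G g ` N = N} G"
proof (rule subgroup_setofI[where P = "\<lambda>g. g \<in> carrier G \<and> conj_by G g ` N = N", simplified])
  have N: "N \<subseteq> carrier G" using assms subgroup.subset by blast
  show "(\<lambda>x. conj_by G \<one> x) ` N = N"
    using N by (auto simp: subset_iff image_iff)
  fix x assume x: "x \<in> carrier G \<and> conj_by G x ` N = N"
  have "conj_by G (inv x) ` N = conj_by G (inv x) ` conj_by G x ` N" using x by simp
  also have "\<dots> = id ` N" unfolding image_image using x N by (intro image_cong) auto
  also have "\<dots> = N" by simp
  finally show "conj_by G (inv x) ` N = N" .
  fix y assume y: "y \<in> carrier G \<and> conj_by G y ` N = N"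
  have "conj_by G (x \<otimes> y) ` N = conj_by G x ` conj_by G y ` N"
    unfolding image_image using x y N by (intro image_cong) (auto simp: conj_by_conj_by)
  then show "conj_by G (x \<otimes> y) ` N = N" using x y by simp
qed

text \<open>Conjugation by a generator could map an infinite \<open>N\<close> properly into itself,
  so inverses have to be checked as well. Together they show that the image is all of
  \<open>N\<close>, and the elements with this property form a subgroup.\<close>

lemma normalizes_if_generators:
  assumes "subgroup N G" "S \<subseteq> carrier G"
    and "\<And>s x. s \<in> S \<Longrightarrow> x \<in> N \<Longrightarrow> conj_by G s x \<in> N"
    and "\<And>s x. s \<in> S \<Longrightarrow> x \<in> N \<Longrightarrow> conj_by G (inv s) x \<in> N"
    and "g \<in> generate G S" "x \<in> N"
  shows "conj_by G g x \<in> N"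
proof -
  have N: "N \<subseteq> carrier G" using assms(1) subgroup.subset by blast
  have "S \<subseteq> {g \<in> carrier G. conj_by G g ` N = N}"
  proof
    fix s assume s: "s \<in> S"
    have "N \<subseteq> conj_by G s ` N"
    proof
      fix y assume "y \<in> N"
      then have "y = conj_by G s (conj_by G (inv s) y)" "conj_by G (inv s) y \<in> N"
        using s assms N by (auto simp: subset_iff)
      then show "y \<in> conj_by G s ` N" by blast
    qed
    then show "s \<in> {g \<in> carrier G. conj_by G g ` N = N}" using s assms by auto
  qed
  then have "g \<in> {g \<in> carrier G. conj_by G g ` N = N}"
    using generate_induct_subgroup[OF assms(5) subgroup_normalizing[OF assms(1)]] by blast
  then show ?thesis using assms(6) by blast
qed

lemma normal_if_generators:
  assumes "subgroup N G" "S \<subseteq> carrier G" "generate G S = carrier G"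
    and "\<And>s x. s \<in> S \<Longrightarrow> x \<in> N \<Longrightarrow> conj_by G s x \<in> N"
    and "\<And>s x. s \<in> S \<Longrightarrow> x \<in> N \<Longrightarrow> conj_by G (inv s) x \<in> N"
  shows "N \<lhd> G"
  using normalizes_if_generators[OF assms(1,2,4,5)] assms(1,3)
  by (intro normal_invI) (auto simp: conj_by_def)

lemma normal_conj_by: "N \<lhd> G \<Longrightarrow> g \<in> carrier G \<Longrightarrow> x \<in> N \<Longrightarrow> conj_by G g x \<in> N"
  by (simp add: conj_by_def normal.inv_op_closed2)

lemma normal_closure_normal:
  assumes "R \<subseteq> carrier G" shows "normal_closure G R \<lhd> G"
proof (rule normal_invI)
  let ?A = "{N. N \<lhd> G \<and> R \<subseteq> N}"
  have "carrier G \<in> ?A" using assms normal_self by simp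
  then show "subgroup (normal_closure G R) G"
    unfolding normal_closure_def
    by (intro subgroups_Inter) (auto dest: normal_imp_subgroup)
  show "x \<otimes> h \<otimes> inv x \<in> normal_closure G R" if "x \<in> carrier G" "h \<in> normal_closure G R" for x h
    using that normal.inv_op_closed2 by (fastforce simp: normal_closure_def)
qed

lemma normal_closure_incl: "R \<subseteq> normal_closure G R"
  by (auto simp: normal_closure_def)

lemma normal_closure_min: "N \<lhd> G \<Longrightarrow> R \<subseteq> N \<Longrightarrow> normal_closure G R \<subseteq> N"
  by (auto simp: normal_closure_def)

lemma normal_closure_mono: "R \<subseteq> R' \<Longrightarrow> R' \<subseteq> carrier G \<Longrightarrow> normal_closure G R \<subseteq> normal_closure G R'"
  by (meson normal_closure_incl normal_closure_min normal_closure_normal order_trans)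

lemma finitely_generated_subgroup_iff:
  assumes "subgroup H G"
  shows "finitely_generated (G\<lparr>carrier := H\<rparr>) \<longleftrightarrow> (\<exists>S. finite S \<and> S \<subseteq> H \<and> generate G S = H)"
  unfolding finitely_generated_def using generate_consistent[OF _ assms] by auto

end

section \<open>Values of words in a group, and presentations\<close>

definition letter_val :: "('a, 'c) monoid_scheme \<Rightarrow> ('x \<Rightarrow> 'a) \<Rightarrow> 'x letter \<Rightarrow> 'a" where
  "letter_val G f a = (if snd a then f (fst a) else inv\<^bsub>G\<^esub> f (fst a))"

definition word_val :: "('a, 'c) monoid_scheme \<Rightarrow> ('x \<Rightarrow> 'a) \<Rightarrow> 'x letter list \<Rightarrow> 'a" where
  "word_val G f w = foldr (\<lambda>a y. letter_val G f a \<otimes>\<^bsub>G\<^esub> y) w \<one>\<^bsub>G\<^esub>"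

lemma word_val_simps [simp]:
  "word_val G f [] = \<one>\<^bsub>G\<^esub>"
  "word_val G f (a # w) = letter_val G f a \<otimes>\<^bsub>G\<^esub> word_val G f w"
  by (simp_all add: word_val_def)

locale letters = group G for G (structure) +
  fixes f :: "'x \<Rightarrow> 'a" and S :: "'x set"
  assumes letters_closed: "x \<in> S \<Longrightarrow> f x \<in> carrier G"
begin

lemma letter_val_closed [simp]: "fst a \<in> S \<Longrightarrow> letter_val G f a \<in> carrier G"
  by (simp add: letter_val_def letters_closed)

lemma letter_val_inv_letter [simp]: "fst a \<in> S \<Longrightarrow> letter_val G f (inv_letter a) = inv (letter_val G f a)"
  by (simp add: letter_val_def inv_letter_def letters_closed)

lemma word_val_closed [simp]: "w \<in> lists (S \<times> UNIV) \<Longrightarrow> word_val G f w \<in> carrier G"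
  by (induction w) auto

lemma word_val_closed' [simp]: "\<forall>a\<in>set w. a \<in> S \<times> UNIV \<Longrightarrow> word_val G f w \<in> carrier G"
  by (rule word_val_closed) auto

lemma word_val_append:
  "u \<in> lists (S \<times> UNIV) \<Longrightarrow> v \<in> lists (S \<times> UNIV) \<Longrightarrow>
    word_val G f (u @ v) = word_val G f u \<otimes> word_val G f v"
  by (induction u) (auto simp: m_assoc mem_Times_iff)

lemma word_val_push:
  assumes "a \<in> S \<times> UNIV" "w \<in> lists (S \<times> UNIV)"
  shows "word_val G f (push a w) = letter_val G f a \<otimes> word_val G f w"
proof (cases w)
  case (Cons b v)
  then show ?thesis using assms by (cases "b = inv_letter a") (auto simp: mem_Times_iff)
qed auto

lemma word_val_foldr_push:
  "u \<in> lists (S \<times> UNIV) \<Longrightarrow> v \<in> lists (S \<times> UNIV) \<Longrightarrow>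
    word_val G f (foldr push u v) = word_val G f u \<otimes> word_val G f v"
proof (induction u)
  case (Cons a u)
  then have "foldr push u v \<in> lists (S \<times> UNIV)" by (intro foldr_push_in_lists) auto
  then show ?case using Cons by (auto simp: word_val_push m_assoc mem_Times_iff)
qed auto

lemma word_val_hom: "word_val G f \<in> hom (free_group S) G"
  by (auto simp: hom_def free_group_def word_val_foldr_push)

lemma word_val_in_generate: "w \<in> lists (S \<times> UNIV) \<Longrightarrow> word_val G f w \<in> generate G (f ` S)"
proof (induction w)
  case (Cons a w)
  then have "letter_val G f a \<in> generate G (f ` S)"
    by (auto simp: letter_val_def intro: generate.incl generate.inv)
  then show ?case using Cons by (auto intro: generate.eng)
qed (simp add: generate.one)

lemma word_val_image: "word_val G f ` carrier (free_group S) = generate G (f ` S)"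
proof
  show "word_val G f ` carrier (free_group S) \<subseteq> generate G (f ` S)"
    using word_val_in_generate by (auto simp: free_group_def)
  interpret F: group "free_group S" by (rule group_free_group)
  interpret group_hom "free_group S" G "word_val G f"
    by unfold_locales (rule word_val_hom)
  have "f ` S \<subseteq> word_val G f ` carrier (free_group S)"
  proof
    fix y assume "y \<in> f ` S"
    then obtain x where x: "x \<in> S" "y = f x" by blast
    then have "y = word_val G f [(x, True)]" by (simp add: letter_val_def letters_closed)
    moreover have "[(x, True)] \<in> carrier (free_group S)" using x by (simp add: free_group_def)
    ultimately show "y \<in> word_val G f ` carrier (free_group S)" by blast
  qed
  then show "generate G (f ` S) \<subseteq> word_val G f ` carrier (free_group S)"
    using generate_subgroup_incl img_is_subgroup by blast
qed

lemma hom_word_val: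
  assumes "group H" "h \<in> hom G H" "w \<in> lists (S \<times> UNIV)"
  shows "h (word_val G f w) = word_val H (h \<circ> f) w"
proof -
  interpret group_hom G H h using assms by (simp add: group_hom_def group_hom_axioms_def)
  have "h (letter_val G f a) = letter_val H (h \<circ> f) a" if "fst a \<in> S" for a
    using that by (simp add: letter_val_def letters_closed)
  then show ?thesis using assms(3) by (induction w) (auto simp: mem_Times_iff)
qed

end

lemma word_val_cong:
  "w \<in> lists (S \<times> UNIV) \<Longrightarrow> (\<And>x. x \<in> S \<Longrightarrow> f x = g x) \<Longrightarrow> word_val G f w = word_val G g w"
  by (induction w) (auto simp: letter_val_def)

lemma (in group_hom) vimage_normal:
  assumes "N \<lhd> H"
  shows "{x \<in> carrier G. h x \<in> N} \<lhd> G"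
proof (rule G.normal_invI)
  interpret N: normal N H by fact
  show "subgroup {x \<in> carrier G. h x \<in> N} G"
    by unfold_locales auto
  show "x \<otimes> y \<otimes> inv x \<in> {x \<in> carrier G. h x \<in> N}"
    if "x \<in> carrier G" "y \<in> {x \<in> carrier G. h x \<in> N}" for x y
    using that N.inv_op_closed2 by simp
qed

lemma word_val_free_group:
  assumes "u \<in> carrier (free_group S)"
  shows "word_val (free_group S) (\<lambda>x. [(x, True)]) u = u"
proof -
  interpret F: group "free_group S" by (rule group_free_group)
  have inv: "inv\<^bsub>free_group S\<^esub> [(x, True)] = [(x, False)]" if "x \<in> S" for x
    using that by (intro F.inv_equality) (auto simp: free_group_def inv_letter_def)
  have "u \<in> lists (S \<times> UNIV)" "reduced u" using assms by (auto simp: free_group_def)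
  then show ?thesis
  proof (induction u)
    case (Cons a u)
    then have "letter_val (free_group S) (\<lambda>x. [(x, True)]) a = [a]"
      by (cases a) (auto simp: letter_val_def inv)
    then show ?case using Cons reduced_tl[of a u]
      by (cases u) (auto simp: free_group_def)
  qed (simp add: free_group_def)
qed

lemma generate_free_group: "generate (free_group S) ((\<lambda>x. [(x, True)]) ` S) = carrier (free_group S)"
proof -
  interpret letters "free_group S" "\<lambda>x. [(x, True)]" S
    by (intro letters.intro group_free_group letters_axioms.intro) (auto simp: free_group_def)
  have "word_val (free_group S) (\<lambda>x. [(x, True)]) ` carrier (free_group S) = id ` carrier (free_group S)"
    by (rule image_cong) (simp_all add: word_val_free_group)
  then show ?thesis by (simp add: word_val_image)
qed

lemma finitely_generated_free_group:
  assumes "finite S" shows "finitely_generated (free_group S)"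
proof -
  have "(\<lambda>x. [(x, True)]) ` S \<subseteq> carrier (free_group S)"
    by (auto simp: free_group_def)
  then show ?thesis
    unfolding finitely_generated_def using generate_free_group[of S] assms by blast
qed

lemma finitely_generated_cover:
  fixes G :: "('a, 'c) monoid_scheme"
  assumes "group G" "finitely_generated G"
  obtains n :: nat and \<pi> where "\<pi> \<in> hom (free_group {..<n}) G" "\<pi> ` carrier (free_group {..<n}) = carrier G"
proof -
  obtain S where S: "finite S" "S \<subseteq> carrier G" "generate G S = carrier G"
    using assms(2) unfolding finitely_generated_def by blast
  obtain n and f :: "nat \<Rightarrow> 'a" where "S = f ` {i. i < n}"
    using finite_imp_nat_seg_image_inj_on[OF S(1)] by blast
  then have f: "S = f ` {..<n}" by (simp only: lessThan_def)
  interpret letters G f "{..<n}"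
    using assms S f by (intro letters.intro letters_axioms.intro) auto
  show ?thesis using that[OF word_val_hom] word_val_image S f by simp
qed

lemma finitely_presentedI:
  fixes n :: nat
  assumes "group G" "\<pi> \<in> hom (free_group {..<n}) G" "\<pi> ` carrier (free_group {..<n}) = carrier G"
    and "finite R" "R \<subseteq> carrier (free_group {..<n})"
    and "kernel (free_group {..<n}) G \<pi> = normal_closure (free_group {..<n}) R"
  shows "finitely_presented G"
proof -
  interpret group_hom "free_group {..<n}" G \<pi>
    using assms by (simp add: group_hom_def group_hom_axioms_def group_free_group)
  have "free_group {..<n} Mod normal_closure (free_group {..<n}) R \<cong> G"
    using FactGroup_iso[OF assms(3)] assms(6) by simp
  moreover have "group (free_group {..<n} Mod normal_closure (free_group {..<n}) R)"
    using G.normal_closure_normal assms(5) normal.factorgroup_is_group by blast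
  ultimately show ?thesis
    unfolding finitely_presented_def using assms(4,5) group.iso_sym by blast
qed

lemma finitely_presented_presentation:
  assumes "group G" "finitely_presented G"
  obtains n :: nat and \<pi> R where "\<pi> \<in> hom (free_group {..<n}) G"
    "\<pi> ` carrier (free_group {..<n}) = carrier G" "finite R" "R \<subseteq> carrier (free_group {..<n})"
    "kernel (free_group {..<n}) G \<pi> = normal_closure (free_group {..<n}) R"
proof -
  obtain n :: nat and R where R: "finite R" "R \<subseteq> carrier (free_group {..<n})"
    and iso: "G \<cong> free_group {..<n} Mod normal_closure (free_group {..<n}) R"
    using assms(2) unfolding finitely_presented_def by blast
  let ?F = "free_group {..<n}" and ?N = "normal_closure (free_group {..<n}) R"
  interpret F: group ?F by (rule group_free_group)
  interpret N: normal ?N ?F by (rule F.normal_closure_normal[OF R(2)])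
  interpret Q: group "?F Mod ?N" by (rule N.factorgroup_is_group)
  obtain \<phi> where \<phi>: "\<phi> \<in> iso (?F Mod ?N) G"
    using group.iso_sym[OF assms(1) iso] by (auto simp: is_iso_def)
  have hom: "\<phi> \<in> hom (?F Mod ?N) G" and inj: "inj_on \<phi> (carrier (?F Mod ?N))"
    using \<phi> by (auto simp: iso_def bij_betw_def)
  have one: "\<phi> ?N = one G" using hom_one[OF hom Q.is_group assms(1)] by simp
  have ker: "(\<phi> (r_coset ?F ?N x) = \<one>\<^bsub>G\<^esub>) = (r_coset ?F ?N x = ?N)" if "x \<in> carrier ?F" for x
    using inj_onD[OF inj, of "r_coset ?F ?N x" ?N] that one Q.one_closed by (auto simp: carrier_FactGroup)
  let ?\<pi> = "\<lambda>x. \<phi> (r_coset ?F ?N x)"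
  have img: "?\<pi> ` carrier ?F = carrier G"
    using \<phi> by (auto simp: iso_def bij_betw_def carrier_FactGroup image_image)
  have "?\<pi> = \<phi> \<circ> (\<lambda>x. r_coset ?F ?N x)" by auto
  then have "?\<pi> \<in> hom ?F G" using hom_compose[OF N.r_coset_hom_Mod] \<phi> by (auto simp: iso_def)
  moreover have "kernel ?F G ?\<pi> = ?N"
  proof -
    have "?\<pi> x = \<one>\<^bsub>G\<^esub> \<longleftrightarrow> x \<in> ?N" if "x \<in> carrier ?F" for x
      using ker[OF that] F.coset_join1[OF _ that N.is_subgroup] F.coset_join2[OF that N.is_subgroup] N.subset
      by (auto simp: carrier_FactGroup)
    then show ?thesis using N.subset by (auto simp: kernel_def)
  qed
  ultimately show ?thesis using that R img by blast
qed

text \<open>The given presentation of \<open>G\<close> may have generators unrelated to those of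
  \<open>F\<close>. Its free group is mapped to \<open>F\<close> by lifting generators. Modulo the
  images of the relators, and one relator for each generator of \<open>F\<close> that expresses it
  by the lifts, \<open>F\<close> becomes a quotient of \<open>G\<close>; so nothing else is in the
  kernel.\<close>

theorem finitely_presented_kernel:
  assumes "group F" "finitely_generated F" "group G" "finitely_presented G"
    and "\<phi> \<in> hom F G" "\<phi> ` carrier F = carrier G"
  obtains R where "finite R" "R \<subseteq> carrier F" "kernel F G \<phi> = normal_closure F R"
proof -
  obtain n :: nat and \<pi> R where pres: "\<pi> \<in> hom (free_group {..<n}) G"
    "\<pi> ` carrier (free_group {..<n}) = carrier G" "finite R" "R \<subseteq> carrier (free_group {..<n})"
    "kernel (free_group {..<n}) G \<pi> = normal_closure (free_group {..<n}) R"
    by (rule finitely_presented_presentation[OF assms(3,4)])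
  let ?P = "free_group {..<n}"
  interpret P: group ?P by (rule group_free_group)
  interpret \<phi>: group_hom F G \<phi>
    using assms by (simp add: group_hom_def group_hom_axioms_def)
  interpret \<pi>: group_hom ?P G \<pi>
    by unfold_locales (rule pres(1))
  obtain S where S: "finite S" "S \<subseteq> carrier F" "generate F S = carrier F"
    using assms(2) unfolding finitely_generated_def by blast
  have "\<exists>y. y \<in> carrier F \<and> \<phi> y = \<pi> [(x, True)]" if "x < n" for x
  proof -
    have "[(x, True)] \<in> carrier ?P" using that by (simp add: free_group_def)
    then have "\<pi> [(x, True)] \<in> \<phi> ` carrier F" using assms(6) by simp
    then show ?thesis by auto
  qed
  then obtain l where l: "l x \<in> carrier F" "\<phi> (l x) = \<pi> [(x, True)]" if "x < n" for x by metis
  interpret L: letters F l "{..<n}"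
    using l by (intro letters.intro letters_axioms.intro) (auto intro: assms(1))
  let ?\<Psi> = "word_val F l"
  interpret \<Psi>: group_hom ?P F ?\<Psi> by unfold_locales (rule L.word_val_hom)
  have \<phi>\<Psi>: "\<phi> (?\<Psi> u) = \<pi> u" if "u \<in> carrier ?P" for u
  proof -
    interpret I: letters ?P "\<lambda>x. [(x, True)]" "{..<n}"
      by (intro letters.intro group_free_group letters_axioms.intro) (auto simp: free_group_def)
    have u: "u \<in> lists ({..<n} \<times> UNIV)" using that by (simp add: free_group_def)
    have "\<phi> (?\<Psi> u) = word_val G (\<phi> \<circ> l) u" by (rule L.hom_word_val[OF assms(3,5) u])
    also have "\<dots> = word_val G (\<pi> \<circ> (\<lambda>x. [(x, True)])) u"
      by (rule word_val_cong[OF u]) (simp add: l)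
    also have "\<dots> = \<pi> (word_val ?P (\<lambda>x. [(x, True)]) u)"
      by (rule I.hom_word_val[OF assms(3) pres(1) u, symmetric])
    finally show ?thesis using word_val_free_group[OF that] by simp
  qed
  have "\<exists>u. u \<in> carrier ?P \<and> \<pi> u = \<phi> s" if "s \<in> S" for s
  proof -
    have "\<phi> s \<in> \<pi> ` carrier ?P" using that S pres(2) by auto
    then show ?thesis by auto
  qed
  then obtain c where c: "c s \<in> carrier ?P" "\<pi> (c s) = \<phi> s" if "s \<in> S" for s by metis
  define T where "T = ?\<Psi> ` R \<union> (\<lambda>s. s \<otimes>\<^bsub>F\<^esub> inv\<^bsub>F\<^esub> ?\<Psi> (c s)) ` S"
  have T: "finite T" "T \<subseteq> carrier F"
    using S pres(3,4) c by (auto simp: T_def)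
  interpret M: normal "normal_closure F T" F by (rule \<phi>.G.normal_closure_normal[OF T(2)])
  have "T \<subseteq> kernel F G \<phi>"
  proof -
    have "R \<subseteq> kernel ?P G \<pi>" using pres(5) P.normal_closure_incl by blast
    then have "?\<Psi> ` R \<subseteq> kernel F G \<phi>" using \<phi>\<Psi> by (auto simp: kernel_def)
    moreover have "s \<otimes>\<^bsub>F\<^esub> inv\<^bsub>F\<^esub> ?\<Psi> (c s) \<in> kernel F G \<phi>" if "s \<in> S" for s
    proof -
      have "?\<Psi> (c s) \<in> carrier F" "s \<in> carrier F" using c that S by auto
      then show ?thesis using c[OF that] \<phi>\<Psi>[of "c s"] by (simp add: kernel_def)
    qed
    ultimately show ?thesis by (auto simp: T_def)
  qed
  then have sub: "normal_closure F T \<subseteq> kernel F G \<phi>"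
    using \<phi>.G.normal_closure_min \<phi>.normal_kernel by blast
  have cover: "\<exists>u\<in>carrier ?P. \<exists>m\<in>normal_closure F T. y = m \<otimes>\<^bsub>F\<^esub> ?\<Psi> u" if "y \<in> carrier F" for y
  proof -
    let ?C = "{y. \<exists>u\<in>carrier ?P. \<exists>m\<in>normal_closure F T. y = m \<otimes>\<^bsub>F\<^esub> ?\<Psi> u}"
    have C_eq: "?C = normal_closure F T <#>\<^bsub>F\<^esub> (?\<Psi> ` carrier ?P)"
      by (auto simp: set_mult_def)
    have "subgroup ?C F"
      unfolding C_eq using \<Psi>.img_is_subgroup
      by (intro second_isomorphism_grp.normal_set_mult_subgroup second_isomorphism_grp.intro
          second_isomorphism_grp_axioms.intro M.normal_axioms)
    moreover have "S \<subseteq> ?C"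
    proof
      fix s assume s: "s \<in> S"
      have "s \<otimes>\<^bsub>F\<^esub> inv\<^bsub>F\<^esub> ?\<Psi> (c s) \<in> normal_closure F T"
        using s \<phi>.G.normal_closure_incl[of T] by (auto simp: T_def)
      moreover have "s = (s \<otimes>\<^bsub>F\<^esub> inv\<^bsub>F\<^esub> ?\<Psi> (c s)) \<otimes>\<^bsub>F\<^esub> ?\<Psi> (c s)"
        using s S c by (simp add: \<phi>.G.m_assoc subset_iff)
      ultimately show "s \<in> ?C" using c[OF s] by blast
    qed
    ultimately have "carrier F \<subseteq> ?C" using S(3) \<phi>.G.generate_subgroup_incl by blast
    then show ?thesis using that by blast
  qed
  have "kernel F G \<phi> \<subseteq> normal_closure F T"
  proof
    fix y assume y: "y \<in> kernel F G \<phi>"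
    then have "y \<in> carrier F" by (simp add: kernel_def)
    from cover[OF this] obtain u m
      where um: "u \<in> carrier ?P" "m \<in> normal_closure F T" "y = m \<otimes>\<^bsub>F\<^esub> ?\<Psi> u"
      by blast
    have "\<phi> m = \<one>\<^bsub>G\<^esub>" using um sub by (auto simp: kernel_def)
    then have "\<pi> u = \<one>\<^bsub>G\<^esub>" using y um \<phi>\<Psi>[OF um(1)] by (simp add: kernel_def)
    then have "u \<in> normal_closure ?P R" using um pres(5) by (auto simp: kernel_def)
    moreover have "{u \<in> carrier ?P. ?\<Psi> u \<in> normal_closure F T} \<lhd> ?P"
      by (rule \<Psi>.vimage_normal[OF M.normal_axioms])
    moreover have "R \<subseteq> {u \<in> carrier ?P. ?\<Psi> u \<in> normal_closure F T}"
      using pres(4) \<phi>.G.normal_closure_incl[of T] by (auto simp: T_def)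
    ultimately have "?\<Psi> u \<in> normal_closure F T"
      using P.normal_closure_min by blast
    then show "y \<in> normal_closure F T" using um by auto
  qed
  then show ?thesis using that T sub by blast
qed

section \<open>Noetherian modules over commuting operators\<close>

lemma (in group) subgroup_Union_chain:
  fixes L :: "nat \<Rightarrow> 'a set"
  assumes L: "\<And>d. subgroup (L d) G" and mono: "\<And>d e. d \<le> e \<Longrightarrow> L d \<subseteq> L e"
  shows "subgroup (\<Union>d. L d) G"
proof
  show "(\<Union>d. L d) \<subseteq> carrier G" using subgroup.subset[OF L] by blast
  show "\<one> \<in> (\<Union>d. L d)" using subgroup.one_closed[OF L] by blast
  fix x assume "x \<in> (\<Union>d. L d)"
  then obtain d where d: "x \<in> L d" by blast
  then show "inv x \<in> (\<Union>d. L d)" using subgroup.m_inv_closed[OF L d] by blast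
  fix y assume "y \<in> (\<Union>d. L d)"
  then obtain e where "y \<in> L e" by blast
  then have "x \<in> L (max d e)" "y \<in> L (max d e)" using d mono[of d "max d e"] mono[of e "max d e"] by auto
  then have "x \<otimes> y \<in> L (max d e)" by (rule subgroup.m_closed[OF L])
  then show "x \<otimes> y \<in> (\<Union>d. L d)" by blast
qed

text \<open>The submodule generated by \<open>S\<close> over the integral polynomials in the
  operators. Inverses of conjugations are not implied; they will be listed as operators of their
  own.\<close>

definition op_span :: "('a, 'c) monoid_scheme \<Rightarrow> ('a \<Rightarrow> 'a) set \<Rightarrow> 'a set \<Rightarrow> 'a set" where
  "op_span G \<Phi> S = \<Inter>{H. subgroup H G \<and> S \<subseteq> H \<and> (\<forall>\<phi>\<in>\<Phi>. \<phi> ` H \<subseteq> H)}"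

locale operators = comm_group G for G (structure) +
  fixes \<Phi> :: "('a \<Rightarrow> 'a) set"
  assumes op_hom: "\<phi> \<in> \<Phi> \<Longrightarrow> \<phi> \<in> hom G G"
    and op_commute: "\<phi> \<in> \<Phi> \<Longrightarrow> \<psi> \<in> \<Phi> \<Longrightarrow> x \<in> carrier G \<Longrightarrow> \<phi> (\<psi> x) = \<psi> (\<phi> x)"
begin

definition invariant :: "'a set \<Rightarrow> bool" where
  "invariant H \<longleftrightarrow> subgroup H G \<and> (\<forall>\<phi>\<in>\<Phi>. \<phi> ` H \<subseteq> H)"

lemma op_closed: "\<phi> \<in> \<Phi> \<Longrightarrow> x \<in> carrier G \<Longrightarrow> \<phi> x \<in> carrier G"
  by (rule hom_in_carrier[OF op_hom])

lemma invariant_carrier: "invariant (carrier G)"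
  unfolding invariant_def using subgroup_self op_closed by blast

lemma op_span_invariant:
  assumes "S \<subseteq> carrier G" shows "invariant (op_span G \<Phi> S)"
proof -
  let ?A = "{H. subgroup H G \<and> S \<subseteq> H \<and> (\<forall>\<phi>\<in>\<Phi>. \<phi> ` H \<subseteq> H)}"
  have "carrier G \<in> ?A" using assms invariant_carrier unfolding invariant_def by blast
  then have "subgroup (\<Inter>?A) G" by (intro subgroups_Inter) blast+
  then show ?thesis unfolding invariant_def op_span_def by blast
qed

lemma op_span_incl: "S \<subseteq> op_span G \<Phi> S"
  unfolding op_span_def by blast

lemma op_span_min: "invariant H \<Longrightarrow> S \<subseteq> H \<Longrightarrow> op_span G \<Phi> S \<subseteq> H"
  unfolding op_span_def invariant_def by blast

end

lemma (in comm_group) m_swap: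
  assumes "a \<in> carrier G" "b \<in> carrier G" "c \<in> carrier G" "d \<in> carrier G"
  shows "(a \<otimes> b) \<otimes> (c \<otimes> d) = (a \<otimes> c) \<otimes> (b \<otimes> d)"
  using assms m_lcomm[of b c d] by (simp add: m_assoc)

text \<open>Hilbert's argument: the span of \<open>insert f \<Phi>\<close> consists of the polynomials in \<open>f\<close> with
  coefficients in the span of \<open>\<Phi>\<close>; the set of leading coefficients is increasing in the degree.\<close>

lemma hilbert_basis_step:
  fixes G (structure)
  assumes ops': "operators G \<Phi>" and ops: "operators G (insert f \<Phi>)" and S: "S \<subseteq> carrier G"
    and noeth: "\<And>B. operators.invariant G \<Phi> B \<Longrightarrow> B \<subseteq> op_span G \<Phi> S \<Longrightarrow> \<exists>Y. finite Y \<and> Y \<subseteq> B \<and> B = op_span G \<Phi> Y"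
    and B: "operators.invariant G (insert f \<Phi>) B" "B \<subseteq> op_span G (insert f \<Phi>) S"
  shows "\<exists>Y. finite Y \<and> Y \<subseteq> B \<and> B = op_span G (insert f \<Phi>) Y"
proof -
  interpret operators G \<Phi> by (fact ops')
  interpret O: operators G "insert f \<Phi>" by (fact ops)
  define M where "M = op_span G \<Phi> S"
  have Mi: "invariant M" unfolding M_def by (rule op_span_invariant[OF S])
  then have Ms: "subgroup M G" by (simp add: invariant_def)
  note M = Mi Ms subgroup.subset[OF Ms]
  let ?p = "\<lambda>d. f ^^ d"
  have p_closed [simp]: "x \<in> carrier G \<Longrightarrow> ?p d x \<in> carrier G" for d x
    by (induction d) (auto intro: O.op_closed[of f])
  have p_mult [simp]: "x \<in> carrier G \<Longrightarrow> y \<in> carrier G \<Longrightarrow> ?p d (x \<otimes> y) = ?p d x \<otimes> ?p d y" for d x y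
    by (induction d) (auto simp: hom_mult[OF O.op_hom[of f]])
  have p_hom: "group_hom G G (?p d)" for d
    by unfold_locales (auto simp: hom_def)
  have p_one [simp]: "?p d \<one> = \<one>" and p_inv [simp]: "x \<in> carrier G \<Longrightarrow> ?p d (inv x) = inv (?p d x)" for d x
    using group_hom.hom_one[OF p_hom] group_hom.hom_inv[OF p_hom] by auto
  have p_op: "\<phi> (?p d x) = ?p d (\<phi> x)" if "\<phi> \<in> \<Phi>" "x \<in> carrier G" for \<phi> d x
    by (induction d) (use that in \<open>auto simp: O.op_commute[of \<phi> f]\<close>)
  \<comment> \<open>\<open>L d\<close> consists of the polynomials in \<open>f\<close> of degree
    below \<open>d\<close> with coefficients in \<open>M\<close>.\<close>
  define L where "L = rec_nat {\<one>} (\<lambda>d l. {?p d m \<otimes> x | m x. m \<in> M \<and> x \<in> l})"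
  have L0: "L 0 = {\<one>}" and LS: "L (Suc d) = {?p d m \<otimes> x | m x. m \<in> M \<and> x \<in> L d}" for d
    by (simp_all add: L_def)
  have M1: "\<one> \<in> M" "\<And>x y. x \<in> M \<Longrightarrow> y \<in> M \<Longrightarrow> x \<otimes> y \<in> M" "\<And>x. x \<in> M \<Longrightarrow> inv x \<in> M"
    "\<And>\<phi> x. \<phi> \<in> \<Phi> \<Longrightarrow> x \<in> M \<Longrightarrow> \<phi> x \<in> M"
    using Mi subgroup.one_closed[OF Ms] subgroup.m_closed[OF Ms] subgroup.m_inv_closed[OF Ms]
    unfolding invariant_def by blast+
  have L_sub: "subgroup (L d) G \<and> (\<forall>\<phi>\<in>\<Phi>. \<phi> ` L d \<subseteq> L d)" for d
  proof (induction d)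
    case 0
    have "\<phi> \<one> = \<one>" if "\<phi> \<in> \<Phi>" for \<phi>
      using hom_one[OF op_hom[OF that] is_group is_group] .
    then show ?case using triv_subgroup by (simp add: L0)
  next
    case (Suc d)
    then have c: "L d \<subseteq> carrier G" using subgroup.subset by blast
    have "subgroup (L (Suc d)) G"
    proof
      show "L (Suc d) \<subseteq> carrier G" using c M(3) by (auto simp: LS subset_iff)
      show "\<one> \<in> L (Suc d)"
        using M1(1) subgroup.one_closed Suc by (force simp: LS intro!: exI[of _ \<one>])
    next
      fix x assume "x \<in> L (Suc d)"
      then obtain m l where "m \<in> M" "l \<in> L d" "x = ?p d m \<otimes> l" by (auto simp: LS)
      moreover from this have "inv x = ?p d (inv m) \<otimes> inv l"
        using c M(3) by (auto simp: subset_iff inv_mult)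
      ultimately show "inv x \<in> L (Suc d)"
        using M1(3) Suc subgroup.m_inv_closed by (fastforce simp: LS)
    next
      fix x y assume "x \<in> L (Suc d)" "y \<in> L (Suc d)"
      then obtain m l m' l' where *: "m \<in> M" "l \<in> L d" "x = ?p d m \<otimes> l"
        "m' \<in> M" "l' \<in> L d" "y = ?p d m' \<otimes> l'" by (auto simp: LS)
      then have "x \<otimes> y = ?p d (m \<otimes> m') \<otimes> (l \<otimes> l')"
        using c M(3) by (auto simp: subset_iff m_swap)
      moreover have "l \<otimes> l' \<in> L d" using * Suc subgroup.m_closed by fast
      ultimately show "x \<otimes> y \<in> L (Suc d)"
        using M1(2) * by (fastforce simp: LS)
    qed
    moreover have "\<phi> x \<in> L (Suc d)" if \<phi>: "\<phi> \<in> \<Phi>" and "x \<in> L (Suc d)" for \<phi> x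
    proof -
      obtain m l where ml: "m \<in> M" "l \<in> L d" "x = ?p d m \<otimes> l" using \<open>x \<in> L (Suc d)\<close> by (auto simp: LS)
      then have "\<phi> x = ?p d (\<phi> m) \<otimes> \<phi> l"
        using c M(3) hom_mult[OF op_hom[OF \<phi>]] p_op[OF \<phi>] by (auto simp: subset_iff)
      moreover have "\<phi> m \<in> M" by (rule M1(4)[OF \<phi> ml(1)])
      moreover have "\<phi> l \<in> L d" using Suc \<phi> ml(2) by blast
      ultimately show ?thesis unfolding LS by blast
    qed
    ultimately show ?case by blast
  qed
  have Lc: "L d \<subseteq> carrier G" for d using L_sub subgroup.subset by blast
  have L1: "\<one> \<in> L d" "x \<in> L d \<Longrightarrow> y \<in> L d \<Longrightarrow> x \<otimes> y \<in> L d" "x \<in> L d \<Longrightarrow> inv x \<in> L d" for d x y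
    using L_sub[of d] subgroup.one_closed subgroup.m_closed subgroup.m_inv_closed by fast+
  have L_Suc: "L d \<subseteq> L (Suc d)" for d
  proof
    fix x assume "x \<in> L d"
    then have "x = ?p d \<one> \<otimes> x" using subsetD[OF Lc] by simp
    then show "x \<in> L (Suc d)" using \<open>x \<in> L d\<close> M1(1) unfolding LS by blast
  qed
  have L_mono: "d \<le> e \<Longrightarrow> L d \<subseteq> L e" for d e
    using lift_Suc_mono_le[of L] L_Suc by blast
  have f_L: "f x \<in> L (Suc d)" if "x \<in> L d" for d x
    using that
  proof (induction d arbitrary: x)
    case 0
    then have "f x = \<one>" using p_one[of 1] by (simp add: L0)
    then show ?case using L1 by simp
  next
    case (Suc d)
    then obtain m l where ml: "m \<in> M" "l \<in> L d" "x = ?p d m \<otimes> l" by (auto simp: LS)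
    then have "f x = ?p (Suc d) m \<otimes> f l" using p_mult[of "?p d m" l 1] Lc M by (auto simp: subset_iff)
    then show ?case using ml Suc.IH[of l] unfolding LS[of "Suc d"] by blast
  qed
  have fp_L: "?p e x \<in> L (e + d)" if "x \<in> L d" for e d x
    by (induction e) (use that f_L in auto)
  let ?U = "\<Union>d. L d"
  have "O.invariant ?U"
    unfolding O.invariant_def
  proof
    show "subgroup ?U G" using L_sub L_mono by (intro subgroup_Union_chain) blast+
    show "\<forall>\<phi>\<in>insert f \<Phi>. \<phi> ` ?U \<subseteq> ?U"
    proof
      fix \<phi> assume "\<phi> \<in> insert f \<Phi>"
      then show "\<phi> ` ?U \<subseteq> ?U"
      proof
        assume "\<phi> = f"
        then show ?thesis using f_L by blast
      next
        assume "\<phi> \<in> \<Phi>"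
        then show ?thesis using L_sub by blast
      qed
    qed
  qed
  moreover have "S \<subseteq> ?U"
  proof
    fix x assume x: "x \<in> S"
    then have "x \<in> M" using op_span_incl[of S] unfolding M_def by blast
    moreover have "x = ?p 0 x \<otimes> \<one>" using subsetD[OF S x] by simp
    ultimately have "x \<in> L (Suc 0)" unfolding LS L0 by blast
    then show "x \<in> ?U" by blast
  qed
  ultimately have BU: "B \<subseteq> ?U" using B(2) O.op_span_min[of ?U S] by blast
  \<comment> \<open>Leading coefficients in degree \<open>d\<close>. An element may have several
    expressions as a polynomial in \<open>f\<close>, so the part \<open>l\<close> of lower degree is
    only asked to exist and no element is assigned a degree.\<close>
  define lead where "lead K d = {m \<in> M. \<exists>l\<in>L d. ?p d m \<otimes> l \<in> K}" for K d
  have lead_inv: "invariant (lead K d)" if K: "O.invariant K" for K d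
    unfolding invariant_def
  proof
    have Ks: "subgroup K G" "\<And>\<phi> x. \<phi> \<in> \<Phi> \<Longrightarrow> x \<in> K \<Longrightarrow> \<phi> x \<in> K"
      using K unfolding O.invariant_def by blast+
    show "subgroup (lead K d) G"
    proof
      show "lead K d \<subseteq> carrier G" using M by (auto simp: lead_def)
      show "\<one> \<in> lead K d"
        using L1(1) M1(1) subgroup.one_closed[OF Ks(1)] by (auto simp: lead_def intro!: bexI[of _ \<one>])
    next
      fix x assume "x \<in> lead K d"
      then obtain l where l: "x \<in> M" "l \<in> L d" "?p d x \<otimes> l \<in> K" by (auto simp: lead_def)
      then have "?p d (inv x) \<otimes> inv l = inv (?p d x \<otimes> l)" using Lc M by (auto simp: subset_iff inv_mult)
      then show "inv x \<in> lead K d"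
        using l L1(3) M1(3) subgroup.m_inv_closed[OF Ks(1) l(3)] by (auto simp: lead_def intro!: bexI[of _ "inv l"])
    next
      fix x y assume "x \<in> lead K d" "y \<in> lead K d"
      then obtain l l' where l: "x \<in> M" "l \<in> L d" "?p d x \<otimes> l \<in> K" "y \<in> M" "l' \<in> L d" "?p d y \<otimes> l' \<in> K"
        by (auto simp: lead_def)
      then have "?p d (x \<otimes> y) \<otimes> (l \<otimes> l') = (?p d x \<otimes> l) \<otimes> (?p d y \<otimes> l')"
        using Lc M by (auto simp: subset_iff m_swap)
      then show "x \<otimes> y \<in> lead K d"
        using l L1(2) M1(2) subgroup.m_closed[OF Ks(1) l(3,6)] by (auto simp: lead_def intro!: bexI[of _ "l \<otimes> l'"])
    qed
    have "\<phi> x \<in> lead K d" if \<phi>: "\<phi> \<in> \<Phi>" and "x \<in> lead K d" for \<phi> x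
    proof -
      obtain l where l: "x \<in> M" "l \<in> L d" "?p d x \<otimes> l \<in> K" using \<open>x \<in> lead K d\<close> by (auto simp: lead_def)
      then have "\<phi> (?p d x \<otimes> l) = ?p d (\<phi> x) \<otimes> \<phi> l"
        using Lc M hom_mult[OF op_hom[OF \<phi>]] p_op[OF \<phi>] by (auto simp: subset_iff)
      moreover have "\<phi> l \<in> L d" using L_sub \<phi> l by blast
      ultimately show ?thesis using M1(4)[OF \<phi> l(1)] Ks(2)[OF \<phi> l(3)] by (auto simp: lead_def)
    qed
    then show "\<forall>\<phi>\<in>\<Phi>. \<phi> ` lead K d \<subseteq> lead K d" by blast
  qed
  have f_B: "f x \<in> B" if "x \<in> B" for x using that B(1) unfolding O.invariant_def by blast
  have Bs: "subgroup B G" using B(1) unfolding O.invariant_def by blast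
  have lead_Suc: "lead B d \<subseteq> lead B (Suc d)" for d
  proof
    fix x assume "x \<in> lead B d"
    then obtain l where l: "x \<in> M" "l \<in> L d" "?p d x \<otimes> l \<in> B" by (auto simp: lead_def)
    then have "f (?p d x \<otimes> l) = ?p (Suc d) x \<otimes> f l" using p_mult[of "?p d x" l 1] Lc M by (auto simp: subset_iff)
    then show "x \<in> lead B (Suc d)" using f_B[OF l(3)] f_L[OF l(2)] l(1) by (auto simp: lead_def)
  qed
  have lead_mono: "d \<le> e \<Longrightarrow> lead B d \<subseteq> lead B e" for d e
    using lift_Suc_mono_le[of "lead B"] lead_Suc by blast
  let ?V = "\<Union>d. lead B d"
  have lead_invB: "invariant (lead B d)" for d using lead_inv B(1) by blast
  have "invariant ?V"
    unfolding invariant_def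
  proof
    show "subgroup ?V G"
      using lead_invB lead_mono unfolding invariant_def by (intro subgroup_Union_chain) blast+
    show "\<forall>\<phi>\<in>\<Phi>. \<phi> ` ?V \<subseteq> ?V"
    proof
      fix \<phi> assume "\<phi> \<in> \<Phi>"
      then have "\<phi> ` lead B d \<subseteq> lead B d" for d using lead_invB[of d] by (simp add: invariant_def)
      then show "\<phi> ` ?V \<subseteq> ?V" by blast
    qed
  qed
  moreover have "?V \<subseteq> op_span G \<Phi> S" by (auto simp: lead_def M_def)
  ultimately have "\<exists>Y. finite Y \<and> Y \<subseteq> ?V \<and> ?V = op_span G \<Phi> Y" by (rule noeth)
  then obtain Y where Y: "finite Y" "Y \<subseteq> ?V" "?V = op_span G \<Phi> Y" by (elim exE conjE)
  \<comment> \<open>The union of the increasing leading coefficients is finitely generated over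
    \<open>\<Phi>\<close>, so it is exhausted in some degree \<open>D\<close>.\<close>
  obtain D where D: "Y \<subseteq> lead B D"
  proof -
    have "\<exists>d. y \<in> lead B d" if "y \<in> Y" for y using that Y(2) by blast
    then obtain dd where dd: "y \<in> lead B (dd y)" if "y \<in> Y" for y by metis
    have "Y \<subseteq> lead B (Max (insert 0 (dd ` Y)))"
    proof
      fix y assume "y \<in> Y"
      then have "dd y \<le> Max (insert 0 (dd ` Y))" using Y(1) by simp
      then show "y \<in> lead B (Max (insert 0 (dd ` Y)))" using dd[OF \<open>y \<in> Y\<close>] lead_mono by blast
    qed
    then show ?thesis using that by blast
  qed
  have VD: "?V = lead B D" using Y(3) op_span_min[OF lead_invB D] by blast
  have "\<exists>Y. finite Y \<and> Y \<subseteq> lead B d \<and> lead B d = op_span G \<Phi> Y" for d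
    by (rule noeth[OF lead_invB]) (auto simp: lead_def M_def)
  then obtain Z where Z: "finite (Z d)" "Z d \<subseteq> lead B d" "lead B d = op_span G \<Phi> (Z d)" for d
    by metis
  have "\<exists>l. l \<in> L d \<and> ?p d y \<otimes> l \<in> B" if "y \<in> Z d" for d y
    using subsetD[OF Z(2) that] by (auto simp: lead_def)
  note lifts = this
  define t where "t d y = (SOME l. l \<in> L d \<and> ?p d y \<otimes> l \<in> B)" for d y
  have t: "t d y \<in> L d" "?p d y \<otimes> t d y \<in> B" if "y \<in> Z d" for d y
    using someI_ex[OF lifts[OF that]] unfolding t_def by auto
  \<comment> \<open>Generators of the leading coefficients in each degree up to \<open>D\<close>,
    completed by lower terms to elements of \<open>B\<close>.\<close>
  define W where "W = (\<Union>d\<le>D. (\<lambda>y. ?p d y \<otimes> t d y) ` Z d)"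
  have W: "finite W" "W \<subseteq> B" unfolding W_def using Z(1) t(2) by blast+
  define C where "C = op_span G (insert f \<Phi>) W"
  have CB: "C \<subseteq> B" unfolding C_def by (rule O.op_span_min[OF B(1) W(2)])
  have WC: "W \<subseteq> C" unfolding C_def by (rule O.op_span_incl)
  have "B \<subseteq> carrier G" using Bs subgroup.subset by blast
  then have C: "O.invariant C" unfolding C_def using W(2) by (intro O.op_span_invariant) blast
  then have Cs: "subgroup C G" and f_C: "\<And>x. x \<in> C \<Longrightarrow> f x \<in> C" unfolding O.invariant_def by blast+
  have fp_C: "?p e x \<in> C" if "x \<in> C" for e x by (induction e) (use that f_C in auto)
  have small: "lead B d \<subseteq> lead C d" if "d \<le> D" for d
  proof -
    have "Z d \<subseteq> lead C d"
    proof
      fix y assume y: "y \<in> Z d"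
      then have "?p d y \<otimes> t d y \<in> C" using WC that by (auto simp: W_def)
      moreover have "y \<in> M" using subsetD[OF Z(2) y] by (simp add: lead_def)
      ultimately show "y \<in> lead C d" using t(1)[OF y] by (auto simp: lead_def)
    qed
    from op_span_min[OF lead_inv[OF C] this] show ?thesis using Z(3)[of d] by simp
  qed
  \<comment> \<open>Beyond degree \<open>D\<close> no new leading coefficients appear, and those of
    degree \<open>D\<close> are raised to degree \<open>d\<close> by applying \<open>f\<close>
    another \<open>d - D\<close> times.\<close>
  have leads: "lead B d \<subseteq> lead C d" for d
  proof (cases "d \<le> D")
    case False
    then obtain e where e: "d = e + D" by (metis add.commute le_iff_add nat_le_linear)
    show ?thesis
    proof
      fix m assume "m \<in> lead B d"
      then have "m \<in> lead C D" using VD small by blast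
      then obtain l where l: "m \<in> M" "l \<in> L D" "?p D m \<otimes> l \<in> C" by (auto simp: lead_def)
      then have "?p e (?p D m \<otimes> l) = ?p d m \<otimes> ?p e l"
        using Lc M by (auto simp: subset_iff e funpow_add)
      then show "m \<in> lead C d" using fp_C[OF l(3), of e] fp_L[OF l(2), of e] l(1) e by (auto simp: lead_def)
    qed
  qed (rule small)
  \<comment> \<open>An element of \<open>C\<close> with the same leading term is divided off, which
    lowers the degree.\<close>
  have "B \<inter> L d \<subseteq> C" for d
  proof (induction d)
    case 0
    then show ?case using subgroup.one_closed[OF Cs] by (auto simp: L0)
  next
    case (Suc d)
    show ?case
    proof
      fix b assume "b \<in> B \<inter> L (Suc d)"
      then obtain m l where b: "b \<in> B" "m \<in> M" "l \<in> L d" "b = ?p d m \<otimes> l" by (auto simp: LS)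
      then have "m \<in> lead C d" using leads by (auto simp: lead_def)
      then obtain l' where l': "l' \<in> L d" "?p d m \<otimes> l' \<in> C" by (auto simp: lead_def)
      have car: "?p d m \<in> carrier G" "l \<in> carrier G" "l' \<in> carrier G" using b l' Lc M by auto
      have "b \<otimes> inv (?p d m \<otimes> l') = l \<otimes> inv l'"
        unfolding b(4) using car by (simp add: inv_mult m_ac)
      moreover have "b \<otimes> inv (?p d m \<otimes> l') \<in> B"
        using b(1) l'(2) CB Bs subgroup.m_closed subgroup.m_inv_closed by (metis subsetD)
      moreover have "l \<otimes> inv l' \<in> L d" using b l' L1 by auto
      ultimately have "b \<otimes> inv (?p d m \<otimes> l') \<in> C" using Suc by auto
      then have "b \<otimes> inv (?p d m \<otimes> l') \<otimes> (?p d m \<otimes> l') \<in> C"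
        using l'(2) subgroup.m_closed[OF Cs] by blast
      then show "b \<in> C" using car b(4) by (simp add: m_assoc)
    qed
  qed
  then have "B \<subseteq> C" using BU by blast
  then show ?thesis using CB W unfolding C_def by blast
qed

lemma (in comm_group) generate_insert:
  assumes "S \<subseteq> carrier G" "x \<in> carrier G"
  shows "generate G (insert x S) = {b \<otimes> x [^] (j::int) | b j. b \<in> generate G S}"
proof
  let ?A = "{b \<otimes> x [^] (j::int) | b j. b \<in> generate G S}"
  note B = generate_is_subgroup[OF assms(1)]
  note Bc = subgroup.mem_carrier[OF B]
  have "subgroup ?A G"
  proof
    show "?A \<subseteq> carrier G" using Bc assms(2) by auto
    show "\<one> \<in> ?A" using generate.one[of G S] by (intro CollectI exI[of _ \<one>] exI[of _ 0]) simp
    fix a assume "a \<in> ?A"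
    then obtain b j where a: "a = b \<otimes> x [^] (j::int)" "b \<in> generate G S" by blast
    have "inv a = inv b \<otimes> x [^] (- j)" using a Bc assms(2) by (simp add: inv_mult int_pow_neg)
    moreover have "inv b \<in> generate G S" by (rule subgroup.m_inv_closed[OF B a(2)])
    ultimately show "inv a \<in> ?A" by blast
    fix a' assume "a' \<in> ?A"
    then obtain b' j' where a': "a' = b' \<otimes> x [^] (j'::int)" "b' \<in> generate G S" by blast
    note c = Bc[OF a(2)] Bc[OF a'(2)]
    have "a \<otimes> a' = b \<otimes> (x [^] j \<otimes> b') \<otimes> x [^] j'"
      using a(1) a'(1) c assms(2) by (simp add: m_assoc)
    also have "x [^] j \<otimes> b' = b' \<otimes> x [^] j" using c assms(2) by (simp add: m_comm)
    also have "b \<otimes> (b' \<otimes> x [^] j) \<otimes> x [^] j' = (b \<otimes> b') \<otimes> x [^] (j + j')"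
      using c assms(2) by (simp add: m_assoc int_pow_mult)
    finally show "a \<otimes> a' \<in> ?A" using subgroup.m_closed[OF B a(2) a'(2)] by blast
  qed
  moreover have "insert x S \<subseteq> ?A"
  proof (intro insert_subsetI subsetI)
    show "x \<in> ?A" using generate.one[of G S] assms(2) by (intro CollectI exI[of _ \<one>] exI[of _ 1]) simp
    fix s assume "s \<in> S"
    then show "s \<in> ?A" using assms generate.incl[of s S G] by (intro CollectI exI[of _ s] exI[of _ 0]) auto
  qed
  ultimately show "generate G (insert x S) \<subseteq> ?A" by (rule generate_subgroup_incl[rotated])
  have G: "subgroup (generate G (insert x S)) G" using assms by (intro generate_is_subgroup) auto
  have "generate G S \<subseteq> generate G (insert x S)" by (rule mono_generate) blast
  moreover have "x [^] (j::int) \<in> generate G (insert x S)" for j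
    by (rule subgroup_int_pow_closed[OF G generate.incl]) simp
  ultimately show "?A \<subseteq> generate G (insert x S)" using subgroup.m_closed[OF G] by auto
qed

text \<open>Induction on the generators. The exponents of \<open>x\<close> that occur in elements of
  \<open>B\<close> form an ideal of the integers. An element of \<open>B\<close> realising the least
  positive exponent \<open>d\<close>, together with generators of the part of \<open>B\<close> free
  of \<open>x\<close>, generates \<open>B\<close> by division with remainder.\<close>

lemma (in comm_group) subgroup_of_finitely_generated:
  assumes "finite S" "S \<subseteq> carrier G" "subgroup B G" "B \<subseteq> generate G S"
  shows "\<exists>Y. finite Y \<and> Y \<subseteq> B \<and> B = generate G Y"
  using assms
proof (induction S arbitrary: B rule: finite_induct)
  case empty
  then have "B = {\<one>}" using generate_empty subgroup.one_closed by blast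
  then show ?case using generate_empty by (intro exI[of _ "{}"]) auto
next
  case (insert x S)
  let ?A = "generate G S"
  have x: "x \<in> carrier G" "S \<subseteq> carrier G" using insert.prems by auto
  have A: "subgroup ?A G" by (rule generate_is_subgroup[OF x(2)])
  have Ac: "a \<in> carrier G" if "a \<in> ?A" for a using subgroup.mem_carrier[OF A that] .
  have Bc: "b \<in> carrier G" if "b \<in> B" for b using subgroup.mem_carrier[OF insert.prems(2) that] .
  have rep: "\<exists>n::int. \<exists>a\<in>?A. b = x [^] n \<otimes> a" if "b \<in> B" for b
  proof -
    have "b \<in> generate G (insert x S)" using insert.prems(3) that by blast
    then obtain a and n :: int where a: "a \<in> ?A" "b = a \<otimes> x [^] n" unfolding generate_insert[OF x(2,1)] by blast
    then have "b = x [^] n \<otimes> a" using Ac x by (simp add: m_comm)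
    then show ?thesis using a(1) by blast
  qed
  have BA: "subgroup (B \<inter> ?A) G" using subgroups_Inter_pair insert.prems(2) A by blast
  have "B \<inter> ?A \<subseteq> ?A" by blast
  then obtain Y where Y: "finite Y" "Y \<subseteq> B \<inter> ?A" "B \<inter> ?A = generate G Y"
    using insert.IH[OF x(2) BA] by blast
  define I where "I = {n::nat. n > 0 \<and> (\<exists>a\<in>?A. x [^] (int n) \<otimes> a \<in> B)}"
  have I_pos: "nat \<bar>n\<bar> \<in> I" if "n \<noteq> 0" "a \<in> ?A" "x [^] n \<otimes> a \<in> B" for n :: int and a
  proof (cases "n > 0")
    case True
    then show ?thesis using that by (auto simp: I_def)
  next
    case False
    then have "inv (x [^] n \<otimes> a) = x [^] (int (nat \<bar>n\<bar>)) \<otimes> inv a"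
      using that x Ac by (simp add: inv_mult int_pow_neg)
    moreover have "inv (x [^] n \<otimes> a) \<in> B" using that subgroup.m_inv_closed[OF insert.prems(2)] by blast
    moreover have "inv a \<in> ?A" using that subgroup.m_inv_closed[OF A] by blast
    ultimately have "\<exists>a\<in>?A. x [^] (int (nat \<bar>n\<bar>)) \<otimes> a \<in> B" by metis
    then show ?thesis using False that(1) by (simp add: I_def)
  qed
  show ?case
  proof (cases "I = {}")
    case True
    have "B \<subseteq> ?A"
    proof
      fix b assume b: "b \<in> B"
      then obtain n :: int and a where a: "a \<in> ?A" "b = x [^] n \<otimes> a" using rep by blast
      then have "n = 0" using I_pos[of n a] b True by blast
      then show "b \<in> ?A" using a Ac by simp
    qed
    then have "B = B \<inter> ?A" by blast
    then show ?thesis using Y by auto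
  next
    case False
    define d where "d = (LEAST n. n \<in> I)"
    have "d \<in> I" unfolding d_def using False LeastI_ex[of "\<lambda>n. n \<in> I"] by blast
    then obtain a0 where a0: "d > 0" "a0 \<in> ?A" "x [^] (int d) \<otimes> a0 \<in> B" by (auto simp: I_def)
    let ?b = "x [^] (int d) \<otimes> a0"
    have bc: "?b \<in> carrier G" using Bc a0 by blast
    have sub: "insert ?b Y \<subseteq> B" using a0 Y by blast
    have "B \<subseteq> generate G (insert ?b Y)"
    proof
      fix b assume b: "b \<in> B"
      then obtain n :: int and a where a: "a \<in> ?A" "b = x [^] n \<otimes> a" using rep by blast
      define q where "q = n div int d"
      let ?c = "b \<otimes> inv (?b [^] q)"
      have q: "?b [^] q = x [^] (int d * q) \<otimes> a0 [^] q"
        using x Ac a0 by (simp add: int_pow_distrib int_pow_pow)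
      have cA: "a \<otimes> inv (a0 [^] q) \<in> ?A"
        using a a0 A subgroup_int_pow_closed[OF A] subgroup.m_closed[OF A] subgroup.m_inv_closed[OF A] by blast
      have "x [^] n = x [^] (n mod int d) \<otimes> x [^] (int d * q)"
        using x by (simp add: int_pow_mult[symmetric] q_def)
      then have "?c = (x [^] (n mod int d) \<otimes> a) \<otimes> (x [^] (int d * q) \<otimes> inv (x [^] (int d * q) \<otimes> a0 [^] q))"
        unfolding q a(2) using x Ac a a0 by (simp add: m_assoc m_lcomm[of "x [^] (int d * q)" a])
      also have "x [^] (int d * q) \<otimes> inv (x [^] (int d * q) \<otimes> a0 [^] q) = inv (a0 [^] q)"
        using x Ac a0 by (simp add: inv_mult)
      finally have c: "?c = x [^] (n mod int d) \<otimes> (a \<otimes> inv (a0 [^] q))"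
        using x Ac a a0 by (simp add: m_assoc)
      have cB: "?c \<in> B"
        using b a0 subgroup_int_pow_closed[OF insert.prems(2)] subgroup.m_closed[OF insert.prems(2)]
          subgroup.m_inv_closed[OF insert.prems(2)] by blast
      have "n mod int d = 0"
      proof (rule ccontr)
        assume nz: "n mod int d \<noteq> 0"
        then have "nat \<bar>n mod int d\<bar> \<in> I" using I_pos[OF nz cA] cB c by simp
        then have "d \<le> nat \<bar>n mod int d\<bar>" unfolding d_def by (rule Least_le)
        moreover have "0 \<le> n mod int d" "n mod int d < int d" using a0(1) by auto
        ultimately show False by linarith
      qed
      then have "?c \<in> ?A" using c cA Ac by simp
      then have "?c \<in> generate G Y" using cB Y by blast
      then have c': "?c \<in> generate G (insert ?b Y)" using mono_generate[of Y "insert ?b Y"] by blast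
      have gs: "subgroup (generate G (insert ?b Y)) G"
        using sub Bc by (intro generate_is_subgroup) blast
      have "?b [^] q \<in> generate G (insert ?b Y)"
        using subgroup_int_pow_closed[OF gs] generate.incl[of ?b "insert ?b Y" G] by blast
      then have "?c \<otimes> ?b [^] q \<in> generate G (insert ?b Y)" using c' subgroup.m_closed[OF gs] by blast
      moreover have "?c \<otimes> ?b [^] q = b" using Bc[OF b] bc by (simp add: m_assoc)
      ultimately show "b \<in> generate G (insert ?b Y)" by simp
    qed
    moreover have "generate G (insert ?b Y) \<subseteq> B" using generate_subgroup_incl[OF sub insert.prems(2)] .
    ultimately show ?thesis using Y(1) sub by (intro exI[of _ "insert ?b Y"]) auto
  qed
qed

text \<open>Operators are adjoined one by one; without any operator the claim concerns subgroups of
  finitely generated abelian groups.\<close>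

theorem noetherian_operators:
  assumes "finite \<Phi>" "operators G \<Phi>" "finite S" "S \<subseteq> carrier G"
    and "operators.invariant G \<Phi> B" "B \<subseteq> op_span G \<Phi> S"
  shows "\<exists>Y. finite Y \<and> Y \<subseteq> B \<and> B = op_span G \<Phi> Y"
  using assms(1,2,5,6)
proof (induction \<Phi> arbitrary: B rule: finite_induct)
  case empty
  interpret operators G "{}" by fact
  have eq: "op_span G {} Y = generate G Y" if "Y \<subseteq> carrier G" for Y
    unfolding op_span_def generate_minimal[OF that] by simp
  have B: "subgroup B G" using empty.prems(2) unfolding invariant_def by blast
  then have "B \<subseteq> generate G S" using empty.prems(3) eq[OF assms(4)] by simp
  then obtain Y where Y: "finite Y" "Y \<subseteq> B" "B = generate G Y"
    using subgroup_of_finitely_generated[OF assms(3,4) B] by blast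
  have "Y \<subseteq> carrier G" using Y(2) subgroup.subset[OF B] by blast
  then show ?case using Y eq[of Y] by (intro exI[of _ Y]) simp
next
  case (insert f \<Phi>)
  have ops: "operators G \<Phi>"
    using insert.prems(1) unfolding operators_def operators_axioms_def by blast
  show ?case
    by (rule hilbert_basis_step[OF ops insert.prems(1) assms(4) insert.IH[OF ops] insert.prems(2,3)])
qed

text \<open>Only the conjugation action on the abelian normal subgroup \<open>N\<close> has to be commutative.\<close>

theorem (in group) normal_subgroups_finitely_generated:
  assumes "finite S" "S \<subseteq> carrier G" "generate G S = carrier G"
    and N: "N \<lhd> G" "\<And>x y. x \<in> N \<Longrightarrow> y \<in> N \<Longrightarrow> x \<otimes> y = y \<otimes> x"
    and comm: "\<And>g h x. g \<in> carrier G \<Longrightarrow> h \<in> carrier G \<Longrightarrow> x \<in> N \<Longrightarrow>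
      conj_by G g (conj_by G h x) = conj_by G h (conj_by G g x)"
    and "finite T" "N = normal_closure G T"
    and "B \<lhd> G" "B \<subseteq> N"
  obtains Y where "finite Y" "Y \<subseteq> B" "B = normal_closure G Y"
proof -
  interpret N: normal N G by fact
  interpret B: normal B G by fact
  let ?N = "G\<lparr>carrier := N\<rparr>"
  \<comment> \<open>Inverse generators are included so that every invariant subgroup is
    normal.\<close>
  let ?\<Phi> = "conj_by G ` (S \<union> m_inv G ` S)"
  have TN: "T \<subseteq> N" using assms(8) normal_closure_incl by simp
  have gN: "group ?N" by (rule subgroup_imp_group[OF N.is_subgroup])
  interpret N': comm_group ?N
    by (rule group.group_comm_groupI[OF gN]) (simp add: N(2))
  have closed: "s \<in> carrier G" if "s \<in> S \<union> m_inv G ` S" for s using that assms(2) by auto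
  interpret operators ?N ?\<Phi>
  proof
    fix \<phi> assume "\<phi> \<in> ?\<Phi>"
    then obtain s where s: "s \<in> carrier G" "\<phi> = conj_by G s" using closed by auto
    then show "\<phi> \<in> hom ?N ?N"
      using normal_conj_by[OF N(1)] N.subset by (auto simp: hom_def conj_by_mult subset_iff)
    fix \<psi> x assume "\<psi> \<in> ?\<Phi>" "x \<in> carrier ?N"
    then obtain t where "t \<in> carrier G" "\<psi> = conj_by G t" "x \<in> N" using closed by auto
    then show "\<phi> (\<psi> x) = \<psi> (\<phi> x)" using s comm by simp
  qed
  have normal: "H \<lhd> G" if H: "invariant H" for H
  proof -
    have Hs: "subgroup H ?N" and HN: "H \<subseteq> N"
      using H subgroup.subset[of H ?N] by (auto simp: invariant_def)
    have "subgroup H G" by (rule incl_subgroup[OF N.is_subgroup Hs])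
    then show ?thesis
    proof (rule normal_if_generators[OF _ assms(2,3)])
      fix s x assume sx: "s \<in> S" "x \<in> H"
      have "conj_by G s ` H \<subseteq> H" "conj_by G (inv s) ` H \<subseteq> H"
        using H sx(1) unfolding invariant_def by blast+
      then show "conj_by G s x \<in> H" "conj_by G (inv s) x \<in> H" using sx(2) by blast+
    qed
  qed
  have inv: "invariant H" if "H \<lhd> G" "H \<subseteq> N" for H
    unfolding invariant_def
  proof
    show "subgroup H ?N" by (rule subgroup_incl[OF normal_imp_subgroup[OF that(1)] N.is_subgroup that(2)])
    show "\<forall>\<phi>\<in>?\<Phi>. \<phi> ` H \<subseteq> H" using normal_conj_by[OF that(1)] closed by blast
  qed
  have eq: "op_span ?N ?\<Phi> Y = normal_closure G Y" if Y: "Y \<subseteq> N" for Y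
  proof
    have YG: "Y \<subseteq> carrier G" using Y N.subset by blast
    have "op_span ?N ?\<Phi> Y \<lhd> G" using normal[OF op_span_invariant] Y by simp
    then show "normal_closure G Y \<subseteq> op_span ?N ?\<Phi> Y"
      by (rule normal_closure_min) (rule op_span_incl)
    have "invariant (normal_closure G Y)"
      using normal_closure_normal[OF YG] normal_closure_min[OF N(1) Y] by (rule inv)
    then show "op_span ?N ?\<Phi> Y \<subseteq> normal_closure G Y"
      by (rule op_span_min) (rule normal_closure_incl)
  qed
  have "finite ?\<Phi>" using assms(1) by blast
  moreover have "B \<subseteq> op_span ?N ?\<Phi> T" using eq[OF TN] assms(8,10) by simp
  ultimately obtain Y where Y: "finite Y" "Y \<subseteq> B" "B = op_span ?N ?\<Phi> Y"
    using noetherian_operators[of ?\<Phi> ?N T B] inv[OF assms(9,10)] assms(7) TN operators_axioms by auto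
  then have "Y \<subseteq> N" using assms(10) by blast
  then have "B = normal_closure G Y" using Y(3) eq by simp
  then show ?thesis using that Y(1,2) by blast
qed

text \<open>Cosets are handled through the projection homomorphism; unfolding the quotient product
  into a product of sets would hide it from the rules for groups.\<close>

declare mult_FactGroup [simp del] one_FactGroup [simp del]

section \<open>Commutators of normal subgroups of a free group\<close>

definition commutators :: "('a, 'c) monoid_scheme \<Rightarrow> 'a set \<Rightarrow> 'a set \<Rightarrow> 'a set" where
  "commutators G A B = {x \<otimes>\<^bsub>G\<^esub> y \<otimes>\<^bsub>G\<^esub> inv\<^bsub>G\<^esub> x \<otimes>\<^bsub>G\<^esub> inv\<^bsub>G\<^esub> y | x y. x \<in> A \<and> y \<in> B}"

lemma (in group) generate_commute:
  assumes "S \<subseteq> carrier G" "C \<subseteq> carrier G" "\<And>s y. s \<in> S \<Longrightarrow> y \<in> C \<Longrightarrow> s \<otimes> y = y \<otimes> s"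
    and "x \<in> generate G S" "y \<in> C"
  shows "x \<otimes> y = y \<otimes> x"
proof -
  have "subgroup {x \<in> carrier G. x \<otimes> y = y \<otimes> x} G"
  proof
    have y: "y \<in> carrier G" using assms(2,5) by blast
    then show "\<one> \<in> {x \<in> carrier G. x \<otimes> y = y \<otimes> x}" by simp
    fix a assume "a \<in> {x \<in> carrier G. x \<otimes> y = y \<otimes> x}"
    then have a: "a \<in> carrier G" "a \<otimes> y = y \<otimes> a" by auto
    have "inv a \<otimes> y = inv a \<otimes> (y \<otimes> a) \<otimes> inv a" using a(1) y by (simp add: m_assoc)
    also have "\<dots> = y \<otimes> inv a" unfolding a(2)[symmetric] using a(1) y by simp
    finally show "inv a \<in> {x \<in> carrier G. x \<otimes> y = y \<otimes> x}" using a(1) by simp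
    fix b assume "b \<in> {x \<in> carrier G. x \<otimes> y = y \<otimes> x}"
    then have b: "b \<in> carrier G" "b \<otimes> y = y \<otimes> b" by auto
    have "a \<otimes> b \<otimes> y = a \<otimes> (y \<otimes> b)" using a(1) b(1) y by (simp add: m_assoc b(2)[symmetric])
    also have "\<dots> = a \<otimes> y \<otimes> b" using a(1) b(1) y by (simp add: m_assoc)
    also have "\<dots> = y \<otimes> (a \<otimes> b)" unfolding a(2) using a(1) b(1) y by (simp add: m_assoc)
    finally show "a \<otimes> b \<in> {x \<in> carrier G. x \<otimes> y = y \<otimes> x}" using a(1) b(1) by simp
  qed auto
  moreover have "S \<subseteq> {x \<in> carrier G. x \<otimes> y = y \<otimes> x}" using assms(1,3,5) by auto
  ultimately have "generate G S \<subseteq> {x \<in> carrier G. x \<otimes> y = y \<otimes> x}" by (rule generate_subgroup_incl[rotated])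
  then show ?thesis using assms(4) by blast
qed

lemma (in group) normal_if_commutators:
  assumes N: "subgroup N G" and commN: "commutators G (carrier G) (carrier G) \<subseteq> N"
  shows "N \<lhd> G"
proof (rule normal_invI[OF N])
  fix x h assume xh: "x \<in> carrier G" "h \<in> N"
  have h: "h \<in> carrier G" using subgroup.mem_carrier[OF N xh(2)] .
  have "x \<otimes> h \<otimes> inv x \<otimes> inv h \<in> N" using commN xh h unfolding commutators_def by blast
  then have "x \<otimes> h \<otimes> inv x \<otimes> inv h \<otimes> h \<in> N" by (rule subgroup.m_closed[OF N _ xh(2)])
  then show "x \<otimes> h \<otimes> inv x \<in> N" using xh h by (simp add: m_assoc)
qed

context group
begin

lemma commutator_eq_one_iff:
  "x \<in> carrier G \<Longrightarrow> y \<in> carrier G \<Longrightarrow> x \<otimes> y \<otimes> inv x \<otimes> inv y = \<one> \<longleftrightarrow> x \<otimes> y = y \<otimes> x"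
proof -
  assume xy: "x \<in> carrier G" "y \<in> carrier G"
  have "x \<otimes> y \<otimes> inv x \<otimes> inv y = (x \<otimes> y) \<otimes> inv (y \<otimes> x)"
    using xy by (simp add: inv_mult_group m_assoc)
  also have "\<dots> = \<one> \<longleftrightarrow> x \<otimes> y = y \<otimes> x"
    using xy inv_solve_right'[of \<one> "x \<otimes> y" "y \<otimes> x"] by simp
  finally show ?thesis .
qed

lemma commutators_subset:
  assumes "A \<lhd> G" "B \<lhd> G"
  shows "commutators G A B \<subseteq> A \<inter> B"
proof
  fix z assume "z \<in> commutators G A B"
  then obtain x y where xy: "x \<in> A" "y \<in> B" "z = x \<otimes> y \<otimes> inv x \<otimes> inv y"
    by (auto simp: commutators_def)
  interpret A: normal A G by fact
  interpret B: normal B G by fact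
  have "z = x \<otimes> (y \<otimes> inv x \<otimes> inv y)" using xy by (simp add: m_assoc)
  moreover have "y \<otimes> inv x \<otimes> inv y \<in> A"
    using A.inv_op_closed2[OF B.mem_carrier[OF xy(2)] A.m_inv_closed[OF xy(1)]] .
  ultimately have "z \<in> A" using A.m_closed[OF xy(1)] by simp
  moreover have "z \<in> B"
    using B.m_closed[OF B.inv_op_closed2[OF A.mem_carrier[OF xy(1)] xy(2)] B.m_inv_closed[OF xy(2)]] xy(3)
    by simp
  ultimately show "z \<in> A \<inter> B" by blast
qed

lemma commutators_carrier: "A \<subseteq> carrier G \<Longrightarrow> B \<subseteq> carrier G \<Longrightarrow> commutators G A B \<subseteq> carrier G"
  unfolding commutators_def by (auto simp: subset_iff)

lemma commutators_conj:
  assumes "A \<lhd> G" "B \<lhd> G" "g \<in> carrier G" "z \<in> commutators G A B"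
  shows "conj_by G g z \<in> commutators G A B"
proof -
  obtain x y where xy: "x \<in> A" "y \<in> B" "z = x \<otimes> y \<otimes> inv x \<otimes> inv y"
    using assms(4) by (auto simp: commutators_def)
  have car: "x \<in> carrier G" "y \<in> carrier G"
    using xy assms(1,2) normal_imp_subgroup subgroup.mem_carrier by metis+
  have "conj_by G g z = conj_by G g x \<otimes> conj_by G g y \<otimes> inv (conj_by G g x) \<otimes> inv (conj_by G g y)"
    using car assms(3) by (simp add: xy(3) conj_by_mult conj_by_inv)
  then show ?thesis
    using xy assms normal_conj_by unfolding commutators_def by blast
qed

lemma normal_generate_conj:
  assumes "C \<subseteq> carrier G" "\<And>g z. g \<in> carrier G \<Longrightarrow> z \<in> C \<Longrightarrow> conj_by G g z \<in> C"
  shows "generate G C \<lhd> G"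
  by (rule normal_generateI[OF assms(1)]) (use assms(2) in \<open>simp add: conj_by_def\<close>)

end

text \<open>Let \<open>A\<close> and \<open>B\<close> be normal subgroups of a free group. The subgroup \<open>AB\<close> of the free group is
  projective, so the projection \<open>AB \<longrightarrow> AB/B = A/(A \<inter> B)\<close> lifts to a homomorphism \<open>AB \<longrightarrow> A\<close>. It is
  written down letter by letter, in the manner of Schreier.\<close>

locale free_normal_pair =
  fixes S :: "'x set" and A B :: "'x letter list set"
  assumes A: "A \<lhd> free_group S" and B: "B \<lhd> free_group S"
begin

abbreviation F where "F \<equiv> free_group S"

sublocale F: group F by (rule group_free_group)
sublocale A: normal A F by (rule A)
sublocale B: normal B F by (rule B)

definition AB where "AB = A <#>\<^bsub>F\<^esub> B"

sublocale AB: normal AB F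
  unfolding AB_def by (rule F.normal_subgroup_set_mult_closed[OF A B])

abbreviation Q where "Q \<equiv> F Mod AB"

sublocale Q: group Q by (rule AB.factorgroup_is_group)

abbreviation gen :: "'x \<Rightarrow> 'x letter list" where "gen x \<equiv> [(x, True)]"

lemma gen_closed: "x \<in> S \<Longrightarrow> gen x \<in> carrier F" by (simp add: free_group_def)

abbreviation cls where "cls w \<equiv> AB #>\<^bsub>F\<^esub> w"

lemma cls_hom: "cls \<in> hom F Q" by (rule AB.r_coset_hom_Mod)

sublocale LF: letters F gen S
  by (intro letters.intro letters_axioms.intro F.is_group) (rule gen_closed)

sublocale LQ: letters Q "\<lambda>x. cls (gen x)" S
  using hom_in_carrier[OF cls_hom] gen_closed
  by (intro letters.intro letters_axioms.intro Q.is_group) blast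

lemma cls_word: "w \<in> carrier F \<Longrightarrow> word_val Q (\<lambda>x. cls (gen x)) w = cls w"
proof -
  assume w: "w \<in> carrier F"
  then have "w \<in> lists (S \<times> UNIV)" by (simp add: free_group_def)
  from LF.hom_word_val[OF Q.is_group cls_hom this] show ?thesis
    using word_val_free_group[OF w] by (simp add: comp_def)
qed

text \<open>A transversal of \<open>AB\<close>. The trivial coset is represented by the neutral
  element, so that for words in \<open>AB\<close> the expression in \<open>lift_schreier\<close> at
  the trivial coset involves the word itself and not a conjugate.\<close>

definition rep :: "'x letter list set \<Rightarrow> 'x letter list" where
  "rep c = (if c = \<one>\<^bsub>Q\<^esub> then \<one>\<^bsub>F\<^esub> else SOME w. w \<in> carrier F \<and> cls w = c)"

lemma rep: "c \<in> carrier Q \<Longrightarrow> rep c \<in> carrier F" "c \<in> carrier Q \<Longrightarrow> cls (rep c) = c"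
proof -
  assume "c \<in> carrier Q"
  then have "\<exists>w. w \<in> carrier F \<and> cls w = c" by (auto simp: carrier_FactGroup)
  from someI_ex[OF this] have "rep c \<in> carrier F \<and> cls (rep c) = c"
    using hom_one[OF cls_hom F.is_group Q.is_group] by (auto simp: rep_def)
  then show "rep c \<in> carrier F" "cls (rep c) = c" by auto
qed

lemma rep_one: "rep (\<one>\<^bsub>Q\<^esub>) = \<one>\<^bsub>F\<^esub>" by (simp add: rep_def)

definition schreier where
  "schreier c w = rep c \<otimes>\<^bsub>F\<^esub> w \<otimes>\<^bsub>F\<^esub> inv\<^bsub>F\<^esub> rep (c \<otimes>\<^bsub>Q\<^esub> cls w)"

lemma schreier_AB:
  assumes "c \<in> carrier Q" "w \<in> carrier F"
  shows "schreier c w \<in> AB"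
proof -
  interpret h: group_hom F Q cls by unfold_locales (rule cls_hom)
  have d: "c \<otimes>\<^bsub>Q\<^esub> cls w \<in> carrier Q" using assms by (intro Q.m_closed h.hom_closed)
  have "schreier c w \<in> carrier F" unfolding schreier_def using rep(1)[OF assms(1)] rep(1)[OF d] assms by auto
  moreover have "cls (schreier c w) = \<one>\<^bsub>Q\<^esub>"
    unfolding schreier_def using rep[OF assms(1)] rep[OF d] assms d
    by (simp only: h.hom_mult h.hom_inv F.m_closed F.inv_closed Q.r_inv)
  ultimately show ?thesis using F.coset_join1[OF _ _ AB.is_subgroup] by (simp add: one_FactGroup)
qed

text \<open>The pairs of a coset and a generator are the edges of the covering graph belonging to
  \<open>AB\<close>. Values on edges can be chosen independently, because a product over the edges
  of a path respects free reduction.\<close>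

definition lift_gen where
  "lift_gen c x = (SOME a. a \<in> A \<and> inv\<^bsub>F\<^esub> a \<otimes>\<^bsub>F\<^esub> schreier c (gen x) \<in> B)"

lemma lift_gen:
  assumes "c \<in> carrier Q" "x \<in> S"
  shows "lift_gen c x \<in> A" "inv\<^bsub>F\<^esub> lift_gen c x \<otimes>\<^bsub>F\<^esub> schreier c (gen x) \<in> B"
proof -
  obtain a b where ab: "a \<in> A" "b \<in> B" "schreier c (gen x) = a \<otimes>\<^bsub>F\<^esub> b"
    using schreier_AB[OF assms(1) gen_closed[OF assms(2)]] by (auto simp: AB_def set_mult_def)
  then have "inv\<^bsub>F\<^esub> a \<otimes>\<^bsub>F\<^esub> schreier c (gen x) = b" by simp
  then have "\<exists>a. a \<in> A \<and> inv\<^bsub>F\<^esub> a \<otimes>\<^bsub>F\<^esub> schreier c (gen x) \<in> B" using ab by auto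
  from someI_ex[OF this] show "lift_gen c x \<in> A" "inv\<^bsub>F\<^esub> lift_gen c x \<otimes>\<^bsub>F\<^esub> schreier c (gen x) \<in> B"
    by (auto simp: lift_gen_def)
qed

abbreviation step where "step c a \<equiv> c \<otimes>\<^bsub>Q\<^esub> letter_val Q (\<lambda>x. cls (gen x)) a"

text \<open>An inverse letter runs through an edge backwards; that edge starts at the coset at which
  the letter arrives.\<close>

definition lift_letter where
  "lift_letter c a = (if snd a then lift_gen c (fst a) else inv\<^bsub>F\<^esub> lift_gen (step c a) (fst a))"

fun lift :: "'x letter list \<Rightarrow> 'x letter list set \<Rightarrow> 'x letter list" where
  "lift [] c = \<one>\<^bsub>F\<^esub>"
| "lift (a # w) c = lift_letter c a \<otimes>\<^bsub>F\<^esub> lift w (step c a)"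

lemma step_closed: "c \<in> carrier Q \<Longrightarrow> fst a \<in> S \<Longrightarrow> step c a \<in> carrier Q"
  by (intro Q.m_closed LQ.letter_val_closed)

lemma step_inv: "c \<in> carrier Q \<Longrightarrow> fst a \<in> S \<Longrightarrow> step (step c a) (inv_letter a) = c"
  using LQ.letter_val_closed[of a] by (simp only: LQ.letter_val_inv_letter Q.m_assoc Q.inv_closed Q.r_inv Q.r_one)

lemma lift_letter_A: "c \<in> carrier Q \<Longrightarrow> fst a \<in> S \<Longrightarrow> lift_letter c a \<in> A"
  unfolding lift_letter_def using lift_gen(1)[of c "fst a"] lift_gen(1)[OF step_closed, of c a "fst a"] by simp

lemma lift_letter_inv:
  assumes "c \<in> carrier Q" "fst a \<in> S"
  shows "lift_letter (step c a) (inv_letter a) = inv\<^bsub>F\<^esub> lift_letter c a"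
proof -
  have "lift_gen c (fst a) \<in> carrier F" "lift_gen (step c a) (fst a) \<in> carrier F"
    using A.mem_carrier[OF lift_gen(1)[OF assms]] A.mem_carrier[OF lift_gen(1)[OF step_closed[OF assms] assms(2)]]
    by blast+
  moreover have "snd (inv_letter a) = (\<not> snd a)" "fst (inv_letter a) = fst a"
    by (simp_all add: inv_letter_def)
  ultimately show ?thesis
    unfolding lift_letter_def step_inv[OF assms] by simp
qed

lemma lift_A: "c \<in> carrier Q \<Longrightarrow> w \<in> lists (S \<times> UNIV) \<Longrightarrow> lift w c \<in> A"
proof (induction w arbitrary: c)
  case (Cons a w)
  then have a: "fst a \<in> S" and w: "w \<in> lists (S \<times> UNIV)" by auto
  show ?case
    using A.m_closed[OF lift_letter_A[OF Cons.prems(1) a] Cons.IH[OF step_closed[OF Cons.prems(1) a] w]]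
    by simp
qed simp

lemma lift_push:
  assumes "c \<in> carrier Q" "a \<in> S \<times> UNIV" "w \<in> lists (S \<times> UNIV)"
  shows "lift (push a w) c = lift_letter c a \<otimes>\<^bsub>F\<^esub> lift w (step c a)"
proof (cases "\<exists>v. w = inv_letter a # v")
  case True
  then obtain v where v: "w = inv_letter a # v" by blast
  have a: "fst a \<in> S" and vl: "v \<in> lists (S \<times> UNIV)" using assms v by auto
  have "lift_letter c a \<in> carrier F" "lift v c \<in> carrier F"
    using lift_letter_A[OF assms(1) a] lift_A[OF assms(1) vl] by auto
  then show ?thesis
    using v lift_letter_inv[OF assms(1) a] step_inv[OF assms(1) a] by simp
next
  case False
  then have "push a w = a # w" by (cases w) auto
  then show ?thesis by simp
qed

text \<open>A cocycle rule. For \<open>u\<close> in \<open>AB\<close> the coset does not change, and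
  the rule becomes multiplicativity of \<open>\<tau>\<close>.\<close>

lemma lift_foldr_push:
  "c \<in> carrier Q \<Longrightarrow> u \<in> lists (S \<times> UNIV) \<Longrightarrow> v \<in> lists (S \<times> UNIV) \<Longrightarrow>
    lift (foldr push u v) c = lift u c \<otimes>\<^bsub>F\<^esub> lift v (c \<otimes>\<^bsub>Q\<^esub> word_val Q (\<lambda>x. cls (gen x)) u)"
proof (induction u arbitrary: c)
  case Nil
  then show ?case using A.mem_carrier[OF lift_A[OF Nil(1,3)]] Q.r_one[OF Nil(1)] by simp
next
  case (Cons a u)
  have a: "fst a \<in> S" "a \<in> S \<times> UNIV" and u: "u \<in> lists (S \<times> UNIV)" using Cons.prems by auto
  let ?d = "step c a" and ?q = "word_val Q (\<lambda>x. cls (gen x)) u"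
  have d: "?d \<in> carrier Q" using step_closed Cons.prems a by blast
  have q: "?q \<in> carrier Q" by (rule LQ.word_val_closed[OF u])
  have l: "letter_val Q (\<lambda>x. cls (gen x)) a \<in> carrier Q" by (rule LQ.letter_val_closed[OF a(1)])
  have "lift (foldr push (a # u) v) c = lift_letter c a \<otimes>\<^bsub>F\<^esub> lift (foldr push u v) ?d"
    using lift_push[OF Cons.prems(1) a(2)] foldr_push_in_lists[OF u Cons.prems(3)] by simp
  also have "\<dots> = lift_letter c a \<otimes>\<^bsub>F\<^esub> (lift u ?d \<otimes>\<^bsub>F\<^esub> lift v (?d \<otimes>\<^bsub>Q\<^esub> ?q))"
    using Cons.IH[OF d u Cons.prems(3)] by simp
  also have "?d \<otimes>\<^bsub>Q\<^esub> ?q = c \<otimes>\<^bsub>Q\<^esub> word_val Q (\<lambda>x. cls (gen x)) (a # u)"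
    using Q.m_assoc[OF Cons.prems(1) l q] by simp
  finally have *: "lift (foldr push (a # u) v) c = lift_letter c a \<otimes>\<^bsub>F\<^esub>
      (lift u ?d \<otimes>\<^bsub>F\<^esub> lift v (c \<otimes>\<^bsub>Q\<^esub> word_val Q (\<lambda>x. cls (gen x)) (a # u)))" .
  have "c \<otimes>\<^bsub>Q\<^esub> word_val Q (\<lambda>x. cls (gen x)) (a # u) \<in> carrier Q"
    using Q.m_closed[OF Cons.prems(1) LQ.word_val_closed[OF Cons.prems(2)]] .
  note V = A.mem_carrier[OF lift_A[OF this Cons.prems(3)]]
  show ?case
    unfolding * lift.simps(2)
    using F.m_assoc[OF A.mem_carrier[OF lift_letter_A[OF Cons.prems(1) a(1)]] A.mem_carrier[OF lift_A[OF d u]] V]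
    by (rule sym)
qed

lemma lift_letter_schreier:
  assumes c: "c \<in> carrier Q" and a: "fst a \<in> S"
  shows "inv\<^bsub>F\<^esub> lift_letter c a \<otimes>\<^bsub>F\<^esub>
    (rep c \<otimes>\<^bsub>F\<^esub> letter_val F gen a \<otimes>\<^bsub>F\<^esub> inv\<^bsub>F\<^esub> rep (step c a)) \<in> B"
proof (cases "snd a")
  case True
  then show ?thesis
    using lift_gen(2)[OF c a] by (simp add: lift_letter_def letter_val_def schreier_def)
next
  case False
  let ?d = "step c a" and ?x = "gen (fst a)"
  have d: "?d \<in> carrier Q" using step_closed c a by blast
  have xF: "?x \<in> carrier F" using gen_closed a by blast
  have xQ: "cls ?x \<in> carrier Q" using LQ.letters_closed a by blast
  have "?d \<otimes>\<^bsub>Q\<^esub> cls ?x = c"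
    using step_inv[OF c a] False by (simp add: letter_val_def inv_letter_def)
  then have s: "schreier ?d ?x = rep ?d \<otimes>\<^bsub>F\<^esub> ?x \<otimes>\<^bsub>F\<^esub> inv\<^bsub>F\<^esub> rep c"
    by (simp add: schreier_def)
  let ?t = "lift_gen ?d (fst a)"
  have t: "?t \<in> A" "inv\<^bsub>F\<^esub> ?t \<otimes>\<^bsub>F\<^esub> schreier ?d ?x \<in> B" using lift_gen[OF d a] by auto
  have car: "?t \<in> carrier F" "rep ?d \<in> carrier F" "rep c \<in> carrier F" using t rep d c by auto
  have "?t \<otimes>\<^bsub>F\<^esub> inv\<^bsub>F\<^esub> (inv\<^bsub>F\<^esub> ?t \<otimes>\<^bsub>F\<^esub> schreier ?d ?x) \<otimes>\<^bsub>F\<^esub> inv\<^bsub>F\<^esub> ?t \<in> B"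
    by (rule B.inv_op_closed2[OF car(1) B.m_inv_closed[OF t(2)]])
  moreover have "?t \<otimes>\<^bsub>F\<^esub> inv\<^bsub>F\<^esub> (inv\<^bsub>F\<^esub> ?t \<otimes>\<^bsub>F\<^esub> schreier ?d ?x) \<otimes>\<^bsub>F\<^esub> inv\<^bsub>F\<^esub> ?t
      = ?t \<otimes>\<^bsub>F\<^esub> (rep c \<otimes>\<^bsub>F\<^esub> inv\<^bsub>F\<^esub> ?x \<otimes>\<^bsub>F\<^esub> inv\<^bsub>F\<^esub> rep ?d)"
    using car xF by (simp add: s F.inv_mult_group F.m_assoc)
  ultimately show ?thesis using False car by (simp add: lift_letter_def letter_val_def)
qed

text \<open>The representatives telescope along the word, and the deviations of the single letters
  combine to an element of \<open>B\<close> because \<open>B\<close> is normal.\<close>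

lemma lift_schreier:
  "c \<in> carrier Q \<Longrightarrow> w \<in> lists (S \<times> UNIV) \<Longrightarrow>
    inv\<^bsub>F\<^esub> lift w c \<otimes>\<^bsub>F\<^esub> (rep c \<otimes>\<^bsub>F\<^esub> word_val F gen w \<otimes>\<^bsub>F\<^esub>
      inv\<^bsub>F\<^esub> rep (c \<otimes>\<^bsub>Q\<^esub> word_val Q (\<lambda>x. cls (gen x)) w)) \<in> B"
proof (induction w arbitrary: c)
  case Nil
  then show ?case using rep(1)[OF Nil(1)] Q.r_one[OF Nil(1)] by simp
next
  case (Cons a w)
  have a: "fst a \<in> S" and w: "w \<in> lists (S \<times> UNIV)" using Cons.prems by auto
  let ?d = "step c a" and ?q = "word_val Q (\<lambda>x. cls (gen x)) w"
  have c: "c \<in> carrier Q" by (fact Cons.prems)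
  have d: "?d \<in> carrier Q" using step_closed c a by blast
  have q: "?q \<in> carrier Q" by (rule LQ.word_val_closed[OF w])
  have e: "?d \<otimes>\<^bsub>Q\<^esub> ?q \<in> carrier Q" using Q.m_closed d q by blast
  have dq: "c \<otimes>\<^bsub>Q\<^esub> word_val Q (\<lambda>x. cls (gen x)) (a # w) = ?d \<otimes>\<^bsub>Q\<^esub> ?q"
    using Q.m_assoc[OF c LQ.letter_val_closed[OF a] q] by simp
  let ?t = "lift_letter c a" and ?l = "letter_val F gen a" and ?u = "lift w ?d" and ?v = "word_val F gen w"
  let ?r = "rep c" and ?s = "rep ?d" and ?z = "rep (?d \<otimes>\<^bsub>Q\<^esub> ?q)"
  have car: "?t \<in> carrier F" "?l \<in> carrier F" "?u \<in> carrier F" "?v \<in> carrier F"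
    "?r \<in> carrier F" "?s \<in> carrier F" "?z \<in> carrier F"
    using A.mem_carrier[OF lift_letter_A[OF c a]] A.mem_carrier[OF lift_A[OF d w]]
      rep(1)[OF c] rep(1)[OF d] rep(1)[OF e] LF.letter_val_closed[OF a] LF.word_val_closed[OF w]
    by blast+
  let ?b = "inv\<^bsub>F\<^esub> ?t \<otimes>\<^bsub>F\<^esub> (?r \<otimes>\<^bsub>F\<^esub> ?l \<otimes>\<^bsub>F\<^esub> inv\<^bsub>F\<^esub> ?s)"
  let ?b' = "inv\<^bsub>F\<^esub> ?u \<otimes>\<^bsub>F\<^esub> (?s \<otimes>\<^bsub>F\<^esub> ?v \<otimes>\<^bsub>F\<^esub> inv\<^bsub>F\<^esub> ?z)"
  have b: "?b \<in> B" by (rule lift_letter_schreier[OF c a])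
  have b': "?b' \<in> B" by (rule Cons.IH[OF d w])
  have "inv\<^bsub>F\<^esub> ?u \<otimes>\<^bsub>F\<^esub> ?b \<otimes>\<^bsub>F\<^esub> ?u \<otimes>\<^bsub>F\<^esub> ?b' \<in> B"
    by (rule B.m_closed[OF B.inv_op_closed1[OF car(3) b] b'])
  moreover have "inv\<^bsub>F\<^esub> ?u \<otimes>\<^bsub>F\<^esub> ?b \<otimes>\<^bsub>F\<^esub> ?u \<otimes>\<^bsub>F\<^esub> ?b' =
      inv\<^bsub>F\<^esub> (?t \<otimes>\<^bsub>F\<^esub> ?u) \<otimes>\<^bsub>F\<^esub> (?r \<otimes>\<^bsub>F\<^esub> (?l \<otimes>\<^bsub>F\<^esub> ?v) \<otimes>\<^bsub>F\<^esub> inv\<^bsub>F\<^esub> ?z)"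
    using car by (simp add: F.inv_mult_group F.m_assoc)
  ultimately show ?case unfolding dq by simp
qed

definition \<tau> where "\<tau> w = lift w \<one>\<^bsub>Q\<^esub>"

lemma carrier_lists: "w \<in> carrier F \<Longrightarrow> w \<in> lists (S \<times> UNIV)"
  by (simp add: free_group_def)

lemma AB_cls: "w \<in> AB \<Longrightarrow> cls w = \<one>\<^bsub>Q\<^esub>"
  using F.coset_join2[OF _ AB.is_subgroup] by (simp add: one_FactGroup)

lemma \<tau>_A: "w \<in> carrier F \<Longrightarrow> \<tau> w \<in> A"
  unfolding \<tau>_def by (rule lift_A[OF Q.one_closed carrier_lists])

lemma \<tau>_B:
  assumes "w \<in> AB" shows "inv\<^bsub>F\<^esub> \<tau> w \<otimes>\<^bsub>F\<^esub> w \<in> B"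
proof -
  have w: "w \<in> carrier F" using assms by simp
  have "\<one>\<^bsub>Q\<^esub> \<otimes>\<^bsub>Q\<^esub> word_val Q (\<lambda>x. cls (gen x)) w = \<one>\<^bsub>Q\<^esub>"
    using cls_word[OF w] AB_cls[OF assms] Q.l_one[OF Q.one_closed] by simp
  then show ?thesis
    using lift_schreier[OF Q.one_closed carrier_lists[OF w]] w word_val_free_group[OF w]
    by (simp add: \<tau>_def rep_one)
qed

lemma \<tau>_mult:
  assumes "u \<in> AB" "v \<in> AB" shows "\<tau> (u \<otimes>\<^bsub>F\<^esub> v) = \<tau> u \<otimes>\<^bsub>F\<^esub> \<tau> v"
proof -
  have uv: "u \<in> carrier F" "v \<in> carrier F" using assms by auto
  have 1: "\<one>\<^bsub>Q\<^esub> \<otimes>\<^bsub>Q\<^esub> word_val Q (\<lambda>x. cls (gen x)) u = \<one>\<^bsub>Q\<^esub>"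
    using cls_word[OF uv(1)] AB_cls[OF assms(1)] Q.l_one[OF Q.one_closed] by simp
  have 2: "u \<otimes>\<^bsub>F\<^esub> v = foldr push u v" by (simp add: free_group_def)
  show ?thesis
    unfolding \<tau>_def 2 lift_foldr_push[OF Q.one_closed carrier_lists[OF uv(1)] carrier_lists[OF uv(2)]] 1
    by (rule refl)
qed

text \<open>The homomorphism \<open>\<tau>\<close> from \<open>AB\<close> to \<open>A\<close> is the
  identity modulo \<open>B\<close>, so it maps \<open>B\<close> into \<open>A \<inter> B\<close>,
  whose elements commute with \<open>A\<close> and with \<open>B\<close> modulo
  \<open>[A, B]\<close>. Modulo \<open>[A, B]\<close> it therefore kills \<open>B'\<close> and
  \<open>[A, B]\<close> but fixes the elements of \<open>A'\<close>. An element of the intersection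
  is both killed and fixed.\<close>

lemma commutator_subgroups_inter:
  assumes z: "z \<in> generate F (commutators F A A \<union> commutators F A B)"
    "z \<in> generate F (commutators F B B \<union> commutators F A B)"
  shows "z \<in> generate F (commutators F A B)"
proof -
  define J where "J = generate F (commutators F A B)"
  have cAB: "commutators F A B \<subseteq> carrier F" by (rule F.commutators_carrier[OF A.subset B.subset])
  interpret J: normal J F
    unfolding J_def by (rule F.normal_generate_conj[OF cAB F.commutators_conj[OF A B]])
  interpret R: group "F Mod J" by (rule J.factorgroup_is_group)
  define \<phi> where "\<phi> = (\<lambda>w. J #>\<^bsub>F\<^esub> w)"
  interpret \<phi>: group_hom F "F Mod J" \<phi>
    unfolding \<phi>_def by unfold_locales (rule J.r_coset_hom_Mod)
  have \<phi>_one: "\<phi> w = \<one>\<^bsub>F Mod J\<^esub> \<longleftrightarrow> w \<in> J" if "w \<in> carrier F" for w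
    unfolding \<phi>_def one_FactGroup
    using F.coset_join1[OF _ that J.is_subgroup] F.coset_join2[OF that J.is_subgroup] by blast
  have comm: "\<phi> x \<otimes>\<^bsub>F Mod J\<^esub> \<phi> y = \<phi> y \<otimes>\<^bsub>F Mod J\<^esub> \<phi> x" if "x \<in> A" "y \<in> B" for x y
  proof -
    have "x \<otimes>\<^bsub>F\<^esub> y \<otimes>\<^bsub>F\<^esub> inv\<^bsub>F\<^esub> x \<otimes>\<^bsub>F\<^esub> inv\<^bsub>F\<^esub> y \<in> J"
      using that unfolding J_def commutators_def by (intro generate.incl) blast
    then have "\<phi> (x \<otimes>\<^bsub>F\<^esub> y \<otimes>\<^bsub>F\<^esub> inv\<^bsub>F\<^esub> x \<otimes>\<^bsub>F\<^esub> inv\<^bsub>F\<^esub> y) = \<one>\<^bsub>F Mod J\<^esub>"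
      using \<phi>_one by simp
    then show ?thesis using that R.commutator_eq_one_iff[of "\<phi> x" "\<phi> y"] by simp
  qed
  have A_AB: "x \<in> AB" if "x \<in> A" for x
  proof -
    have "x = x \<otimes>\<^bsub>F\<^esub> \<one>\<^bsub>F\<^esub>" using that by simp
    then show ?thesis using that B.one_closed unfolding AB_def set_mult_def by blast
  qed
  have B_AB: "x \<in> AB" if "x \<in> B" for x
  proof -
    have "x = \<one>\<^bsub>F\<^esub> \<otimes>\<^bsub>F\<^esub> x" using that by simp
    then show ?thesis using that A.one_closed unfolding AB_def set_mult_def by blast
  qed
  interpret \<tau>: group_hom "F\<lparr>carrier := AB\<rparr>" F \<tau>
  proof -
    have "\<tau> \<in> hom (F\<lparr>carrier := AB\<rparr>) F"
      using \<tau>_mult \<tau>_A by (auto simp: hom_def)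
    then show "group_hom (F\<lparr>carrier := AB\<rparr>) F \<tau>"
      using F.subgroup_imp_group[OF AB.is_subgroup] F.is_group by (simp add: group_hom_def group_hom_axioms_def)
  qed
  have \<tau>_inv: "\<tau> (inv\<^bsub>F\<^esub> x) = inv\<^bsub>F\<^esub> \<tau> x" if "x \<in> AB" for x
    using \<tau>.hom_inv[of x] that F.m_inv_consistent[OF AB.is_subgroup that] by simp
  have \<tau>_one: "\<tau> \<one>\<^bsub>F\<^esub> = \<one>\<^bsub>F\<^esub>" using \<tau>.hom_one by simp
  have \<tau>c: "\<tau> x \<in> carrier F" if "x \<in> AB" for x using \<tau>_A[of x] that by auto
  have \<tau>_comm: "\<phi> (\<tau> (x \<otimes>\<^bsub>F\<^esub> y \<otimes>\<^bsub>F\<^esub> inv\<^bsub>F\<^esub> x \<otimes>\<^bsub>F\<^esub> inv\<^bsub>F\<^esub> y)) =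
      \<phi> (\<tau> x) \<otimes>\<^bsub>F Mod J\<^esub> \<phi> (\<tau> y) \<otimes>\<^bsub>F Mod J\<^esub> inv\<^bsub>F Mod J\<^esub> \<phi> (\<tau> x) \<otimes>\<^bsub>F Mod J\<^esub> inv\<^bsub>F Mod J\<^esub> \<phi> (\<tau> y)"
    if "x \<in> AB" "y \<in> AB" for x y
    using that \<tau>c by (simp add: \<tau>_mult \<tau>_inv)
  have \<tau>_AB: "\<tau> y \<in> A" "\<tau> y \<in> B" if "y \<in> B" for y
  proof -
    show A': "\<tau> y \<in> A" using \<tau>_A that by simp
    have "inv\<^bsub>F\<^esub> \<tau> y \<otimes>\<^bsub>F\<^esub> y \<in> B" using \<tau>_B[OF B_AB[OF that]] .
    then have "y \<otimes>\<^bsub>F\<^esub> inv\<^bsub>F\<^esub> (inv\<^bsub>F\<^esub> \<tau> y \<otimes>\<^bsub>F\<^esub> y) \<in> B" using B.m_closed[OF that B.m_inv_closed] by blast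
    moreover have "y \<otimes>\<^bsub>F\<^esub> inv\<^bsub>F\<^esub> (inv\<^bsub>F\<^esub> \<tau> y \<otimes>\<^bsub>F\<^esub> y) = \<tau> y"
      using A.mem_carrier[OF A'] B.mem_carrier[OF that] by (simp add: F.inv_mult_group)
    ultimately show "\<tau> y \<in> B" by simp
  qed
  have trivial: "\<phi> (\<tau> (x \<otimes>\<^bsub>F\<^esub> y \<otimes>\<^bsub>F\<^esub> inv\<^bsub>F\<^esub> x \<otimes>\<^bsub>F\<^esub> inv\<^bsub>F\<^esub> y)) = \<one>\<^bsub>F Mod J\<^esub>"
    if "x \<in> AB" "y \<in> B" for x y
  proof -
    have x: "\<tau> x \<in> A" using \<tau>_A that by simp
    show ?thesis
      unfolding \<tau>_comm[OF that(1) B_AB[OF that(2)]]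
      using R.commutator_eq_one_iff[of "\<phi> (\<tau> x)" "\<phi> (\<tau> y)"] comm[OF x \<tau>_AB(2)[OF that(2)]]
        A.mem_carrier[OF x] A.mem_carrier[OF \<tau>_AB(1)[OF that(2)]] by simp
  qed
  \<comment> \<open>The elements \<open>\<tau> x\<close> and \<open>x\<close> differ by a factor in
    \<open>A \<inter> B\<close>, and likewise for \<open>y\<close>. Modulo \<open>J\<close> these
    factors commute with everything in sight and drop out of the commutator.\<close>
  have agree: "\<phi> (\<tau> (x \<otimes>\<^bsub>F\<^esub> y \<otimes>\<^bsub>F\<^esub> inv\<^bsub>F\<^esub> x \<otimes>\<^bsub>F\<^esub> inv\<^bsub>F\<^esub> y)) =
      \<phi> (x \<otimes>\<^bsub>F\<^esub> y \<otimes>\<^bsub>F\<^esub> inv\<^bsub>F\<^esub> x \<otimes>\<^bsub>F\<^esub> inv\<^bsub>F\<^esub> y)" if xy: "x \<in> A" "y \<in> A" for x y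
  proof -
    have b: "\<exists>b\<in>A \<inter> B. \<tau> x = x \<otimes>\<^bsub>F\<^esub> b" if "x \<in> A" for x
    proof
      have t: "\<tau> x \<in> A" using \<tau>_A that by simp
      have "inv\<^bsub>F\<^esub> (inv\<^bsub>F\<^esub> \<tau> x \<otimes>\<^bsub>F\<^esub> x) \<in> B" using \<tau>_B[OF A_AB[OF that]] by (rule B.m_inv_closed)
      then have "inv\<^bsub>F\<^esub> x \<otimes>\<^bsub>F\<^esub> \<tau> x \<in> B"
        using A.mem_carrier[OF t] A.mem_carrier[OF that] by (simp add: F.inv_mult_group)
      moreover have "inv\<^bsub>F\<^esub> x \<otimes>\<^bsub>F\<^esub> \<tau> x \<in> A" using that t by simp
      ultimately show "inv\<^bsub>F\<^esub> x \<otimes>\<^bsub>F\<^esub> \<tau> x \<in> A \<inter> B" by blast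
      show "\<tau> x = x \<otimes>\<^bsub>F\<^esub> (inv\<^bsub>F\<^esub> x \<otimes>\<^bsub>F\<^esub> \<tau> x)"
        using A.mem_carrier[OF t] A.mem_carrier[OF that] by simp
    qed
    obtain b c where bc: "b \<in> A" "b \<in> B" "\<tau> x = x \<otimes>\<^bsub>F\<^esub> b" "c \<in> A" "c \<in> B" "\<tau> y = y \<otimes>\<^bsub>F\<^esub> c"
      using b[OF xy(1)] b[OF xy(2)] by blast
    let ?x = "\<phi> x" and ?y = "\<phi> y" and ?b = "\<phi> b" and ?c = "\<phi> c"
    have carF: "x \<in> carrier F" "y \<in> carrier F" "b \<in> carrier F" "c \<in> carrier F" using xy bc by auto
    note car = carF[THEN \<phi>.hom_closed]
    note eqs = comm[OF xy(1) bc(2)] comm[OF xy(1) bc(5)] comm[OF xy(2) bc(2)] comm[OF xy(2) bc(5)] comm[OF bc(1,5)]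
    have 1: "(?x \<otimes>\<^bsub>F Mod J\<^esub> ?b) \<otimes>\<^bsub>F Mod J\<^esub> (?y \<otimes>\<^bsub>F Mod J\<^esub> ?c) = (?x \<otimes>\<^bsub>F Mod J\<^esub> ?y) \<otimes>\<^bsub>F Mod J\<^esub> (?b \<otimes>\<^bsub>F Mod J\<^esub> ?c)"
      using car eqs by (metis R.m_assoc R.m_closed)
    have 2: "(?y \<otimes>\<^bsub>F Mod J\<^esub> ?c) \<otimes>\<^bsub>F Mod J\<^esub> (?x \<otimes>\<^bsub>F Mod J\<^esub> ?b) = (?y \<otimes>\<^bsub>F Mod J\<^esub> ?x) \<otimes>\<^bsub>F Mod J\<^esub> (?b \<otimes>\<^bsub>F Mod J\<^esub> ?c)"
      using car eqs by (metis R.m_assoc R.m_closed)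
    have com: "u \<otimes>\<^bsub>F Mod J\<^esub> v \<otimes>\<^bsub>F Mod J\<^esub> inv\<^bsub>F Mod J\<^esub> u \<otimes>\<^bsub>F Mod J\<^esub> inv\<^bsub>F Mod J\<^esub> v =
        (u \<otimes>\<^bsub>F Mod J\<^esub> v) \<otimes>\<^bsub>F Mod J\<^esub> inv\<^bsub>F Mod J\<^esub> (v \<otimes>\<^bsub>F Mod J\<^esub> u)"
      if "u \<in> carrier (F Mod J)" "v \<in> carrier (F Mod J)" for u v
      using that by (simp add: R.inv_mult_group R.m_assoc)
    have "\<phi> (\<tau> (x \<otimes>\<^bsub>F\<^esub> y \<otimes>\<^bsub>F\<^esub> inv\<^bsub>F\<^esub> x \<otimes>\<^bsub>F\<^esub> inv\<^bsub>F\<^esub> y)) =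
      ((?x \<otimes>\<^bsub>F Mod J\<^esub> ?b) \<otimes>\<^bsub>F Mod J\<^esub> (?y \<otimes>\<^bsub>F Mod J\<^esub> ?c)) \<otimes>\<^bsub>F Mod J\<^esub>
      inv\<^bsub>F Mod J\<^esub> ((?y \<otimes>\<^bsub>F Mod J\<^esub> ?c) \<otimes>\<^bsub>F Mod J\<^esub> (?x \<otimes>\<^bsub>F Mod J\<^esub> ?b))"
      unfolding \<tau>_comm[OF A_AB[OF xy(1)] A_AB[OF xy(2)]] bc(3,6) \<phi>.hom_mult[OF carF(1,3)] \<phi>.hom_mult[OF carF(2,4)]
      using car by (intro com) auto
    also have "\<dots> = (?x \<otimes>\<^bsub>F Mod J\<^esub> ?y) \<otimes>\<^bsub>F Mod J\<^esub> inv\<^bsub>F Mod J\<^esub> (?y \<otimes>\<^bsub>F Mod J\<^esub> ?x)"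
      unfolding 1 2 using car by (simp add: R.inv_mult_group R.m_assoc)
    also have "\<dots> = \<phi> (x \<otimes>\<^bsub>F\<^esub> y \<otimes>\<^bsub>F\<^esub> inv\<^bsub>F\<^esub> x \<otimes>\<^bsub>F\<^esub> inv\<^bsub>F\<^esub> y)"
      using com[OF car(1,2)] carF by simp
    finally show ?thesis .
  qed
  let ?E = "{s \<in> AB. \<phi> (\<tau> s) = \<phi> s}" and ?Z = "{s \<in> AB. \<phi> (\<tau> s) = \<one>\<^bsub>F Mod J\<^esub>}"
  have E: "subgroup ?E F" and Z: "subgroup ?Z F"
    by (unfold_locales; auto simp: \<tau>_mult \<tau>_inv \<tau>_one \<tau>c)+
  have in_J: "\<phi> w = \<one>\<^bsub>F Mod J\<^esub>" if "w \<in> commutators F A B" for w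
    using \<phi>_one[of w] that cAB generate.incl[of w "commutators F A B" F] by (auto simp: J_def)
  have cab: "commutators F C D \<subseteq> AB" if "C \<lhd> F" "D \<lhd> F" "C \<subseteq> AB" for C D
    using F.commutators_subset[OF that(1,2)] that(3) by blast
  have sub: "A \<subseteq> AB" "B \<subseteq> AB" using A_AB B_AB by auto
  have mixed: "commutators F A B \<subseteq> ?E \<inter> ?Z"
  proof
    fix w assume w: "w \<in> commutators F A B"
    then obtain x y where xy: "x \<in> A" "y \<in> B" "w = x \<otimes>\<^bsub>F\<^esub> y \<otimes>\<^bsub>F\<^esub> inv\<^bsub>F\<^esub> x \<otimes>\<^bsub>F\<^esub> inv\<^bsub>F\<^esub> y"
      by (auto simp: commutators_def)
    have "\<phi> (\<tau> w) = \<one>\<^bsub>F Mod J\<^esub>" unfolding xy(3) by (rule trivial[OF A_AB[OF xy(1)] xy(2)])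
    then show "w \<in> ?E \<inter> ?Z" using in_J[OF w] w cab[OF A B sub(1)] by auto
  qed
  have "commutators F A A \<subseteq> ?E"
  proof
    fix w assume w: "w \<in> commutators F A A"
    then obtain x y where xy: "x \<in> A" "y \<in> A" "w = x \<otimes>\<^bsub>F\<^esub> y \<otimes>\<^bsub>F\<^esub> inv\<^bsub>F\<^esub> x \<otimes>\<^bsub>F\<^esub> inv\<^bsub>F\<^esub> y"
      by (auto simp: commutators_def)
    have "\<phi> (\<tau> w) = \<phi> w" unfolding xy(3) by (rule agree[OF xy(1,2)])
    then show "w \<in> ?E" using w cab[OF A A sub(1)] by auto
  qed
  moreover have "commutators F A B \<subseteq> ?E" using mixed by (rule order_trans) (rule Int_lower1)
  ultimately have "z \<in> ?E" using subsetD[OF F.generate_subgroup_incl[OF Un_least E] z(1)] by blast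
  moreover have zz: "commutators F B B \<subseteq> ?Z"
  proof
    fix w assume w: "w \<in> commutators F B B"
    then obtain x y where xy: "x \<in> B" "y \<in> B" "w = x \<otimes>\<^bsub>F\<^esub> y \<otimes>\<^bsub>F\<^esub> inv\<^bsub>F\<^esub> x \<otimes>\<^bsub>F\<^esub> inv\<^bsub>F\<^esub> y"
      by (auto simp: commutators_def)
    have "\<phi> (\<tau> w) = \<one>\<^bsub>F Mod J\<^esub>" unfolding xy(3) by (rule trivial[OF B_AB[OF xy(1)] xy(2)])
    then show "w \<in> ?Z" using w cab[OF B B sub(2)] by auto
  qed
  moreover have "commutators F A B \<subseteq> ?Z" using mixed by (rule order_trans) (rule Int_lower2)
  from subsetD[OF F.generate_subgroup_incl[OF Un_least[OF zz this] Z] z(2)] have "z \<in> ?Z" .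
  ultimately have "\<phi> z = \<one>\<^bsub>F Mod J\<^esub>" "z \<in> carrier F" by auto
  then show ?thesis using \<phi>_one[of z] by (simp add: J_def)
qed

end

lemma (in group_hom) img_normal:
  assumes surj: "h ` carrier G = carrier H" and "N \<lhd> G"
  shows "h ` N \<lhd> H"
proof (rule H.normal_invI)
  interpret N: normal N G by fact
  show "subgroup (h ` N) H" by (rule subgroup_img_is_subgroup[OF N.is_subgroup])
  fix x y assume "x \<in> carrier H" "y \<in> h ` N"
  then obtain g n where gn: "g \<in> carrier G" "x = h g" "n \<in> N" "y = h n" using surj by blast
  then have "x \<otimes>\<^bsub>H\<^esub> y \<otimes>\<^bsub>H\<^esub> inv\<^bsub>H\<^esub> x = h (g \<otimes> n \<otimes> inv g)" by simp
  then show "x \<otimes>\<^bsub>H\<^esub> y \<otimes>\<^bsub>H\<^esub> inv\<^bsub>H\<^esub> x \<in> h ` N" using N.inv_op_closed2[OF gn(1,3)] by blast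
qed

lemma (in group_hom) img_normal_closure:
  assumes surj: "h ` carrier G = carrier H" and T: "T \<subseteq> carrier G"
  shows "h ` normal_closure G T = normal_closure H (h ` T)"
proof
  have hT: "h ` T \<subseteq> carrier H" using T by auto
  have "{x \<in> carrier G. h x \<in> normal_closure H (h ` T)} \<lhd> G"
    by (rule vimage_normal[OF H.normal_closure_normal[OF hT]])
  moreover have "T \<subseteq> {x \<in> carrier G. h x \<in> normal_closure H (h ` T)}"
    using T H.normal_closure_incl[of "h ` T"] by blast
  ultimately have "normal_closure G T \<subseteq> {x \<in> carrier G. h x \<in> normal_closure H (h ` T)}"
    by (rule G.normal_closure_min)
  then show "h ` normal_closure G T \<subseteq> normal_closure H (h ` T)" by blast
  show "normal_closure H (h ` T) \<subseteq> h ` normal_closure G T"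
    by (rule H.normal_closure_min[OF img_normal[OF surj G.normal_closure_normal[OF T]]])
      (use G.normal_closure_incl[of T] in blast)
qed

lemma (in normal) Mod_hom: "group_hom G (G Mod H) (\<lambda>x. H #> x)"
  using r_coset_hom_Mod factorgroup_is_group is_group by (simp add: group_hom_def group_hom_axioms_def)

lemma (in normal) Mod_eq_one_iff: "x \<in> carrier G \<Longrightarrow> H #> x = \<one>\<^bsub>G Mod H\<^esub> \<longleftrightarrow> x \<in> H"
  unfolding one_FactGroup using coset_join1[OF _ _ is_subgroup] coset_join2[OF _ is_subgroup] by blast

lemma (in normal) Mod_eq_iff:
  assumes "x \<in> carrier G" "y \<in> carrier G"
  shows "H #> x = H #> y \<longleftrightarrow> x \<otimes> inv y \<in> H"
proof -
  interpret h: group_hom G "G Mod H" "\<lambda>x. H #> x" by (rule Mod_hom)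
  have "H #> x = H #> y \<longleftrightarrow> (H #> x) \<otimes>\<^bsub>G Mod H\<^esub> inv\<^bsub>G Mod H\<^esub> (H #> y) = \<one>\<^bsub>G Mod H\<^esub>"
    using h.H.inv_solve_right'[of "\<one>\<^bsub>G Mod H\<^esub>" "H #> x" "H #> y"] h.hom_closed[OF assms(1)] h.hom_closed[OF assms(2)]
    by (metis h.H.l_one h.H.one_closed h.H.r_inv)
  also have "(H #> x) \<otimes>\<^bsub>G Mod H\<^esub> inv\<^bsub>G Mod H\<^esub> (H #> y) = H #> (x \<otimes> inv y)"
    using assms by simp
  finally show ?thesis unfolding Mod_eq_one_iff[OF m_closed[OF assms(1) inv_closed[OF assms(2)]]] .
qed

lemma (in normal) Mod_surj: "(\<lambda>x. H #> x) ` carrier G = carrier (G Mod H)"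
  by (simp add: carrier_FactGroup)

text \<open>Modulo \<open>M\<close> the subgroup \<open>N\<close> becomes abelian and commutators
  act trivially on it, so its normal subgroups are submodules over a commutative Noetherian
  ring.\<close>

lemma (in group) finite_generation_mod:
  assumes fg: "finitely_generated G" and N: "N \<lhd> G" and M: "M \<lhd> G"
    and NN: "commutators G N N \<subseteq> M"
    and central: "\<And>g h x. g \<in> carrier G \<Longrightarrow> h \<in> carrier G \<Longrightarrow> x \<in> N \<Longrightarrow>
      conj_by G (g \<otimes> h \<otimes> inv g \<otimes> inv h) x \<otimes> inv x \<in> M"
    and T: "finite T" "T \<subseteq> carrier G" "N = normal_closure G T" and B: "B \<lhd> G" "B \<subseteq> N"
  obtains Y where "finite Y" "Y \<subseteq> B" "B \<subseteq> M <#> normal_closure G Y"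
proof -
  interpret M: normal M G by fact
  interpret N: normal N G by fact
  interpret B: normal B G by fact
  define \<phi> where "\<phi> = (\<lambda>x. M #> x)"
  interpret \<phi>: group_hom G "G Mod M" \<phi> unfolding \<phi>_def by (rule M.Mod_hom)
  have surj: "\<phi> ` carrier G = carrier (G Mod M)" unfolding \<phi>_def by (rule M.Mod_surj)
  obtain S where S: "finite S" "S \<subseteq> carrier G" "generate G S = carrier G"
    using fg unfolding finitely_generated_def by blast
  have eq: "\<phi> x = \<phi> y \<longleftrightarrow> x \<otimes> inv y \<in> M" if "x \<in> carrier G" "y \<in> carrier G" for x y
    unfolding \<phi>_def by (rule M.Mod_eq_iff[OF that])
  have conj: "conj_by (G Mod M) (\<phi> g) (\<phi> x) = \<phi> (conj_by G g x)" if "g \<in> carrier G" "x \<in> carrier G" for g x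
    using that by (simp add: conj_by_def)
  obtain Y' where Y': "finite Y'" "Y' \<subseteq> \<phi> ` B" "\<phi> ` B = normal_closure (G Mod M) Y'"
  proof (rule \<phi>.H.normal_subgroups_finitely_generated)
    show "finite (\<phi> ` S)" "\<phi> ` S \<subseteq> carrier (G Mod M)" using S by auto
    show "generate (G Mod M) (\<phi> ` S) = carrier (G Mod M)"
      using \<phi>.generate_img[OF S(2)] S(3) surj by simp
    show "\<phi> ` N \<lhd> G Mod M" "\<phi> ` B \<lhd> G Mod M" using \<phi>.img_normal[OF surj] N B by auto
    show "finite (\<phi> ` T)" "\<phi> ` N = normal_closure (G Mod M) (\<phi> ` T)" "\<phi> ` B \<subseteq> \<phi> ` N"
      using T \<phi>.img_normal_closure[OF surj T(2)] B by auto
  next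
    fix x y assume "x \<in> \<phi> ` N" "y \<in> \<phi> ` N"
    then obtain a b where ab: "a \<in> N" "b \<in> N" "x = \<phi> a" "y = \<phi> b" by blast
    then have "a \<otimes> b \<otimes> inv a \<otimes> inv b \<in> M" using NN unfolding commutators_def by blast
    moreover have "a \<otimes> b \<otimes> inv (b \<otimes> a) = a \<otimes> b \<otimes> inv a \<otimes> inv b"
      using ab by (simp add: inv_mult_group m_assoc)
    ultimately have "\<phi> (a \<otimes> b) = \<phi> (b \<otimes> a)" using eq[of "a \<otimes> b" "b \<otimes> a"] ab(1,2) by simp
    then show "x \<otimes>\<^bsub>G Mod M\<^esub> y = y \<otimes>\<^bsub>G Mod M\<^esub> x" using ab by simp
  next
    fix u v x assume "u \<in> carrier (G Mod M)" "v \<in> carrier (G Mod M)" "x \<in> \<phi> ` N"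
    then have uvx: "u \<in> \<phi> ` carrier G" "v \<in> \<phi> ` carrier G" "x \<in> \<phi> ` N" by (simp_all only: surj)
    obtain g where g: "g \<in> carrier G" "u = \<phi> g" using uvx(1) by (elim imageE)
    obtain h where h: "h \<in> carrier G" "v = \<phi> h" using uvx(2) by (elim imageE)
    obtain n where n: "n \<in> N" "x = \<phi> n" using uvx(3) by (elim imageE)
    note gh = g(1) h(1) n(1) g(2) h(2) n(2)
    have n: "n \<in> carrier G" using gh by simp
    \<comment> \<open>This commutator is chosen such that \<open>h \<otimes> g \<otimes> ?c\<close>
      equals \<open>g \<otimes> h\<close>.\<close>
    let ?c = "inv g \<otimes> inv h \<otimes> inv (inv g) \<otimes> inv (inv h)"
    have c: "?c \<in> carrier G" using gh by simp
    have "conj_by G ?c n \<otimes> inv n \<in> M" using central[of "inv g" "inv h" n] gh by simp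
    then have "\<phi> (conj_by G ?c n) = \<phi> n" using eq c n by simp
    then have "\<phi> (conj_by G (h \<otimes> g) (conj_by G ?c n)) = \<phi> (conj_by G (h \<otimes> g) n)"
      using conj[of "h \<otimes> g" "conj_by G ?c n"] conj[of "h \<otimes> g" n] gh c n by simp
    moreover have "conj_by G (h \<otimes> g) (conj_by G ?c n) = conj_by G (g \<otimes> h) n"
      using gh n by (simp add: conj_by_conj_by[symmetric] m_assoc)
    ultimately have "\<phi> (conj_by G g (conj_by G h n)) = \<phi> (conj_by G h (conj_by G g n))"
      using gh n by (simp add: conj_by_conj_by)
    then show "conj_by (G Mod M) u (conj_by (G Mod M) v x) = conj_by (G Mod M) v (conj_by (G Mod M) u x)"
      using gh n conj by simp
  qed
  obtain Y where Y: "finite Y" "Y \<subseteq> B" "Y' = \<phi> ` Y" using finite_subset_image[OF Y'(1,2)] by blast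
  have Yc: "Y \<subseteq> carrier G" using Y B.subset by blast
  have img: "\<phi> ` B = \<phi> ` normal_closure G Y"
    using Y'(3) \<phi>.img_normal_closure[OF surj Yc] Y(3) by simp
  have "B \<subseteq> M <#> normal_closure G Y"
  proof
    fix b assume b: "b \<in> B"
    then have "\<phi> b \<in> \<phi> ` normal_closure G Y" unfolding img[symmetric] by (rule imageI)
    then obtain y where y: "y \<in> normal_closure G Y" "\<phi> b = \<phi> y" by (elim imageE)
    have yc: "y \<in> carrier G" using subgroup.mem_carrier[OF normal_imp_subgroup[OF normal_closure_normal[OF Yc]] y(1)] .
    then have "b \<otimes> inv y \<in> M" using eq y(2) b by simp
    moreover have "b = (b \<otimes> inv y) \<otimes> y" using b yc by (simp add: m_assoc)
    ultimately show "b \<in> M <#> normal_closure G Y" using y(1) unfolding set_mult_def by blast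
  qed
  then show ?thesis using that Y(1,2) by blast
qed

context free_normal_pair
begin

text \<open>Modulo \<open>M\<close> the group \<open>A\<close> acts trivially on itself and
  \<open>B\<close> acts trivially on \<open>A\<close>; so the action on \<open>A\<close> factors
  through the quotient by \<open>AB\<close>.\<close>

lemma commuting_mod:
  assumes "M \<lhd> F" "commutators F A A \<subseteq> M" "commutators F A B \<subseteq> M" "c \<in> AB" "x \<in> A"
  shows "conj_by F c x \<otimes>\<^bsub>F\<^esub> inv\<^bsub>F\<^esub> x \<in> M"
proof -
  interpret M: normal M F by fact
  obtain a b where ab: "a \<in> A" "b \<in> B" "c = a \<otimes>\<^bsub>F\<^esub> b" using assms(4) by (auto simp: AB_def set_mult_def)
  have car: "a \<in> carrier F" "b \<in> carrier F" "x \<in> carrier F" using ab assms by auto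
  have "x \<otimes>\<^bsub>F\<^esub> b \<otimes>\<^bsub>F\<^esub> inv\<^bsub>F\<^esub> x \<otimes>\<^bsub>F\<^esub> inv\<^bsub>F\<^esub> b \<in> M"
    using assms(3,5) ab unfolding commutators_def by blast
  then have "inv\<^bsub>F\<^esub> (x \<otimes>\<^bsub>F\<^esub> b \<otimes>\<^bsub>F\<^esub> inv\<^bsub>F\<^esub> x \<otimes>\<^bsub>F\<^esub> inv\<^bsub>F\<^esub> b) \<in> M" by (rule M.m_inv_closed)
  from M.inv_op_closed2[OF car(1) this]
  have "a \<otimes>\<^bsub>F\<^esub> inv\<^bsub>F\<^esub> (x \<otimes>\<^bsub>F\<^esub> b \<otimes>\<^bsub>F\<^esub> inv\<^bsub>F\<^esub> x \<otimes>\<^bsub>F\<^esub> inv\<^bsub>F\<^esub> b) \<otimes>\<^bsub>F\<^esub> inv\<^bsub>F\<^esub> a \<in> M" .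
  moreover have "a \<otimes>\<^bsub>F\<^esub> x \<otimes>\<^bsub>F\<^esub> inv\<^bsub>F\<^esub> a \<otimes>\<^bsub>F\<^esub> inv\<^bsub>F\<^esub> x \<in> M"
    using assms(2,5) ab unfolding commutators_def by blast
  ultimately have "(a \<otimes>\<^bsub>F\<^esub> inv\<^bsub>F\<^esub> (x \<otimes>\<^bsub>F\<^esub> b \<otimes>\<^bsub>F\<^esub> inv\<^bsub>F\<^esub> x \<otimes>\<^bsub>F\<^esub> inv\<^bsub>F\<^esub> b) \<otimes>\<^bsub>F\<^esub> inv\<^bsub>F\<^esub> a) \<otimes>\<^bsub>F\<^esub>
      (a \<otimes>\<^bsub>F\<^esub> x \<otimes>\<^bsub>F\<^esub> inv\<^bsub>F\<^esub> a \<otimes>\<^bsub>F\<^esub> inv\<^bsub>F\<^esub> x) \<in> M" by (rule M.m_closed)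
  moreover have "(a \<otimes>\<^bsub>F\<^esub> inv\<^bsub>F\<^esub> (x \<otimes>\<^bsub>F\<^esub> b \<otimes>\<^bsub>F\<^esub> inv\<^bsub>F\<^esub> x \<otimes>\<^bsub>F\<^esub> inv\<^bsub>F\<^esub> b) \<otimes>\<^bsub>F\<^esub> inv\<^bsub>F\<^esub> a) \<otimes>\<^bsub>F\<^esub>
      (a \<otimes>\<^bsub>F\<^esub> x \<otimes>\<^bsub>F\<^esub> inv\<^bsub>F\<^esub> a \<otimes>\<^bsub>F\<^esub> inv\<^bsub>F\<^esub> x) = conj_by F c x \<otimes>\<^bsub>F\<^esub> inv\<^bsub>F\<^esub> x"
    using car by (simp add: ab(3) conj_by_def F.m_assoc F.inv_mult_group)
  ultimately show ?thesis by simp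
qed

end

lemma (in group) commutators_swap:
  assumes "subgroup M G" "A \<subseteq> carrier G" "B \<subseteq> carrier G" "commutators G A B \<subseteq> M"
  shows "commutators G B A \<subseteq> M"
proof
  fix z assume "z \<in> commutators G B A"
  then obtain x y where xy: "x \<in> B" "y \<in> A" "z = x \<otimes> y \<otimes> inv x \<otimes> inv y" by (auto simp: commutators_def)
  have car: "x \<in> carrier G" "y \<in> carrier G" using xy assms by auto
  have "y \<otimes> x \<otimes> inv y \<otimes> inv x \<in> M" using assms(4) xy unfolding commutators_def by blast
  then have "inv (y \<otimes> x \<otimes> inv y \<otimes> inv x) \<in> M" using subgroup.m_inv_closed[OF assms(1)] by blast
  then show "z \<in> M" using car by (simp add: xy(3) inv_mult_group m_assoc)
qed

text \<open>\<open>MA\<close> and \<open>MB\<close> stand for \<open>A'[A, B]\<close> and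
  \<open>B'[A, B]\<close>. Finitely many elements account for \<open>A \<inter> B\<close> up to
  \<open>MA\<close>, finitely many more for the part inside \<open>MA\<close> up to
  \<open>MB\<close>; what remains lies in both and hence in \<open>[A, B]\<close>.\<close>

theorem (in free_normal_pair) inter_modulo_commutators:
  assumes "finite S" "commutators F (carrier F) (carrier F) \<subseteq> AB"
    and "finite TA" "TA \<subseteq> carrier F" "A = normal_closure F TA"
    and "finite TB" "TB \<subseteq> carrier F" "B = normal_closure F TB"
  obtains R where "finite R" "R \<subseteq> A \<inter> B"
    "\<And>M. M \<lhd> F \<Longrightarrow> R \<subseteq> M \<Longrightarrow> commutators F A B \<subseteq> M \<Longrightarrow> A \<inter> B \<subseteq> M"
proof -
  let ?CA = "commutators F A A \<union> commutators F A B" and ?CB = "commutators F B B \<union> commutators F A B"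
  define MA where "MA = generate F ?CA"
  define MB where "MB = generate F ?CB"
  have car: "?CA \<subseteq> carrier F" "?CB \<subseteq> carrier F" using A.subset B.subset F.commutators_carrier by blast+
  have MA: "MA \<lhd> F" unfolding MA_def
    by (rule F.normal_generate_conj[OF car(1)]) (use F.commutators_conj[OF A A] F.commutators_conj[OF A B] in blast)
  have MB: "MB \<lhd> F" unfolding MB_def
    by (rule F.normal_generate_conj[OF car(2)]) (use F.commutators_conj[OF B B] F.commutators_conj[OF A B] in blast)
  have inMA: "commutators F A A \<subseteq> MA" "commutators F A B \<subseteq> MA"
    and inMB: "commutators F B B \<subseteq> MB" "commutators F A B \<subseteq> MB"
    unfolding MA_def MB_def by (auto intro: generate.incl)
  have inMB': "commutators F B A \<subseteq> MB"
    by (rule F.commutators_swap[OF normal_imp_subgroup[OF MB] A.subset B.subset inMB(2)])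
  interpret BA: free_normal_pair S B A by unfold_locales
  have BA_eq: "BA.AB = AB"
    unfolding AB_def BA.AB_def using F.commut_normal[OF A.is_subgroup B] by simp
  have comm: "g \<otimes>\<^bsub>F\<^esub> h \<otimes>\<^bsub>F\<^esub> inv\<^bsub>F\<^esub> g \<otimes>\<^bsub>F\<^esub> inv\<^bsub>F\<^esub> h \<in> AB" if "g \<in> carrier F" "h \<in> carrier F" for g h
    using assms(2) that unfolding commutators_def by blast
  have N1: "A \<inter> B \<lhd> F" by (rule F.normal_subgroup_intersect[OF A B])
  obtain Y1 where Y1: "finite Y1" "Y1 \<subseteq> A \<inter> B" "A \<inter> B \<subseteq> MA <#>\<^bsub>F\<^esub> normal_closure F Y1"
  proof (rule F.finite_generation_mod[OF finitely_generated_free_group[OF assms(1)] A MA inMA(1) _ assms(3-5) N1])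
    show "conj_by F (g \<otimes>\<^bsub>F\<^esub> h \<otimes>\<^bsub>F\<^esub> inv\<^bsub>F\<^esub> g \<otimes>\<^bsub>F\<^esub> inv\<^bsub>F\<^esub> h) x \<otimes>\<^bsub>F\<^esub> inv\<^bsub>F\<^esub> x \<in> MA"
      if "g \<in> carrier F" "h \<in> carrier F" "x \<in> A" for g h x
      by (rule commuting_mod[OF MA inMA comm[OF that(1,2)] that(3)])
  qed auto
  have N2: "A \<inter> B \<inter> MA \<lhd> F" by (rule F.normal_subgroup_intersect[OF N1 MA])
  obtain Y2 where Y2: "finite Y2" "Y2 \<subseteq> A \<inter> B \<inter> MA" "A \<inter> B \<inter> MA \<subseteq> MB <#>\<^bsub>F\<^esub> normal_closure F Y2"
  proof (rule F.finite_generation_mod[OF finitely_generated_free_group[OF assms(1)] B MB inMB(1) _ assms(6-8) N2])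
    show "conj_by F (g \<otimes>\<^bsub>F\<^esub> h \<otimes>\<^bsub>F\<^esub> inv\<^bsub>F\<^esub> g \<otimes>\<^bsub>F\<^esub> inv\<^bsub>F\<^esub> h) x \<otimes>\<^bsub>F\<^esub> inv\<^bsub>F\<^esub> x \<in> MB"
      if "g \<in> carrier F" "h \<in> carrier F" "x \<in> B" for g h x
      using BA.commuting_mod[OF MB inMB(1) inMB' _ that(3)] comm[OF that(1,2)] BA_eq by blast
  qed auto
  show ?thesis
  proof (rule that)
    show "finite (Y1 \<union> Y2)" "Y1 \<union> Y2 \<subseteq> A \<inter> B" using Y1 Y2 by auto
    fix M assume M: "M \<lhd> F" "Y1 \<union> Y2 \<subseteq> M" "commutators F A B \<subseteq> M"
    interpret M: normal M F by fact
    interpret N1: normal "A \<inter> B" F by (rule N1)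
    interpret N2: normal "A \<inter> B \<inter> MA" F by (rule N2)
    have nc1: "normal_closure F Y1 \<subseteq> M" "normal_closure F Y1 \<subseteq> A \<inter> B"
      using F.normal_closure_min[OF M(1), of Y1] F.normal_closure_min[OF N1, of Y1] M(2) Y1(2) by auto
    have nc2: "normal_closure F Y2 \<subseteq> M" "normal_closure F Y2 \<subseteq> A \<inter> B \<inter> MA"
      using F.normal_closure_min[OF M(1), of Y2] F.normal_closure_min[OF N2, of Y2] M(2) Y2(2) by auto
    show "A \<inter> B \<subseteq> M"
    proof
      fix z assume z: "z \<in> A \<inter> B"
      then obtain m y where my: "m \<in> MA" "y \<in> normal_closure F Y1" "z = m \<otimes>\<^bsub>F\<^esub> y"
        using Y1(3) by (auto simp: set_mult_def)
      have mc: "m \<in> carrier F" and y: "y \<in> A \<inter> B" "y \<in> M"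
        using my nc1 subgroup.mem_carrier[OF normal_imp_subgroup[OF MA]] by auto
      have "m = z \<otimes>\<^bsub>F\<^esub> inv\<^bsub>F\<^esub> y" using mc y z my(3) by (simp add: F.m_assoc)
      then have "m \<in> A \<inter> B" using N1.m_closed[OF z N1.m_inv_closed[OF y(1)]] by simp
      then have "m \<in> A \<inter> B \<inter> MA" using my(1) by blast
      then obtain p v where pv: "p \<in> MB" "v \<in> normal_closure F Y2" "m = p \<otimes>\<^bsub>F\<^esub> v"
        using Y2(3) by (auto simp: set_mult_def)
      have pc: "p \<in> carrier F" and v: "v \<in> A \<inter> B \<inter> MA" "v \<in> M"
        using pv nc2 subgroup.mem_carrier[OF normal_imp_subgroup[OF MB]] by auto
      have "p = m \<otimes>\<^bsub>F\<^esub> inv\<^bsub>F\<^esub> v" using pc v mc pv(3) by (simp add: F.m_assoc)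
      then have "p \<in> A \<inter> B \<inter> MA"
        using N2.m_closed[OF \<open>m \<in> A \<inter> B \<inter> MA\<close> N2.m_inv_closed[OF v(1)]] by simp
      then have "p \<in> MA" by blast
      then have "p \<in> generate F (commutators F A B)"
        using commutator_subgroups_inter[of p] pv(1) unfolding MA_def MB_def by blast
      then have "p \<in> M" using F.generate_subgroup_incl[OF M(3) M.is_subgroup] by blast
      then have "m \<in> M" using M.m_closed v(2) pv(3) by simp
      then show "z \<in> M" using M.m_closed y(2) my(3) by simp
    qed
  qed
qed

section \<open>Filtrations of normal subgroups with abelian quotient\<close>

lemma (in group) commuting_generators:
  assumes S: "S \<subseteq> carrier G" "generate G S = carrier G"
    and comm: "\<And>s t. s \<in> S \<Longrightarrow> t \<in> S \<Longrightarrow> s \<otimes> t = t \<otimes> s"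
  shows "comm_group G"
proof (rule group_comm_groupI)
  have *: "x \<otimes> s = s \<otimes> x" if "x \<in> carrier G" "s \<in> S" for x s
    using generate_commute[OF S(1) S(1) comm] that S(2) by blast
  show "x \<otimes> y = y \<otimes> x" if "x \<in> carrier G" "y \<in> carrier G" for x y
    by (rule generate_commute[OF S(1) order_refl *[symmetric]]) (use that S(2) in simp_all)
qed

text \<open>The commutators of the generators already make the quotient abelian. There the image of
  \<open>N\<close> is a subgroup of a finitely generated abelian group, and preimages of its
  generators complete the list.\<close>

theorem (in group) abelian_quotient_kernel:
  assumes "finitely_generated G" "N \<lhd> G" "commutators G (carrier G) (carrier G) \<subseteq> N"
  obtains T where "finite T" "T \<subseteq> N" "N = normal_closure G T"
proof -
  interpret N: normal N G by fact
  obtain S where S: "finite S" "S \<subseteq> carrier G" "generate G S = carrier G"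
    using assms(1) unfolding finitely_generated_def by blast
  let ?C = "commutators G S S"
  have "?C = (\<lambda>(x, y). x \<otimes> y \<otimes> inv x \<otimes> inv y) ` (S \<times> S)" by (auto simp: commutators_def)
  then have C: "finite ?C" using S(1) by simp
  have CN: "?C \<subseteq> N" using assms(3) S(2) unfolding commutators_def by blast
  have Cc: "?C \<subseteq> carrier G" using CN N.subset by blast
  define D where "D = normal_closure G ?C"
  interpret D: normal D G unfolding D_def by (rule normal_closure_normal[OF Cc])
  have DN: "D \<subseteq> N" unfolding D_def by (rule normal_closure_min[OF assms(2) CN])
  define \<phi> where "\<phi> = (\<lambda>x. D #> x)"
  interpret \<phi>: group_hom G "G Mod D" \<phi> unfolding \<phi>_def by (rule D.Mod_hom)
  have surj: "\<phi> ` carrier G = carrier (G Mod D)" unfolding \<phi>_def by (rule D.Mod_surj)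
  have eq: "\<phi> x = \<phi> y \<longleftrightarrow> x \<otimes> inv y \<in> D" if "x \<in> carrier G" "y \<in> carrier G" for x y
    unfolding \<phi>_def by (rule D.Mod_eq_iff[OF that])
  have gen: "generate (G Mod D) (\<phi> ` S) = carrier (G Mod D)"
    using \<phi>.generate_img[OF S(2)] S(3) surj by simp
  interpret Q: comm_group "G Mod D"
  proof (rule \<phi>.H.commuting_generators[OF _ gen])
    show "\<phi> ` S \<subseteq> carrier (G Mod D)" using S(2) by auto
    fix u v assume "u \<in> \<phi> ` S" "v \<in> \<phi> ` S"
    then obtain s t where st: "s \<in> S" "t \<in> S" "u = \<phi> s" "v = \<phi> t" by blast
    then have stc: "s \<in> carrier G" "t \<in> carrier G" using S(2) by auto
    have "s \<otimes> t \<otimes> inv s \<otimes> inv t \<in> D"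
      unfolding D_def by (rule subsetD[OF normal_closure_incl]) (use st in \<open>auto simp: commutators_def\<close>)
    then have "s \<otimes> t \<otimes> inv (t \<otimes> s) \<in> D" using stc by (simp add: inv_mult_group m_assoc)
    then have "\<phi> (s \<otimes> t) = \<phi> (t \<otimes> s)" using eq[of "s \<otimes> t" "t \<otimes> s"] stc by simp
    then show "u \<otimes>\<^bsub>G Mod D\<^esub> v = v \<otimes>\<^bsub>G Mod D\<^esub> u" using st stc by simp
  qed
  have "subgroup (\<phi> ` N) (G Mod D)" by (rule \<phi>.subgroup_img_is_subgroup[OF N.is_subgroup])
  moreover have "\<phi> ` N \<subseteq> generate (G Mod D) (\<phi> ` S)" unfolding gen using N.subset by auto
  moreover have "\<phi> ` S \<subseteq> carrier (G Mod D)" using S(2) by auto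
  ultimately obtain Y' where Y': "finite Y'" "Y' \<subseteq> \<phi> ` N" "\<phi> ` N = generate (G Mod D) Y'"
    using Q.subgroup_of_finitely_generated[of "\<phi> ` S" "\<phi> ` N"] S(1) by auto
  obtain Y where Y: "finite Y" "Y \<subseteq> N" "Y' = \<phi> ` Y" using finite_subset_image[OF Y'(1,2)] by blast
  have Yc: "Y \<subseteq> carrier G" using Y(2) N.subset by blast
  let ?T = "?C \<union> Y"
  have TN: "?T \<subseteq> N" using CN Y(2) by blast
  have Tc: "?T \<subseteq> carrier G" using TN N.subset by blast
  interpret M: normal "normal_closure G ?T" G by (rule normal_closure_normal[OF Tc])
  have DM: "D \<subseteq> normal_closure G ?T" unfolding D_def by (rule normal_closure_mono[OF _ Tc]) blast
  have YM: "generate G Y \<subseteq> normal_closure G ?T"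
    by (rule generate_subgroup_incl[OF _ M.is_subgroup]) (use normal_closure_incl[of ?T] in blast)
  have "N \<subseteq> normal_closure G ?T"
  proof
    fix x assume x: "x \<in> N"
    have "\<phi> ` N = \<phi> ` generate G Y" using Y'(3) Y(3) \<phi>.generate_img[OF Yc] by simp
    then have "\<phi> x \<in> \<phi> ` generate G Y" using x by blast
    then obtain y where y: "y \<in> generate G Y" "\<phi> x = \<phi> y" by (elim imageE)
    have yc: "y \<in> carrier G" using generate_in_carrier[OF Yc y(1)] .
    have "x \<otimes> inv y \<in> D" using eq[of x y] y(2) x yc by simp
    then have "x \<otimes> inv y \<otimes> y \<in> normal_closure G ?T" using DM YM y(1) M.m_closed by blast
    then show "x \<in> normal_closure G ?T" using x yc by (simp add: m_assoc)
  qed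
  moreover have "normal_closure G ?T \<subseteq> N" by (rule normal_closure_min[OF assms(2) TN])
  ultimately show ?thesis using that[of ?T] C Y(1) TN by blast
qed

text \<open>In the application \<open>T / N\<close> is the finite torsion subgroup of
  \<open>G / N\<close>, represented by \<open>\<Theta>\<close>, the letters \<open>e\<close> lift a
  basis of \<open>K / T\<close>, and the letters \<open>q\<close> complete it to a basis of
  \<open>G / T\<close>.\<close>

locale depth = group G for G (structure) +
  fixes N T K :: "'a set" and e :: "'p \<Rightarrow> 'a" and P :: "'p set" and \<Theta> :: "'a set"
    and q :: "'q \<Rightarrow> 'a" and J :: "'q set"
  assumes NsubT: "N \<subseteq> T" and TsubK: "T \<subseteq> K"
    and N: "subgroup N G" and T: "subgroup T G" and K: "subgroup K G"
    and commN: "commutators G (carrier G) (carrier G) \<subseteq> N"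
    and K_fg: "finitely_generated (G\<lparr>carrier := K\<rparr>)"
    and e: "e ` P \<subseteq> K" "finite P"
    and K_gen: "x \<in> K \<Longrightarrow> \<exists>u\<in>generate G (e ` P). \<exists>t\<in>T. x = u \<otimes> t"
    and \<Theta>: "finite \<Theta>" "\<Theta> \<subseteq> T" "\<one> \<in> \<Theta>" "x \<in> T \<Longrightarrow> \<exists>t\<in>\<Theta>. \<exists>n\<in>N. x = t \<otimes> n"
    and q: "q ` J \<subseteq> carrier G" "finite J"
begin

sublocale N: normal N G by (rule normal_if_commutators[OF N commN])

lemmas N_normal = N.normal_axioms

lemma swap_in_N: "x \<in> carrier G \<Longrightarrow> y \<in> carrier G \<Longrightarrow> inv x \<otimes> y \<otimes> x \<otimes> inv y \<in> N"
proof -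
  assume xy: "x \<in> carrier G" "y \<in> carrier G"
  have "inv x \<otimes> y \<otimes> inv (inv x) \<otimes> inv y \<in> N"
    using commN xy unfolding commutators_def by blast
  then show ?thesis using xy by simp
qed

sublocale LP: letters G e P
  using e K by unfold_locales (auto dest: subgroup.mem_carrier)

sublocale LQ: letters G q J
  using q by unfold_locales auto

lemma Kc: "x \<in> K \<Longrightarrow> x \<in> carrier G" and Tc: "x \<in> T \<Longrightarrow> x \<in> carrier G"
  using subgroup.mem_carrier[OF K] subgroup.mem_carrier[OF T] by auto

definition pletters :: "'a set" where "pletters = letter_val G e ` (P \<times> UNIV)"

definition \<Theta>' :: "'a set" where "\<Theta>' = \<Theta> \<union> m_inv G ` \<Theta>"

lemma plettersc: "l \<in> pletters \<Longrightarrow> l \<in> carrier G"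
  unfolding pletters_def by (auto simp: mem_Times_iff)

lemma \<Theta>'c: "t \<in> \<Theta>' \<Longrightarrow> t \<in> carrier G" "t \<in> \<Theta>' \<Longrightarrow> t \<in> T" "t \<in> \<Theta>' \<Longrightarrow> inv t \<in> \<Theta>'"
  using \<Theta>(2) Tc subgroup.m_inv_closed[OF T] unfolding \<Theta>'_def by (auto simp: subset_iff)

lemma finite_pletters: "finite pletters" "finite \<Theta>'"
  using e(2) \<Theta>(1) by (auto simp: pletters_def \<Theta>'_def)

text \<open>Besides normal generators of \<open>N\<close> in \<open>K\<close>, the set contains the
  errors that arise when generators of \<open>K\<close> are written through letters and
  representatives, when representatives are multiplied, and when they are moved past letters. With
  these errors in \<open>D 0\<close>, torsion costs no depth.\<close>

definition good_base :: "'a set \<Rightarrow> bool" where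
  "good_base A \<longleftrightarrow> finite A \<and> A \<subseteq> N \<and>
    N = normal_closure (G\<lparr>carrier := K\<rparr>) A \<and>
    (\<exists>S\<subseteq>K. generate G S = K \<and> (\<forall>s\<in>S. \<exists>u\<in>generate G (e ` P). \<exists>t\<in>\<Theta>. \<exists>n\<in>A. s = u \<otimes> t \<otimes> n)) \<and>
    (\<forall>t\<in>\<Theta>'. \<forall>t'\<in>\<Theta>. \<exists>t''\<in>\<Theta>. \<exists>n\<in>A. t \<otimes> t' = t'' \<otimes> n) \<and>
    (\<forall>t\<in>\<Theta>'. \<forall>l\<in>pletters. inv l \<otimes> t \<otimes> l \<otimes> inv t \<in> A)"

lemma ex_good_base: "\<exists>A. good_base A"
proof -
  have gK: "group (G\<lparr>carrier := K\<rparr>)" by (rule subgroup_imp_group[OF K])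
  have NK: "N \<subseteq> K" using NsubT TsubK by blast
  have NK': "N \<lhd> G\<lparr>carrier := K\<rparr>" by (rule normal_restrict_supergroup[OF K N_normal NK])
  have "commutators (G\<lparr>carrier := K\<rparr>) K K \<subseteq> N"
  proof
    fix z assume "z \<in> commutators (G\<lparr>carrier := K\<rparr>) K K"
    then obtain x y where "x \<in> K" "y \<in> K" "z = x \<otimes> y \<otimes> inv x \<otimes> inv y"
      using m_inv_consistent[OF K] by (auto simp: commutators_def)
    then show "z \<in> N" using commN Kc unfolding commutators_def by blast
  qed
  then obtain Y where Y: "finite Y" "Y \<subseteq> N" "N = normal_closure (G\<lparr>carrier := K\<rparr>) Y"
    using group.abelian_quotient_kernel[OF gK K_fg NK'] by auto
  obtain S where S: "finite S" "S \<subseteq> K" "generate G S = K"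
    using K_fg finitely_generated_subgroup_iff[OF K] by blast
  have "\<exists>n\<in>N. \<exists>u\<in>generate G (e ` P). \<exists>t\<in>\<Theta>. s = u \<otimes> t \<otimes> n" if s: "s \<in> S" for s
  proof -
    obtain u t where ut: "u \<in> generate G (e ` P)" "t \<in> T" "s = u \<otimes> t" using K_gen s S by blast
    obtain t' n where tn: "t' \<in> \<Theta>" "n \<in> N" "t = t' \<otimes> n" using \<Theta>(4)[OF ut(2)] by blast
    have "u \<in> carrier G" using generate_in_carrier[OF _ ut(1)] e(1) Kc by blast
    moreover have "t' \<in> carrier G" "n \<in> carrier G" using tn \<Theta>(2) Tc by auto
    ultimately have "s = u \<otimes> t' \<otimes> n" using ut tn by (simp add: m_assoc)
    then show ?thesis using ut tn by blast
  qed
  then obtain f where f: "\<And>s. s \<in> S \<Longrightarrow> f s \<in> N \<and> (\<exists>u\<in>generate G (e ` P). \<exists>t\<in>\<Theta>. s = u \<otimes> t \<otimes> f s)"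
    by metis
  have "\<exists>n\<in>N. \<exists>t''\<in>\<Theta>. t \<otimes> t' = t'' \<otimes> n" if "t \<in> \<Theta>'" "t' \<in> \<Theta>" for t t'
    using \<Theta>(4)[of "t \<otimes> t'"] \<Theta>'c(2)[OF that(1)] subgroup.m_closed[OF T] that(2) \<Theta>(2) by blast
  then obtain g where g: "\<And>t t'. t \<in> \<Theta>' \<Longrightarrow> t' \<in> \<Theta> \<Longrightarrow> g t t' \<in> N \<and> (\<exists>t''\<in>\<Theta>. t \<otimes> t' = t'' \<otimes> g t t')"
    by metis
  let ?A = "Y \<union> f ` S \<union> (\<lambda>(t, t'). g t t') ` (\<Theta>' \<times> \<Theta>) \<union>
    (\<lambda>(t, l). inv l \<otimes> t \<otimes> l \<otimes> inv t) ` (\<Theta>' \<times> pletters)"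
  have fin: "finite ?A" using Y(1) S(1) \<Theta>(1) finite_pletters by auto
  have "(\<lambda>(t, l). inv l \<otimes> t \<otimes> l \<otimes> inv t) ` (\<Theta>' \<times> pletters) \<subseteq> N"
    using swap_in_N plettersc \<Theta>'c(1) by auto
  moreover have "(\<lambda>(t, t'). g t t') ` (\<Theta>' \<times> \<Theta>) \<subseteq> N" using g by auto
  moreover have "f ` S \<subseteq> N" using f by auto
  ultimately have sub: "?A \<subseteq> N" using Y(2) by (intro Un_least)
  have nc: "N = normal_closure (G\<lparr>carrier := K\<rparr>) ?A"
  proof
    have "normal_closure (G\<lparr>carrier := K\<rparr>) Y \<subseteq> normal_closure (G\<lparr>carrier := K\<rparr>) ?A"
      by (rule group.normal_closure_mono[OF gK]) (use sub NK in auto)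
    then show "N \<subseteq> normal_closure (G\<lparr>carrier := K\<rparr>) ?A" using Y(3) by simp
    show "normal_closure (G\<lparr>carrier := K\<rparr>) ?A \<subseteq> N"
      by (rule group.normal_closure_min[OF gK NK' sub])
  qed
  have ex_S: "\<exists>S\<subseteq>K. generate G S = K \<and> (\<forall>s\<in>S. \<exists>u\<in>generate G (e ` P). \<exists>t\<in>\<Theta>. \<exists>n\<in>?A. s = u \<otimes> t \<otimes> n)"
  proof (intro exI[of _ S] conjI ballI S(2,3))
    fix s assume s: "s \<in> S"
    then have "f s \<in> ?A" by blast
    then show "\<exists>u\<in>generate G (e ` P). \<exists>t\<in>\<Theta>. \<exists>n\<in>?A. s = u \<otimes> t \<otimes> n" using f[OF s] by blast
  qed
  have \<Theta>_mult: "\<exists>t''\<in>\<Theta>. \<exists>n\<in>?A. t \<otimes> t' = t'' \<otimes> n" if tt: "t \<in> \<Theta>'" "t' \<in> \<Theta>" for t t'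
  proof -
    have "g t t' \<in> ?A" using tt by blast
    then show ?thesis using g[OF tt] by blast
  qed
  have comm: "inv l \<otimes> t \<otimes> l \<otimes> inv t \<in> ?A" if "t \<in> \<Theta>'" "l \<in> pletters" for t l
    using that by force
  have "good_base ?A"
    unfolding good_base_def by (intro conjI ballI fin sub nc ex_S \<Theta>_mult comm)
  then show ?thesis by blast
qed

definition base :: "'a set" where "base = (SOME A. good_base A)"

lemma base: "good_base base"
  unfolding base_def by (rule someI_ex[OF ex_good_base])

lemma baseN: "finite base" "base \<subseteq> N"
  using base unfolding good_base_def by blast+

text \<open>Conjugates under the representatives are put in from the start, so that only words in
  the letters \<open>e\<close> count for the depth.\<close>

definition D0gens :: "'a set" where "D0gens = (\<Union>t\<in>\<Theta>. conj_by G t ` base)"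

definition Dgens :: "nat \<Rightarrow> 'a set" where
  "Dgens r = (\<Union>b\<in>{b \<in> lists (P \<times> UNIV). length b \<le> r}. conj_by G (word_val G e b) ` D0gens)"

definition D :: "nat \<Rightarrow> 'a set" where "D r = generate G (Dgens r)"

lemma D0gens_N: "D0gens \<subseteq> N"
  unfolding D0gens_def
  by (intro UN_least image_subsetI normal_conj_by[OF N_normal]) (use baseN \<Theta>(2) Tc in auto)

lemma Dgens_N: "Dgens r \<subseteq> N"
proof
  fix y assume "y \<in> Dgens r"
  then obtain b x where bx: "b \<in> lists (P \<times> UNIV)" "x \<in> D0gens" "y = conj_by G (word_val G e b) x"
    unfolding Dgens_def by blast
  have "x \<in> N" using D0gens_N bx(2) by blast
  then show "y \<in> N" unfolding bx(3) by (rule normal_conj_by[OF N_normal LP.word_val_closed[OF bx(1)]])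
qed

lemma Dgens_c: "Dgens r \<subseteq> carrier G" using Dgens_N N.subset by blast

lemma D_subgroup: "subgroup (D r) G" unfolding D_def by (rule generate_is_subgroup[OF Dgens_c])

lemma D_N: "D r \<subseteq> N" unfolding D_def by (rule generate_subgroup_incl[OF Dgens_N N])

lemma finite_Dgens: "finite (Dgens r)"
proof -
  have "finite {b. set b \<subseteq> P \<times> (UNIV :: bool set) \<and> length b \<le> r}"
    using e(2) by (intro finite_lists_length_le) auto
  moreover have "{b \<in> lists (P \<times> (UNIV :: bool set)). length b \<le> r} = {b. set b \<subseteq> P \<times> UNIV \<and> length b \<le> r}"
    by (auto simp: in_lists_conv_set)
  ultimately have "finite {b \<in> lists (P \<times> (UNIV :: bool set)). length b \<le> r}" by simp
  then show ?thesis unfolding Dgens_def D0gens_def using baseN(1) \<Theta>(1) by blast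
qed

lemma D_mono: "r \<le> s \<Longrightarrow> D r \<subseteq> D s"
  unfolding D_def by (rule mono_generate) (auto simp: Dgens_def)

lemma D0gens_D: "D0gens \<subseteq> D r"
proof
  fix x assume x: "x \<in> D0gens"
  have "x = conj_by G (word_val G e []) x" using x D0gens_N N.subset by auto
  then have "x \<in> Dgens r" using x unfolding Dgens_def by (intro UN_I[of "[]"]) auto
  then show "x \<in> D r" unfolding D_def by (rule generate.incl)
qed

lemma base_D: "base \<subseteq> D r"
proof
  fix x assume x: "x \<in> base"
  then have "x = conj_by G \<one> x" using baseN(2) N.subset by auto
  then have "x \<in> D0gens" using x \<Theta>(3) unfolding D0gens_def by (intro UN_I[of \<one>]) auto
  then show "x \<in> D r" using D0gens_D by blast
qed

lemma conj_D_le: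
  assumes g: "g \<in> carrier G" and "\<And>x. x \<in> Dgens r \<Longrightarrow> conj_by G g x \<in> D s" and "x \<in> D r"
  shows "conj_by G g x \<in> D s"
proof -
  have "conj_by G g ` generate G (Dgens r) = generate G (conj_by G g ` Dgens r)"
    by (rule conj_by_generate[OF g Dgens_c])
  also have "\<dots> \<subseteq> D s"
    by (rule generate_subgroup_incl[OF _ D_subgroup]) (use assms(2) in blast)
  finally show ?thesis using assms(3) unfolding D_def by blast
qed

lemma conj_D_self: "n \<in> D r \<Longrightarrow> x \<in> D r \<Longrightarrow> conj_by G n x \<in> D r"
  unfolding conj_by_def
  by (intro subgroup.m_closed[OF D_subgroup] subgroup.m_inv_closed[OF D_subgroup])

lemma Dc: "x \<in> D r \<Longrightarrow> x \<in> carrier G" by (rule subgroup.mem_carrier[OF D_subgroup])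

lemma letter_D:
  assumes "l \<in> pletters" "x \<in> D r" shows "conj_by G l x \<in> D (Suc r)"
proof (rule conj_D_le[OF plettersc[OF assms(1)] _ assms(2)])
  fix y assume "y \<in> Dgens r"
  then obtain b z where bz: "b \<in> lists (P \<times> UNIV)" "length b \<le> r" "z \<in> D0gens" "y = conj_by G (word_val G e b) z"
    unfolding Dgens_def by blast
  obtain a where a: "a \<in> P \<times> UNIV" "l = letter_val G e a" using assms(1) unfolding pletters_def by blast
  have zc: "z \<in> carrier G" using bz(3) D0gens_N N.subset by blast
  have "conj_by G l y = conj_by G (word_val G e (a # b)) z"
    unfolding bz(4) using conj_by_conj_by[OF plettersc[OF assms(1)] LP.word_val_closed[OF bz(1)] zc] a(2) by simp
  then have "conj_by G l y \<in> Dgens (Suc r)"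
    unfolding Dgens_def using a(1) bz by (intro UN_I[of "a # b"]) auto
  then show "conj_by G l y \<in> D (Suc r)" unfolding D_def by (rule generate.incl)
qed

text \<open>The identity \<open>g l = l (l^-1 g l g^-1) g\<close>.\<close>

lemma conj_past_letter:
  assumes "l \<in> carrier G" "g \<in> carrier G" "y \<in> carrier G"
  shows "conj_by G g (conj_by G l y) = conj_by G l (conj_by G (inv l \<otimes> g \<otimes> l \<otimes> inv g) (conj_by G g y))"
proof -
  have "conj_by G l (conj_by G (inv l \<otimes> g \<otimes> l \<otimes> inv g) (conj_by G g y)) =
      conj_by G (l \<otimes> (inv l \<otimes> g \<otimes> l \<otimes> inv g) \<otimes> g) y"
    using assms by (simp add: conj_by_conj_by)
  also have "l \<otimes> (inv l \<otimes> g \<otimes> l \<otimes> inv g) \<otimes> g = g \<otimes> l" using assms by (simp add: m_assoc)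
  finally show ?thesis using assms by (simp add: conj_by_conj_by)
qed

text \<open>A conjugation moves past the letters of a word at the price of commutators; these lie in \<open>D c\<close>
  and do not deepen \<open>D r\<close> for \<open>r \<ge> c\<close>.\<close>

lemma conj_D_shift:
  assumes g: "g \<in> carrier G" and D0: "\<And>x. x \<in> D0gens \<Longrightarrow> conj_by G g x \<in> D c"
    and com: "\<And>l. l \<in> pletters \<Longrightarrow> inv l \<otimes> g \<otimes> l \<otimes> inv g \<in> D c"
    and x: "x \<in> D r"
  shows "conj_by G g x \<in> D (r + c)"
proof (rule conj_D_le[OF g _ x])
  fix y assume "y \<in> Dgens r"
  then obtain b z where bz: "b \<in> lists (P \<times> UNIV)" "length b \<le> r" "z \<in> D0gens" "y = conj_by G (word_val G e b) z"
    unfolding Dgens_def by blast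
  have zc: "z \<in> carrier G" using bz(3) D0gens_N N.subset by blast
  have "conj_by G g (conj_by G (word_val G e b) z) \<in> D (length b + c)"
    using bz(1)
  proof (induction b rule: list.induct)
    case Nil
    then show ?case using D0[OF bz(3)] zc by simp
  next
    case (Cons a b)
    have a: "a \<in> P \<times> UNIV" and b: "b \<in> lists (P \<times> UNIV)" using Cons.prems by auto
    let ?l = "letter_val G e a" and ?y = "conj_by G (word_val G e b) z"
    have l: "?l \<in> pletters" using a unfolding pletters_def by blast
    note lc = plettersc[OF l] and bc = LP.word_val_closed[OF b]
    have yc: "?y \<in> carrier G" using bc zc by simp
    have "conj_by G g ?y \<in> D (length b + c)" by (rule Cons.IH[OF b])
    moreover have "inv ?l \<otimes> g \<otimes> ?l \<otimes> inv g \<in> D (length b + c)"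
      using com[OF l] D_mono[of c "length b + c"] by auto
    ultimately have "conj_by G (inv ?l \<otimes> g \<otimes> ?l \<otimes> inv g) (conj_by G g ?y) \<in> D (length b + c)"
      using conj_D_self by blast
    then have "conj_by G ?l (conj_by G (inv ?l \<otimes> g \<otimes> ?l \<otimes> inv g) (conj_by G g ?y)) \<in> D (Suc (length b + c))"
      by (rule letter_D[OF l])
    then show ?case
      using conj_past_letter[OF lc g yc] conj_by_conj_by[OF lc bc zc] by simp
  qed
  then show "conj_by G g y \<in> D (r + c)" using bz(2,4) D_mono[of "length b + c" "r + c"] by auto
qed

lemma theta_D0: "t \<in> \<Theta>' \<Longrightarrow> x \<in> D0gens \<Longrightarrow> conj_by G t x \<in> D 0"
proof -
  assume t: "t \<in> \<Theta>'" and x: "x \<in> D0gens"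
  obtain t' y where ty: "t' \<in> \<Theta>" "y \<in> base" "x = conj_by G t' y" using x unfolding D0gens_def by blast
  obtain t'' n where tn: "t'' \<in> \<Theta>" "n \<in> base" "t \<otimes> t' = t'' \<otimes> n"
    using base t ty(1) unfolding good_base_def by blast
  have car: "t \<in> carrier G" "t' \<in> carrier G" "t'' \<in> carrier G" "n \<in> carrier G" "y \<in> carrier G"
    using \<Theta>'c(1)[OF t] ty(1,2) tn(1,2) \<Theta>(2) Tc baseN(2) N.subset by auto
  have "conj_by G t x = conj_by G t'' (conj_by G n y)"
    using car by (simp add: ty(3) conj_by_conj_by[symmetric] tn(3))
  also have "\<dots> = conj_by G t'' n \<otimes> conj_by G t'' y \<otimes> inv (conj_by G t'' n)"
    using car by (simp add: conj_by_def[of G n] conj_by_mult conj_by_inv)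
  also have "\<dots> \<in> D 0"
  proof -
    have "conj_by G t'' n \<in> D 0" "conj_by G t'' y \<in> D 0"
      using subsetD[OF D0gens_D] tn(1,2) ty(2) unfolding D0gens_def by blast+
    then show ?thesis by (intro subgroup.m_closed[OF D_subgroup] subgroup.m_inv_closed[OF D_subgroup])
  qed
  finally show ?thesis .
qed

lemma theta_D: "t \<in> \<Theta>' \<Longrightarrow> x \<in> D r \<Longrightarrow> conj_by G t x \<in> D r"
proof -
  assume t: "t \<in> \<Theta>'" and x: "x \<in> D r"
  have "conj_by G t x \<in> D (r + 0)"
  proof (rule conj_D_shift[OF \<Theta>'c(1)[OF t] theta_D0[OF t] _ x])
    fix l assume "l \<in> pletters"
    then have "inv l \<otimes> t \<otimes> l \<otimes> inv t \<in> base" using base t unfolding good_base_def by blast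
    then show "inv l \<otimes> t \<otimes> l \<otimes> inv t \<in> D 0" using base_D by blast
  qed
  then show ?thesis by simp
qed

text \<open>The union is normalised by the letters, by \<open>\<Theta>\<close> and by
  \<open>base\<close>, hence by the generators of \<open>K\<close> recorded in
  \<open>good_base\<close>. Being normal in \<open>K\<close>, it contains the normal closure of
  \<open>base\<close> there, which is \<open>N\<close>.\<close>

lemma Union_D: "(\<Union>r. D r) = N"
proof
  show "(\<Union>r. D r) \<subseteq> N" using D_N by blast
  let ?V = "\<Union>r. D r"
  have V: "subgroup ?V G" by (rule subgroup_Union_chain[OF D_subgroup D_mono])
  let ?W = "{g \<in> carrier G. conj_by G g ` ?V = ?V}"
  have W: "subgroup ?W G" by (rule subgroup_normalizing[OF V])
  have WI: "g \<in> ?W" if g: "g \<in> carrier G" "\<And>x. x \<in> ?V \<Longrightarrow> conj_by G g x \<in> ?V" "\<And>x. x \<in> ?V \<Longrightarrow> conj_by G (inv g) x \<in> ?V" for g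
  proof -
    have "?V \<subseteq> conj_by G g ` ?V"
    proof
      fix x assume x: "x \<in> ?V"
      then have "x \<in> carrier G" using Dc by blast
      then have "x = conj_by G g (conj_by G (inv g) x)" using g(1) by simp
      then show "x \<in> conj_by G g ` ?V" using g(3)[OF x] by (rule image_eqI)
    qed
    moreover have "conj_by G g ` ?V \<subseteq> ?V" using g(2) by blast
    ultimately show ?thesis using g(1) by blast
  qed
  have plW: "generate G (e ` P) \<subseteq> ?W"
  proof (rule generate_subgroup_incl[OF _ W])
    show "e ` P \<subseteq> ?W"
    proof
      fix y assume "y \<in> e ` P"
      then obtain i where i: "i \<in> P" "y = e i" by blast
      have "letter_val G e (i, True) \<in> pletters" "letter_val G e (i, False) \<in> pletters"
        unfolding pletters_def using i(1) by blast+
      then have l: "y \<in> pletters" "inv y \<in> pletters" using i(2) by (auto simp: letter_val_def)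
      show "y \<in> ?W"
        by (rule WI[OF plettersc[OF l(1)]]) (use letter_D[OF l(1)] letter_D[OF l(2)] in blast)+
    qed
  qed
  have tW: "t \<in> ?W" if "t \<in> \<Theta>" for t
  proof -
    have t: "t \<in> \<Theta>'" "inv t \<in> \<Theta>'" using that by (auto simp: \<Theta>'_def)
    show ?thesis by (rule WI[OF \<Theta>'c(1)[OF t(1)]]) (use theta_D[OF t(1)] theta_D[OF t(2)] in blast)+
  qed
  have bW: "n \<in> ?W" if "n \<in> base" for n
  proof -
    have n: "n \<in> ?V" "inv n \<in> ?V" "n \<in> carrier G"
      using that base_D[of 0] subgroup.m_inv_closed[OF V] Dc[of n 0] by auto
    show ?thesis
      by (rule WI[OF n(3)]; unfold conj_by_def; intro subgroup.m_closed[OF V] subgroup.m_inv_closed[OF V] n)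
  qed
  obtain S where S: "S \<subseteq> K" "generate G S = K"
    "\<forall>s\<in>S. \<exists>u\<in>generate G (e ` P). \<exists>t\<in>\<Theta>. \<exists>n\<in>base. s = u \<otimes> t \<otimes> n"
    using base unfolding good_base_def by blast
  have "S \<subseteq> ?W"
  proof
    fix s assume "s \<in> S"
    from bspec[OF S(3) this] obtain u t n
      where utn: "u \<in> generate G (e ` P)" "t \<in> \<Theta>" "n \<in> base" and s: "s = u \<otimes> t \<otimes> n"
      by (elim bexE)
    have "u \<in> ?W" by (rule subsetD[OF plW utn(1)])
    moreover note tW[OF utn(2)] bW[OF utn(3)]
    ultimately show "s \<in> ?W" unfolding s by (intro subgroup.m_closed[OF W])
  qed
  from generate_subgroup_incl[OF this W] have KW: "K \<subseteq> ?W" unfolding S(2) .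
  have VK: "?V \<subseteq> K" using D_N NsubT TsubK by blast
  have gK: "group (G\<lparr>carrier := K\<rparr>)" by (rule subgroup_imp_group[OF K])
  have "?V \<lhd> G\<lparr>carrier := K\<rparr>"
  proof (rule group.normal_invI[OF gK])
    show "subgroup ?V (G\<lparr>carrier := K\<rparr>)" by (rule subgroup_incl[OF V K VK])
    fix x h assume xh: "x \<in> carrier (G\<lparr>carrier := K\<rparr>)" "h \<in> ?V"
    then have "conj_by G x ` ?V = ?V" using subsetD[OF KW] by simp
    then have "conj_by G x h \<in> ?V" using xh(2) by blast
    then show "x \<otimes>\<^bsub>G\<lparr>carrier := K\<rparr>\<^esub> h \<otimes>\<^bsub>G\<lparr>carrier := K\<rparr>\<^esub> inv\<^bsub>G\<lparr>carrier := K\<rparr>\<^esub> x \<in> ?V"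
      using xh(1) m_inv_consistent[OF K] by (simp add: conj_by_def)
  qed
  moreover have "base \<subseteq> ?V" using base_D by blast
  moreover have "N = normal_closure (G\<lparr>carrier := K\<rparr>) base" using base unfolding good_base_def by blast
  ultimately show "N \<subseteq> ?V" using group.normal_closure_min[OF gK] by blast
qed

lemma finite_subset_D: "finite Y \<Longrightarrow> Y \<subseteq> N \<Longrightarrow> \<exists>r. Y \<subseteq> D r"
proof (induction Y rule: finite_induct)
  case (insert y Y)
  then obtain r s where "Y \<subseteq> D r" "y \<in> D s" using Union_D by blast
  then have "insert y Y \<subseteq> D (max r s)" using D_mono[of r "max r s"] D_mono[of s "max r s"] by auto
  then show ?case by blast
qed auto

text \<open>A word of length at most \<open>r + d\<close> is one of length at most \<open>d\<close>
  followed by one of length at most \<open>r\<close>, and the latter acts first.\<close>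

lemma D_split:
  assumes "x \<in> D (r + d)"
  shows "x \<in> generate G (\<Union>b\<in>{b \<in> lists (P \<times> UNIV). length b \<le> d}. conj_by G (word_val G e b) ` D r)"
proof -
  let ?E = "\<Union>b\<in>{b \<in> lists (P \<times> UNIV). length b \<le> d}. conj_by G (word_val G e b) ` D r"
  have "Dgens (r + d) \<subseteq> ?E"
  proof
    fix y assume "y \<in> Dgens (r + d)"
    then obtain b z where bz: "b \<in> lists (P \<times> UNIV)" "length b \<le> r + d" "z \<in> D0gens" "y = conj_by G (word_val G e b) z"
      unfolding Dgens_def by blast
    have zc: "z \<in> carrier G" using bz(3) D0gens_N N.subset by blast
    have t: "take d b \<in> lists (P \<times> UNIV)" "drop d b \<in> lists (P \<times> UNIV)"
      using bz(1) by (auto simp: in_lists_conv_set dest: in_set_takeD in_set_dropD)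
    have "word_val G e b = word_val G e (take d b) \<otimes> word_val G e (drop d b)"
      using LP.word_val_append[OF t] by simp
    then have "y = conj_by G (word_val G e (take d b)) (conj_by G (word_val G e (drop d b)) z)"
      using bz(4) conj_by_conj_by[OF LP.word_val_closed[OF t(1)] LP.word_val_closed[OF t(2)] zc] by simp
    moreover have "conj_by G (word_val G e (drop d b)) z \<in> D r"
      unfolding D_def Dgens_def using t(2) bz(2,3) by (intro generate.incl UN_I[of "drop d b"]) auto
    moreover have "length (take d b) \<le> d" by simp
    ultimately show "y \<in> ?E" using t(1) by blast
  qed
  then show ?thesis using assms mono_generate unfolding D_def by blast
qed

text \<open>An element of \<open>T\<close> is a representative times some \<open>n\<close> in
  \<open>N\<close>. From the depth at which \<open>n\<close> appears, conjugation by
  \<open>n\<close> preserves each \<open>D r\<close>; this is the origin of the thresholds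
  \<open>r0\<close>.\<close>

lemma T_D: "t \<in> T \<Longrightarrow> \<exists>r0. \<forall>r\<ge>r0. \<forall>x\<in>D r. conj_by G t x \<in> D r"
proof -
  assume "t \<in> T"
  then obtain t' n where tn: "t' \<in> \<Theta>" "n \<in> N" "t = t' \<otimes> n" using \<Theta>(4) by blast
  obtain r0 where r0: "n \<in> D r0" using tn(2) Union_D by blast
  have t': "t' \<in> \<Theta>'" using tn(1) by (simp add: \<Theta>'_def)
  have "conj_by G t x \<in> D r" if "r \<ge> r0" "x \<in> D r" for r x
  proof -
    have "n \<in> D r" using r0 D_mono[OF that(1)] by blast
    then have "conj_by G t' (conj_by G n x) \<in> D r" using conj_D_self theta_D[OF t'] that(2) by blast
    then show ?thesis using conj_by_conj_by[OF \<Theta>'c(1)[OF t'] _ Dc[OF that(2)]] tn(2,3) by simp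
  qed
  then show ?thesis by blast
qed

text \<open>Only finitely many elements of \<open>N\<close> matter, namely the conjugates of
  \<open>D0gens\<close> by letters \<open>q\<close> and the commutators of these with the letters
  \<open>e\<close>. They have a common depth \<open>C\<close>.\<close>

lemma ex_shift:
  "\<exists>C. \<forall>a\<in>J \<times> UNIV. \<forall>r. \<forall>x\<in>D r. conj_by G (letter_val G q a) x \<in> D (r + C)"
proof -
  let ?L = "letter_val G q ` (J \<times> UNIV)"
  let ?Y = "(\<Union>l\<in>?L. conj_by G l ` D0gens) \<union> (\<lambda>(g, l). inv l \<otimes> g \<otimes> l \<otimes> inv g) ` (?L \<times> pletters)"
  have Lc: "l \<in> carrier G" if "l \<in> ?L" for l using that LQ.letter_val_closed by (auto simp: mem_Times_iff)
  have fin: "finite ?Y"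
    using q(2) finite_pletters baseN(1) \<Theta>(1) by (auto simp: D0gens_def)
  have "(\<Union>l\<in>?L. conj_by G l ` D0gens) \<subseteq> N"
    using normal_conj_by[OF N_normal Lc] D0gens_N by blast
  moreover have "(\<lambda>(g, l). inv l \<otimes> g \<otimes> l \<otimes> inv g) ` (?L \<times> pletters) \<subseteq> N"
    using swap_in_N[OF plettersc Lc] by fast
  ultimately have sub: "?Y \<subseteq> N" by (rule Un_least)
  obtain C where C: "?Y \<subseteq> D C" using finite_subset_D[OF fin sub] by blast
  have "conj_by G (letter_val G q a) x \<in> D (r + C)" if a: "a \<in> J \<times> UNIV" "x \<in> D r" for a r x
  proof (rule conj_D_shift[OF _ _ _ a(2)])
    have l: "letter_val G q a \<in> ?L" using a(1) by blast
    show "letter_val G q a \<in> carrier G" by (rule Lc[OF l])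
    show "conj_by G (letter_val G q a) x \<in> D C" if "x \<in> D0gens" for x
      by (rule subsetD[OF C UnI1], rule UN_I[OF l imageI[OF that]])
    show "inv l \<otimes> letter_val G q a \<otimes> l \<otimes> inv letter_val G q a \<in> D C" if "l \<in> pletters" for l
      by (rule subsetD[OF C UnI2], rule image_eqI[of _ _ "(letter_val G q a, l)"]) (use l that in simp_all)
  qed
  then show ?thesis by blast
qed

text \<open>Each letter \<open>q\<close> costs at most \<open>C\<close>, whereas the factor in
  \<open>T\<close> costs nothing once \<open>r\<close> is large. Later arguments see the filtration
  only through these properties.\<close>

theorem depth_filtration:
  obtains C :: nat and D :: "nat \<Rightarrow> 'a set" where
    "\<And>r. \<exists>A. finite A \<and> A \<subseteq> N \<and> D r = generate G A"
    "\<And>r s. r \<le> s \<Longrightarrow> D r \<subseteq> D s" "(\<Union>r. D r) = N"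
    "\<And>r d x. x \<in> D (r + d) \<Longrightarrow>
      x \<in> generate G (\<Union>b\<in>{b \<in> lists (P \<times> UNIV). length b \<le> d}. conj_by G (word_val G e b) ` D r)"
    "\<And>w t. w \<in> lists (J \<times> UNIV) \<Longrightarrow> t \<in> T \<Longrightarrow>
      \<exists>r0. \<forall>r\<ge>r0. \<forall>x\<in>D r. conj_by G (word_val G q w \<otimes> t) x \<in> D (r + length w * C)"
proof -
  obtain C where C: "\<And>a r x. a \<in> J \<times> UNIV \<Longrightarrow> x \<in> D r \<Longrightarrow> conj_by G (letter_val G q a) x \<in> D (r + C)"
    using ex_shift by blast
  have word: "conj_by G (word_val G q w) x \<in> D (r + length w * C)" if "w \<in> lists (J \<times> UNIV)" "x \<in> D r" for w x r
    using that
  proof (induction w rule: list.induct)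
    case Nil
    then show ?case using Dc by simp
  next
    case (Cons a w)
    have a: "a \<in> J \<times> UNIV" and w: "w \<in> lists (J \<times> UNIV)" using Cons.prems by auto
    have ac: "letter_val G q a \<in> carrier G" using a by (auto simp: mem_Times_iff)
    have "conj_by G (letter_val G q a) (conj_by G (word_val G q w) x) \<in> D (r + length w * C + C)"
      by (rule C[OF a Cons.IH[OF w Cons.prems(2)]])
    then show ?case
      using conj_by_conj_by[OF ac LQ.word_val_closed[OF w] Dc[OF Cons.prems(2)]] by (simp add: algebra_simps)
  qed
  show ?thesis
  proof (rule that[of D C])
    show "\<exists>A. finite A \<and> A \<subseteq> N \<and> D r = generate G A" for r
      using finite_Dgens[of r] Dgens_N[of r] D_def[of r] by blast
    show "D r \<subseteq> D s" if "r \<le> s" for r s by (rule D_mono[OF that])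
    show "(\<Union>r. D r) = N" by (rule Union_D)
    fix r d x assume "x \<in> D (r + d)"
    then show "x \<in> generate G (\<Union>b\<in>{b \<in> lists (P \<times> UNIV). length b \<le> d}. conj_by G (word_val G e b) ` D r)"
      by (rule D_split)
  next
    fix w :: "'q letter list" and t assume w: "w \<in> lists (J \<times> UNIV)" and t: "t \<in> T"
    obtain r0 where r0: "\<And>r x. r \<ge> r0 \<Longrightarrow> x \<in> D r \<Longrightarrow> conj_by G t x \<in> D r" using T_D[OF t] by blast
    have "conj_by G (word_val G q w \<otimes> t) x \<in> D (r + length w * C)" if "r \<ge> r0" "x \<in> D r" for r x
      using word[OF w r0[OF that]] conj_by_conj_by[OF LQ.word_val_closed[OF w] Tc[OF t] Dc[OF that(2)]] by simp
    then show "\<exists>r0. \<forall>r\<ge>r0. \<forall>x\<in>D r. conj_by G (word_val G q w \<otimes> t) x \<in> D (r + length w * C)" by blast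
  qed
qed

end

section \<open>Coordinates and torsion-free rank\<close>

text \<open>Elimination without fractions: an unknown \<open>b0\<close> that occurs in equation
  \<open>i\<close> is removed from the others by cross multiplication.\<close>

lemma homogeneous_system:
  fixes K :: "'j \<Rightarrow> 'b \<Rightarrow> int"
  assumes "finite J" "finite B" "card J < card B"
  shows "\<exists>c. (\<exists>b\<in>B. c b \<noteq> 0) \<and> (\<forall>j\<in>J. (\<Sum>b\<in>B. c b * K j b) = 0)"
  using assms
proof (induction J arbitrary: B K rule: finite_induct)
  case empty
  then have "B \<noteq> {}" by auto
  then show ?case by (intro exI[of _ "\<lambda>_. 1"]) auto
next
  case (insert i J)
  show ?case
  proof (cases "\<forall>b\<in>B. K i b = 0")
    case True
    obtain c where "\<exists>b\<in>B. c b \<noteq> 0" "\<forall>j\<in>J. (\<Sum>b\<in>B. c b * K j b) = 0"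
      using insert.IH[of B K] insert.prems insert.hyps by auto
    then show ?thesis using True by (intro exI[of _ c]) auto
  next
    case False
    then obtain b0 where b0: "b0 \<in> B" "K i b0 \<noteq> 0" by blast
    let ?B = "B - {b0}"
    have "card J < card ?B" using insert.prems insert.hyps b0(1) by simp
    then obtain c where c: "\<exists>b\<in>?B. c b \<noteq> 0"
      "\<forall>j\<in>J. (\<Sum>b\<in>?B. c b * (K i b0 * K j b - K i b * K j b0)) = 0"
      using insert.IH[of ?B "\<lambda>j b. K i b0 * K j b - K i b * K j b0"] insert.prems(1) by auto
    define d where "d b = (if b = b0 then - (\<Sum>b\<in>?B. c b * K i b) else K i b0 * c b)" for b
    have sum: "(\<Sum>b\<in>B. d b * K j b) = K i b0 * (\<Sum>b\<in>?B. c b * K j b) - (\<Sum>b\<in>?B. c b * K i b) * K j b0" for j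
    proof -
      have "(\<Sum>b\<in>B. d b * K j b) = d b0 * K j b0 + (\<Sum>b\<in>?B. d b * K j b)"
        by (rule sum.remove[OF insert.prems(1) b0(1)])
      also have "(\<Sum>b\<in>?B. d b * K j b) = (\<Sum>b\<in>?B. K i b0 * (c b * K j b))"
        by (rule sum.cong) (auto simp: d_def)
      finally show ?thesis by (simp add: d_def sum_distrib_left)
    qed
    have "(\<Sum>b\<in>B. d b * K j b) = 0" if "j \<in> insert i J" for j
    proof (cases "j = i")
      case True
      then show ?thesis unfolding sum by simp
    next
      case False
      then have "0 = (\<Sum>b\<in>?B. c b * (K i b0 * K j b - K i b * K j b0))" using c(2) that by simp
      also have "\<dots> = (\<Sum>b\<in>?B. K i b0 * (c b * K j b) - c b * K i b * K j b0)"
        by (rule sum.cong) (auto simp: algebra_simps)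
      also have "\<dots> = (\<Sum>b\<in>B. d b * K j b)"
        unfolding sum by (simp add: sum_subtractf sum_distrib_left sum_distrib_right)
      finally show ?thesis by simp
    qed
    moreover have "\<exists>b\<in>B. d b \<noteq> 0" using c(1) b0(2) by (auto simp: d_def)
    ultimately show ?thesis by blast
  qed
qed

definition int_hom :: "('a, 'c) monoid_scheme \<Rightarrow> ('a \<Rightarrow> int) \<Rightarrow> bool" where
  "int_hom G f \<longleftrightarrow> (\<forall>x\<in>carrier G. \<forall>y\<in>carrier G. f (x \<otimes>\<^bsub>G\<^esub> y) = f x + f y)"

text \<open>Joint surjectivity is demanded rather than independence, as it provides dual elements
  and a splitting over the integers.\<close>

definition coordinates :: "('a, 'c) monoid_scheme \<Rightarrow> nat \<Rightarrow> (nat \<Rightarrow> 'a \<Rightarrow> int) \<Rightarrow> bool" where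
  "coordinates G n \<kappa> \<longleftrightarrow> (\<forall>i<n. int_hom G (\<kappa> i)) \<and> (\<forall>z. \<exists>x\<in>carrier G. \<forall>i<n. \<kappa> i x = z i)"

context group
begin

lemma int_hom_mult: "int_hom G f \<Longrightarrow> x \<in> carrier G \<Longrightarrow> y \<in> carrier G \<Longrightarrow> f (x \<otimes> y) = f x + f y"
  by (simp add: int_hom_def)

lemma int_hom_one: "int_hom G f \<Longrightarrow> f \<one> = 0"
  using int_hom_mult[of f \<one> \<one>] by simp

lemma int_hom_inv: "int_hom G f \<Longrightarrow> x \<in> carrier G \<Longrightarrow> f (inv x) = - f x"
  using int_hom_mult[of f x "inv x"] int_hom_one[of f] by simp

lemma int_hom_nat_pow: "int_hom G f \<Longrightarrow> x \<in> carrier G \<Longrightarrow> f (x [^] (k::nat)) = int k * f x"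
  by (induction k) (simp_all add: int_hom_one int_hom_mult algebra_simps)

lemma int_hom_int_pow: "int_hom G f \<Longrightarrow> x \<in> carrier G \<Longrightarrow> f (x [^] (k::int)) = k * f x"
  by (cases k rule: int_cases2) (simp_all add: int_pow_int int_pow_neg_int int_hom_nat_pow int_hom_inv)

lemma int_hom_kernel:
  assumes "\<And>i. i < n \<Longrightarrow> int_hom G (\<kappa> i)"
  shows "subgroup {x \<in> carrier G. \<forall>i<n. \<kappa> i x = 0} G"
  by unfold_locales (auto simp: int_hom_mult[OF assms] int_hom_one[OF assms] int_hom_inv[OF assms])

lemma int_hom_generate:
  assumes "int_hom G f" "S \<subseteq> carrier G" "\<And>s. s \<in> S \<Longrightarrow> f s = 0" "x \<in> generate G S"
  shows "f x = 0"
proof -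
  have "subgroup {x \<in> carrier G. \<forall>i<1::nat. (\<lambda>_. f) i x = 0} G" by (rule int_hom_kernel) (rule assms(1))
  from generate_subgroup_incl[OF _ this, of S] show ?thesis using assms(2-4) by auto
qed

lemma coordinates_units:
  assumes "coordinates G n \<kappa>"
  obtains q where "\<And>j. q j \<in> carrier G" "\<And>i j. i < n \<Longrightarrow> \<kappa> i (q j) = (if i = j then 1 else 0)"
proof -
  have "\<forall>j. \<exists>x. x \<in> carrier G \<and> (\<forall>i<n. \<kappa> i x = (if i = j then 1 else 0))"
  proof
    fix j
    from assms[unfolded coordinates_def, THEN conjunct2, THEN spec, of "\<lambda>i. if i = j then 1 else 0"]
    show "\<exists>x. x \<in> carrier G \<and> (\<forall>i<n. \<kappa> i x = (if i = j then 1 else 0))" by (simp add: Bex_def)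
  qed
  from choice[OF this] obtain q
    where q: "\<forall>j. q j \<in> carrier G \<and> (\<forall>i<n. \<kappa> i (q j) = (if i = j then 1 else 0))" by (elim exE)
  show ?thesis by (rule that[of q]) (use q in auto)
qed

end

context comm_group
begin

lemma int_hom_finprod:
  assumes "int_hom G f" "finite B" "g \<in> B \<rightarrow> carrier G"
  shows "f (\<Otimes>b\<in>B. g b) = (\<Sum>b\<in>B. f (g b))"
  using assms(2,3) by (induction rule: finite_induct) (auto simp: int_hom_one[OF assms(1)] int_hom_mult[OF assms(1)])

text \<open>Either the exponent of the new generator \<open>x\<close> is well defined, or some power
  \<open>x [^] d\<close> lies in the old subgroup. In the second case the old subgroup has finite
  index, is infinite as well, and contains all \<open>d\<close>-th powers; its homomorphism is
  composed with the \<open>d\<close>-th power map.\<close>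

lemma ex_nonzero_int_hom:
  assumes "finite S" "S \<subseteq> carrier G" "infinite (generate G S)"
  shows "\<exists>f. int_hom (G\<lparr>carrier := generate G S\<rparr>) f \<and> (\<exists>x\<in>generate G S. f x \<noteq> 0)"
  using assms
proof (induction S rule: finite_induct)
  case empty
  then show ?case by (simp add: generate_empty)
next
  case (insert x S)
  let ?B = "generate G S" and ?A = "generate G (insert x S)"
  have x: "x \<in> carrier G" and S: "S \<subseteq> carrier G" using insert.prems by auto
  note B = generate_is_subgroup[OF S] and A = generate_insert[OF S x]
  note Bc = subgroup.mem_carrier[OF B]
  show ?case
  proof (cases "\<exists>d>0. x [^] (d::nat) \<in> ?B")
    case False
    have unique: "j = j'" if "b \<in> ?B" "b' \<in> ?B" "b \<otimes> x [^] (j::int) = b' \<otimes> x [^] j'" for b b' j j'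
    proof -
      have main: "j \<le> j'" if bb: "b \<in> ?B" "b' \<in> ?B" and e: "b \<otimes> x [^] (j::int) = b' \<otimes> x [^] j'" for b b' j j'
      proof (rule ccontr)
        assume "\<not> j \<le> j'"
        then have pos: "nat (j - j') > 0" and pow: "x [^] (j - j') = x [^] nat (j - j')"
          using int_pow_int[of G x "nat (j - j')"] by auto
        have "x [^] (j - j') = inv b \<otimes> b'"
        proof -
          have "x [^] (j - j') = inv b \<otimes> (b \<otimes> x [^] j) \<otimes> inv (x [^] j')"
            using Bc[OF bb(1)] x by (simp add: int_pow_diff)
          also have "\<dots> = inv b \<otimes> b'" unfolding e using Bc[OF bb(1)] Bc[OF bb(2)] x by (simp add: m_assoc)
          finally show ?thesis .
        qed
        then have "x [^] nat (j - j') = inv b \<otimes> b'" unfolding pow .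
        moreover have "inv b \<otimes> b' \<in> ?B" by (intro subgroup.m_closed[OF B] subgroup.m_inv_closed[OF B] bb)
        ultimately show False using False pos by metis
      qed
      show ?thesis using main[OF that] main[OF that(2,1) that(3)[symmetric]] by simp
    qed
    define f where "f a = (THE j. \<exists>b\<in>?B. a = b \<otimes> x [^] (j::int))" for a
    have f: "f (b \<otimes> x [^] j) = j" if "b \<in> ?B" for b j
      unfolding f_def using unique that by (intro the_equality) blast+
    have "int_hom (G\<lparr>carrier := ?A\<rparr>) f"
      unfolding int_hom_def
    proof (intro ballI)
      fix a a' assume "a \<in> carrier (G\<lparr>carrier := ?A\<rparr>)" "a' \<in> carrier (G\<lparr>carrier := ?A\<rparr>)"
      then obtain b b' j j' where a: "a = b \<otimes> x [^] (j::int)" "b \<in> ?B" "a' = b' \<otimes> x [^] (j'::int)" "b' \<in> ?B"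
        unfolding A by auto
      have "a \<otimes> a' = b \<otimes> (x [^] j \<otimes> b') \<otimes> x [^] j'"
        using a(1,3) Bc[OF a(2)] Bc[OF a(4)] x by (simp add: m_assoc)
      also have "x [^] j \<otimes> b' = b' \<otimes> x [^] j" using Bc[OF a(4)] x by (simp add: m_comm)
      also have "b \<otimes> (b' \<otimes> x [^] j) \<otimes> x [^] j' = (b \<otimes> b') \<otimes> x [^] (j + j')"
        using Bc[OF a(2)] Bc[OF a(4)] x by (simp add: m_assoc int_pow_mult)
      finally have "f (a \<otimes> a') = j + j'" using f[OF subgroup.m_closed[OF B a(2,4)]] by simp
      then show "f (a \<otimes>\<^bsub>G\<lparr>carrier := ?A\<rparr>\<^esub> a') = f a + f a'" using a f by simp
    qed
    moreover have "f x = 1" using f[OF generate.one, of 1] x by simp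
    then have "\<exists>y\<in>?A. f y \<noteq> 0" by (intro bexI[of _ x] generate.incl) auto
    ultimately show ?thesis by blast
  next
    case True
    then obtain d :: nat where d: "d > 0" "x [^] d \<in> ?B" by blast
    have xd: "x [^] (int d * j) \<in> ?B" for j
    proof -
      have "x [^] (int d * j) = (x [^] d) [^] j" using x by (simp add: int_pow_pow flip: int_pow_int)
      then show ?thesis using subgroup_int_pow_closed[OF B d(2)] by simp
    qed
    have "?A \<subseteq> (\<lambda>(b, j). b \<otimes> x [^] j) ` (?B \<times> {0..<int d})"
    proof
      fix a assume "a \<in> ?A"
      then obtain b j where a: "a = b \<otimes> x [^] (j::int)" "b \<in> ?B" unfolding A by blast
      have "a = b \<otimes> x [^] (int d * (j div int d)) \<otimes> x [^] (j mod int d)"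
        using a Bc[OF a(2)] x by (simp add: m_assoc int_pow_mult[symmetric])
      moreover have "b \<otimes> x [^] (int d * (j div int d)) \<in> ?B" by (rule subgroup.m_closed[OF B a(2) xd])
      ultimately show "a \<in> (\<lambda>(b, j). b \<otimes> x [^] j) ` (?B \<times> {0..<int d})"
        using d(1) by (intro image_eqI[of _ _ "(b \<otimes> x [^] (int d * (j div int d)), j mod int d)"]) auto
    qed
    then have "finite ?A" if "finite ?B" by (rule finite_subset) (use that in simp)
    then have "infinite ?B" using insert.prems(2) by blast
    then obtain f where f: "int_hom (G\<lparr>carrier := ?B\<rparr>) f" "\<exists>y\<in>?B. f y \<noteq> 0" using insert.IH[OF S] by blast
    have gB: "group (G\<lparr>carrier := ?B\<rparr>)" by (rule subgroup_imp_group[OF B])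
    have powB: "a [^] d \<in> ?B" if "a \<in> ?A" for a
    proof -
      obtain b j where a: "a = b \<otimes> x [^] (j::int)" "b \<in> ?B" using \<open>a \<in> ?A\<close> unfolding A by blast
      have "a [^] d = b [^] int d \<otimes> x [^] (int d * j)"
        using a Bc[OF a(2)] x by (simp add: int_pow_distrib int_pow_pow mult.commute flip: int_pow_int)
      then show ?thesis
        using subgroup.m_closed[OF B subgroup_int_pow_closed[OF B a(2)] xd] by simp
    qed
    have Ac: "a \<in> carrier G" if "a \<in> ?A" for a using generate_in_carrier[OF _ that] x S by blast
    have "int_hom (G\<lparr>carrier := ?A\<rparr>) (\<lambda>a. f (a [^] d))"
      using f(1) powB Ac by (auto simp: int_hom_def nat_pow_distrib)
    moreover obtain y where y: "y \<in> ?B" "f y \<noteq> 0" using f(2) by blast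
    have "f (y [^] d) = int d * f y"
      using group.int_hom_nat_pow[OF gB f(1)] y(1) nat_pow_consistent[of y d ?B] by simp
    moreover have "y \<in> ?A" using y(1) mono_generate[of S "insert x S"] by blast
    ultimately show ?thesis using y(2) d(1) by (intro exI[of _ "\<lambda>a. f (a [^] d)"]) auto
  qed
qed

text \<open>Free abelian groups are projective; here the splitting is the product of powers of the
  dual elements.\<close>

lemma coordinates_section:
  assumes "coordinates G n \<kappa>"
  obtains r where "\<And>z. r z \<in> carrier G" "\<And>z i. i < n \<Longrightarrow> \<kappa> i (r z) = z i"
    "\<And>z w. r (\<lambda>i. z i + w i) = r z \<otimes> r w" "\<And>z w. (\<And>i. i < n \<Longrightarrow> z i = w i) \<Longrightarrow> r z = r w"
proof -
  have hom: "int_hom G (\<kappa> i)" if "i < n" for i using assms that by (simp add: coordinates_def)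
  obtain q where q: "\<And>j. q j \<in> carrier G" "\<And>i j. i < n \<Longrightarrow> \<kappa> i (q j) = (if i = j then 1 else 0)"
    using coordinates_units[OF assms] by blast
  define r where "r z = (\<Otimes>j\<in>{..<n}. q j [^] (z j :: int))" for z
  show ?thesis
  proof (rule that[of r])
    show "r z \<in> carrier G" for z unfolding r_def using q(1) by (intro finprod_closed) auto
    show "\<kappa> i (r z) = z i" if "i < n" for i z
    proof -
      have "\<kappa> i (r z) = (\<Sum>j<n. \<kappa> i (q j [^] z j))"
        unfolding r_def using q(1) by (intro int_hom_finprod[OF hom[OF that]]) auto
      also have "\<dots> = (\<Sum>j<n. if j = i then z j else 0)"
        by (rule sum.cong) (auto simp: int_hom_int_pow[OF hom[OF that] q(1)] q(2)[OF that])
      finally show ?thesis using that by simp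
    qed
    show "r (\<lambda>i. z i + w i) = r z \<otimes> r w" for z w
      unfolding r_def using q(1) by (subst finprod_multf[symmetric]) (auto simp: int_pow_mult intro!: finprod_cong)
    show "r z = r w" if "\<And>i. i < n \<Longrightarrow> z i = w i" for z w
      unfolding r_def using that q(1) by (intro finprod_cong) auto
  qed
qed

text \<open>With more coordinates than generators some nontrivial combination of them vanishes on
  all generators, hence everywhere. At an element whose coordinates are the coefficients
  \<open>c\<close> its value is a sum of squares.\<close>

lemma coordinates_bounded:
  assumes "finite S" "S \<subseteq> carrier G" "generate G S = carrier G" "coordinates G n \<kappa>"
  shows "n \<le> card S"
proof (rule ccontr)
  assume "\<not> n \<le> card S"
  then obtain c :: "nat \<Rightarrow> int" where c: "\<exists>i\<in>{..<n}. c i \<noteq> 0" "\<forall>s\<in>S. (\<Sum>i<n. c i * \<kappa> i s) = 0"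
    using homogeneous_system[of S "{..<n}" "\<lambda>s i. \<kappa> i s"] assms(1) by auto
  define f where "f x = (\<Sum>i<n. c i * \<kappa> i x)" for x
  have "int_hom G f"
    unfolding int_hom_def f_def sum.distrib[symmetric]
    using assms(4) by (intro ballI sum.cong) (auto simp: int_hom_def coordinates_def distrib_left)
  then have f0: "f x = 0" if "x \<in> carrier G" for x
    using int_hom_generate[of f S x] assms(2,3) c(2) that by (simp add: f_def)
  obtain x where x: "x \<in> carrier G" "\<forall>i<n. \<kappa> i x = c i" using assms(4) unfolding coordinates_def by blast
  have "(\<Sum>i<n. c i * c i) = f x" unfolding f_def using x(2) by (intro sum.cong) auto
  also have "\<dots> = 0" by (rule f0[OF x(1)])
  finally have "\<forall>i\<in>{..<n}. c i * c i = 0" by (simp add: sum_nonneg_eq_0_iff)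
  then show False using c(1) by auto
qed

text \<open>The values of \<open>f\<close> may be proper multiples, so \<open>f\<close> is divided
  by its least positive value \<open>d\<close>. It is carried from the common kernel to
  \<open>G\<close> by the projection \<open>\<tau>\<close> along a section.\<close>

lemma extend_coordinates:
  assumes "coordinates G n \<kappa>" "int_hom (G\<lparr>carrier := {x \<in> carrier G. \<forall>i<n. \<kappa> i x = 0}\<rparr>) f"
    and "t \<in> carrier G" "\<forall>i<n. \<kappa> i t = 0" "f t \<noteq> 0"
  shows "\<exists>g. coordinates G (Suc n) (\<kappa>(n := g))"
proof -
  let ?T = "{x \<in> carrier G. \<forall>i<n. \<kappa> i x = 0}"
  have hom: "int_hom G (\<kappa> i)" if "i < n" for i using assms that by (simp add: coordinates_def)
  have T: "subgroup ?T G" by (rule int_hom_kernel[OF hom])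
  interpret T: group "G\<lparr>carrier := ?T\<rparr>" by (rule subgroup_imp_group[OF T])
  have fmult: "f (x \<otimes> y) = f x + f y" if "x \<in> ?T" "y \<in> ?T" for x y
    using assms(2) that by (simp add: int_hom_def)
  have fpow: "f (x [^] (k::int)) = k * f x" if "x \<in> ?T" for x k
    using T.int_hom_int_pow[OF assms(2), of x k] that int_pow_consistent[OF T that, of k] by simp
  obtain d x0 where d: "d > 0" "x0 \<in> ?T" "f x0 = int d"
    and min: "\<And>d' x. d' > 0 \<Longrightarrow> x \<in> ?T \<Longrightarrow> f x = int d' \<Longrightarrow> d \<le> d'"
  proof -
    let ?P = "\<lambda>d. d > 0 \<and> (\<exists>x\<in>?T. f x = int d)"
    have t: "t \<in> ?T" using assms by simp
    have "\<exists>x\<in>?T. f x = \<bar>f t\<bar>"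
      using t fpow[OF t, of "-1"] subgroup_int_pow_closed[OF T t, of "-1"] by (cases "f t \<ge> 0") auto
    then have "?P (nat \<bar>f t\<bar>)" using assms(5) by simp
    then have "?P (LEAST d. ?P d)" by (rule LeastI)
    moreover have "(LEAST d. ?P d) \<le> d'" if "?P d'" for d' using that by (rule Least_le)
    ultimately show ?thesis using that by blast
  qed
  have dvd: "int d dvd f x" if x: "x \<in> ?T" for x
  proof -
    let ?k = "f x div int d"
    let ?y = "x \<otimes> x0 [^] (- ?k)"
    have x0: "x0 [^] (- ?k) \<in> ?T" by (rule subgroup_int_pow_closed[OF T d(2)])
    have y: "?y \<in> ?T" by (rule subgroup.m_closed[OF T x x0])
    have "f ?y = f x - f x div int d * int d" unfolding fmult[OF x x0] fpow[OF d(2)] d(3) by simp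
    then have fy: "f ?y = f x mod int d" by (simp add: minus_div_mult_eq_mod)
    have bounds: "0 \<le> f x mod int d" "f x mod int d < int d" using d(1) by simp_all
    have "f x mod int d = 0"
    proof (rule ccontr)
      assume "f x mod int d \<noteq> 0"
      then have "d \<le> nat (f x mod int d)" using bounds(1) fy by (intro min[OF _ y]) simp_all
      then show False using bounds by simp
    qed
    then show ?thesis by (rule mod_0_imp_dvd)
  qed
  define f' where "f' x = f x div int d" for x
  have f'mult: "f' (x \<otimes> y) = f' x + f' y" if "x \<in> ?T" "y \<in> ?T" for x y
    unfolding f'_def using fmult[OF that] dvd that by (simp add: div_plus_div_distrib_dvd_left)
  obtain r where r: "\<And>z. r z \<in> carrier G" "\<And>z i. i < n \<Longrightarrow> \<kappa> i (r z) = z i"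
    "\<And>z w. r (\<lambda>i. z i + w i) = r z \<otimes> r w" "\<And>z w. (\<And>i. i < n \<Longrightarrow> z i = w i) \<Longrightarrow> r z = r w"
    using coordinates_section[OF assms(1)] by blast
  define \<tau> where "\<tau> x = x \<otimes> inv (r (\<lambda>i. \<kappa> i x))" for x
  have \<tau>T: "\<tau> x \<in> ?T" if "x \<in> carrier G" for x
    using that r(1,2) by (auto simp: \<tau>_def int_hom_mult[OF hom] int_hom_inv[OF hom])
  have \<tau>mult: "\<tau> (x \<otimes> y) = \<tau> x \<otimes> \<tau> y" if "x \<in> carrier G" "y \<in> carrier G" for x y
  proof -
    have "r (\<lambda>i. \<kappa> i (x \<otimes> y)) = r (\<lambda>i. \<kappa> i x) \<otimes> r (\<lambda>i. \<kappa> i y)"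
      unfolding r(3)[symmetric] using that by (intro r(4)) (simp add: int_hom_mult[OF hom])
    then have "\<tau> (x \<otimes> y) = x \<otimes> (y \<otimes> inv (r (\<lambda>i. \<kappa> i x))) \<otimes> inv (r (\<lambda>i. \<kappa> i y))"
      using that r(1) by (simp add: \<tau>_def inv_mult m_assoc)
    also have "y \<otimes> inv (r (\<lambda>i. \<kappa> i x)) = inv (r (\<lambda>i. \<kappa> i x)) \<otimes> y" using that r(1) by (simp add: m_comm)
    finally show ?thesis unfolding \<tau>_def[of x] \<tau>_def[of y] using that r(1) by (simp add: m_assoc)
  qed
  have g_hom: "int_hom G (\<lambda>x. f' (\<tau> x))"
    unfolding int_hom_def
  proof (intro ballI)
    fix x y assume "x \<in> carrier G" "y \<in> carrier G"
    then show "f' (\<tau> (x \<otimes> y)) = f' (\<tau> x) + f' (\<tau> y)"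
      unfolding \<tau>mult[OF \<open>x \<in> carrier G\<close> \<open>y \<in> carrier G\<close>] by (intro f'mult \<tau>T)
  qed
  let ?\<kappa> = "\<kappa>(n := \<lambda>x. f' (\<tau> x))"
  have "coordinates G (Suc n) ?\<kappa>"
    unfolding coordinates_def
  proof (intro conjI allI impI)
    fix i assume "i < Suc n"
    then show "int_hom G (?\<kappa> i)"
      using hom[of i] g_hom by (cases "i = n") simp_all
  next
    fix z :: "nat \<Rightarrow> int"
    let ?y = "x0 [^] (z n - f' (\<tau> (r z)))"
    have y: "?y \<in> ?T" by (rule subgroup_int_pow_closed[OF T d(2)])
    then have yc: "?y \<in> carrier G" by blast
    have "\<tau> ?y = ?y"
    proof -
      have "r (\<lambda>i. \<kappa> i ?y) = r (\<lambda>i. 0)" using y by (intro r(4)) simp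
      also have "\<dots> = \<one>" using r(3)[of "\<lambda>_. 0" "\<lambda>_. 0"] r(1)[of "\<lambda>_. 0"] by (simp add: l_cancel_one')
      finally show ?thesis using yc by (simp add: \<tau>_def)
    qed
    then have "f' (\<tau> (r z \<otimes> ?y)) = f' (\<tau> (r z)) + f' ?y"
      using int_hom_mult[OF g_hom r(1) yc] by simp
    also have "f' ?y = z n - f' (\<tau> (r z))" unfolding f'_def fpow[OF d(2)] d(3) using d(1) by simp
    finally have n: "f' (\<tau> (r z \<otimes> ?y)) = z n" by simp
    have "\<forall>i<Suc n. ?\<kappa> i (r z \<otimes> ?y) = z i"
    proof (intro allI impI)
      fix i assume "i < Suc n"
      then consider "i = n" | "i < n" by linarith
      then show "?\<kappa> i (r z \<otimes> ?y) = z i"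
      proof cases
        case 2
        have "\<kappa> i ?y = 0" using y 2 by blast
        then show ?thesis using int_hom_mult[OF hom[OF 2] r(1) yc] r(2)[OF 2] 2 by simp
      qed (simp add: n)
    qed
    then show "\<exists>x\<in>carrier G. \<forall>i<Suc n. ?\<kappa> i x = z i" by (rule bexI[OF _ m_closed[OF r(1) yc]])
  qed
  then show ?thesis by blast
qed

text \<open>The number of generators bounds the length of such families, so a longest one exists; an
  infinite common kernel would allow it to be extended.\<close>

theorem ex_coordinates_extending:
  assumes "finitely_generated G" "coordinates G m \<kappa>0"
  obtains n \<kappa> where "m \<le> n" "\<And>i. i < m \<Longrightarrow> \<kappa> i = \<kappa>0 i" "coordinates G n \<kappa>"
    "finite {x \<in> carrier G. \<forall>i<n. \<kappa> i x = 0}"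
proof -
  obtain S where S: "finite S" "S \<subseteq> carrier G" "generate G S = carrier G"
    using assms(1) unfolding finitely_generated_def by blast
  let ?P = "\<lambda>n. m \<le> n \<and> (\<exists>\<kappa>. (\<forall>i<m. \<kappa> i = \<kappa>0 i) \<and> coordinates G n \<kappa>)"
  have "?P m" using assms(2) by blast
  moreover have "\<forall>n. ?P n \<longrightarrow> n < Suc (card S)" using coordinates_bounded[OF S] by (auto simp: less_Suc_eq_le)
  ultimately obtain n where n: "?P n" "\<And>n'. ?P n' \<Longrightarrow> n' \<le> n"
    using ex_has_greatest_nat[of ?P m "\<lambda>n. n" "Suc (card S)"] by blast
  then obtain \<kappa> where \<kappa>: "m \<le> n" "\<forall>i<m. \<kappa> i = \<kappa>0 i" "coordinates G n \<kappa>" by blast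
  let ?T = "{x \<in> carrier G. \<forall>i<n. \<kappa> i x = 0}"
  have T: "subgroup ?T G" using \<kappa>(3) by (intro int_hom_kernel) (simp add: coordinates_def)
  obtain Y where Y: "finite Y" "Y \<subseteq> ?T" "?T = generate G Y"
    using subgroup_of_finitely_generated[OF S(1,2) T] S(3) by auto
  have "finite ?T"
  proof (rule ccontr)
    assume "infinite ?T"
    then obtain f t where f: "int_hom (G\<lparr>carrier := ?T\<rparr>) f" "t \<in> ?T" "f t \<noteq> 0"
      using ex_nonzero_int_hom[of Y] Y by auto
    then obtain g where g: "coordinates G (Suc n) (\<kappa>(n := g))" using extend_coordinates[OF \<kappa>(3) f(1)] by blast
    have "?P (Suc n)" using g \<kappa>(1,2) by (intro conjI exI[of _ "\<kappa>(n := g)"]) auto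
    then show False using n(2)[of "Suc n"] by simp
  qed
  then show ?thesis using that[of n \<kappa>] \<kappa> by blast
qed

lemma finite_kernel_torsion:
  assumes "\<And>i. i < n \<Longrightarrow> int_hom G (\<kappa> i)" "finite {x \<in> carrier G. \<forall>i<n. \<kappa> i x = 0}"
    and "x \<in> carrier G" "\<And>i. i < n \<Longrightarrow> \<kappa> i x = 0"
  obtains d :: nat where "d > 0" "x [^] d = \<one>"
proof -
  let ?T = "{x \<in> carrier G. \<forall>i<n. \<kappa> i x = 0}"
  have T: "subgroup ?T G" by (rule int_hom_kernel[OF assms(1)])
  interpret T: group "G\<lparr>carrier := ?T\<rparr>" by (rule subgroup_imp_group[OF T])
  have "order (G\<lparr>carrier := ?T\<rparr>) > 0" using assms(2) T.order_gt_0_iff_finite by simp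
  moreover have "x [^] order (G\<lparr>carrier := ?T\<rparr>) = \<one>"
    using T.pow_order_eq_1[of x] assms(3,4) nat_pow_consistent[of x _ ?T] by simp
  ultimately show ?thesis using that by blast
qed

text \<open>Dual elements are independent. Among more than \<open>n\<close> elements some nontrivial
  combination has all coordinates zero, so it lies in the finite kernel and a positive multiple of
  it is trivial.\<close>

theorem torsion_free_rank_coordinates:
  assumes \<kappa>: "coordinates G n \<kappa>" and fin: "finite {x \<in> carrier G. \<forall>i<n. \<kappa> i x = 0}"
  shows "torsion_free_rank G = n"
  unfolding torsion_free_rank_def
proof (rule Greatest_equality)
  have hom: "int_hom G (\<kappa> i)" if "i < n" for i using \<kappa> that by (simp add: coordinates_def)
  obtain q where q: "\<And>j. q j \<in> carrier G" "\<And>i j. i < n \<Longrightarrow> \<kappa> i (q j) = (if i = j then 1 else 0)"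
    using coordinates_units[OF \<kappa>] by blast
  have inj: "inj_on q {..<n}"
  proof
    fix i j assume ij: "i \<in> {..<n}" "j \<in> {..<n}" "q i = q j"
    then have "(if i = i then 1 else (0::int)) = (if i = j then 1 else 0)"
      using q(2)[of i i] q(2)[of i j] by simp
    then show "i = j" by (simp split: if_splits)
  qed
  have "int_independent G (q ` {..<n})"
    unfolding int_independent_def
  proof (intro conjI allI impI ballI)
    fix c :: "'a \<Rightarrow> int" and b
    assume c: "(\<Otimes>b\<in>q ` {..<n}. b [^] c b) = \<one>" and "b \<in> q ` {..<n}"
    then obtain i where i: "i < n" "b = q i" by blast
    have "0 = (\<Sum>b\<in>q ` {..<n}. \<kappa> i (b [^] c b))"
      using int_hom_finprod[OF hom[OF i(1)], of "q ` {..<n}" "\<lambda>b. b [^] c b"] c q(1) int_hom_one[OF hom[OF i(1)]] by auto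
    also have "\<dots> = (\<Sum>j<n. \<kappa> i (q j [^] c (q j)))" by (simp add: sum.reindex[OF inj])
    also have "\<dots> = (\<Sum>j<n. if j = i then c (q j) else 0)"
      by (rule sum.cong) (auto simp: int_hom_int_pow[OF hom[OF i(1)] q(1)] q(2)[OF i(1)])
    finally show "c b = 0" using i by simp
  qed (use q(1) in auto)
  moreover have "card (q ` {..<n}) = n" using card_image[OF inj] by simp
  ultimately show "\<exists>B. int_independent G B \<and> card B = n" by blast
  fix y assume "\<exists>B. int_independent G B \<and> card B = y"
  then obtain B where B: "int_independent G B" "card B = y" by blast
  have Bc: "finite B" "B \<subseteq> carrier G" using B(1) by (auto simp: int_independent_def)
  show "y \<le> n"
  proof (rule ccontr)
    assume "\<not> y \<le> n"
    then obtain c where c: "\<exists>b\<in>B. c b \<noteq> 0" "\<forall>i\<in>{..<n}. (\<Sum>b\<in>B. c b * \<kappa> i b) = 0"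
      using homogeneous_system[of "{..<n}" B \<kappa>] Bc(1) B(2) by auto
    let ?x = "\<Otimes>b\<in>B. b [^] c b"
    have x: "?x \<in> carrier G" using Bc(2) by (intro finprod_closed) auto
    have "\<kappa> i ?x = 0" if "i < n" for i
    proof -
      have "\<kappa> i ?x = (\<Sum>b\<in>B. \<kappa> i (b [^] c b))"
        using Bc by (intro int_hom_finprod[OF hom[OF that]]) auto
      also have "\<dots> = (\<Sum>b\<in>B. c b * \<kappa> i b)"
        using Bc(2) by (intro sum.cong) (auto simp: int_hom_int_pow[OF hom[OF that]])
      finally show ?thesis using c(2) that by simp
    qed
    then obtain d :: nat where d: "d > 0" "?x [^] d = \<one>"
      using finite_kernel_torsion[OF hom fin x] by blast
    have pow: "(\<Otimes>b\<in>B'. b [^] c b) [^] d = (\<Otimes>b\<in>B'. b [^] (int d * c b))" if "finite B'" "B' \<subseteq> B" for B'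
      using that
    proof (induction B' rule: finite_induct)
      case (insert b B')
      have car: "b \<in> carrier G" "B' \<subseteq> carrier G" using insert.prems Bc(2) by auto
      have fc: "(\<Otimes>b\<in>B'. b [^] c b) \<in> carrier G" using car(2) by (intro finprod_closed) auto
      have "(b [^] c b) [^] d = b [^] (int d * c b)"
        using car(1) by (simp add: int_pow_pow mult.commute flip: int_pow_int)
      then show ?case
        using insert car fc by (subst (1 2) finprod_insert) (auto simp: nat_pow_distrib)
    qed simp
    have "(\<Otimes>b\<in>B. b [^] (int d * c b)) = \<one>" using pow[OF Bc(1)] d(2) by simp
    then have "\<forall>b\<in>B. int d * c b = 0"
      using B(1)[unfolded int_independent_def, THEN conjunct2, THEN conjunct2, THEN spec, of "\<lambda>b. int d * c b"] by simp
    then show False using c(1) d(1) by auto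
  qed
qed

end

text \<open>Both groups split as torsion times a lattice, and an isomorphism preserves torsion.
  Keeping \<open>\<iota>\<close> on the torsion part and prescribing the lattice part by coordinates
  gives an isomorphism again. This is the freedom by which the fibre product is chosen.\<close>

theorem iso_matching_coordinates:
  assumes "comm_group G" "comm_group H" "\<iota> \<in> iso G H"
    and \<kappa>: "coordinates G n \<kappa>" "finite {x \<in> carrier G. \<forall>i<n. \<kappa> i x = 0}"
    and \<nu>: "coordinates H n \<nu>" "finite {x \<in> carrier H. \<forall>i<n. \<nu> i x = 0}"
  obtains \<mu> where "\<mu> \<in> iso G H" "\<And>x i. x \<in> carrier G \<Longrightarrow> i < n \<Longrightarrow> \<nu> i (\<mu> x) = \<kappa> i x"
proof -
  interpret G: comm_group G by fact
  interpret H: comm_group H by fact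
  have \<iota>: "\<iota> \<in> hom G H" "bij_betw \<iota> (carrier G) (carrier H)" using assms(3) by (auto simp: iso_def)
  have \<iota>_inj: "inj_on \<iota> (carrier G)" using \<iota>(2) by (simp add: bij_betw_def)
  interpret \<iota>: group_hom G H \<iota> using \<iota>(1) by unfold_locales
  have homG: "int_hom G (\<kappa> i)" and homH: "int_hom H (\<nu> i)" if "i < n" for i
    using \<kappa>(1) \<nu>(1) that by (auto simp: coordinates_def)
  obtain r where r: "\<And>z. r z \<in> carrier G" "\<And>z i. i < n \<Longrightarrow> \<kappa> i (r z) = z i"
    "\<And>z w. r (\<lambda>i. z i + w i) = r z \<otimes>\<^bsub>G\<^esub> r w" "\<And>z w. (\<And>i. i < n \<Longrightarrow> z i = w i) \<Longrightarrow> r z = r w"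
    using G.coordinates_section[OF \<kappa>(1)] by blast
  obtain s where s: "\<And>z. s z \<in> carrier H" "\<And>z i. i < n \<Longrightarrow> \<nu> i (s z) = z i"
    "\<And>z w. s (\<lambda>i. z i + w i) = s z \<otimes>\<^bsub>H\<^esub> s w" "\<And>z w. (\<And>i. i < n \<Longrightarrow> z i = w i) \<Longrightarrow> s z = s w"
    using H.coordinates_section[OF \<nu>(1)] by blast
  have r0: "r (\<lambda>i. 0) = \<one>\<^bsub>G\<^esub>" using r(3)[of "\<lambda>_. 0" "\<lambda>_. 0"] r(1)[of "\<lambda>_. 0"] by (simp add: G.l_cancel_one')
  have s0: "s (\<lambda>i. 0) = \<one>\<^bsub>H\<^esub>" using s(3)[of "\<lambda>_. 0" "\<lambda>_. 0"] s(1)[of "\<lambda>_. 0"] by (simp add: H.l_cancel_one')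
  define \<mu> where "\<mu> x = \<iota> (x \<otimes>\<^bsub>G\<^esub> inv\<^bsub>G\<^esub> r (\<lambda>i. \<kappa> i x)) \<otimes>\<^bsub>H\<^esub> s (\<lambda>i. \<kappa> i x)" for x
  have \<iota>_torsion: "\<nu> i (\<iota> x) = 0" if x: "x \<in> carrier G" "\<And>i. i < n \<Longrightarrow> \<kappa> i x = 0" and i: "i < n" for x i
  proof -
    obtain d :: nat where d: "d > 0" "x [^]\<^bsub>G\<^esub> d = \<one>\<^bsub>G\<^esub>" using G.finite_kernel_torsion[OF homG \<kappa>(2) x] by blast
    have "int d * \<nu> i (\<iota> x) = \<nu> i (\<iota> (x [^]\<^bsub>G\<^esub> d))"
      using x(1) by (simp add: \<iota>.hom_nat_pow H.int_hom_nat_pow[OF homH[OF i]])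
    then show ?thesis using d H.int_hom_one[OF homH[OF i]] by simp
  qed
  have t: "x \<otimes>\<^bsub>G\<^esub> inv\<^bsub>G\<^esub> r (\<lambda>i. \<kappa> i x) \<in> carrier G" "\<kappa> i (x \<otimes>\<^bsub>G\<^esub> inv\<^bsub>G\<^esub> r (\<lambda>i. \<kappa> i x)) = 0" if "x \<in> carrier G" "i < n" for x i
    using that r(1,2) by (auto simp: G.int_hom_mult[OF homG] G.int_hom_inv[OF homG])
  have \<mu>\<nu>: "\<nu> i (\<mu> x) = \<kappa> i x" if "x \<in> carrier G" "i < n" for x i
    using that t[OF that(1)] \<iota>_torsion[of "x \<otimes>\<^bsub>G\<^esub> inv\<^bsub>G\<^esub> r (\<lambda>i. \<kappa> i x)" i] r(1) s(1,2)
    by (simp add: \<mu>_def H.int_hom_mult[OF homH] del: \<iota>.hom_mult)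
  have \<mu>c: "\<mu> x \<in> carrier H" if "x \<in> carrier G" for x
    using that r(1) s(1) by (simp add: \<mu>_def)
  have mult: "\<mu> (x \<otimes>\<^bsub>G\<^esub> y) = \<mu> x \<otimes>\<^bsub>H\<^esub> \<mu> y" if xy: "x \<in> carrier G" "y \<in> carrier G" for x y
  proof -
    let ?r = "\<lambda>x. r (\<lambda>i. \<kappa> i x)" and ?s = "\<lambda>x. s (\<lambda>i. \<kappa> i x)"
    have rr: "?r (x \<otimes>\<^bsub>G\<^esub> y) = ?r x \<otimes>\<^bsub>G\<^esub> ?r y"
      unfolding r(3)[symmetric] using xy by (intro r(4)) (simp add: G.int_hom_mult[OF homG])
    have ss: "?s (x \<otimes>\<^bsub>G\<^esub> y) = ?s x \<otimes>\<^bsub>H\<^esub> ?s y"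
      unfolding s(3)[symmetric] using xy by (intro s(4)) (simp add: G.int_hom_mult[OF homG])
    have "\<mu> (x \<otimes>\<^bsub>G\<^esub> y) = (\<iota> x \<otimes>\<^bsub>H\<^esub> \<iota> y) \<otimes>\<^bsub>H\<^esub> (inv\<^bsub>H\<^esub> \<iota> (?r x) \<otimes>\<^bsub>H\<^esub> inv\<^bsub>H\<^esub> \<iota> (?r y)) \<otimes>\<^bsub>H\<^esub> (?s x \<otimes>\<^bsub>H\<^esub> ?s y)"
      using xy r(1) s(1) by (simp add: \<mu>_def rr ss H.inv_mult)
    moreover have "\<mu> x \<otimes>\<^bsub>H\<^esub> \<mu> y = (\<iota> x \<otimes>\<^bsub>H\<^esub> inv\<^bsub>H\<^esub> \<iota> (?r x) \<otimes>\<^bsub>H\<^esub> ?s x) \<otimes>\<^bsub>H\<^esub> (\<iota> y \<otimes>\<^bsub>H\<^esub> inv\<^bsub>H\<^esub> \<iota> (?r y) \<otimes>\<^bsub>H\<^esub> ?s y)"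
      using xy r(1) s(1) by (simp add: \<mu>_def)
    moreover have "(a \<otimes>\<^bsub>H\<^esub> a') \<otimes>\<^bsub>H\<^esub> (b \<otimes>\<^bsub>H\<^esub> b') \<otimes>\<^bsub>H\<^esub> (c \<otimes>\<^bsub>H\<^esub> c') = (a \<otimes>\<^bsub>H\<^esub> b \<otimes>\<^bsub>H\<^esub> c) \<otimes>\<^bsub>H\<^esub> (a' \<otimes>\<^bsub>H\<^esub> b' \<otimes>\<^bsub>H\<^esub> c')"
      if "a \<in> carrier H" "a' \<in> carrier H" "b \<in> carrier H" "b' \<in> carrier H" "c \<in> carrier H" "c' \<in> carrier H" for a a' b b' c c'
      using that by (simp add: H.m_ac)
    ultimately show ?thesis using xy r(1) s(1) by simp
  qed
  then have \<mu>h: "\<mu> \<in> hom G H" using \<mu>c by (auto simp: hom_def)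
  interpret \<mu>: group_hom G H \<mu> using \<mu>h by unfold_locales
  have "inj_on \<mu> (carrier G)"
    unfolding \<mu>.inj_on_one_iff
  proof (intro allI impI)
    fix x assume x: "x \<in> carrier G" "\<mu> x = \<one>\<^bsub>H\<^esub>"
    then have k0: "\<kappa> i x = 0" if "i < n" for i using \<mu>\<nu>[OF x(1) that] H.int_hom_one[OF homH[OF that]] by simp
    have "r (\<lambda>i. \<kappa> i x) = \<one>\<^bsub>G\<^esub>" "s (\<lambda>i. \<kappa> i x) = \<one>\<^bsub>H\<^esub>"
      using r(4)[of "\<lambda>i. \<kappa> i x" "\<lambda>i. 0"] s(4)[of "\<lambda>i. \<kappa> i x" "\<lambda>i. 0"] k0 r0 s0 by auto
    then have "\<mu> x = \<iota> x" using x by (simp add: \<mu>_def)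
    then have "\<iota> x = \<iota> \<one>\<^bsub>G\<^esub>" using x(2) by simp
    then show "x = \<one>\<^bsub>G\<^esub>" using inj_onD[OF \<iota>_inj] x(1) by blast
  qed
  moreover have "\<mu> ` carrier G = carrier H"
  proof
    show "\<mu> ` carrier G \<subseteq> carrier H" using \<mu>c by blast
    show "carrier H \<subseteq> \<mu> ` carrier G"
    proof
      fix y assume y: "y \<in> carrier H"
      let ?s = "s (\<lambda>i. \<nu> i y)"
      let ?t = "y \<otimes>\<^bsub>H\<^esub> inv\<^bsub>H\<^esub> ?s"
      have tc: "?t \<in> carrier H" using y s(1) by simp
      have t0: "\<nu> i ?t = 0" if "i < n" for i
        using that y s(1,2) by (simp add: H.int_hom_mult[OF homH] H.int_hom_inv[OF homH])
      have "?t \<in> \<iota> ` carrier G" using \<iota>(2) tc by (simp add: bij_betw_def)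
      then obtain x where x: "x \<in> carrier G" "\<iota> x = ?t" by (elim imageE) simp
      obtain d :: nat where d: "d > 0" "?t [^]\<^bsub>H\<^esub> d = \<one>\<^bsub>H\<^esub>" using H.finite_kernel_torsion[OF homH \<nu>(2) tc t0] by blast
      have "\<iota> (x [^]\<^bsub>G\<^esub> d) = \<iota> \<one>\<^bsub>G\<^esub>" using d(2) x by (simp add: \<iota>.hom_nat_pow)
      then have xd: "x [^]\<^bsub>G\<^esub> d = \<one>\<^bsub>G\<^esub>" using inj_onD[OF \<iota>_inj] x(1) by blast
      have x0: "\<kappa> i x = 0" if "i < n" for i
        using G.int_hom_nat_pow[OF homG[OF that] x(1), of d] xd G.int_hom_one[OF homG[OF that]] d(1) by simp
      let ?x = "x \<otimes>\<^bsub>G\<^esub> r (\<lambda>i. \<nu> i y)"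
      have kx: "\<kappa> i ?x = \<nu> i y" if "i < n" for i
        using that x(1) r(1,2) x0 by (simp add: G.int_hom_mult[OF homG])
      have "r (\<lambda>i. \<kappa> i ?x) = r (\<lambda>i. \<nu> i y)" "s (\<lambda>i. \<kappa> i ?x) = ?s"
        by (rule r(4)[OF kx], assumption, rule s(4)[OF kx], assumption)
      then have "\<mu> ?x = \<iota> x \<otimes>\<^bsub>H\<^esub> ?s" unfolding \<mu>_def using x(1) r(1) by (simp add: G.m_assoc)
      also have "\<dots> = y" unfolding x(2) using y s(1) by (simp add: H.m_assoc)
      finally show "y \<in> \<mu> ` carrier G" using x(1) r(1) by (intro image_eqI[of _ _ ?x]) auto
    qed
  qed
  ultimately have "\<mu> \<in> iso G H" using \<mu>h by (simp add: iso_def bij_betw_def)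
  then show ?thesis using that \<mu>\<nu> by blast
qed

section \<open>Coordinates of a group modulo a subgroup with abelian quotient\<close>

definition coordinates_mod ::
  "('a, 'c) monoid_scheme \<Rightarrow> 'a set \<Rightarrow> nat \<Rightarrow> (nat \<Rightarrow> 'a \<Rightarrow> int) \<Rightarrow> bool" where
  "coordinates_mod G N n \<kappa> \<longleftrightarrow> coordinates G n \<kappa> \<and> (\<forall>i<n. \<forall>x\<in>N. \<kappa> i x = 0) \<and>
    (\<exists>\<Theta>. finite \<Theta> \<and> \<Theta> \<subseteq> carrier G \<and>
      (\<forall>x\<in>carrier G. (\<forall>i<n. \<kappa> i x = 0) \<longrightarrow> (\<exists>t\<in>\<Theta>. x \<otimes>\<^bsub>G\<^esub> inv\<^bsub>G\<^esub> t \<in> N)))"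

lemma (in normal) comm_group_Mod:
  assumes "commutators G (carrier G) (carrier G) \<subseteq> H"
  shows "comm_group (G Mod H)"
proof -
  interpret h: group_hom G "G Mod H" "\<lambda>x. H #> x" by (rule Mod_hom)
  show ?thesis
  proof (rule h.H.group_comm_groupI)
    fix u v assume "u \<in> carrier (G Mod H)" "v \<in> carrier (G Mod H)"
    then obtain x y where xy: "x \<in> carrier G" "y \<in> carrier G" "u = H #> x" "v = H #> y"
      unfolding Mod_surj[symmetric] by (elim imageE)
    have "x \<otimes> y \<otimes> inv x \<otimes> inv y \<in> H" using assms xy(1,2) unfolding commutators_def by blast
    then have "x \<otimes> y \<otimes> inv (y \<otimes> x) \<in> H" using xy by (simp add: inv_mult_group m_assoc)
    then have "H #> (x \<otimes> y) = H #> (y \<otimes> x)" using Mod_eq_iff[of "x \<otimes> y" "y \<otimes> x"] xy by simp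
    then show "u \<otimes>\<^bsub>G Mod H\<^esub> v = v \<otimes>\<^bsub>G Mod H\<^esub> u"
      unfolding xy(3,4) h.hom_mult[OF xy(1,2), symmetric] h.hom_mult[OF xy(2,1), symmetric] .
  qed
qed

lemma (in group_hom) finitely_generated_img:
  assumes "finitely_generated G" "h ` carrier G = carrier H"
  shows "finitely_generated H"
proof -
  obtain S where S: "finite S" "S \<subseteq> carrier G" "generate G S = carrier G"
    using assms(1) unfolding finitely_generated_def by blast
  have "generate H (h ` S) = carrier H" using generate_img[OF S(2)] S(3) assms(2) by simp
  moreover have "h ` S \<subseteq> carrier H" using S(2) by auto
  ultimately show ?thesis unfolding finitely_generated_def using S(1) by blast
qed

lemma (in normal) coordinates_Mod:
  assumes "coordinates G n \<kappa>" "\<And>i x. i < n \<Longrightarrow> x \<in> H \<Longrightarrow> \<kappa> i x = 0"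
  obtains \<kappa>' where "coordinates (G Mod H) n \<kappa>'" "\<And>i x. i < n \<Longrightarrow> x \<in> carrier G \<Longrightarrow> \<kappa>' i (H #> x) = \<kappa> i x"
proof -
  interpret h: group_hom G "G Mod H" "\<lambda>x. H #> x" by (rule Mod_hom)
  have hom: "int_hom G (\<kappa> i)" if "i < n" for i using assms(1) that by (simp add: coordinates_def)
  define \<kappa>' where "\<kappa>' i C = \<kappa> i (SOME x. x \<in> C)" for i C
  have \<kappa>': "\<kappa>' i (H #> x) = \<kappa> i x" if ix: "i < n" "x \<in> carrier G" for i x
  proof -
    have "(SOME y. y \<in> H #> x) \<in> H #> x" by (rule someI[of _ x]) (rule rcos_self[OF ix(2) is_subgroup])
    then obtain y where y: "y \<in> H" "(SOME y. y \<in> H #> x) = y \<otimes> x" unfolding r_coset_def by auto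
    have "\<kappa> i (y \<otimes> x) = \<kappa> i y + \<kappa> i x" using y(1) ix by (intro int_hom_mult[OF hom]) auto
    then show ?thesis unfolding \<kappa>'_def y(2) using assms(2)[OF ix(1) y(1)] by simp
  qed
  have "int_hom (G Mod H) (\<kappa>' i)" if i: "i < n" for i
    unfolding int_hom_def
  proof (intro ballI)
    fix u v assume "u \<in> carrier (G Mod H)" "v \<in> carrier (G Mod H)"
    then obtain x y where xy: "x \<in> carrier G" "y \<in> carrier G" "u = H #> x" "v = H #> y"
      unfolding Mod_surj[symmetric] by (elim imageE)
    show "\<kappa>' i (u \<otimes>\<^bsub>G Mod H\<^esub> v) = \<kappa>' i u + \<kappa>' i v"
      unfolding xy(3,4) h.hom_mult[OF xy(1,2), symmetric]
      by (simp only: \<kappa>'[OF i m_closed[OF xy(1,2)]] \<kappa>'[OF i xy(1)] \<kappa>'[OF i xy(2)] int_hom_mult[OF hom[OF i] xy(1,2)])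
  qed
  moreover have "\<exists>u\<in>carrier (G Mod H). \<forall>i<n. \<kappa>' i u = z i" for z
  proof -
    obtain x where x: "x \<in> carrier G" "\<forall>i<n. \<kappa> i x = z i"
      using assms(1)[unfolded coordinates_def, THEN conjunct2, THEN spec, of z] by (elim bexE)
    show ?thesis by (rule bexI[OF _ h.hom_closed[OF x(1)]]) (use x \<kappa>' in auto)
  qed
  ultimately have "coordinates (G Mod H) n \<kappa>'" by (simp add: coordinates_def)
  then show ?thesis using that[of \<kappa>'] \<kappa>' by blast
qed

lemma (in normal) coordinates_mod_Mod:
  assumes "coordinates_mod G H n \<kappa>"
  obtains \<kappa>' where "coordinates (G Mod H) n \<kappa>'" "\<And>i x. i < n \<Longrightarrow> x \<in> carrier G \<Longrightarrow> \<kappa>' i (H #> x) = \<kappa> i x"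
    "finite {x \<in> carrier (G Mod H). \<forall>i<n. \<kappa>' i x = 0}"
proof -
  obtain \<Theta> where \<Theta>: "finite \<Theta>" "\<Theta> \<subseteq> carrier G"
    "\<And>x. x \<in> carrier G \<Longrightarrow> (\<forall>i<n. \<kappa> i x = 0) \<Longrightarrow> (\<exists>t\<in>\<Theta>. x \<otimes> inv t \<in> H)"
    using assms unfolding coordinates_mod_def by (elim conjE exE) simp
  have \<kappa>: "coordinates G n \<kappa>" "\<And>i x. i < n \<Longrightarrow> x \<in> H \<Longrightarrow> \<kappa> i x = 0"
    using assms by (auto simp: coordinates_mod_def)
  obtain \<kappa>' where \<kappa>': "coordinates (G Mod H) n \<kappa>'" "\<And>i x. i < n \<Longrightarrow> x \<in> carrier G \<Longrightarrow> \<kappa>' i (H #> x) = \<kappa> i x"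
    using coordinates_Mod[OF \<kappa>] by blast
  have "{x \<in> carrier (G Mod H). \<forall>i<n. \<kappa>' i x = 0} \<subseteq> (\<lambda>t. H #> t) ` \<Theta>"
  proof
    fix u assume u: "u \<in> {x \<in> carrier (G Mod H). \<forall>i<n. \<kappa>' i x = 0}"
    then obtain x where x: "x \<in> carrier G" "u = H #> x" unfolding Mod_surj[symmetric] by blast
    have "\<forall>i<n. \<kappa> i x = 0" using u \<kappa>'(2)[OF _ x(1)] unfolding x(2) by auto
    from \<Theta>(3)[OF x(1) this] obtain t where t: "t \<in> \<Theta>" "x \<otimes> inv t \<in> H" by blast
    have "t \<in> carrier G" using t(1) \<Theta>(2) by blast
    then have "u = H #> t" using Mod_eq_iff[OF x(1)] t(2) x(2) by simp
    then show "u \<in> (\<lambda>t. H #> t) ` \<Theta>" using t(1) by blast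
  qed
  then have "finite {x \<in> carrier (G Mod H). \<forall>i<n. \<kappa>' i x = 0}" using \<Theta>(1) finite_surj by blast
  then show ?thesis using that \<kappa>' by blast
qed

lemma (in group) co_rank_coordinates:
  assumes "subgroup N G" "commutators G (carrier G) (carrier G) \<subseteq> N" "coordinates_mod G N n \<kappa>"
  shows "torsion_free_rank (G Mod N) = n"
proof -
  interpret N: normal N G by (rule normal_if_commutators[OF assms(1,2)])
  interpret Q: comm_group "G Mod N" by (rule N.comm_group_Mod[OF assms(2)])
  obtain \<kappa>' where "coordinates (G Mod N) n \<kappa>'" "finite {x \<in> carrier (G Mod N). \<forall>i<n. \<kappa>' i x = 0}"
    using N.coordinates_mod_Mod[OF assms(3)] by blast
  then show ?thesis by (rule Q.torsion_free_rank_coordinates)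
qed

text \<open>All coordinates factor through \<open>G Mod N\<close>, where only finitely many classes
  have all coordinates zero; \<open>\<Theta>\<close> consists of representatives of these
  classes.\<close>

lemma (in group) ex_coordinates_mod_extending:
  assumes "finitely_generated G" "subgroup N G" "commutators G (carrier G) (carrier G) \<subseteq> N"
    and \<kappa>0: "coordinates G m \<kappa>0" "\<And>i x. i < m \<Longrightarrow> x \<in> N \<Longrightarrow> \<kappa>0 i x = 0"
  obtains n \<kappa> where "m \<le> n" "\<And>i. i < m \<Longrightarrow> \<kappa> i = \<kappa>0 i" "coordinates_mod G N n \<kappa>"
proof -
  interpret N: normal N G by (rule normal_if_commutators[OF assms(2,3)])
  interpret Q: comm_group "G Mod N" by (rule N.comm_group_Mod[OF assms(3)])
  interpret h: group_hom G "G Mod N" "\<lambda>x. N #> x" by (rule N.Mod_hom)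
  have fgQ: "finitely_generated (G Mod N)" by (rule h.finitely_generated_img[OF assms(1) N.Mod_surj])
  obtain \<kappa>1 where \<kappa>1: "coordinates (G Mod N) m \<kappa>1" "\<And>i x. i < m \<Longrightarrow> x \<in> carrier G \<Longrightarrow> \<kappa>1 i (N #> x) = \<kappa>0 i x"
    using N.coordinates_Mod[OF \<kappa>0] by blast
  obtain n \<kappa>2 where \<kappa>2: "m \<le> n" "\<And>i. i < m \<Longrightarrow> \<kappa>2 i = \<kappa>1 i" "coordinates (G Mod N) n \<kappa>2"
    "finite {x \<in> carrier (G Mod N). \<forall>i<n. \<kappa>2 i x = 0}"
    using Q.ex_coordinates_extending[OF fgQ \<kappa>1(1)] by blast
  define \<kappa> where "\<kappa> i = (if i < m then \<kappa>0 i else (\<lambda>x. \<kappa>2 i (N #> x)))" for i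
  have \<kappa>: "\<kappa> i x = \<kappa>2 i (N #> x)" if "x \<in> carrier G" for i x
    using that \<kappa>1(2) \<kappa>2(2) by (simp add: \<kappa>_def)
  have hom2: "int_hom (G Mod N) (\<kappa>2 i)" if "i < n" for i using \<kappa>2(3) that by (simp add: coordinates_def)
  have hom: "int_hom G (\<kappa> i)" if i: "i < n" for i
    unfolding int_hom_def
  proof (intro ballI)
    fix x y assume xy: "x \<in> carrier G" "y \<in> carrier G"
    show "\<kappa> i (x \<otimes> y) = \<kappa> i x + \<kappa> i y"
      using Q.int_hom_mult[OF hom2[OF i] h.hom_closed[OF xy(1)] h.hom_closed[OF xy(2)]] xy \<kappa> by simp
  qed
  have surj: "\<exists>x\<in>carrier G. \<forall>i<n. \<kappa> i x = z i" for z
  proof -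
    obtain u where u: "u \<in> carrier (G Mod N)" "\<forall>i<n. \<kappa>2 i u = z i"
      using \<kappa>2(3)[unfolded coordinates_def, THEN conjunct2, THEN spec, of z] by (elim bexE)
    obtain x where x: "x \<in> carrier G" "u = N #> x" using u(1) unfolding N.Mod_surj[symmetric] by (elim imageE)
    show ?thesis by (rule bexI[OF _ x(1)]) (use u(2) \<kappa>[OF x(1)] x(2) in simp)
  qed
  have triv: "\<kappa> i x = 0" if "i < n" "x \<in> N" for i x
  proof -
    have "N #> x = \<one>\<^bsub>G Mod N\<^esub>" using N.Mod_eq_one_iff that(2) by simp
    then show ?thesis using \<kappa>[of x i] that(2) Q.int_hom_one[OF hom2[OF that(1)]] by simp
  qed
  let ?U = "{x \<in> carrier (G Mod N). \<forall>i<n. \<kappa>2 i x = 0}"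
  have "?U \<subseteq> (\<lambda>x. N #> x) ` carrier G" unfolding N.Mod_surj by (rule Collect_subset)
  from finite_subset_image[OF \<kappa>2(4) this]
  obtain \<Theta> where \<Theta>: "finite \<Theta>" "\<Theta> \<subseteq> carrier G" "?U = (\<lambda>x. N #> x) ` \<Theta>"
    by (elim exE conjE)
  have "\<exists>t\<in>\<Theta>. x \<otimes> inv t \<in> N" if x: "x \<in> carrier G" "\<forall>i<n. \<kappa> i x = 0" for x
  proof -
    have "N #> x \<in> ?U" using x \<kappa>[OF x(1)] h.hom_closed[OF x(1)] by simp
    then obtain t where t: "t \<in> \<Theta>" "N #> x = N #> t" unfolding \<Theta>(3) by (elim imageE)
    have "x \<otimes> inv t \<in> N" using N.Mod_eq_iff[OF x(1)] t \<Theta>(2) by blast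
    then show ?thesis using t(1) by blast
  qed
  then have "coordinates_mod G N n \<kappa>"
    unfolding coordinates_mod_def coordinates_def using hom surj triv \<Theta>(1,2) by (intro conjI exI[of _ \<Theta>]) auto
  then show ?thesis using that[of n \<kappa>] \<kappa>2(1) by (simp add: \<kappa>_def)
qed

text \<open>This allows \<open>K\<close> to be replaced by the common zero set of its coordinates,
  in which it has finite index.\<close>

lemma (in group) finitely_generated_finite_index:
  assumes "subgroup K G" "subgroup L G" "K \<subseteq> L" "finitely_generated (G\<lparr>carrier := K\<rparr>)"
    and \<Theta>: "finite \<Theta>" "\<Theta> \<subseteq> carrier G" "\<And>x. x \<in> L \<Longrightarrow> \<exists>t\<in>\<Theta>. x \<otimes> inv t \<in> K"
  shows "finitely_generated (G\<lparr>carrier := L\<rparr>)"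
proof -
  obtain S where S: "finite S" "S \<subseteq> K" "generate G S = K"
    using assms(4) finitely_generated_subgroup_iff[OF assms(1)] by blast
  let ?S = "S \<union> (\<Theta> \<inter> L)"
  have sub: "?S \<subseteq> L" using S(2) assms(3) by blast
  then have Sc: "?S \<subseteq> carrier G" using subgroup.subset[OF assms(2)] by blast
  note gen = generate_is_subgroup[OF Sc]
  have "L \<subseteq> generate G ?S"
  proof
    fix x assume x: "x \<in> L"
    obtain t where t: "t \<in> \<Theta>" "x \<otimes> inv t \<in> K" using \<Theta>(3)[OF x] by blast
    have car: "x \<in> carrier G" "t \<in> carrier G" using subgroup.mem_carrier[OF assms(2) x] t(1) \<Theta>(2) by auto
    have "inv (x \<otimes> inv t) \<otimes> x \<in> L"
      by (rule subgroup.m_closed[OF assms(2) subgroup.m_inv_closed[OF assms(2) subsetD[OF assms(3) t(2)]] x])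
    then have "t \<in> L" using car by (simp add: inv_mult_group m_assoc)
    then have "t \<in> generate G ?S" using t(1) by (intro generate.incl) blast
    moreover have "x \<otimes> inv t \<in> generate G ?S" using t(2) S(3) mono_generate[of S ?S] by blast
    ultimately have "x \<otimes> inv t \<otimes> t \<in> generate G ?S" by (rule subgroup.m_closed[OF gen, rotated])
    then show "x \<in> generate G ?S" using car by (simp add: m_assoc)
  qed
  moreover have "generate G ?S \<subseteq> L" by (rule generate_subgroup_incl[OF sub assms(2)])
  ultimately have "generate G ?S = L" by blast
  moreover have "finite ?S" using S(1) \<Theta>(1) by simp
  ultimately show ?thesis
    unfolding finitely_generated_subgroup_iff[OF assms(2)] using sub by (intro exI[of _ ?S] conjI)
qed

text \<open>Coordinates modulo \<open>K\<close> are extended to coordinates modulo \<open>N\<close>.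
  The zero set of the original ones contains \<open>K\<close> with finite index and is thus finitely
  generated too.\<close>

theorem (in group) ex_coordinates_co_rank:
  assumes fg: "finitely_generated G" and N: "subgroup N G" and comm: "commutators G (carrier G) (carrier G) \<subseteq> N"
    and K: "subgroup K G" "N \<subseteq> K" "finitely_generated (G\<lparr>carrier := K\<rparr>)"
  obtains \<kappa> where "co_rank G K \<le> torsion_free_rank (G Mod N)"
    "coordinates_mod G N (torsion_free_rank (G Mod N)) \<kappa>"
    "finitely_generated (G\<lparr>carrier := {x \<in> carrier G. \<forall>i<co_rank G K. \<kappa> i x = 0}\<rparr>)"
proof -
  have commK: "commutators G (carrier G) (carrier G) \<subseteq> K" using comm K(2) by blast
  have "coordinates G 0 (\<lambda>_ _. 0)" by (auto simp: coordinates_def intro: exI[of _ \<one>])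
  then obtain m \<kappa>0 where \<kappa>0: "coordinates_mod G K m \<kappa>0"
    using ex_coordinates_mod_extending[OF fg K(1) commK, of 0] by blast
  have m: "co_rank G K = m" unfolding co_rank_def by (rule co_rank_coordinates[OF K(1) commK \<kappa>0])
  have \<kappa>0': "coordinates G m \<kappa>0" "\<And>i x. i < m \<Longrightarrow> x \<in> N \<Longrightarrow> \<kappa>0 i x = 0"
    using \<kappa>0 K(2) by (auto simp: coordinates_mod_def)
  then obtain n \<kappa> where \<kappa>: "m \<le> n" "\<And>i. i < m \<Longrightarrow> \<kappa> i = \<kappa>0 i" "coordinates_mod G N n \<kappa>"
    using ex_coordinates_mod_extending[OF fg N comm] by blast
  have n: "torsion_free_rank (G Mod N) = n" by (rule co_rank_coordinates[OF N comm \<kappa>(3)])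
  let ?L = "{x \<in> carrier G. \<forall>i<m. \<kappa> i x = 0}"
  have "int_hom G (\<kappa> i)" if "i < m" for i using \<kappa>0'(1) \<kappa>(2) that by (simp add: coordinates_def)
  then have L: "subgroup ?L G" by (rule int_hom_kernel)
  obtain \<Theta> where \<Theta>: "finite \<Theta>" "\<Theta> \<subseteq> carrier G"
    "\<And>x. x \<in> carrier G \<Longrightarrow> (\<forall>i<m. \<kappa>0 i x = 0) \<Longrightarrow> (\<exists>t\<in>\<Theta>. x \<otimes> inv t \<in> K)"
    using \<kappa>0 unfolding coordinates_mod_def by (elim conjE exE) simp
  have "K \<subseteq> ?L" using \<kappa>0 \<kappa>(2) subgroup.subset[OF K(1)] by (auto simp: coordinates_mod_def)
  then have "finitely_generated (G\<lparr>carrier := ?L\<rparr>)"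
    using \<Theta> \<kappa>(2) by (intro finitely_generated_finite_index[OF K(1) L _ K(3), of \<Theta>]) auto
  then show ?thesis using that[of \<kappa>] \<kappa>(1,3) m n by simp
qed

text \<open>The finite set \<open>\<Theta>\<close> depends only on the common kernel, which a change
  of basis leaves alone.\<close>

lemma (in group) coordinates_mod_change:
  assumes \<kappa>: "coordinates_mod G N n \<kappa>" and N: "subgroup N G"
    and hom: "\<And>i. i < n \<Longrightarrow> int_hom G (\<epsilon> i)"
    and ker: "\<And>x. x \<in> carrier G \<Longrightarrow> (\<forall>i<n. \<epsilon> i x = 0) \<longleftrightarrow> (\<forall>i<n. \<kappa> i x = 0)"
    and surj: "\<And>z. \<exists>w. \<forall>x\<in>carrier G. (\<forall>i<n. \<kappa> i x = w i) \<longrightarrow> (\<forall>i<n. \<epsilon> i x = z i)"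
  shows "coordinates_mod G N n \<epsilon>"
proof -
  obtain \<Theta> where \<Theta>: "finite \<Theta>" "\<Theta> \<subseteq> carrier G"
    "\<And>x. x \<in> carrier G \<Longrightarrow> (\<forall>i<n. \<kappa> i x = 0) \<Longrightarrow> (\<exists>t\<in>\<Theta>. x \<otimes> inv t \<in> N)"
    using \<kappa> unfolding coordinates_mod_def by (elim conjE exE) simp
  have "\<exists>x\<in>carrier G. \<forall>i<n. \<epsilon> i x = z i" for z
  proof -
    obtain w where w: "\<And>x. x \<in> carrier G \<Longrightarrow> (\<forall>i<n. \<kappa> i x = w i) \<Longrightarrow> (\<forall>i<n. \<epsilon> i x = z i)" using surj by blast
    obtain x where x: "x \<in> carrier G" "\<forall>i<n. \<kappa> i x = w i"
      using \<kappa>[unfolded coordinates_mod_def coordinates_def, THEN conjunct1, THEN conjunct2, THEN spec, of w] by (elim bexE)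
    show ?thesis using w[OF x] x(1) by blast
  qed
  moreover have "\<forall>i<n. \<epsilon> i x = 0" if "x \<in> N" for x
    using ker[of x] that subgroup.mem_carrier[OF N] \<kappa> by (auto simp: coordinates_mod_def)
  moreover have "\<exists>t\<in>\<Theta>. x \<otimes> inv t \<in> N" if "x \<in> carrier G" "\<forall>i<n. \<epsilon> i x = 0" for x
    using \<Theta>(3)[OF that(1)] ker[OF that(1)] that(2) by blast
  ultimately show ?thesis
    unfolding coordinates_mod_def coordinates_def using hom \<Theta>(1,2) by (intro conjI exI[of _ \<Theta>]) auto
qed

lemma (in letters) int_hom_word_val:
  assumes "int_hom G \<kappa>" "w \<in> lists (S \<times> UNIV)"
  shows "\<kappa> (word_val G f w) = (\<Sum>a\<leftarrow>w. (if snd a then 1 else -1) * \<kappa> (f (fst a)))"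
  using assms(2)
proof (induction w rule: list.induct)
  case Nil
  then show ?case by (simp add: int_hom_one[OF assms(1)])
next
  case (Cons a w)
  have a: "fst a \<in> S" and w: "w \<in> lists (S \<times> UNIV)" using Cons.prems by (auto simp: mem_Times_iff)
  have "\<kappa> (letter_val G f a) = (if snd a then 1 else -1) * \<kappa> (f (fst a))"
    using letters_closed[OF a] int_hom_inv[OF assms(1)] by (simp add: letter_val_def)
  then show ?case
    using int_hom_mult[OF assms(1) letter_val_closed[OF a] word_val_closed[OF w]] Cons.IH[OF w] by simp
qed

lemma exp_sum_proj: "exp_sum (proj i w) = (\<Sum>a\<leftarrow>w. (if snd a then 1 else -1) * (if i = fst a then 1 else 0))"
  by (induction w) (auto simp: proj_def exp_sum_def)

lemma length_monomial: "int (length (monomial L z)) = (\<Sum>i\<leftarrow>L. \<bar>z i\<bar>)"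
  by (induction L) (simp_all add: monomial_def)

text \<open>The coordinates in \<open>I\<close> vanish on the finitely generated subgroup; the dual
  elements for the other indices are the letters that measure depth. An element with only
  \<open>I\<close>-coordinates is a word in the remaining letters up to torsion, of length the sum
  of its absolute coordinates.\<close>

theorem (in group) depth_filtration_coordinates:
  assumes N: "subgroup N G" and comm: "commutators G (carrier G) (carrier G) \<subseteq> N"
    and \<kappa>: "coordinates_mod G N n \<kappa>" and I: "I \<subseteq> {..<n}"
    and fg: "finitely_generated (G\<lparr>carrier := {x \<in> carrier G. \<forall>i\<in>I. \<kappa> i x = 0}\<rparr>)"
    and e: "\<And>j. j < n \<Longrightarrow> e j \<in> carrier G" "\<And>i j. i < n \<Longrightarrow> j < n \<Longrightarrow> \<kappa> i (e j) = (if i = j then 1 else 0)"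
  obtains C :: nat and D :: "nat \<Rightarrow> 'a set" where
    "\<And>r. \<exists>A. finite A \<and> A \<subseteq> N \<and> D r = generate G A"
    "\<And>r s. r \<le> s \<Longrightarrow> D r \<subseteq> D s" "(\<Union>r. D r) = N"
    "\<And>r d x. x \<in> D (r + d) \<Longrightarrow>
      x \<in> generate G (\<Union>b\<in>{b \<in> lists (({..<n} - I) \<times> UNIV). length b \<le> d}. conj_by G (word_val G e b) ` D r)"
    "\<And>g. g \<in> carrier G \<Longrightarrow> \<forall>i<n. i \<notin> I \<longrightarrow> \<kappa> i g = 0 \<Longrightarrow>
      \<exists>r0. \<forall>r\<ge>r0. \<forall>x\<in>D r. conj_by G g x \<in> D (r + nat (\<Sum>i\<in>I. \<bar>\<kappa> i g\<bar>) * C)"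
proof -
  have hom: "int_hom G (\<kappa> i)" if "i < n" for i using \<kappa> that by (simp add: coordinates_mod_def coordinates_def)
  have triv: "\<kappa> i x = 0" if "i < n" "x \<in> N" for i x using \<kappa> that by (simp add: coordinates_mod_def)
  let ?T = "{x \<in> carrier G. \<forall>i<n. \<kappa> i x = 0}" and ?K = "{x \<in> carrier G. \<forall>i\<in>I. \<kappa> i x = 0}"
  have T: "subgroup ?T G" by (rule int_hom_kernel[OF hom])
  have "subgroup {x \<in> carrier G. \<forall>i<n. (\<lambda>i. if i \<in> I then \<kappa> i else (\<lambda>_. 0)) i x = 0} G"
    by (rule int_hom_kernel) (use hom in \<open>simp add: int_hom_def\<close>)
  also have "{x \<in> carrier G. \<forall>i<n. (\<lambda>i. if i \<in> I then \<kappa> i else (\<lambda>_. 0)) i x = 0} = ?K" using I by auto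
  finally have K: "subgroup ?K G" .
  obtain \<Theta>0 where \<Theta>0: "finite \<Theta>0" "\<Theta>0 \<subseteq> carrier G"
    "\<And>x. x \<in> carrier G \<Longrightarrow> (\<forall>i<n. \<kappa> i x = 0) \<Longrightarrow> (\<exists>t\<in>\<Theta>0. x \<otimes> inv t \<in> N)"
    using \<kappa> unfolding coordinates_mod_def by (elim conjE exE) simp
  have Nn: "N \<lhd> G" by (rule normal_if_commutators[OF N comm])
  define \<Theta> where "\<Theta> = insert \<one> (\<Theta>0 \<inter> ?T)"
  interpret L: letters G e "{..<n}" using e(1) by unfold_locales auto
  have val: "\<kappa> i (word_val G e w) = exp_sum (proj i w)" if "i < n" "w \<in> lists ({..<n} \<times> UNIV)" for i w
    unfolding L.int_hom_word_val[OF hom[OF that(1)] that(2)] exp_sum_proj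
    using that by (intro arg_cong[of _ _ sum_list] map_cong refl) (auto simp: e(2))
  have decomp: "\<exists>w\<in>lists (A \<times> UNIV). int (length w) = (\<Sum>i\<in>A. \<bar>\<kappa> i g\<bar>) \<and> inv (word_val G e w) \<otimes> g \<in> ?T"
    if A: "A \<subseteq> {..<n}" and g: "g \<in> carrier G" "\<And>i. i < n \<Longrightarrow> i \<notin> A \<Longrightarrow> \<kappa> i g = 0" for A g
  proof -
    let ?L = "sorted_list_of_set A"
    let ?w = "monomial ?L (\<lambda>i. \<kappa> i g)"
    have fin: "finite A" using A finite_subset by blast
    have w: "?w \<in> lists (A \<times> UNIV)" using monomial_in_lists[of ?L A] fin by simp
    then have w': "?w \<in> lists ({..<n} \<times> UNIV)" using A by (auto simp: in_lists_conv_set)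
    have len: "int (length ?w) = (\<Sum>i\<in>A. \<bar>\<kappa> i g\<bar>)"
      unfolding length_monomial using fin by (simp add: sum_list_distinct_conv_sum_set)
    have wc: "word_val G e ?w \<in> carrier G" by (rule L.word_val_closed[OF w'])
    have "\<kappa> i (inv (word_val G e ?w) \<otimes> g) = 0" if i: "i < n" for i
    proof -
      have "\<kappa> i (word_val G e ?w) = \<kappa> i g"
        unfolding val[OF i w'] using proj_monomial[of ?L i "\<lambda>i. \<kappa> i g"] fin g(2)[OF i] by simp
      then show ?thesis using int_hom_mult[OF hom[OF i] inv_closed[OF wc] g(1)] int_hom_inv[OF hom[OF i] wc] by simp
    qed
    then show ?thesis using w len wc g(1) by (intro bexI[of _ ?w]) auto
  qed
  have eP: "e ` ({..<n} - I) \<subseteq> ?K" using e I by auto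
  interpret P: letters G e "{..<n} - I" using e(1) by unfold_locales auto
  interpret depth G N ?T ?K e "{..<n} - I" \<Theta> e I
  proof (intro depth.intro depth_axioms.intro)
    show "N \<subseteq> ?T" using triv subgroup.mem_carrier[OF N] by auto
    show "?T \<subseteq> ?K" using I by auto
    show "e ` I \<subseteq> carrier G" using e(1) I by auto
    show "finite I" using I finite_subset by blast
    show "finite \<Theta>" "\<Theta> \<subseteq> ?T" "\<one> \<in> \<Theta>" using \<Theta>0(1) subgroup.one_closed[OF T] by (auto simp: \<Theta>_def)
    fix x
    show "\<exists>u\<in>generate G (e ` ({..<n} - I)). \<exists>t\<in>?T. x = u \<otimes> t" if "x \<in> ?K"
    proof -
      have "x \<in> carrier G" using that by blast
      then obtain w where w: "w \<in> lists (({..<n} - I) \<times> UNIV)" "inv (word_val G e w) \<otimes> x \<in> ?T"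
        using decomp[of "{..<n} - I" x] \<open>x \<in> ?K\<close> by auto
      have "x = word_val G e w \<otimes> (inv (word_val G e w) \<otimes> x)"
        using P.word_val_closed[OF w(1)] \<open>x \<in> carrier G\<close> by simp
      then show ?thesis using P.word_val_in_generate[OF w(1)] w(2) by blast
    qed
    show "\<exists>t\<in>\<Theta>. \<exists>y\<in>N. x = t \<otimes> y" if x: "x \<in> ?T"
    proof -
      obtain t where t: "t \<in> \<Theta>0" "x \<otimes> inv t \<in> N" using \<Theta>0(3) x by blast
      have car: "x \<in> carrier G" "t \<in> carrier G" using x t(1) \<Theta>0(2) by auto
      have "\<kappa> i t = 0" if i: "i < n" for i
      proof -
        have "\<kappa> i x - \<kappa> i t = 0"
          using triv[OF i t(2)] int_hom_mult[OF hom[OF i] car(1) inv_closed[OF car(2)]] int_hom_inv[OF hom[OF i] car(2)] by simp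
        then show ?thesis using x i by simp
      qed
      then have t\<Theta>: "t \<in> \<Theta>" using t(1) car(2) by (simp add: \<Theta>_def)
      have "conj_by G (inv t) (x \<otimes> inv t) \<in> N" using normal_conj_by[OF Nn _ t(2)] car by simp
      moreover have "x = t \<otimes> conj_by G (inv t) (x \<otimes> inv t)" using car by (simp add: conj_by_def m_assoc)
      ultimately show ?thesis using t\<Theta> by blast
    qed
    show "e ` ({..<n} - I) \<subseteq> ?K" by (rule eP)
    show "finite ({..<n} - I)" by blast
    show "group G" by (rule is_group)
  qed (rule T K N comm fg)+
  obtain C D where CD: "\<And>r. \<exists>A. finite A \<and> A \<subseteq> N \<and> D r = generate G A"
    "\<And>r s. r \<le> s \<Longrightarrow> D r \<subseteq> D s" "(\<Union>r. D r) = N"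
    "\<And>r d x. x \<in> D (r + d) \<Longrightarrow>
      x \<in> generate G (\<Union>b\<in>{b \<in> lists (({..<n} - I) \<times> UNIV). length b \<le> d}. conj_by G (word_val G e b) ` D r)"
    "\<And>w t. w \<in> lists (I \<times> UNIV) \<Longrightarrow> t \<in> ?T \<Longrightarrow>
      \<exists>r0. \<forall>r\<ge>r0. \<forall>x\<in>D r. conj_by G (word_val G e w \<otimes> t) x \<in> D (r + length w * C)"
    by (rule depth_filtration) (rule that; assumption)
  have conj: "\<exists>r0. \<forall>r\<ge>r0. \<forall>x\<in>D r. conj_by G g x \<in> D (r + nat (\<Sum>i\<in>I. \<bar>\<kappa> i g\<bar>) * C)"
    if g: "g \<in> carrier G" "\<forall>i<n. i \<notin> I \<longrightarrow> \<kappa> i g = 0" for g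
  proof -
    obtain w where w: "w \<in> lists (I \<times> UNIV)" "int (length w) = (\<Sum>i\<in>I. \<bar>\<kappa> i g\<bar>)" "inv (word_val G e w) \<otimes> g \<in> ?T"
      using decomp[OF I g(1)] g(2) by blast
    have "w \<in> lists ({..<n} \<times> UNIV)" using w(1) I by (auto simp: in_lists_conv_set)
    then have "word_val G e w \<otimes> (inv (word_val G e w) \<otimes> g) = g" using L.word_val_closed[of w] g(1) by simp
    then show ?thesis using CD(5)[OF w(1,3)] unfolding w(2)[symmetric] by simp
  qed
  show ?thesis by (rule that[OF CD(1-4) conj])
qed

section \<open>Commuting normal subgroups\<close>

lemma (in group) conj_by_commute:
  assumes "g \<in> carrier G" "x \<in> carrier G" "y \<in> carrier G"
  shows "conj_by G g x \<otimes> conj_by G g y = conj_by G g y \<otimes> conj_by G g x \<longleftrightarrow> x \<otimes> y = y \<otimes> x"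
  using assms conj_by_inv_conj_by(1)[of g] by (metis conj_by_mult m_closed)

lemma (in letters) inverse_word_in_lists: "u \<in> lists (S \<times> UNIV) \<Longrightarrow> rev (map inv_letter u) \<in> lists (S \<times> UNIV)"
  by (auto simp: in_lists_conv_set inv_letter_def)

lemma (in letters) word_val_inverse:
  "u \<in> lists (S \<times> UNIV) \<Longrightarrow> word_val G f (rev (map inv_letter u)) = inv (word_val G f u)"
proof (induction u rule: list.induct)
  case (Cons a u)
  have a: "fst a \<in> S" and u: "u \<in> lists (S \<times> UNIV)" using Cons.prems by (auto simp: mem_Times_iff)
  have "[inv_letter a] \<in> lists (S \<times> UNIV)" using a by (auto simp: inv_letter_def)
  then have "word_val G f (rev (map inv_letter (a # u))) = inv (word_val G f u) \<otimes> inv (letter_val G f a)"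
    using word_val_append[OF inverse_word_in_lists[OF u]] a Cons.IH[OF u] by simp
  then show ?case using word_val_closed[OF u] a by (simp add: inv_mult_group)
qed simp

text \<open>In the application \<open>G\<close> is a quotient of the free group, and
  \<open>P1\<close>, \<open>P2\<close> are finitely generated parts of the images of
  \<open>A\<close> and \<open>B\<close>. A sign pattern is served by \<open>P1\<close> or by
  \<open>P2\<close>. The two alternatives of \<open>move\<close> differ by inverses because in
  \<open>E_append\<close> a suffix acts on \<open>P1\<close> while the inverse of a prefix acts on
  \<open>P2\<close>.\<close>

locale commuting_pair = group G for G (structure) +
  fixes P1 P2 :: "'a set" and n :: nat and e :: "nat \<Rightarrow> 'a" and \<Theta> :: "'a set"
    and z :: "(nat \<Rightarrow> bool) \<Rightarrow> nat \<Rightarrow> int" and Z :: int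
  assumes P1: "subgroup P1 G" and P2: "subgroup P2 G"
    and e: "j < n \<Longrightarrow> e j \<in> carrier G"
    and swap_letters: "fst a < n \<Longrightarrow> fst b < n \<Longrightarrow>
      \<exists>x\<in>P1. \<exists>y\<in>P2. word_val G e [a, b] = word_val G e [b, a] \<otimes> (x \<otimes> y)"
    and \<Theta>: "\<Theta> \<subseteq> carrier G" "t \<in> \<Theta> \<Longrightarrow> inv t \<in> \<Theta>"
    and \<Theta>_P1: "t \<in> \<Theta> \<Longrightarrow> x \<in> P1 \<Longrightarrow> conj_by G t x \<in> P1"
    and \<Theta>_P2: "t \<in> \<Theta> \<Longrightarrow> x \<in> P2 \<Longrightarrow> conj_by G t x \<in> P2"
    and \<Theta>_letters: "t \<in> \<Theta> \<Longrightarrow> fst a < n \<Longrightarrow>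
      \<exists>x\<in>P1. \<exists>y\<in>P2. t \<otimes> letter_val G e a = (x \<otimes> y) \<otimes> (letter_val G e a \<otimes> t)"
    and gen: "generate G (e ` {..<n} \<union> \<Theta>) = carrier G"
    and z: "c < n \<Longrightarrow> z \<epsilon> c \<noteq> 0 \<and> (z \<epsilon> c > 0 \<longleftrightarrow> \<epsilon> c) \<and> \<bar>z \<epsilon> c\<bar> \<le> Z" and Z: "0 \<le> Z"
    and move: "
      (\<forall>h. has_exponents n (z \<epsilon>) h \<longrightarrow> (\<exists>B. narrow n (z \<epsilon>) B \<and>
          (\<forall>x\<in>P1. conj_by G (word_val G e h) x \<in> generate G (\<Union>b\<in>B. conj_by G (word_val G e b) ` P1)))) \<or>
      (\<forall>h. has_exponents n (z \<epsilon>) h \<longrightarrow> (\<exists>B. narrow n (z \<epsilon>) B \<and>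
          (\<forall>y\<in>P2. conj_by G (inv (word_val G e h)) y \<in> generate G (\<Union>b\<in>B. conj_by G (inv (word_val G e b)) ` P2))))"
    and base: "(\<And>c. c < n \<Longrightarrow> \<bar>\<delta> c\<bar> \<le> 3 * Z) \<Longrightarrow> x \<in> P1 \<Longrightarrow> y \<in> P2 \<Longrightarrow>
      conj_by G (word_val G e (monomial [0..<n] \<delta>)) x \<otimes> y = y \<otimes> conj_by G (word_val G e (monomial [0..<n] \<delta>)) x"
begin

abbreviation "words \<equiv> lists ({..<n} \<times> (UNIV :: bool set))"

abbreviation ev :: "nat letter list \<Rightarrow> 'a" where "ev \<equiv> word_val G e"

sublocale L: letters G e "{..<n}"
  using e by unfold_locales auto

lemma P1c: "x \<in> P1 \<Longrightarrow> x \<in> carrier G" and P2c: "x \<in> P2 \<Longrightarrow> x \<in> carrier G"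
  by (rule subgroup.mem_carrier[OF P1], assumption) (rule subgroup.mem_carrier[OF P2], assumption)

definition E :: "nat letter list \<Rightarrow> bool" where
  "E w \<longleftrightarrow> (\<forall>x\<in>P1. \<forall>y\<in>P2. conj_by G (ev w) x \<otimes> y = y \<otimes> conj_by G (ev w) x)"

lemma ED: "E w \<Longrightarrow> x \<in> P1 \<Longrightarrow> y \<in> P2 \<Longrightarrow> conj_by G (ev w) x \<otimes> y = y \<otimes> conj_by G (ev w) x"
  by (simp add: E_def)

text \<open>Conjugation by the inverse of the prefix shifts that prefix to the other side of the
  relation.\<close>

lemma E_append:
  assumes u: "u \<in> words" and v: "v \<in> words"
  shows "E (u @ v) \<longleftrightarrow> (\<forall>x\<in>P1. \<forall>y\<in>P2.
    conj_by G (ev v) x \<otimes> conj_by G (inv (ev u)) y = conj_by G (inv (ev u)) y \<otimes> conj_by G (ev v) x)"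
proof -
  note uc = L.word_val_closed[OF u] and vc = L.word_val_closed[OF v]
  have "conj_by G (ev (u @ v)) x \<otimes> y = y \<otimes> conj_by G (ev (u @ v)) x \<longleftrightarrow>
      conj_by G (ev v) x \<otimes> conj_by G (inv (ev u)) y = conj_by G (inv (ev u)) y \<otimes> conj_by G (ev v) x"
    if xy: "x \<in> P1" "y \<in> P2" for x y
  proof -
    note xc = P1c[OF xy(1)] and yc = P2c[OF xy(2)]
    have "conj_by G (ev (u @ v)) x = conj_by G (ev u) (conj_by G (ev v) x)"
      unfolding L.word_val_append[OF u v] by (rule conj_by_conj_by[OF uc vc xc])
    moreover have "y = conj_by G (ev u) (conj_by G (inv (ev u)) y)" using uc yc by simp
    ultimately show ?thesis
      using conj_by_commute[OF uc conj_by_closed[OF vc xc] conj_by_closed[OF inv_closed[OF uc] yc]] by simp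
  qed
  then show ?thesis unfolding E_def by blast
qed

lemma E_appendD:
  "u \<in> words \<Longrightarrow> v \<in> words \<Longrightarrow> E (u @ v) \<Longrightarrow> x \<in> P1 \<Longrightarrow> y \<in> P2 \<Longrightarrow>
    conj_by G (ev v) x \<otimes> conj_by G (inv (ev u)) y = conj_by G (inv (ev u)) y \<otimes> conj_by G (ev v) x"
  using E_append by blast

lemma E_cancel:
  assumes "u \<in> words" "v \<in> words" "fst a < n"
  shows "E (u @ [a, inv_letter a] @ v) \<longleftrightarrow> E (u @ v)"
proof -
  have a: "[a, inv_letter a] \<in> words" using assms(3) by (auto simp: mem_Times_iff inv_letter_def)
  have "ev [a, inv_letter a] = \<one>" using assms(3) by simp
  then have "ev (u @ [a, inv_letter a] @ v) = ev (u @ v)"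
    using L.word_val_append[OF a assms(2)] L.word_val_append[OF assms(1), of "[a, inv_letter a] @ v"]
      L.word_val_append[OF assms(1,2)] L.word_val_closed[OF assms(2)] a assms(2) by simp
  then show ?thesis by (simp add: E_def)
qed

text \<open>The two orders of the letters differ by \<open>c1 \<otimes> c2\<close>. By
  \<open>E (u @ [b, a])\<close> the factor \<open>c1\<close> commutes with the conjugate of
  \<open>y\<close> and disappears; by \<open>E v\<close> the factor \<open>c2\<close> commutes with
  the conjugate of \<open>x\<close>, so that conjugating both sides by it changes nothing.\<close>

lemma E_swap:
  assumes u: "u \<in> words" and v: "v \<in> words" and ab: "fst a < n" "fst b < n"
    and Ev: "E v" and Eu: "E (u @ [b, a])" and Euv: "E (u @ [b, a] @ v)"
  shows "E (u @ [a, b] @ v)"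
proof -
  obtain c1 c2 where c: "c1 \<in> P1" "c2 \<in> P2" "ev [a, b] = ev [b, a] \<otimes> (c1 \<otimes> c2)"
    using swap_letters[OF ab] by blast
  note cc = P1c[OF c(1)] P2c[OF c(2)]
  have w: "[a, b] \<in> words" "[b, a] \<in> words" using ab by (auto simp: mem_Times_iff)
  have uba: "u @ [b, a] \<in> words" "u @ [a, b] \<in> words" "u @ [b, a] @ v \<in> words" using u v w by auto
  note vc = L.word_val_closed[OF v] and ubac = L.word_val_closed[OF uba(1)]
  have eq: "ev (u @ [a, b]) = ev (u @ [b, a]) \<otimes> (c1 \<otimes> c2)"
    using L.word_val_append[OF u w(1)] L.word_val_append[OF u w(2)] c(3) cc
      L.word_val_closed[OF u] L.word_val_closed[OF w(2)] by (simp add: m_assoc)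
  show ?thesis
    unfolding append_assoc[symmetric] E_append[OF uba(2) v]
  proof (intro ballI)
    fix x y assume x: "x \<in> P1" and y: "y \<in> P2"
    let ?X = "conj_by G (ev v) x" and ?Y = "conj_by G (inv (ev (u @ [b, a]))) y"
    note xc = P1c[OF x] and yc = P2c[OF y]
    have Xc: "?X \<in> carrier G" and Yc: "?Y \<in> carrier G" using xc yc vc ubac by auto
    have XY: "?X \<otimes> ?Y = ?Y \<otimes> ?X"
      using E_appendD[OF uba(1) v _ x y] Euv by simp
    have c1Y: "c1 \<otimes> ?Y = ?Y \<otimes> c1"
      using E_appendD[OF uba(1) lists.Nil _ c(1) y] Eu cc(1) by simp
    have Xc2: "?X \<otimes> c2 = c2 \<otimes> ?X" by (rule ED[OF Ev x c(2)])
    have "conj_by G (inv (ev (u @ [a, b]))) y = conj_by G (inv c2) (conj_by G (inv c1) ?Y)"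
      unfolding eq using cc ubac yc by (simp add: inv_mult_group conj_by_conj_by)
    also have "conj_by G (inv c1) ?Y = inv c1 \<otimes> (?Y \<otimes> c1)" using cc Yc by (simp add: conj_by_def m_assoc)
    also have "\<dots> = ?Y" unfolding c1Y[symmetric] using cc Yc by simp
    finally have Y: "conj_by G (inv (ev (u @ [a, b]))) y = conj_by G (inv c2) ?Y" .
    have "conj_by G (inv c2) ?X = inv c2 \<otimes> (?X \<otimes> c2)" using cc Xc by (simp add: conj_by_def m_assoc)
    also have "\<dots> = ?X" unfolding Xc2 using cc Xc by simp
    finally have X: "conj_by G (inv c2) ?X = ?X" .
    have "conj_by G (inv c2) ?X \<otimes> conj_by G (inv c2) ?Y = conj_by G (inv c2) ?Y \<otimes> conj_by G (inv c2) ?X"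
      using conj_by_commute[OF inv_closed[OF cc(2)] Xc Yc] XY by simp
    then show "?X \<otimes> conj_by G (inv (ev (u @ [a, b]))) y = conj_by G (inv (ev (u @ [a, b]))) y \<otimes> ?X"
      unfolding Y X .
  qed
qed

text \<open>Commuting with the fixed conjugate of \<open>y\<close> passes from generators to the
  group they generate, and this group contains the conjugates by \<open>h\<close>.\<close>

lemma E_move_right:
  assumes "u \<in> words" "h \<in> words" "B \<subseteq> words" "\<forall>b\<in>B. E (u @ b)"
    and "\<forall>x\<in>P1. conj_by G (ev h) x \<in> generate G (\<Union>b\<in>B. conj_by G (ev b) ` P1)"
  shows "E (u @ h)"
  unfolding E_append[OF assms(1,2)]
proof (intro ballI)
  fix x y assume x: "x \<in> P1" and y: "y \<in> P2"
  let ?C = "{conj_by G (inv (ev u)) y}"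
  have yc: "?C \<subseteq> carrier G" using P2c[OF y] L.word_val_closed[OF assms(1)] by simp
  show "conj_by G (ev h) x \<otimes> conj_by G (inv (ev u)) y = conj_by G (inv (ev u)) y \<otimes> conj_by G (ev h) x"
  proof (rule generate_commute[OF _ yc _ assms(5)[rule_format, OF x]])
    show "(\<Union>b\<in>B. conj_by G (ev b) ` P1) \<subseteq> carrier G"
      using assms(3) L.word_val_closed P1c by (intro UN_least image_subsetI conj_by_closed) blast+
    fix s w assume "s \<in> (\<Union>b\<in>B. conj_by G (ev b) ` P1)" and w: "w \<in> ?C"
    then obtain b x' where b: "b \<in> B" "x' \<in> P1" "s = conj_by G (ev b) x'" by blast
    have "b \<in> words" using b(1) assms(3) by blast
    then show "s \<otimes> w = w \<otimes> s"
      using E_appendD[OF assms(1) _ _ b(2) y, of b] assms(4) b(1,3) w by blast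
  qed simp
qed

lemma E_move_left:
  assumes "u \<in> words" "h \<in> words" "B \<subseteq> words" "\<forall>b\<in>B. E (b @ u)"
    and "\<forall>y\<in>P2. conj_by G (inv (ev h)) y \<in> generate G (\<Union>b\<in>B. conj_by G (inv (ev b)) ` P2)"
  shows "E (h @ u)"
  unfolding E_append[OF assms(2,1)]
proof (intro ballI)
  fix x y assume x: "x \<in> P1" and y: "y \<in> P2"
  let ?C = "{conj_by G (ev u) x}"
  have xc: "?C \<subseteq> carrier G" using P1c[OF x] L.word_val_closed[OF assms(1)] by simp
  show "conj_by G (ev u) x \<otimes> conj_by G (inv (ev h)) y = conj_by G (inv (ev h)) y \<otimes> conj_by G (ev u) x"
  proof (rule generate_commute[OF _ xc _ assms(5)[rule_format, OF y], symmetric])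
    show "(\<Union>b\<in>B. conj_by G (inv (ev b)) ` P2) \<subseteq> carrier G"
      using assms(3) L.word_val_closed P2c by (intro UN_least image_subsetI conj_by_closed inv_closed) blast+
    fix s w assume "s \<in> (\<Union>b\<in>B. conj_by G (inv (ev b)) ` P2)" and w: "w \<in> ?C"
    then obtain b y' where b: "b \<in> B" "y' \<in> P2" "s = conj_by G (inv (ev b)) y'" by blast
    have "b \<in> words" using b(1) assms(3) by blast
    then show "s \<otimes> w = w \<otimes> s"
      using E_appendD[OF _ assms(1) _ x b(2), of b] assms(4) b(1,3) w by simp
  qed simp
qed

lemma E_all: "w \<in> words \<Longrightarrow> E w"
proof -
  assume w: "w \<in> words"
  interpret W: word_closure n E
    by unfold_locales (rule E_cancel E_swap; assumption)+
  show "E w"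
  proof (rule W.all_words[where z = z and Z = Z])
    show "z \<epsilon> c \<noteq> 0 \<and> (z \<epsilon> c > 0 \<longleftrightarrow> \<epsilon> c) \<and> \<bar>z \<epsilon> c\<bar> \<le> Z" if "c < n" for \<epsilon> c by (rule z[OF that])
    show "E (monomial [0..<n] \<delta>)" if "\<forall>c<n. \<bar>\<delta> c\<bar> \<le> 3 * Z" for \<delta>
      unfolding E_def using base that by blast
    fix \<epsilon>
    have right: "\<exists>B. narrow n (z \<epsilon>) B \<and> (\<forall>u\<in>words. (\<forall>b\<in>B. E (u @ b)) \<longrightarrow> E (u @ h))"
      if h: "has_exponents n (z \<epsilon>) h" and ex: "\<exists>B. narrow n (z \<epsilon>) B \<and>
        (\<forall>x\<in>P1. conj_by G (ev h) x \<in> generate G (\<Union>b\<in>B. conj_by G (ev b) ` P1))" for h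
    proof -
      obtain B where B: "narrow n (z \<epsilon>) B"
        "\<forall>x\<in>P1. conj_by G (ev h) x \<in> generate G (\<Union>b\<in>B. conj_by G (ev b) ` P1)" using ex by blast
      show ?thesis
        using B(1) h E_move_right[OF _ _ _ _ B(2)]
        by (intro exI[of _ B] conjI) (simp_all add: has_exponents_def narrow_def)
    qed
    have left: "\<exists>B. narrow n (z \<epsilon>) B \<and> (\<forall>u\<in>words. (\<forall>b\<in>B. E (b @ u)) \<longrightarrow> E (h @ u))"
      if h: "has_exponents n (z \<epsilon>) h" and ex: "\<exists>B. narrow n (z \<epsilon>) B \<and>
        (\<forall>y\<in>P2. conj_by G (inv (ev h)) y \<in> generate G (\<Union>b\<in>B. conj_by G (inv (ev b)) ` P2))" for h
    proof -
      obtain B where B: "narrow n (z \<epsilon>) B"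
        "\<forall>y\<in>P2. conj_by G (inv (ev h)) y \<in> generate G (\<Union>b\<in>B. conj_by G (inv (ev b)) ` P2)" using ex by blast
      show ?thesis
        using B(1) h E_move_left[OF _ _ _ _ B(2)]
        by (intro exI[of _ B] conjI) (simp_all add: has_exponents_def narrow_def)
    qed
    from move[of \<epsilon>]
    show "(\<forall>h. has_exponents n (z \<epsilon>) h \<longrightarrow>
        (\<exists>B. narrow n (z \<epsilon>) B \<and> (\<forall>u\<in>words. (\<forall>b\<in>B. E (u @ b)) \<longrightarrow> E (u @ h)))) \<or>
      (\<forall>h. has_exponents n (z \<epsilon>) h \<longrightarrow>
        (\<exists>B. narrow n (z \<epsilon>) B \<and> (\<forall>u\<in>words. (\<forall>b\<in>B. E (b @ u)) \<longrightarrow> E (h @ u))))"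
      using right left by (elim disj_forward) blast+
  qed (use Z w in simp_all)
qed

definition span :: "'a set \<Rightarrow> 'a set" where
  "span P = generate G (\<Union>w\<in>words. conj_by G (ev w) ` P)"

lemma span_carrier: "P \<subseteq> carrier G \<Longrightarrow> (\<Union>w\<in>words. conj_by G (ev w) ` P) \<subseteq> carrier G"
  by (intro UN_least image_subsetI conj_by_closed L.word_val_closed) auto

lemma span_subgroup: "P \<subseteq> carrier G \<Longrightarrow> subgroup (span P) G"
  unfolding span_def by (rule generate_is_subgroup[OF span_carrier])

lemma span_incl: "P \<subseteq> carrier G \<Longrightarrow> P \<subseteq> span P"
proof
  fix x assume P: "P \<subseteq> carrier G" and x: "x \<in> P"
  then have "x = conj_by G (ev []) x" by auto
  then show "x \<in> span P" unfolding span_def using x by (intro generate.incl UN_I[of "[]"]) auto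
qed

lemma words_commute:
  assumes "u \<in> words" "v \<in> words" "x \<in> P1" "y \<in> P2"
  shows "conj_by G (ev v) x \<otimes> conj_by G (ev u) y = conj_by G (ev u) y \<otimes> conj_by G (ev v) x"
proof -
  note u' = L.inverse_word_in_lists[OF assms(1)]
  have "rev (map inv_letter u) @ v \<in> words" using u' assms(2) by simp
  then show ?thesis
    using E_appendD[OF u' assms(2) E_all assms(3,4)] L.word_val_inverse[OF assms(1)] L.word_val_closed[OF assms(1)] by simp
qed

lemma spans_commute:
  assumes "x \<in> span P1" "y \<in> span P2"
  shows "x \<otimes> y = y \<otimes> x"
proof -
  note c1 = span_carrier[OF subgroup.subset[OF P1]] and c2 = span_carrier[OF subgroup.subset[OF P2]]
  have "y \<otimes> x = x \<otimes> y" if x: "x \<in> (\<Union>w\<in>words. conj_by G (ev w) ` P1)" and y: "y \<in> span P2" for x y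
  proof (rule generate_commute[OF c2 c1 _ y[unfolded span_def] x])
    fix s w assume "s \<in> (\<Union>w\<in>words. conj_by G (ev w) ` P2)" "w \<in> (\<Union>w\<in>words. conj_by G (ev w) ` P1)"
    then obtain u v a b where "u \<in> words" "v \<in> words" "a \<in> P1" "b \<in> P2" "s = conj_by G (ev u) b" "w = conj_by G (ev v) a"
      by blast
    then show "s \<otimes> w = w \<otimes> s" using words_commute by simp
  qed
  then show ?thesis
    using generate_commute[OF c1 subgroup.subset[OF span_subgroup[OF subgroup.subset[OF P2]]] _ assms(1)[unfolded span_def] assms(2)]
    by simp
qed

lemma span_letter:
  assumes P: "P \<subseteq> carrier G" and a: "fst a < n" and x: "x \<in> span P"
  shows "conj_by G (letter_val G e a) x \<in> span P"
proof -
  note ac = L.letter_val_closed[of a]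
  have "conj_by G (letter_val G e a) ` (\<Union>w\<in>words. conj_by G (ev w) ` P) \<subseteq> span P"
  proof
    fix y assume "y \<in> conj_by G (letter_val G e a) ` (\<Union>w\<in>words. conj_by G (ev w) ` P)"
    then obtain w p where w: "w \<in> words" "p \<in> P" "y = conj_by G (letter_val G e a) (conj_by G (ev w) p)" by blast
    have "y = conj_by G (ev (a # w)) p"
      unfolding w(3) using conj_by_conj_by[OF _ L.word_val_closed[OF w(1)], of "letter_val G e a" p] P w(2) a by auto
    moreover have "a # w \<in> words" using w(1) a by (auto simp: mem_Times_iff)
    ultimately show "y \<in> span P" unfolding span_def using w(2) by (intro generate.incl) blast
  qed
  then have "generate G (conj_by G (letter_val G e a) ` (\<Union>w\<in>words. conj_by G (ev w) ` P)) \<subseteq> span P"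
    by (rule generate_subgroup_incl[OF _ span_subgroup[OF P]])
  then have "conj_by G (letter_val G e a) ` span P \<subseteq> span P"
    unfolding span_def using conj_by_generate[OF ac span_carrier[OF P]] a by simp
  then show ?thesis using x by blast
qed

text \<open>Moving \<open>t\<close> past a letter leaves a factor \<open>x \<otimes> y\<close> with
  \<open>x\<close> in \<open>P1\<close> and \<open>y\<close> in \<open>P2\<close>. Such factors
  preserve both spans as soon as the spans commute; this is how \<open>P12\<close> will be
  met.\<close>

lemma span_normal:
  assumes P: "subgroup P G" and \<Theta>P: "\<And>t x. t \<in> \<Theta> \<Longrightarrow> x \<in> P \<Longrightarrow> conj_by G t x \<in> P"
    and P12: "\<And>x y p. x \<in> P1 \<Longrightarrow> y \<in> P2 \<Longrightarrow> p \<in> span P \<Longrightarrow> conj_by G (x \<otimes> y) p \<in> span P"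
  shows "span P \<lhd> G"
proof -
  note Pc = subgroup.subset[OF P]
  note Q = span_subgroup[OF Pc]
  have t: "conj_by G t x \<in> span P" if t: "t \<in> \<Theta>" and x: "x \<in> span P" for t x
  proof -
    have tc: "t \<in> carrier G" using t \<Theta>(1) by blast
    have word: "conj_by G t (conj_by G (ev w) p) \<in> span P" if p: "p \<in> P" and "w \<in> words" for w p
      using that(2)
    proof (induction w rule: list.induct)
      case Nil
      have "conj_by G t p \<in> span P" by (rule subsetD[OF span_incl[OF Pc] \<Theta>P[OF t p]])
      then show ?case using subsetD[OF Pc p] by simp
    next
      case (Cons a w)
      have a: "fst a < n" and w: "w \<in> words" using Cons.prems by (auto simp: mem_Times_iff)
      obtain x y where xy: "x \<in> P1" "y \<in> P2" "t \<otimes> letter_val G e a = (x \<otimes> y) \<otimes> (letter_val G e a \<otimes> t)"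
        using \<Theta>_letters[OF t a] by blast
      have ac: "letter_val G e a \<in> carrier G" using a by simp
      note wc = L.word_val_closed[OF w] and xc = P1c[OF xy(1)] and yc = P2c[OF xy(2)]
      have pc: "p \<in> carrier G" using p Pc by blast
      let ?q = "conj_by G (ev w) p"
      have qc: "?q \<in> carrier G" using wc pc by simp
      have "conj_by G t (conj_by G (ev (a # w)) p) = conj_by G (t \<otimes> letter_val G e a) ?q"
        using conj_by_conj_by[OF ac wc pc] conj_by_conj_by[OF tc ac qc] by simp
      also have "\<dots> = conj_by G (x \<otimes> y) (conj_by G (letter_val G e a) (conj_by G t ?q))"
        unfolding xy(3) using conj_by_conj_by[OF _ _ qc] conj_by_conj_by[OF ac tc qc] xc yc ac tc by simp
      also have "\<dots> \<in> span P" by (rule P12[OF xy(1,2) span_letter[OF Pc a Cons.IH[OF w]]])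
      finally show ?case .
    qed
    have "conj_by G t ` (\<Union>w\<in>words. conj_by G (ev w) ` P) \<subseteq> span P" using word by blast
    then have "generate G (conj_by G t ` (\<Union>w\<in>words. conj_by G (ev w) ` P)) \<subseteq> span P"
      by (rule generate_subgroup_incl[OF _ Q])
    then have "conj_by G t ` span P \<subseteq> span P"
      unfolding span_def using conj_by_generate[OF tc span_carrier[OF Pc]] by simp
    then show ?thesis using x by blast
  qed
  show ?thesis
  proof (rule normal_if_generators[OF Q _ gen])
    show "e ` {..<n} \<union> \<Theta> \<subseteq> carrier G" using e \<Theta>(1) by auto
    fix s x assume s: "s \<in> e ` {..<n} \<union> \<Theta>" and x: "x \<in> span P"
    show "conj_by G s x \<in> span P"
    proof (cases "s \<in> \<Theta>")
      case False
      then obtain i where "i < n" "s = letter_val G e (i, True)" using s by (auto simp: letter_val_def)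
      then show ?thesis using span_letter[OF Pc _ x, of "(i, True)"] by simp
    qed (rule t[OF _ x])
    show "conj_by G (inv s) x \<in> span P"
    proof (cases "s \<in> \<Theta>")
      case False
      then obtain i where "i < n" "inv s = letter_val G e (i, False)" using s by (auto simp: letter_val_def)
      then show ?thesis using span_letter[OF Pc _ x, of "(i, False)"] by simp
    qed (rule t[OF \<Theta>(2) x])
  qed
qed

lemma conj_by_commuting: "g \<in> carrier G \<Longrightarrow> p \<in> carrier G \<Longrightarrow> g \<otimes> p = p \<otimes> g \<Longrightarrow> conj_by G g p = p"
  by (simp add: conj_by_def m_assoc)

theorem commuting_normal_subgroups:
  obtains Q1 Q2 where "Q1 \<lhd> G" "Q2 \<lhd> G" "P1 \<subseteq> Q1" "P2 \<subseteq> Q2" "\<And>x y. x \<in> Q1 \<Longrightarrow> y \<in> Q2 \<Longrightarrow> x \<otimes> y = y \<otimes> x"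
proof (rule that)
  note P1s = subgroup.subset[OF P1] and P2s = subgroup.subset[OF P2]
  note Q1 = span_subgroup[OF P1s] and Q2 = span_subgroup[OF P2s]
  note Q1c = subgroup.mem_carrier[OF Q1] and Q2c = subgroup.mem_carrier[OF Q2]
  have self: "conj_by G x p \<in> Q" if "subgroup Q G" "x \<in> Q" "p \<in> Q" for Q x p
    unfolding conj_by_def by (intro subgroup.m_closed[OF that(1)] subgroup.m_inv_closed[OF that(1)] that(2,3))
  show "span P1 \<lhd> G"
  proof (rule span_normal[OF P1 \<Theta>_P1])
    fix x y p assume x: "x \<in> P1" and y: "y \<in> P2" and p: "p \<in> span P1"
    have "conj_by G y p = p"
      by (rule conj_by_commuting[OF P2c[OF y] Q1c[OF p] spans_commute[OF p subsetD[OF span_incl[OF P2s] y], symmetric]])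
    then have "conj_by G (x \<otimes> y) p = conj_by G x p"
      using conj_by_conj_by[OF P1c[OF x] P2c[OF y] Q1c[OF p]] by simp
    then show "conj_by G (x \<otimes> y) p \<in> span P1" using self[OF Q1 subsetD[OF span_incl[OF P1s] x] p] by simp
  qed
  show "span P2 \<lhd> G"
  proof (rule span_normal[OF P2 \<Theta>_P2])
    fix x y p assume x: "x \<in> P1" and y: "y \<in> P2" and p: "p \<in> span P2"
    have q: "conj_by G y p \<in> span P2" by (rule self[OF Q2 subsetD[OF span_incl[OF P2s] y] p])
    have "conj_by G x (conj_by G y p) = conj_by G y p"
      by (rule conj_by_commuting[OF P1c[OF x] Q2c[OF q] spans_commute[OF subsetD[OF span_incl[OF P1s] x] q]])
    then show "conj_by G (x \<otimes> y) p \<in> span P2"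
      using conj_by_conj_by[OF P1c[OF x] P2c[OF y] Q2c[OF p]] q by simp
  qed
  show "P1 \<subseteq> span P1" "P2 \<subseteq> span P2" by (rule span_incl[OF P1s], rule span_incl[OF P2s])
  show "x \<otimes> y = y \<otimes> x" if "x \<in> span P1" "y \<in> span P2" for x y by (rule spans_commute[OF that])
qed

end

section \<open>From filtrations to finitely many relators\<close>

lemma (in group_hom) hom_conj_by:
  "g \<in> carrier G \<Longrightarrow> x \<in> carrier G \<Longrightarrow> h (conj_by G g x) = conj_by H (h g) (h x)"
  by (simp add: conj_by_def)

abbreviation short_words :: "'p set \<Rightarrow> nat \<Rightarrow> 'p letter list set" where
  "short_words P d \<equiv> {b \<in> lists (P \<times> UNIV). length b \<le> d}"

lemma (in group) conj_words_carrier: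
  assumes "e ` P \<subseteq> carrier G" "Q \<subseteq> carrier G"
  shows "(\<Union>b\<in>short_words P d. conj_by G (word_val G e b) ` Q) \<subseteq> carrier G"
proof -
  interpret L: letters G e P using assms(1) by unfold_locales auto
  show ?thesis by (intro UN_least image_subsetI conj_by_closed L.word_val_closed) (use assms(2) in auto)
qed

lemma (in group_hom) hom_generate_conj_words:
  assumes e: "e ` P \<subseteq> carrier G" and Q: "Q \<subseteq> carrier G"
  shows "h ` generate G (\<Union>b\<in>short_words P d. conj_by G (word_val G e b) ` Q) =
    generate H (\<Union>b\<in>short_words P d. conj_by H (word_val H (h \<circ> e) b) ` (h ` Q))"
proof -
  interpret L: letters G e P using e by unfold_locales auto
  have "h ` (\<Union>b\<in>short_words P d. conj_by G (word_val G e b) ` Q) =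
      (\<Union>b\<in>short_words P d. (\<lambda>x. h (conj_by G (word_val G e b) x)) ` Q)"
    by (simp add: image_UN image_image)
  also have "\<dots> = (\<Union>b\<in>short_words P d. (\<lambda>x. conj_by H (word_val H (h \<circ> e) b) (h x)) ` Q)"
  proof (intro SUP_cong image_cong refl)
    fix b x assume b: "b \<in> short_words P d" and x: "x \<in> Q"
    then have b: "b \<in> lists (P \<times> UNIV)" by blast
    have "h (word_val G e b) = word_val H (h \<circ> e) b" by (rule L.hom_word_val[OF H.is_group homh b])
    then show "h (conj_by G (word_val G e b) x) = conj_by H (word_val H (h \<circ> e) b) (h x)"
      using hom_conj_by[OF L.word_val_closed[OF b] subsetD[OF Q x]] by simp
  qed
  finally show ?thesis
    unfolding generate_img[OF G.conj_words_carrier[OF e Q], symmetric] by (simp add: image_image)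
qed

text \<open>At one sufficiently large depth the filtration property consists of finitely many
  statements about generators in \<open>H\<close>. Lifted to \<open>G\<close>, each holds up to an
  element of \<open>A\<close> killed by \<open>h\<close>. These errors form \<open>R\<close>, so the
  statements become true in every quotient by an \<open>M\<close> that contains
  \<open>R\<close>.\<close>

lemma (in group_hom) filtration_relations:
  fixes D :: "nat \<Rightarrow> 'c set" and e :: "'p \<Rightarrow> 'a" and HD :: "('a \<times> nat) set"
  assumes A: "A \<lhd> G" and fg: "\<And>r. \<exists>B. finite B \<and> B \<subseteq> h ` A \<and> D r = generate H B"
    and mono: "\<And>r s. r \<le> s \<Longrightarrow> D r \<subseteq> D s" and un: "(\<Union>r. D r) = h ` A"
    and split: "\<And>r d x. x \<in> D (r + d) \<Longrightarrow>
      x \<in> generate H (\<Union>b\<in>short_words P d. conj_by H (word_val H (h \<circ> e) b) ` D r)"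
    and e: "e ` P \<subseteq> carrier G"
    and U: "finite U" "U \<subseteq> A"
    and HD: "finite HD" "\<And>g d. (g, d) \<in> HD \<Longrightarrow> g \<in> carrier G"
      "\<And>g d. (g, d) \<in> HD \<Longrightarrow> \<exists>r0. \<forall>r\<ge>r0. \<forall>x\<in>D r. conj_by H (h g) x \<in> D (r + d)"
  obtains Y R where "finite Y" "Y \<subseteq> A" "finite R" "R \<subseteq> {x \<in> A. h x = \<one>\<^bsub>H\<^esub>}"
    "\<And>M x. M \<lhd> G \<Longrightarrow> R \<subseteq> M \<Longrightarrow> x \<in> U \<Longrightarrow> M #> x \<in> (\<lambda>x. M #> x) ` generate G Y"
    "\<And>M g d y. M \<lhd> G \<Longrightarrow> R \<subseteq> M \<Longrightarrow> (g, d) \<in> HD \<Longrightarrow> y \<in> generate G Y \<Longrightarrow>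
      M #> conj_by G g y \<in> (\<lambda>x. M #> x) ` generate G (\<Union>b\<in>short_words P d. conj_by G (word_val G e b) ` generate G Y)"
proof -
  interpret A: normal A G by fact
  have "\<exists>r. h ` V \<subseteq> D r" if "finite V" "V \<subseteq> A" for V
    using that
  proof (induction V rule: finite_induct)
    case (insert v V)
    then obtain r where r: "h ` V \<subseteq> D r" by blast
    have "h v \<in> (\<Union>r. D r)" unfolding un using insert.prems by blast
    then obtain s where s: "h v \<in> D s" by blast
    have "h ` insert v V \<subseteq> D (max r s)" using r s mono[of r "max r s"] mono[of s "max r s"] by auto
    then show ?case by blast
  qed simp
  then obtain r1 where r1: "h ` U \<subseteq> D r1" using U by blast
  have "\<forall>p\<in>HD. \<exists>r0. \<forall>r\<ge>r0. \<forall>x\<in>D r. conj_by H (h (fst p)) x \<in> D (r + snd p)"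
    using HD(3) by auto
  from bchoice[OF this] obtain r0 where
    r0: "\<forall>p\<in>HD. \<forall>r\<ge>r0 p. \<forall>x\<in>D r. conj_by H (h (fst p)) x \<in> D (r + snd p)" by (elim exE)
  \<comment> \<open>Deep enough to contain the image of \<open>U\<close> and to pass the thresholds
    of all conjugations in the finite set \<open>HD\<close>.\<close>
  define r where "r = r1 + sum r0 HD"
  have r0_le: "r0 p \<le> r" if "p \<in> HD" for p using member_le_sum[OF that _ HD(1), of r0] by (simp add: r_def)
  have Ur: "h ` U \<subseteq> D r" using r1 mono[of r1 r] by (auto simp: r_def)
  obtain B where B: "finite B" "B \<subseteq> h ` A" "D r = generate H B" using fg by blast
  obtain Y where Y: "finite Y" "Y \<subseteq> A" "B = h ` Y" using finite_subset_image[OF B(1,2)] by blast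
  have Yc: "Y \<subseteq> carrier G" using Y(2) A.subset by (rule order_trans)
  let ?P = "generate G Y"
  have PA: "?P \<subseteq> A" by (rule G.generate_subgroup_incl[OF Y(2) A.is_subgroup])
  then have Pc: "?P \<subseteq> carrier G" using A.subset by (rule order_trans)
  have hP: "h ` ?P = D r" using generate_img[OF Yc] B(3) Y(3) by simp
  define L where "L d = generate G (\<Union>b\<in>short_words P d. conj_by G (word_val G e b) ` ?P)" for d
  interpret Let: letters G e P using e by unfold_locales auto
  have LA: "L d \<subseteq> A" for d
    unfolding L_def
  proof (rule G.generate_subgroup_incl[OF _ A.is_subgroup], intro UN_least image_subsetI)
    fix b y assume "b \<in> short_words P d" "y \<in> ?P"
    then show "conj_by G (word_val G e b) y \<in> A"
      using PA by (intro G.normal_conj_by[OF A] Let.word_val_closed) auto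
  qed
  have hL: "h ` L d = generate H (\<Union>b\<in>short_words P d. conj_by H (word_val H (h \<circ> e) b) ` D r)" for d
    unfolding L_def hom_generate_conj_words[OF e Pc] hP ..
  have "\<forall>x\<in>U. \<exists>l. l \<in> ?P \<and> h l = h x"
  proof
    fix x assume "x \<in> U"
    then have "h x \<in> h ` ?P" using Ur unfolding hP by blast
    then show "\<exists>l. l \<in> ?P \<and> h l = h x" by (elim imageE) auto
  qed
  from bchoice[OF this] obtain l1 where l1: "\<forall>x\<in>U. l1 x \<in> ?P \<and> h (l1 x) = h x" by (elim exE)
  have conjA: "conj_by G (fst (fst q)) (snd q) \<in> A" if "q \<in> HD \<times> Y" for q
    using that HD(2) Y(2) by (intro G.normal_conj_by[OF A]) auto
  have "\<forall>q\<in>HD \<times> Y. \<exists>l. l \<in> L (snd (fst q)) \<and> h l = h (conj_by G (fst (fst q)) (snd q))"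
  proof
    fix q assume q: "q \<in> HD \<times> Y"
    then obtain g d y where gdy: "q = ((g, d), y)" "(g, d) \<in> HD" "y \<in> Y" by auto
    have "h y \<in> D r" using gdy(3) hP G.generate_incl[OF Yc] generate.incl[of y Y G] by blast
    then have "conj_by H (h g) (h y) \<in> D (r + d)" using r0 r0_le[OF gdy(2)] gdy(2) by fastforce
    then have "h (conj_by G g y) \<in> D (r + d)" using hom_conj_by[OF HD(2)[OF gdy(2)]] gdy(3) Yc by auto
    then have "h (conj_by G g y) \<in> h ` L d" unfolding hL by (rule split)
    then show "\<exists>l. l \<in> L (snd (fst q)) \<and> h l = h (conj_by G (fst (fst q)) (snd q))"
      unfolding gdy(1) by (elim imageE) auto
  qed
  from bchoice[OF this] obtain l2 where
    l2: "\<forall>q\<in>HD \<times> Y. l2 q \<in> L (snd (fst q)) \<and> h (l2 q) = h (conj_by G (fst (fst q)) (snd q))" by (elim exE)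
  define R where "R = (\<lambda>x. x \<otimes> inv (l1 x)) ` U \<union> (\<lambda>q. conj_by G (fst (fst q)) (snd q) \<otimes> inv (l2 q)) ` (HD \<times> Y)"
  have rel: "x \<otimes> inv l \<in> {x \<in> A. h x = \<one>\<^bsub>H\<^esub>}" if "x \<in> A" "l \<in> A" "h l = h x" for x l
  proof -
    have "x \<otimes> inv l \<in> A" by (intro A.m_closed A.m_inv_closed that(1,2))
    moreover have "h (x \<otimes> inv l) = h x \<otimes>\<^bsub>H\<^esub> inv\<^bsub>H\<^esub> h l" using that(1,2) by simp
    ultimately show ?thesis using that(1,3) by simp
  qed
  have R: "R \<subseteq> {x \<in> A. h x = \<one>\<^bsub>H\<^esub>}"
    unfolding R_def
  proof (intro Un_least image_subsetI rel)
    show "x \<in> A" "l1 x \<in> A" "h (l1 x) = h x" if "x \<in> U" for x using that l1 PA U(2) by auto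
    show "conj_by G (fst (fst q)) (snd q) \<in> A" "l2 q \<in> A" "h (l2 q) = h (conj_by G (fst (fst q)) (snd q))"
      if "q \<in> HD \<times> Y" for q
      using l2[rule_format, OF that] conjA[OF that] subsetD[OF LA] by auto
  qed
  have finR: "finite R" unfolding R_def using U(1) HD(1) Y(1) by blast
  show ?thesis
  proof (rule that[OF Y(1,2) finR R])
    fix M x assume M: "M \<lhd> G" and RM: "R \<subseteq> M" and x: "x \<in> U"
    have "x \<otimes> inv (l1 x) \<in> M" using RM x by (auto simp: R_def)
    moreover have "x \<in> carrier G" "l1 x \<in> carrier G" using l1 x U(2) Pc by auto
    ultimately have "M #> x = M #> l1 x" using normal.Mod_eq_iff[OF M] by blast
    then show "M #> x \<in> (\<lambda>x. M #> x) ` ?P" using l1 x by blast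
  next
    fix M g d y assume M: "M \<lhd> G" and RM: "R \<subseteq> M" and gd: "(g, d) \<in> HD" and y: "y \<in> ?P"
    interpret \<rho>: group_hom G "G Mod M" "\<lambda>x. M #> x" by (rule normal.Mod_hom[OF M])
    note gc = HD(2)[OF gd]
    interpret c: group_hom G G "conj_by G g" by (rule G.conj_by_group_hom[OF gc])
    interpret \<rho>c: group_hom G "G Mod M" "\<lambda>x. M #> conj_by G g x"
      by unfold_locales (rule homI; use gc in simp)
    have Ls: "subgroup (L d) G" unfolding L_def by (rule G.generate_is_subgroup[OF G.conj_words_carrier[OF e Pc]])
    have "(\<lambda>x. M #> conj_by G g x) ` Y \<subseteq> (\<lambda>x. M #> x) ` L d"
    proof (intro image_subsetI)
      fix y assume "y \<in> Y"
      then have q: "((g, d), y) \<in> HD \<times> Y" using gd by blast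
      let ?l = "l2 ((g, d), y)"
      have l: "?l \<in> L d" using l2 q by auto
      have "(\<lambda>q. conj_by G (fst (fst q)) (snd q) \<otimes> inv (l2 q)) ((g, d), y) \<in> R"
        unfolding R_def by (rule UnI2, rule imageI[OF q])
      then have "conj_by G g y \<otimes> inv ?l \<in> M" using RM by auto
      moreover have "?l \<in> carrier G" "conj_by G g y \<in> carrier G" using l LA[of d] conjA[OF q] by auto
      ultimately have "M #> conj_by G g y = M #> ?l" using normal.Mod_eq_iff[OF M] by blast
      then show "M #> conj_by G g y \<in> (\<lambda>x. M #> x) ` L d" using l by (rule image_eqI)
    qed
    then have "generate (G Mod M) ((\<lambda>x. M #> conj_by G g x) ` Y) \<subseteq> (\<lambda>x. M #> x) ` L d"
      by (rule \<rho>.H.generate_subgroup_incl[OF _ \<rho>.subgroup_img_is_subgroup[OF Ls]])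
    then have "(\<lambda>x. M #> conj_by G g x) ` ?P \<subseteq> (\<lambda>x. M #> x) ` L d" using \<rho>c.generate_img[OF Yc] by simp
    then show "M #> conj_by G g y \<in> (\<lambda>x. M #> x) ` generate G (\<Union>b\<in>short_words P d. conj_by G (word_val G e b) ` ?P)"
      using y unfolding L_def by blast
  qed
qed

lemma length_proj:
  "h \<in> lists ({..<n} \<times> UNIV) \<Longrightarrow> length h = (\<Sum>c<n. length (proj c h))"
proof (induction h rule: list.induct)
  case (Cons a h)
  then have a: "fst a < n" and h: "h \<in> lists ({..<n} \<times> UNIV)" by (auto simp: mem_Times_iff)
  have "(\<Sum>c<n. length (proj c (a # h))) = (\<Sum>c<n. (if c = fst a then 1 else 0) + length (proj c h))"
    by (rule sum.cong) (auto simp: proj_def)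
  also have "\<dots> = Suc (length h)" using a Cons.IH[OF h] by (simp add: sum.distrib)
  finally show ?case by simp
qed simp

lemma finite_short_words: "finite P \<Longrightarrow> finite (short_words P d)"
proof -
  assume "finite P"
  then have "finite {b. set b \<subseteq> P \<times> (UNIV :: bool set) \<and> length b \<le> d}" by (intro finite_lists_length_le) simp
  moreover have "short_words P d = {b. set b \<subseteq> P \<times> UNIV \<and> length b \<le> d}" by auto
  ultimately show ?thesis by simp
qed

lemma proj_length_le: "length (proj c b) \<le> length b"
  by (simp add: proj_def)

lemma proj_outside: "b \<in> lists (P \<times> UNIV) \<Longrightarrow> c \<notin> P \<Longrightarrow> proj c b = []"
  by (auto simp: proj_def filter_empty_conv in_lists_conv_set)

lemma short_words_lists:
  assumes "P \<subseteq> Q" shows "short_words P d \<subseteq> lists (Q \<times> UNIV)"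
proof
  fix b assume "b \<in> short_words P d"
  then have "b \<in> lists (P \<times> UNIV)" by simp
  then show "b \<in> lists (Q \<times> UNIV)" by (rule subsetD[OF lists_mono, rotated]) (use assms in auto)
qed

text \<open>Letters outside \<open>P\<close> do not occur at all, so for them
  \<open>w c \<noteq> 0\<close> is enough to have the bound \<open>\<bar>w c\<bar> - 1\<close>
  nonnegative.\<close>

lemma narrow_short_words:
  assumes P: "P \<subseteq> {..<n}" and d: "\<And>c. c \<in> P \<Longrightarrow> int d < \<bar>w c\<bar>" and w: "\<And>c. c < n \<Longrightarrow> w c \<noteq> 0"
  shows "narrow n w (short_words P d)" "narrow n w ((\<lambda>b. rev (map inv_letter b)) ` short_words P d)"
proof -
  show *: "narrow n w (short_words P d)"
    unfolding narrow_def
  proof (intro conjI ballI allI impI)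
    show "short_words P d \<subseteq> lists ({..<n} \<times> UNIV)"
      by (rule short_words_lists[OF P])
    fix b c assume b: "b \<in> short_words P d" and c: "c < n"
    have "int (length (proj c b)) \<le> \<bar>w c\<bar> - 1"
    proof (cases "c \<in> P")
      case True
      then show ?thesis using d[OF True] proj_length_le[of c b] b by simp
    next
      case False
      then show ?thesis using proj_outside[of b P c] b w[OF c] by simp
    qed
    then show "range_le (\<bar>w c\<bar> - 1) (proj c b)" by (rule range_le_length)
  qed
  have "(\<lambda>b. rev (map inv_letter b)) ` short_words P d \<subseteq> short_words P d"
    by (force simp: in_lists_conv_set inv_letter_def mem_Times_iff)
  then show "narrow n w ((\<lambda>b. rev (map inv_letter b)) ` short_words P d)" using * unfolding narrow_def by blast
qed

lemma (in group_hom) kernel_as_set: "kernel G H h = {x \<in> carrier G. h x = \<one>\<^bsub>H\<^esub>}"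
  by (simp add: kernel_def)

lemma finite_commutators: "finite A \<Longrightarrow> finite B \<Longrightarrow> finite (commutators G A B)"
proof -
  assume "finite A" "finite B"
  moreover have "commutators G A B = (\<lambda>(x, y). x \<otimes>\<^bsub>G\<^esub> y \<otimes>\<^bsub>G\<^esub> inv\<^bsub>G\<^esub> x \<otimes>\<^bsub>G\<^esub> inv\<^bsub>G\<^esub> y) ` (A \<times> B)"
    by (auto simp: commutators_def)
  ultimately show ?thesis by simp
qed

lemma commutators_mono: "A \<subseteq> A' \<Longrightarrow> B \<subseteq> B' \<Longrightarrow> commutators G A B \<subseteq> commutators G A' B'"
  unfolding commutators_def by blast

text \<open>In the quotient by \<open>M\<close> the subgroups generated by \<open>Y1\<close> and
  \<open>Y2\<close> form a \<open>commuting_pair\<close>: \<open>R1\<close> and \<open>R2\<close>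
  provide the moves and the behaviour of torsion, \<open>R3\<close> the base relations. The
  commuting normal subgroups obtained from it contain the images of \<open>TA\<close> and
  \<open>TB\<close>, hence those of \<open>A\<close> and \<open>B\<close>.\<close>

theorem finite_relations_commutators:
  fixes F :: "('f, 'm) monoid_scheme" and G1 :: "('a, 'c) monoid_scheme" and G2 :: "('b, 'd) monoid_scheme"
    and e :: "nat \<Rightarrow> 'f" and z :: "(nat \<Rightarrow> bool) \<Rightarrow> nat \<Rightarrow> int"
  assumes \<phi>1: "group_hom F G1 \<phi>1" and \<phi>2: "group_hom F G2 \<phi>2"
    and A: "A = kernel F G2 \<phi>2" and B: "B = kernel F G1 \<phi>1"
    and comm: "commutators F (carrier F) (carrier F) \<subseteq> A <#>\<^bsub>F\<^esub> B"
    and TA: "finite TA" "TA \<subseteq> carrier F" "A = normal_closure F TA"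
    and TB: "finite TB" "TB \<subseteq> carrier F" "B = normal_closure F TB"
    and e: "\<And>j. j < n \<Longrightarrow> e j \<in> carrier F"
    and \<Theta>: "finite \<Theta>" "\<Theta> \<subseteq> carrier F" "\<And>t. t \<in> \<Theta> \<Longrightarrow> inv\<^bsub>F\<^esub> t \<in> \<Theta>"
    and gen: "generate F (e ` {..<n} \<union> \<Theta>) = carrier F"
    and P1: "P1 \<subseteq> {..<n}" and P2: "P2 \<subseteq> {..<n}"
    and D1: "\<And>r. \<exists>B. finite B \<and> B \<subseteq> \<phi>1 ` A \<and> D1 r = generate G1 B"
      "\<And>r s. r \<le> s \<Longrightarrow> D1 r \<subseteq> D1 s" "(\<Union>r. D1 r) = \<phi>1 ` A"
      "\<And>r d x. x \<in> D1 (r + d) \<Longrightarrow>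
        x \<in> generate G1 (\<Union>b\<in>short_words P1 d. conj_by G1 (word_val G1 (\<phi>1 \<circ> e) b) ` D1 r)"
    and D2: "\<And>r. \<exists>A. finite A \<and> A \<subseteq> \<phi>2 ` B \<and> D2 r = generate G2 A"
      "\<And>r s. r \<le> s \<Longrightarrow> D2 r \<subseteq> D2 s" "(\<Union>r. D2 r) = \<phi>2 ` B"
      "\<And>r d x. x \<in> D2 (r + d) \<Longrightarrow>
        x \<in> generate G2 (\<Union>b\<in>short_words P2 d. conj_by G2 (word_val G2 (\<phi>2 \<circ> e) b) ` D2 r)"
    and \<Theta>D1: "\<And>t. t \<in> \<Theta> \<Longrightarrow> \<exists>r0. \<forall>r\<ge>r0. \<forall>x\<in>D1 r. conj_by G1 (\<phi>1 t) x \<in> D1 r"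
    and \<Theta>D2: "\<And>t. t \<in> \<Theta> \<Longrightarrow> \<exists>r0. \<forall>r\<ge>r0. \<forall>x\<in>D2 r. conj_by G2 (\<phi>2 t) x \<in> D2 r"
    and z: "\<And>\<epsilon> c. c < n \<Longrightarrow> z \<epsilon> c \<noteq> 0 \<and> (z \<epsilon> c > 0 \<longleftrightarrow> \<epsilon> c) \<and> \<bar>z \<epsilon> c\<bar> \<le> Z" and Z: "0 \<le> Z"
    and move: "\<And>\<epsilon>.
      (\<forall>h. has_exponents n (z \<epsilon>) h \<longrightarrow>
        (\<exists>d. (\<forall>c\<in>P1. int d < \<bar>z \<epsilon> c\<bar>) \<and>
          (\<exists>r0. \<forall>r\<ge>r0. \<forall>x\<in>D1 r. conj_by G1 (\<phi>1 (word_val F e h)) x \<in> D1 (r + d)))) \<or>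
      (\<forall>h. has_exponents n (z \<epsilon>) h \<longrightarrow>
        (\<exists>d. (\<forall>c\<in>P2. int d < \<bar>z \<epsilon> c\<bar>) \<and>
          (\<exists>r0. \<forall>r\<ge>r0. \<forall>x\<in>D2 r. conj_by G2 (\<phi>2 (inv\<^bsub>F\<^esub> word_val F e h)) x \<in> D2 (r + d))))"
  obtains R where "finite R" "R \<subseteq> A \<inter> B" "\<And>M. M \<lhd> F \<Longrightarrow> R \<subseteq> M \<Longrightarrow> commutators F A B \<subseteq> M"
proof -
  interpret F: group F by (rule group_hom.axioms(1)[OF \<phi>1])
  interpret \<phi>1: group_hom F G1 \<phi>1 by fact
  interpret \<phi>2: group_hom F G2 \<phi>2 by fact
  interpret L: letters F e "{..<n}" using e by unfold_locales auto
  let ?W = "lists ({..<n} \<times> (UNIV :: bool set))"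
  let ?ev = "word_val F e"
  have An: "A \<lhd> F" unfolding A by (rule \<phi>2.normal_kernel)
  have Bn: "B \<lhd> F" unfolding B by (rule \<phi>1.normal_kernel)
  interpret A: normal A F by (rule An)
  interpret B: normal B F by (rule Bn)
  have eP1: "e ` P1 \<subseteq> carrier F" and eP2: "e ` P2 \<subseteq> carrier F" using P1 P2 e by auto
  have Z1: "{x \<in> A. \<phi>1 x = \<one>\<^bsub>G1\<^esub>} = A \<inter> B" using A.subset unfolding B \<phi>1.kernel_as_set by blast
  have Z2: "{x \<in> B. \<phi>2 x = \<one>\<^bsub>G2\<^esub>} = A \<inter> B" using B.subset unfolding A \<phi>2.kernel_as_set by blast
  text \<open>Only finitely many words \<open>h\<close> are relevant in \<open>move\<close>.\<close>
  define Hs where "Hs = short_words {..<n} (n * nat Z)"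
  have HsI: "h \<in> Hs" if h: "has_exponents n (z \<epsilon>) h" for h \<epsilon>
  proof -
    have hW: "h \<in> ?W" using h by (simp add: has_exponents_def)
    have "length h = (\<Sum>c<n. nat \<bar>z \<epsilon> c\<bar>)"
      unfolding length_proj[OF hW] using h by (intro sum.cong) (auto simp: has_exponents_def)
    also have "\<dots> \<le> (\<Sum>c<n. nat Z)" by (intro sum_mono nat_mono) (use z in auto)
    finally show ?thesis using hW by (simp add: Hs_def)
  qed
  have HsW: "h \<in> ?W" if "h \<in> Hs" for h using that by (simp add: Hs_def)
  \<comment> \<open>The bound is phrased by the letters of \<open>h\<close> instead of
    \<open>z\<close>, so that the chosen shift and the finite set \<open>HD1\<close> depend on
    \<open>h\<close> alone and not on the sign pattern.\<close>
  define Q1 where "Q1 h d \<longleftrightarrow> (\<forall>c\<in>P1. d < length (proj c h)) \<and>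
    (\<exists>r0. \<forall>r\<ge>r0. \<forall>x\<in>D1 r. conj_by G1 (\<phi>1 (?ev h)) x \<in> D1 (r + d))" for h and d :: nat
  define Q2 where "Q2 h d \<longleftrightarrow> (\<forall>c\<in>P2. d < length (proj c h)) \<and>
    (\<exists>r0. \<forall>r\<ge>r0. \<forall>x\<in>D2 r. conj_by G2 (\<phi>2 (inv\<^bsub>F\<^esub> ?ev h)) x \<in> D2 (r + d))" for h and d :: nat
  define \<delta>1 where "\<delta>1 h = (SOME d. Q1 h d)" for h
  define \<delta>2 where "\<delta>2 h = (SOME d. Q2 h d)" for h
  \<comment> \<open>Elements of \<open>\<Theta>\<close> enter with shift 0, which later means that
    they conjugate the finitely generated subgroup into itself.\<close>
  define HD1 where "HD1 = (\<lambda>h. (?ev h, \<delta>1 h)) ` {h \<in> Hs. Q1 h (\<delta>1 h)} \<union> (\<lambda>t. (t, 0)) ` \<Theta>"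
  define HD2 where "HD2 = (\<lambda>h. (inv\<^bsub>F\<^esub> ?ev h, \<delta>2 h)) ` {h \<in> Hs. Q2 h (\<delta>2 h)} \<union> (\<lambda>t. (t, 0)) ` \<Theta>"
  have finHs: "finite Hs" unfolding Hs_def by (rule finite_short_words) simp
  have HD1: "finite HD1" "\<And>g d. (g, d) \<in> HD1 \<Longrightarrow> g \<in> carrier F"
    "\<And>g d. (g, d) \<in> HD1 \<Longrightarrow> \<exists>r0. \<forall>r\<ge>r0. \<forall>x\<in>D1 r. conj_by G1 (\<phi>1 g) x \<in> D1 (r + d)"
  proof -
    show "finite HD1" using finHs \<Theta>(1) by (simp add: HD1_def)
    show "g \<in> carrier F" if "(g, d) \<in> HD1" for g d
      using that \<Theta>(2) L.word_val_closed[OF HsW] by (auto simp: HD1_def)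
    show "\<exists>r0. \<forall>r\<ge>r0. \<forall>x\<in>D1 r. conj_by G1 (\<phi>1 g) x \<in> D1 (r + d)" if "(g, d) \<in> HD1" for g d
      using that \<Theta>D1 by (auto simp: HD1_def Q1_def)
  qed
  have HD2: "finite HD2" "\<And>g d. (g, d) \<in> HD2 \<Longrightarrow> g \<in> carrier F"
    "\<And>g d. (g, d) \<in> HD2 \<Longrightarrow> \<exists>r0. \<forall>r\<ge>r0. \<forall>x\<in>D2 r. conj_by G2 (\<phi>2 g) x \<in> D2 (r + d)"
  proof -
    show "finite HD2" using finHs \<Theta>(1) by (simp add: HD2_def)
    show "g \<in> carrier F" if "(g, d) \<in> HD2" for g d
      using that \<Theta>(2) F.inv_closed[OF L.word_val_closed[OF HsW]] by (auto simp: HD2_def)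
    show "\<exists>r0. \<forall>r\<ge>r0. \<forall>x\<in>D2 r. conj_by G2 (\<phi>2 g) x \<in> D2 (r + d)" if "(g, d) \<in> HD2" for g d
      using that \<Theta>D2 by (auto simp: HD2_def Q2_def)
  qed
  have "\<forall>c\<in>commutators F (carrier F) (carrier F). \<exists>p. fst p \<in> A \<and> snd p \<in> B \<and> c = fst p \<otimes>\<^bsub>F\<^esub> snd p"
  proof
    fix c assume "c \<in> commutators F (carrier F) (carrier F)"
    then have "c \<in> A <#>\<^bsub>F\<^esub> B" using comm by blast
    then obtain x y where "x \<in> A" "y \<in> B" "c = x \<otimes>\<^bsub>F\<^esub> y" by (auto simp: set_mult_def)
    then show "\<exists>p. fst p \<in> A \<and> snd p \<in> B \<and> c = fst p \<otimes>\<^bsub>F\<^esub> snd p" by (intro exI[of _ "(x, y)"]) simp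
  qed
  from bchoice[OF this] obtain \<alpha> where \<alpha>: "\<forall>c\<in>commutators F (carrier F) (carrier F).
    fst (\<alpha> c) \<in> A \<and> snd (\<alpha> c) \<in> B \<and> c = fst (\<alpha> c) \<otimes>\<^bsub>F\<^esub> snd (\<alpha> c)" by (elim exE)
  let ?\<Lambda> = "letter_val F e ` ({..<n} \<times> UNIV)"
  let ?\<Lambda>' = "m_inv F ` ?\<Lambda>"
  \<comment> \<open>The product of two letters is the product in the other order times the
    commutator of their inverses, while \<open>t\<close> followed by a letter is a commutator of the
    two times the opposite order. Both kinds are collected here.\<close>
  let ?C = "commutators F (\<Theta> \<union> ?\<Lambda>') (?\<Lambda> \<union> ?\<Lambda>')"
  have \<Lambda>: "?\<Lambda> \<subseteq> carrier F" by (intro image_subsetI L.letter_val_closed) (simp add: mem_Times_iff)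
  then have \<Lambda>': "?\<Lambda>' \<subseteq> carrier F" by blast
  have finC: "finite ?C" using \<Theta>(1) by (intro finite_commutators) auto
  have Cc: "?C \<subseteq> commutators F (carrier F) (carrier F)"
    by (rule commutators_mono[OF Un_least[OF \<Theta>(2) \<Lambda>'] Un_least[OF \<Lambda> \<Lambda>']])
  \<comment> \<open>The \<open>A\<close>-parts of these commutators have to be visible in the
    subgroup generated by \<open>Y1\<close>, and so do the normal generators of \<open>A\<close>;
    the same holds for \<open>B\<close> and \<open>Y2\<close> below.\<close>
  define U1 where "U1 = TA \<union> (\<lambda>c. fst (\<alpha> c)) ` ?C"
  define U2 where "U2 = TB \<union> (\<lambda>c. snd (\<alpha> c)) ` ?C"
  have U1: "finite U1" "U1 \<subseteq> A" using TA(1) finC \<alpha> Cc F.normal_closure_incl[of TA] by (auto simp: U1_def TA(3))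
  have U2: "finite U2" "U2 \<subseteq> B" using TB(1) finC \<alpha> Cc F.normal_closure_incl[of TB] by (auto simp: U2_def TB(3))
  obtain Y1 R1 where Y1: "finite Y1" "Y1 \<subseteq> A" "finite R1" "R1 \<subseteq> {x \<in> A. \<phi>1 x = \<one>\<^bsub>G1\<^esub>}"
    and Y1U: "\<And>M x. M \<lhd> F \<Longrightarrow> R1 \<subseteq> M \<Longrightarrow> x \<in> U1 \<Longrightarrow> M #>\<^bsub>F\<^esub> x \<in> (\<lambda>x. M #>\<^bsub>F\<^esub> x) ` generate F Y1"
    and Y1m: "\<And>M g d y. M \<lhd> F \<Longrightarrow> R1 \<subseteq> M \<Longrightarrow> (g, d) \<in> HD1 \<Longrightarrow> y \<in> generate F Y1 \<Longrightarrow>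
      M #>\<^bsub>F\<^esub> conj_by F g y \<in> (\<lambda>x. M #>\<^bsub>F\<^esub> x) ` generate F (\<Union>b\<in>short_words P1 d. conj_by F (word_val F e b) ` generate F Y1)"
    by (rule \<phi>1.filtration_relations[OF An D1 eP1 U1 HD1]) (assumption | rule that; assumption)+
  obtain Y2 R2 where Y2: "finite Y2" "Y2 \<subseteq> B" "finite R2" "R2 \<subseteq> {x \<in> B. \<phi>2 x = \<one>\<^bsub>G2\<^esub>}"
    and Y2U: "\<And>M x. M \<lhd> F \<Longrightarrow> R2 \<subseteq> M \<Longrightarrow> x \<in> U2 \<Longrightarrow> M #>\<^bsub>F\<^esub> x \<in> (\<lambda>x. M #>\<^bsub>F\<^esub> x) ` generate F Y2"
    and Y2m: "\<And>M g d y. M \<lhd> F \<Longrightarrow> R2 \<subseteq> M \<Longrightarrow> (g, d) \<in> HD2 \<Longrightarrow> y \<in> generate F Y2 \<Longrightarrow>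
      M #>\<^bsub>F\<^esub> conj_by F g y \<in> (\<lambda>x. M #>\<^bsub>F\<^esub> x) ` generate F (\<Union>b\<in>short_words P2 d. conj_by F (word_val F e b) ` generate F Y2)"
    by (rule \<phi>2.filtration_relations[OF Bn D2 eP2 U2 HD2]) (assumption | rule that; assumption)+
  have Y1c: "Y1 \<subseteq> carrier F" and Y2c: "Y2 \<subseteq> carrier F" using Y1(2) Y2(2) A.subset B.subset by auto
  let ?base = "\<lambda>(m, x, y). conj_by F (?ev m) x \<otimes>\<^bsub>F\<^esub> y \<otimes>\<^bsub>F\<^esub> inv\<^bsub>F\<^esub> conj_by F (?ev m) x \<otimes>\<^bsub>F\<^esub> inv\<^bsub>F\<^esub> y"
  \<comment> \<open>Monomials with exponents up to \<open>3 * Z\<close> have at most this length.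
    Commutation of the generators is enough for the generated subgroups.\<close>
  define R3 where "R3 = ?base ` (short_words {..<n} (n * nat (3 * Z)) \<times> Y1 \<times> Y2)"
  have finR3: "finite R3" unfolding R3_def using Y1(1) Y2(1) by (intro finite_imageI finite_cartesian_product finite_short_words) auto
  have R3: "R3 \<subseteq> A \<inter> B"
    unfolding R3_def
  proof (rule image_subsetI)
    fix q assume "q \<in> short_words {..<n} (n * nat (3 * Z)) \<times> Y1 \<times> Y2"
    then obtain m x y where q: "q = (m, x, y)" and m: "m \<in> ?W" and x: "x \<in> Y1" and y: "y \<in> Y2" by auto
    have "conj_by F (?ev m) x \<in> A" using x Y1(2) by (intro F.normal_conj_by[OF An L.word_val_closed[OF m]]) blast
    then have "?base (m, x, y) \<in> commutators F A B" using y Y2(2) unfolding commutators_def by auto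
    then show "?base q \<in> A \<inter> B" unfolding q by (rule subsetD[OF F.commutators_subset[OF An Bn]])
  qed
  show ?thesis
  proof (rule that[of "R1 \<union> R2 \<union> R3"])
    show "finite (R1 \<union> R2 \<union> R3)" using Y1(3) Y2(3) finR3 by simp
    show "R1 \<union> R2 \<union> R3 \<subseteq> A \<inter> B" using Y1(4) Y2(4) R3 unfolding Z1 Z2 by (intro Un_least)
    fix M assume M: "M \<lhd> F" and "R1 \<union> R2 \<union> R3 \<subseteq> M"
    then have RM: "R1 \<subseteq> M" "R2 \<subseteq> M" "R3 \<subseteq> M" by auto
    note Y1U = Y1U[OF M RM(1)] and Y1m = Y1m[OF M RM(1)] and Y2U = Y2U[OF M RM(2)] and Y2m = Y2m[OF M RM(2)]
    interpret M: normal M F by fact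
    define \<rho> where "\<rho> = (\<lambda>x. M #>\<^bsub>F\<^esub> x)"
    interpret \<rho>: group_hom F "F Mod M" \<rho> unfolding \<rho>_def by (rule M.Mod_hom)
    let ?\<Gamma> = "F Mod M"
    let ?P1 = "generate F Y1" and ?P2 = "generate F Y2"
    have \<rho>surj: "\<rho> ` carrier F = carrier ?\<Gamma>" unfolding \<rho>_def by (rule M.Mod_surj)
    note P1s = F.generate_is_subgroup[OF Y1c] and P2s = F.generate_is_subgroup[OF Y2c]
    note P1c = subgroup.subset[OF P1s] and P2c = subgroup.subset[OF P2s]
    let ?v = "word_val ?\<Gamma> (\<rho> \<circ> e)"
    have ev: "?v w = \<rho> (?ev w)" if "w \<in> ?W" for w
      using L.hom_word_val[OF \<rho>.H.is_group \<rho>.homh that] by simp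
    have U1\<rho>: "\<rho> x \<in> \<rho> ` ?P1" if "x \<in> U1" for x using Y1U[OF that] unfolding \<rho>_def .
    have U2\<rho>: "\<rho> x \<in> \<rho> ` ?P2" if "x \<in> U2" for x using Y2U[OF that] unfolding \<rho>_def .
    have moved1: "\<rho> (conj_by F g y) \<in> generate ?\<Gamma> (\<Union>b\<in>short_words P1 d. conj_by ?\<Gamma> (?v b) ` (\<rho> ` ?P1))"
      if "(g, d) \<in> HD1" "y \<in> ?P1" for g d y
      using Y1m[OF that] unfolding \<rho>_def[symmetric] \<rho>.hom_generate_conj_words[OF eP1 P1c] .
    have moved2: "\<rho> (conj_by F g y) \<in> generate ?\<Gamma> (\<Union>b\<in>short_words P2 d. conj_by ?\<Gamma> (?v b) ` (\<rho> ` ?P2))"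
      if "(g, d) \<in> HD2" "y \<in> ?P2" for g d y
      using Y2m[OF that] unfolding \<rho>_def[symmetric] \<rho>.hom_generate_conj_words[OF eP2 P2c] .
    have short0: "short_words P 0 = {[]}" for P :: "nat set" by auto
    have \<rho>P1: "subgroup (\<rho> ` ?P1) ?\<Gamma>" and \<rho>P2: "subgroup (\<rho> ` ?P2) ?\<Gamma>"
      by (rule \<rho>.subgroup_img_is_subgroup[OF P1s], rule \<rho>.subgroup_img_is_subgroup[OF P2s])
    have gen_self: "generate ?\<Gamma> (\<Union>b\<in>short_words P 0. conj_by ?\<Gamma> (?v b) ` S) \<subseteq> S"
      if S: "subgroup S ?\<Gamma>" for S and P :: "nat set"
      unfolding short0 by (rule \<rho>.H.generate_subgroup_incl[OF _ S]) (use subgroup.mem_carrier[OF S] in auto)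
    have comm\<rho>: "\<exists>x\<in>\<rho> ` ?P1. \<exists>y\<in>\<rho> ` ?P2. \<rho> c = x \<otimes>\<^bsub>?\<Gamma>\<^esub> y" if c: "c \<in> ?C" for c
    proof -
      have a: "fst (\<alpha> c) \<in> A" "snd (\<alpha> c) \<in> B" "c = fst (\<alpha> c) \<otimes>\<^bsub>F\<^esub> snd (\<alpha> c)" using \<alpha> Cc c by auto
      have "\<rho> c = \<rho> (fst (\<alpha> c)) \<otimes>\<^bsub>?\<Gamma>\<^esub> \<rho> (snd (\<alpha> c))" using a(1,2) by (subst a(3)) simp
      moreover have "\<rho> (fst (\<alpha> c)) \<in> \<rho> ` ?P1" "\<rho> (snd (\<alpha> c)) \<in> \<rho> ` ?P2"
        using c by (auto intro!: U1\<rho> U2\<rho> simp: U1_def U2_def)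
      ultimately show ?thesis by blast
    qed
    have lv: "letter_val ?\<Gamma> (\<rho> \<circ> e) a = \<rho> (letter_val F e a)" if "fst a < n" for a
      using ev[of "[a]"] that e[of "fst a"] by (auto simp: letter_val_def mem_Times_iff)
    have \<Theta>P1: "conj_by ?\<Gamma> t x \<in> \<rho> ` ?P1" if t: "t \<in> \<rho> ` \<Theta>" and x: "x \<in> \<rho> ` ?P1" for t x
    proof -
      obtain t' x' where t': "t' \<in> \<Theta>" "t = \<rho> t'" and x': "x' \<in> ?P1" "x = \<rho> x'" using t x by blast
      have "(t', 0) \<in> HD1" using t'(1) by (simp add: HD1_def)
      from moved1[OF this x'(1)] have "\<rho> (conj_by F t' x') \<in> \<rho> ` ?P1" using gen_self[OF \<rho>P1] by blast
      moreover have "t' \<in> carrier F" "x' \<in> carrier F" using t'(1) x'(1) \<Theta>(2) P1c by auto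
      ultimately show ?thesis unfolding t'(2) x'(2) by (simp only: \<rho>.hom_conj_by)
    qed
    have \<Theta>P2: "conj_by ?\<Gamma> t x \<in> \<rho> ` ?P2" if t: "t \<in> \<rho> ` \<Theta>" and x: "x \<in> \<rho> ` ?P2" for t x
    proof -
      obtain t' x' where t': "t' \<in> \<Theta>" "t = \<rho> t'" and x': "x' \<in> ?P2" "x = \<rho> x'" using t x by blast
      have "(t', 0) \<in> HD2" using t'(1) by (simp add: HD2_def)
      from moved2[OF this x'(1)] have "\<rho> (conj_by F t' x') \<in> \<rho> ` ?P2" using gen_self[OF \<rho>P2] by blast
      moreover have "t' \<in> carrier F" "x' \<in> carrier F" using t'(1) x'(1) \<Theta>(2) P2c by auto
      ultimately show ?thesis unfolding t'(2) x'(2) by (simp only: \<rho>.hom_conj_by)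
    qed
    have commuting: "commuting_pair ?\<Gamma> (\<rho> ` ?P1) (\<rho> ` ?P2) n (\<rho> \<circ> e) (\<rho> ` \<Theta>) z Z"
    proof (intro commuting_pair.intro commuting_pair_axioms.intro)
      show "group ?\<Gamma>" by (rule \<rho>.H.is_group)
      show "subgroup (\<rho> ` ?P1) ?\<Gamma>" "subgroup (\<rho> ` ?P2) ?\<Gamma>" by (rule \<rho>P1, rule \<rho>P2)
      show "(\<rho> \<circ> e) j \<in> carrier ?\<Gamma>" if "j < n" for j using e[OF that] by simp
      show "\<rho> ` \<Theta> \<subseteq> carrier ?\<Gamma>" using \<Theta>(2) by auto
      show "inv\<^bsub>?\<Gamma>\<^esub> t \<in> \<rho> ` \<Theta>" if "t \<in> \<rho> ` \<Theta>" for t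
      proof -
        obtain t' where t': "t' \<in> \<Theta>" "t = \<rho> t'" using \<open>t \<in> \<rho> ` \<Theta>\<close> by blast
        then have "inv\<^bsub>?\<Gamma>\<^esub> t = \<rho> (inv\<^bsub>F\<^esub> t')" using \<Theta>(2) by auto
        then show ?thesis using \<Theta>(3)[OF t'(1)] by blast
      qed
      show "conj_by ?\<Gamma> t x \<in> \<rho> ` ?P1" if "t \<in> \<rho> ` \<Theta>" "x \<in> \<rho> ` ?P1" for t x by (rule \<Theta>P1[OF that])
      show "conj_by ?\<Gamma> t x \<in> \<rho> ` ?P2" if "t \<in> \<rho> ` \<Theta>" "x \<in> \<rho> ` ?P2" for t x by (rule \<Theta>P2[OF that])
      show "0 \<le> Z" by (rule Z)
      show "z \<epsilon> c \<noteq> 0 \<and> (z \<epsilon> c > 0 \<longleftrightarrow> \<epsilon> c) \<and> \<bar>z \<epsilon> c\<bar> \<le> Z" if "c < n" for c \<epsilon> by (rule z[OF that])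
      show "generate ?\<Gamma> ((\<rho> \<circ> e) ` {..<n} \<union> \<rho> ` \<Theta>) = carrier ?\<Gamma>"
      proof -
        have "(\<rho> \<circ> e) ` {..<n} \<union> \<rho> ` \<Theta> = \<rho> ` (e ` {..<n} \<union> \<Theta>)" by (simp add: image_Un image_comp)
        moreover have "e ` {..<n} \<union> \<Theta> \<subseteq> carrier F" using e \<Theta>(2) by auto
        ultimately show ?thesis using \<rho>.generate_img gen \<rho>surj by simp
      qed
    next
      fix a b :: "nat letter" assume ab: "fst a < n" "fst b < n"
      let ?a = "letter_val F e a" and ?b = "letter_val F e b"
      have ac: "?a \<in> carrier F" and bc: "?b \<in> carrier F" using ab by simp_all
      have W: "[a, b] \<in> ?W" "[b, a] \<in> ?W" using ab by (auto simp: mem_Times_iff)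
      have \<Lambda>ab: "?a \<in> ?\<Lambda>" "?b \<in> ?\<Lambda>" using ab by (auto intro!: imageI simp: mem_Times_iff)
      let ?c = "inv\<^bsub>F\<^esub> ?a \<otimes>\<^bsub>F\<^esub> inv\<^bsub>F\<^esub> ?b \<otimes>\<^bsub>F\<^esub> inv\<^bsub>F\<^esub> (inv\<^bsub>F\<^esub> ?a) \<otimes>\<^bsub>F\<^esub> inv\<^bsub>F\<^esub> (inv\<^bsub>F\<^esub> ?b)"
      have "?c \<in> ?C" unfolding commutators_def using \<Lambda>ab by blast
      then obtain x y where xy: "x \<in> \<rho> ` ?P1" "y \<in> \<rho> ` ?P2" "\<rho> ?c = x \<otimes>\<^bsub>?\<Gamma>\<^esub> y" using comm\<rho> by blast
      have "?ev [a, b] = ?ev [b, a] \<otimes>\<^bsub>F\<^esub> ?c" using ac bc by (simp add: F.m_assoc)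
      then have "\<rho> (?ev [a, b]) = \<rho> (?ev [b, a]) \<otimes>\<^bsub>?\<Gamma>\<^esub> \<rho> ?c"
        using \<rho>.hom_mult[OF L.word_val_closed[OF W(2)], of ?c] ac bc by simp
      then show "\<exists>x\<in>\<rho> ` ?P1. \<exists>y\<in>\<rho> ` ?P2. ?v [a, b] = ?v [b, a] \<otimes>\<^bsub>?\<Gamma>\<^esub> (x \<otimes>\<^bsub>?\<Gamma>\<^esub> y)"
        unfolding ev[OF W(1)] ev[OF W(2)] xy(3) using xy(1,2) by blast
    next
      fix t and a :: "nat letter" assume t: "t \<in> \<rho> ` \<Theta>" and a: "fst a < n"
      obtain t' where t': "t' \<in> \<Theta>" "t = \<rho> t'" using t by blast
      let ?a = "letter_val F e a"
      have ac: "?a \<in> carrier F" and tc: "t' \<in> carrier F" using a t'(1) \<Theta>(2) by auto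
      let ?c = "t' \<otimes>\<^bsub>F\<^esub> ?a \<otimes>\<^bsub>F\<^esub> inv\<^bsub>F\<^esub> t' \<otimes>\<^bsub>F\<^esub> inv\<^bsub>F\<^esub> ?a"
      have "?a \<in> ?\<Lambda>" using a by (auto intro!: imageI simp: mem_Times_iff)
      then have "?c \<in> ?C" unfolding commutators_def using t'(1) by blast
      then obtain x y where xy: "x \<in> \<rho> ` ?P1" "y \<in> \<rho> ` ?P2" "\<rho> ?c = x \<otimes>\<^bsub>?\<Gamma>\<^esub> y" using comm\<rho> by blast
      have "t' \<otimes>\<^bsub>F\<^esub> ?a = ?c \<otimes>\<^bsub>F\<^esub> (?a \<otimes>\<^bsub>F\<^esub> t')" using ac tc by (simp add: F.m_assoc)
      then have "\<rho> (t' \<otimes>\<^bsub>F\<^esub> ?a) = \<rho> ?c \<otimes>\<^bsub>?\<Gamma>\<^esub> \<rho> (?a \<otimes>\<^bsub>F\<^esub> t')"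
        using \<rho>.hom_mult[of ?c "?a \<otimes>\<^bsub>F\<^esub> t'"] ac tc by simp
      then have "t \<otimes>\<^bsub>?\<Gamma>\<^esub> \<rho> ?a = (x \<otimes>\<^bsub>?\<Gamma>\<^esub> y) \<otimes>\<^bsub>?\<Gamma>\<^esub> (\<rho> ?a \<otimes>\<^bsub>?\<Gamma>\<^esub> t)"
        unfolding xy(3) t'(2) using \<rho>.hom_mult[OF tc ac] \<rho>.hom_mult[OF ac tc] by simp
      then show "\<exists>x\<in>\<rho> ` ?P1. \<exists>y\<in>\<rho> ` ?P2. t \<otimes>\<^bsub>?\<Gamma>\<^esub> letter_val ?\<Gamma> (\<rho> \<circ> e) a = (x \<otimes>\<^bsub>?\<Gamma>\<^esub> y) \<otimes>\<^bsub>?\<Gamma>\<^esub> (letter_val ?\<Gamma> (\<rho> \<circ> e) a \<otimes>\<^bsub>?\<Gamma>\<^esub> t)"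
        unfolding lv[OF a] using xy(1,2) by blast
    next
      fix \<delta> :: "nat \<Rightarrow> int" and x y
      assume \<delta>: "\<And>c. c < n \<Longrightarrow> \<bar>\<delta> c\<bar> \<le> 3 * Z" and x: "x \<in> \<rho> ` ?P1" and y: "y \<in> \<rho> ` ?P2"
      let ?m = "monomial [0..<n] \<delta>"
      have m: "?m \<in> ?W" by (rule monomial_in_lists) auto
      have "int (length ?m) = (\<Sum>i<n. \<bar>\<delta> i\<bar>)"
        unfolding length_monomial by (simp add: interv_sum_list_conv_sum_set_nat atLeast0LessThan)
      also have "\<dots> \<le> (\<Sum>i<n. 3 * Z)" by (rule sum_mono) (use \<delta> in auto)
      also have "\<dots> = int (n * nat (3 * Z))" using Z by simp
      finally have "length ?m \<le> n * nat (3 * Z)" by (rule iffD1[OF of_nat_le_iff])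
      then have m': "?m \<in> short_words {..<n} (n * nat (3 * Z))" using m by blast
      let ?g = "\<rho> (?ev ?m)"
      have evc: "?ev ?m \<in> carrier F" by (rule L.word_val_closed[OF m])
      have gc: "?g \<in> carrier ?\<Gamma>" using evc by simp
      have step: "conj_by ?\<Gamma> ?g s \<otimes>\<^bsub>?\<Gamma>\<^esub> w = w \<otimes>\<^bsub>?\<Gamma>\<^esub> conj_by ?\<Gamma> ?g s" if sw: "s \<in> \<rho> ` Y1" "w \<in> \<rho> ` Y2" for s w
      proof -
        obtain s' w' where s': "s' \<in> Y1" "s = \<rho> s'" and w': "w' \<in> Y2" "w = \<rho> w'" using sw by blast
        have c: "s' \<in> carrier F" "w' \<in> carrier F" using s'(1) w'(1) Y1c Y2c by auto
        let ?k = "conj_by F (?ev ?m) s'"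
        have kc: "?k \<in> carrier F" using evc c(1) by simp
        have "?base (?m, s', w') \<in> M" using RM(3) m' s'(1) w'(1) unfolding R3_def by blast
        then have "?k \<otimes>\<^bsub>F\<^esub> w' \<otimes>\<^bsub>F\<^esub> inv\<^bsub>F\<^esub> (w' \<otimes>\<^bsub>F\<^esub> ?k) \<in> M"
          using kc c(2) by (simp add: F.inv_mult_group F.m_assoc)
        then have "\<rho> (?k \<otimes>\<^bsub>F\<^esub> w') = \<rho> (w' \<otimes>\<^bsub>F\<^esub> ?k)"
          unfolding \<rho>_def using M.Mod_eq_iff[of "?k \<otimes>\<^bsub>F\<^esub> w'" "w' \<otimes>\<^bsub>F\<^esub> ?k"] kc c(2) by simp
        then show ?thesis
          unfolding s'(2) w'(2) using \<rho>.hom_mult[OF kc c(2)] \<rho>.hom_mult[OF c(2) kc] \<rho>.hom_conj_by[OF evc c(1)] by simp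
      qed
      have Y1\<rho>: "\<rho> ` Y1 \<subseteq> carrier ?\<Gamma>" and Y2\<rho>: "\<rho> ` Y2 \<subseteq> carrier ?\<Gamma>" using Y1c Y2c by auto
      have cY1: "conj_by ?\<Gamma> ?g ` \<rho> ` Y1 \<subseteq> carrier ?\<Gamma>" using Y1\<rho> gc by auto
      have xg: "conj_by ?\<Gamma> ?g x \<in> generate ?\<Gamma> (conj_by ?\<Gamma> ?g ` \<rho> ` Y1)"
        using x \<rho>.H.conj_by_generate[OF gc Y1\<rho>] \<rho>.generate_img[OF Y1c] by auto
      have yg: "y \<in> generate ?\<Gamma> (\<rho> ` Y2)" using y \<rho>.generate_img[OF Y2c] by simp
      have "y \<otimes>\<^bsub>?\<Gamma>\<^esub> s = s \<otimes>\<^bsub>?\<Gamma>\<^esub> y" if "s \<in> conj_by ?\<Gamma> ?g ` \<rho> ` Y1" for s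
        by (rule \<rho>.H.generate_commute[OF Y2\<rho> cY1 _ yg that]) (use step in auto)
      then have "conj_by ?\<Gamma> ?g x \<otimes>\<^bsub>?\<Gamma>\<^esub> y = y \<otimes>\<^bsub>?\<Gamma>\<^esub> conj_by ?\<Gamma> ?g x"
        using \<rho>.H.generate_commute[OF cY1 _ _ xg, of "{y}"] subgroup.mem_carrier[OF \<rho>P2 y] by simp
      then show "conj_by ?\<Gamma> (?v ?m) x \<otimes>\<^bsub>?\<Gamma>\<^esub> y = y \<otimes>\<^bsub>?\<Gamma>\<^esub> conj_by ?\<Gamma> (?v ?m) x"
        unfolding ev[OF m] .
    next
      fix \<epsilon> :: "nat \<Rightarrow> bool"
      have z0: "z \<epsilon> c \<noteq> 0" if "c < n" for c using z[OF that] by blast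
      have len: "length (proj c h) = nat \<bar>z \<epsilon> c\<bar>" if "has_exponents n (z \<epsilon>) h" "c < n" for h c
        using that by (simp add: has_exponents_def)
      from move[of \<epsilon>] show "(\<forall>h. has_exponents n (z \<epsilon>) h \<longrightarrow> (\<exists>B. narrow n (z \<epsilon>) B \<and>
            (\<forall>x\<in>\<rho> ` ?P1. conj_by ?\<Gamma> (?v h) x \<in>
              generate ?\<Gamma> (\<Union>b\<in>B. conj_by ?\<Gamma> (?v b) ` \<rho> ` ?P1)))) \<or>
        (\<forall>h. has_exponents n (z \<epsilon>) h \<longrightarrow> (\<exists>B. narrow n (z \<epsilon>) B \<and>
            (\<forall>y\<in>\<rho> ` ?P2. conj_by ?\<Gamma> (inv\<^bsub>?\<Gamma>\<^esub> ?v h) y \<in>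
              generate ?\<Gamma> (\<Union>b\<in>B. conj_by ?\<Gamma> (inv\<^bsub>?\<Gamma>\<^esub> ?v b) ` \<rho> ` ?P2))))"
      proof (elim disjE)
        assume *: "\<forall>h. has_exponents n (z \<epsilon>) h \<longrightarrow>
          (\<exists>d. (\<forall>c\<in>P1. int d < \<bar>z \<epsilon> c\<bar>) \<and>
            (\<exists>r0. \<forall>r\<ge>r0. \<forall>x\<in>D1 r. conj_by G1 (\<phi>1 (?ev h)) x \<in> D1 (r + d)))"
        show ?thesis
        proof (intro disjI1 allI impI)
          fix h assume h: "has_exponents n (z \<epsilon>) h"
          have hc: "?ev h \<in> carrier F" and evh: "?v h = \<rho> (?ev h)"
            using h ev by (auto simp: has_exponents_def)
          have Q1_iff: "Q1 h d \<longleftrightarrow> (\<forall>c\<in>P1. int d < \<bar>z \<epsilon> c\<bar>) \<and>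
              (\<exists>r0. \<forall>r\<ge>r0. \<forall>x\<in>D1 r. conj_by G1 (\<phi>1 (?ev h)) x \<in> D1 (r + d))" for d
            unfolding Q1_def using len[OF h] P1 by (intro conj_cong ball_cong refl) (auto simp: zless_nat_eq_int_zless)
          have Q: "Q1 h (\<delta>1 h)" unfolding \<delta>1_def by (rule someI_ex) (use * h Q1_iff in blast)
          then have hd: "(?ev h, \<delta>1 h) \<in> HD1" using HsI[OF h] by (simp add: HD1_def)
          have "conj_by ?\<Gamma> (?v h) x \<in>
              generate ?\<Gamma> (\<Union>b\<in>short_words P1 (\<delta>1 h). conj_by ?\<Gamma> (?v b) ` \<rho> ` ?P1)"
            if "x \<in> \<rho> ` ?P1" for x
          proof -
            obtain x' where x': "x' \<in> ?P1" "x = \<rho> x'" using \<open>x \<in> \<rho> ` ?P1\<close> by blast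
            show ?thesis
              using moved1[OF hd x'(1)] unfolding evh x'(2) \<rho>.hom_conj_by[OF hc subsetD[OF P1c x'(1)]] .
          qed
          moreover have "narrow n (z \<epsilon>) (short_words P1 (\<delta>1 h))"
            by (rule narrow_short_words(1)[OF P1 _ z0]) (use Q Q1_iff in blast)
          ultimately show "\<exists>B. narrow n (z \<epsilon>) B \<and> (\<forall>x\<in>\<rho> ` ?P1. conj_by ?\<Gamma> (?v h) x \<in>
              generate ?\<Gamma> (\<Union>b\<in>B. conj_by ?\<Gamma> (?v b) ` \<rho> ` ?P1))" by blast
        qed
      next
        assume *: "\<forall>h. has_exponents n (z \<epsilon>) h \<longrightarrow>
          (\<exists>d. (\<forall>c\<in>P2. int d < \<bar>z \<epsilon> c\<bar>) \<and>
            (\<exists>r0. \<forall>r\<ge>r0. \<forall>x\<in>D2 r. conj_by G2 (\<phi>2 (inv\<^bsub>F\<^esub> ?ev h)) x \<in> D2 (r + d)))"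
        show ?thesis
        proof (intro disjI2 allI impI)
          fix h assume h: "has_exponents n (z \<epsilon>) h"
          have hc: "?ev h \<in> carrier F" and evh: "?v h = \<rho> (?ev h)"
            using h ev by (auto simp: has_exponents_def)
          have Q2_iff: "Q2 h d \<longleftrightarrow> (\<forall>c\<in>P2. int d < \<bar>z \<epsilon> c\<bar>) \<and>
              (\<exists>r0. \<forall>r\<ge>r0. \<forall>x\<in>D2 r. conj_by G2 (\<phi>2 (inv\<^bsub>F\<^esub> ?ev h)) x \<in> D2 (r + d))" for d
            unfolding Q2_def using len[OF h] P2 by (intro conj_cong ball_cong refl) (auto simp: zless_nat_eq_int_zless)
          have Q: "Q2 h (\<delta>2 h)" unfolding \<delta>2_def by (rule someI_ex) (use * h Q2_iff in blast)
          then have hd: "(inv\<^bsub>F\<^esub> ?ev h, \<delta>2 h) \<in> HD2" using HsI[OF h] by (simp add: HD2_def)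
          interpret \<Gamma>L: letters ?\<Gamma> "\<rho> \<circ> e" "{..<n}" using e by unfold_locales auto
          \<comment> \<open>The filtration gives conjugates by short words, whereas
            \<open>move\<close> asks for conjugates by inverses of words. Formal inversion
            translates between them and keeps the words narrow.\<close>
          let ?i = "\<lambda>b :: nat letter list. rev (map inv_letter b)"
          have sub: "short_words P2 (\<delta>2 h) \<subseteq> ?W" by (rule short_words_lists[OF P2])
          have "?v b = inv\<^bsub>?\<Gamma>\<^esub> ?v (?i b)" if "b \<in> short_words P2 (\<delta>2 h)" for b
            using \<Gamma>L.word_val_inverse[of b] \<Gamma>L.word_val_closed[of b] subsetD[OF sub that] by simp
          then have union: "(\<Union>b\<in>short_words P2 (\<delta>2 h). conj_by ?\<Gamma> (?v b) ` \<rho> ` ?P2) =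
              (\<Union>b\<in>?i ` short_words P2 (\<delta>2 h). conj_by ?\<Gamma> (inv\<^bsub>?\<Gamma>\<^esub> ?v b) ` \<rho> ` ?P2)"
            by (simp add: SUP_image comp_def)
          have "conj_by ?\<Gamma> (inv\<^bsub>?\<Gamma>\<^esub> ?v h) y \<in>
              generate ?\<Gamma> (\<Union>b\<in>?i ` short_words P2 (\<delta>2 h). conj_by ?\<Gamma> (inv\<^bsub>?\<Gamma>\<^esub> ?v b) ` \<rho> ` ?P2)"
            if "y \<in> \<rho> ` ?P2" for y
          proof -
            obtain y' where y': "y' \<in> ?P2" "y = \<rho> y'" using \<open>y \<in> \<rho> ` ?P2\<close> by blast
            show ?thesis
              using moved2[OF hd y'(1)] hc
              unfolding evh y'(2) \<rho>.hom_conj_by[OF F.inv_closed[OF hc] subsetD[OF P2c y'(1)]] union by simp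
          qed
          moreover have "narrow n (z \<epsilon>) (?i ` short_words P2 (\<delta>2 h))"
            by (rule narrow_short_words(2)[OF P2 _ z0]) (use Q Q2_iff in blast)
          ultimately show "\<exists>B. narrow n (z \<epsilon>) B \<and> (\<forall>y\<in>\<rho> ` ?P2. conj_by ?\<Gamma> (inv\<^bsub>?\<Gamma>\<^esub> ?v h) y \<in>
              generate ?\<Gamma> (\<Union>b\<in>B. conj_by ?\<Gamma> (inv\<^bsub>?\<Gamma>\<^esub> ?v b) ` \<rho> ` ?P2))" by blast
        qed
      qed
    qed
    obtain S1 S2 where S: "S1 \<lhd> ?\<Gamma>" "S2 \<lhd> ?\<Gamma>" "\<rho> ` ?P1 \<subseteq> S1" "\<rho> ` ?P2 \<subseteq> S2"
      "\<And>x y. x \<in> S1 \<Longrightarrow> y \<in> S2 \<Longrightarrow> x \<otimes>\<^bsub>?\<Gamma>\<^esub> y = y \<otimes>\<^bsub>?\<Gamma>\<^esub> x"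
      by (rule commuting_pair.commuting_normal_subgroups[OF commuting]) (rule that; assumption)
    have "A \<subseteq> {x \<in> carrier F. \<rho> x \<in> S1}"
      unfolding TA(3)
      by (rule F.normal_closure_min[OF \<rho>.vimage_normal[OF S(1)]]) (use TA(2) U1\<rho> S(3) in \<open>auto simp: U1_def\<close>)
    moreover have "B \<subseteq> {x \<in> carrier F. \<rho> x \<in> S2}"
      unfolding TB(3)
      by (rule F.normal_closure_min[OF \<rho>.vimage_normal[OF S(2)]]) (use TB(2) U2\<rho> S(4) in \<open>auto simp: U2_def\<close>)
    ultimately have AB: "\<rho> x \<otimes>\<^bsub>?\<Gamma>\<^esub> \<rho> y = \<rho> y \<otimes>\<^bsub>?\<Gamma>\<^esub> \<rho> x" if "x \<in> A" "y \<in> B" for x y using S(5) that by blast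
    show "commutators F A B \<subseteq> M"
    proof
      fix w assume "w \<in> commutators F A B"
      then obtain x y where xy: "x \<in> A" "y \<in> B" "w = x \<otimes>\<^bsub>F\<^esub> y \<otimes>\<^bsub>F\<^esub> inv\<^bsub>F\<^esub> x \<otimes>\<^bsub>F\<^esub> inv\<^bsub>F\<^esub> y" by (auto simp: commutators_def)
      then have c: "x \<in> carrier F" "y \<in> carrier F" by auto
      have "M #>\<^bsub>F\<^esub> (x \<otimes>\<^bsub>F\<^esub> y) = M #>\<^bsub>F\<^esub> (y \<otimes>\<^bsub>F\<^esub> x)"
        using AB[OF xy(1,2)] \<rho>.hom_mult[OF c] \<rho>.hom_mult[OF c(2,1)] unfolding \<rho>_def by simp
      then have "x \<otimes>\<^bsub>F\<^esub> y \<otimes>\<^bsub>F\<^esub> inv\<^bsub>F\<^esub> (y \<otimes>\<^bsub>F\<^esub> x) \<in> M" using M.Mod_eq_iff[of "x \<otimes>\<^bsub>F\<^esub> y" "y \<otimes>\<^bsub>F\<^esub> x"] c by simp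
      then show "w \<in> M" unfolding xy(3) using c by (simp add: F.inv_mult_group F.m_assoc)
    qed
  qed
qed

section \<open>Exponent vectors for all orthants\<close>

lemma sg_pos_iff: "sg b * x > 0 \<Longrightarrow> x \<noteq> 0 \<and> (x > 0 \<longleftrightarrow> b)"
  by (cases b) auto

text \<open>In the first alternative \<open>z\<close> is a combination of the \<open>q\<close>, in
  the second of the \<open>p'\<close> of the overview. The inequalities say that the shift caused by
  the coefficients stays below every coordinate in which that filtration measures depth.\<close>

theorem ex_exponents:
  fixes m k C1 C2 :: nat
  obtains V :: "nat \<Rightarrow> nat \<Rightarrow> int" and s :: int and z :: "(nat \<Rightarrow> bool) \<Rightarrow> nat \<Rightarrow> int" and Z :: int where
    "0 \<le> Z" "\<And>\<epsilon> j. j < m + k \<Longrightarrow> z \<epsilon> j \<noteq> 0 \<and> (z \<epsilon> j > 0 \<longleftrightarrow> \<epsilon> j) \<and> \<bar>z \<epsilon> j\<bar> \<le> Z"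
    "\<And>\<epsilon>. (\<forall>c<k. z \<epsilon> (m + c) = s * (\<Sum>i<m. V i c * z \<epsilon> i) \<and>
        int (nat (\<Sum>i<m. \<bar>z \<epsilon> i\<bar>) * C1) < \<bar>z \<epsilon> (m + c)\<bar>) \<or>
      (\<forall>i<m. z \<epsilon> i = - s * (\<Sum>c<k. V i c * z \<epsilon> (m + c)) \<and>
        int (nat (\<Sum>c<k. \<bar>z \<epsilon> (m + c)\<bar>) * C2) < \<bar>z \<epsilon> i\<bar>)"
proof -
  obtain V where V: "\<And>\<epsilon> \<eta>. signs_realised V m k \<epsilon> \<eta>" using ex_sign_matrix[of k m] by blast
  define L where "L \<epsilon> y \<longleftrightarrow> (\<forall>i<m. sg (\<epsilon> i) * y i > 0) \<and>
    (\<forall>c<k. sg (\<epsilon> (m + c)) * (\<Sum>i<m. V i c * y i) > 0)" for \<epsilon> and y :: "nat \<Rightarrow> int"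
  define R where "R \<epsilon> y \<longleftrightarrow> (\<forall>c<k. sg (\<epsilon> (m + c)) * y (m + c) > 0) \<and>
    (\<forall>i<m. sg (\<epsilon> i) * (\<Sum>c<k. V i c * y (m + c)) < 0)" for \<epsilon> and y :: "nat \<Rightarrow> int"
  have "\<exists>y. L \<epsilon> y \<or> R \<epsilon> y" for \<epsilon>
    using V[of \<epsilon> "\<lambda>c. \<epsilon> (m + c)"] unfolding signs_realised_def
  proof (elim disjE exE)
    fix \<tau> assume "(\<forall>i<m. sg (\<epsilon> i) * \<tau> i > 0) \<and> (\<forall>c<k. sg (\<epsilon> (m + c)) * (\<Sum>i<m. \<tau> i * V i c) > 0)"
    then have "L \<epsilon> \<tau>" by (simp add: L_def mult.commute)
    then show ?thesis by blast
  next
    fix \<sigma> assume "(\<forall>c<k. sg (\<epsilon> (m + c)) * \<sigma> c > 0) \<and> (\<forall>i<m. sg (\<epsilon> i) * (\<Sum>c<k. V i c * \<sigma> c) < 0)"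
    then have "R \<epsilon> (\<lambda>j. \<sigma> (j - m))" by (simp add: R_def)
    then show ?thesis by blast
  qed
  then have "\<forall>\<epsilon>. \<exists>y. L \<epsilon> y \<or> R \<epsilon> y" by blast
  from choice[OF this] obtain y0 where y0: "\<forall>\<epsilon>. L \<epsilon> (y0 \<epsilon>) \<or> R \<epsilon> (y0 \<epsilon>)" by (elim exE)
  \<comment> \<open>Only the signs at the first \<open>m + k\<close> indices matter. Cutting off the
    others leaves finitely many patterns, so that the bounds \<open>W\<close> and \<open>Z\<close>
    are uniform.\<close>
  define cut where "cut \<epsilon> = (\<lambda>j. j < m + k \<and> \<epsilon> j)" for \<epsilon> :: "nat \<Rightarrow> bool"
  have cut_cut: "cut (cut \<epsilon>) = cut \<epsilon>" for \<epsilon> by (auto simp: cut_def)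
  have L_cut: "L (cut \<epsilon>) y = L \<epsilon> y" and R_cut: "R (cut \<epsilon>) y = R \<epsilon> y" for \<epsilon> y
    by (simp_all add: L_def R_def cut_def)
  have fin: "finite (range cut)"
    by (rule finite_subset[OF _ finite_bounded_support[of "m + k"]]) (auto simp: cut_def)
  define y where "y \<epsilon> = y0 (cut \<epsilon>)" for \<epsilon>
  have LR: "L \<epsilon> (y \<epsilon>) \<or> R \<epsilon> (y \<epsilon>)" for \<epsilon> using y0 L_cut R_cut unfolding y_def by blast
  define W where "W = (\<Sum>f\<in>range cut. \<Sum>j<m + k. \<bar>y0 f j\<bar>)"
  have W0: "0 \<le> W" unfolding W_def by (intro sum_nonneg) simp
  have W: "(\<Sum>j<m + k. \<bar>y \<epsilon> j\<bar>) \<le> W" for \<epsilon>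
    unfolding y_def W_def by (rule member_le_sum[OF _ _ fin]) (auto intro: sum_nonneg)
  have W1: "(\<Sum>i<m. \<bar>y \<epsilon> i\<bar>) \<le> W" for \<epsilon>
    by (rule order_trans[OF sum_mono2 W[of \<epsilon>]]) auto
  have W2: "(\<Sum>c<k. \<bar>y \<epsilon> (m + c)\<bar>) \<le> W" for \<epsilon>
  proof -
    have "(\<Sum>c<k. \<bar>y \<epsilon> (m + c)\<bar>) = (\<Sum>j\<in>(+) m ` {..<k}. \<bar>y \<epsilon> j\<bar>)" by (simp add: sum.reindex)
    also have "\<dots> \<le> (\<Sum>j<m + k. \<bar>y \<epsilon> j\<bar>)" by (rule sum_mono2) auto
    finally show ?thesis using W[of \<epsilon>] by linarith
  qed
  \<comment> \<open>\<open>W\<close> bounds the sum of the absolute coefficients in every orthant,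
    so \<open>s\<close> exceeds the largest possible shift of either filtration.\<close>
  define s where "s = 1 + int (C1 + C2) * W"
  have s: "s > 0" "int C1 * W < s" "int C2 * W < s"
    using W0 by (simp_all add: s_def add_pos_nonneg distrib_right zero_le_mult_iff add_nonneg_nonneg add_strict_increasing)
  have big: "int (nat x * C) < \<bar>s * t\<bar>" if "x \<le> W" "0 \<le> x" "int C * W < s" "t \<noteq> 0" for x t and C :: nat
  proof -
    have "int (nat x * C) = int C * x" using that(2) by simp
    also have "\<dots> \<le> int C * W" using that(1) by (intro mult_left_mono) auto
    also have "\<dots> < s * 1" using that(3) by simp
    also have "\<dots> \<le> s * \<bar>t\<bar>" using that(4) s(1) by (intro mult_left_mono) auto
    finally show ?thesis using s(1) by (simp add: abs_mult)
  qed
  define z where "z \<epsilon> j = (if L \<epsilon> (y \<epsilon>)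
    then (if j < m then y \<epsilon> j else s * (\<Sum>i<m. V i (j - m) * y \<epsilon> i))
    else (if j < m then - s * (\<Sum>c<k. V j c * y \<epsilon> (m + c)) else y \<epsilon> j))" for \<epsilon> j
  have z_cut: "z \<epsilon> j = z (cut \<epsilon>) j" for \<epsilon> j by (simp add: z_def y_def cut_cut L_cut)
  define Z where "Z = (\<Sum>f\<in>range cut. \<Sum>j<m + k. \<bar>z f j\<bar>)"
  have Z: "\<bar>z \<epsilon> j\<bar> \<le> Z" if "j < m + k" for \<epsilon> j
  proof -
    have "\<bar>z (cut \<epsilon>) j\<bar> \<le> (\<Sum>j<m + k. \<bar>z (cut \<epsilon>) j\<bar>)"
      by (rule member_le_sum) (use that in auto)
    also have "\<dots> \<le> Z" unfolding Z_def
      by (rule member_le_sum[where f = "\<lambda>f. \<Sum>j<m + k. \<bar>z f j\<bar>", OF _ _ fin]) (auto intro: sum_nonneg)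
    finally show ?thesis using z_cut[of \<epsilon> j] by simp
  qed
  have main: "(\<forall>j<m + k. z \<epsilon> j \<noteq> 0 \<and> (z \<epsilon> j > 0 \<longleftrightarrow> \<epsilon> j) \<and> \<bar>z \<epsilon> j\<bar> \<le> Z) \<and>
      ((\<forall>c<k. z \<epsilon> (m + c) = s * (\<Sum>i<m. V i c * z \<epsilon> i) \<and>
          int (nat (\<Sum>i<m. \<bar>z \<epsilon> i\<bar>) * C1) < \<bar>z \<epsilon> (m + c)\<bar>) \<or>
       (\<forall>i<m. z \<epsilon> i = - s * (\<Sum>c<k. V i c * z \<epsilon> (m + c)) \<and>
          int (nat (\<Sum>c<k. \<bar>z \<epsilon> (m + c)\<bar>) * C2) < \<bar>z \<epsilon> i\<bar>))" for \<epsilon>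
  proof (cases "L \<epsilon> (y \<epsilon>)")
    case True
    have zm: "z \<epsilon> i = y \<epsilon> i" if "i < m" for i using that True by (simp add: z_def)
    have zk: "z \<epsilon> (m + c) = s * (\<Sum>i<m. V i c * y \<epsilon> i)" for c using True by (simp add: z_def)
    have ym: "sg (\<epsilon> i) * y \<epsilon> i > 0" if "i < m" for i using True that by (simp add: L_def)
    have yk: "sg (\<epsilon> (m + c)) * (\<Sum>i<m. V i c * y \<epsilon> i) > 0" if "c < k" for c using True that by (simp add: L_def)
    have "z \<epsilon> j \<noteq> 0 \<and> (z \<epsilon> j > 0 \<longleftrightarrow> \<epsilon> j)" if j: "j < m + k" for j
    proof (cases "j < m")
      case True
      then show ?thesis using sg_pos_iff[OF ym] zm by simp
    next
      case False
      then obtain c where c: "j = m + c" "c < k" using j by (metis add_less_cancel_left le_add_diff_inverse not_less)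
      show ?thesis unfolding c(1) zk using sg_pos_iff[OF yk[OF c(2)]] s(1) by (simp add: zero_less_mult_iff)
    qed
    moreover have "z \<epsilon> (m + c) = s * (\<Sum>i<m. V i c * z \<epsilon> i) \<and>
        int (nat (\<Sum>i<m. \<bar>z \<epsilon> i\<bar>) * C1) < \<bar>z \<epsilon> (m + c)\<bar>" if c: "c < k" for c
      unfolding zk using big[OF W1[of \<epsilon>] _ s(2)] sg_pos_iff[OF yk[OF c]] by (simp add: zm sum_nonneg)
    ultimately show ?thesis using Z by blast
  next
    case False
    then have Ry: "R \<epsilon> (y \<epsilon>)" using LR by blast
    have zk: "z \<epsilon> (m + c) = y \<epsilon> (m + c)" for c using False by (simp add: z_def)
    have zm: "z \<epsilon> i = - s * (\<Sum>c<k. V i c * y \<epsilon> (m + c))" if "i < m" for i using False that by (simp add: z_def)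
    have yk: "sg (\<epsilon> (m + c)) * y \<epsilon> (m + c) > 0" if "c < k" for c using Ry that by (simp add: R_def)
    have ym: "sg (\<epsilon> i) * - (\<Sum>c<k. V i c * y \<epsilon> (m + c)) > 0" if "i < m" for i using Ry that by (simp add: R_def)
    have "z \<epsilon> j \<noteq> 0 \<and> (z \<epsilon> j > 0 \<longleftrightarrow> \<epsilon> j)" if j: "j < m + k" for j
    proof (cases "j < m")
      case True
      then show ?thesis unfolding zm[OF True] using sg_pos_iff[OF ym[OF True]] s(1) by (auto simp: zero_less_mult_iff mult_less_0_iff)
    next
      case False
      then obtain c where c: "j = m + c" "c < k" using j by (metis add_less_cancel_left le_add_diff_inverse not_less)
      show ?thesis unfolding c(1) zk using sg_pos_iff[OF yk[OF c(2)]] by simp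
    qed
    moreover have "z \<epsilon> i = - s * (\<Sum>c<k. V i c * z \<epsilon> (m + c)) \<and>
        int (nat (\<Sum>c<k. \<bar>z \<epsilon> (m + c)\<bar>) * C2) < \<bar>z \<epsilon> i\<bar>" if i: "i < m" for i
      unfolding zm[OF i] zk using big[OF W2[of \<epsilon>] _ s(3)] sg_pos_iff[OF ym[OF i]] by (simp add: sum_nonneg)
    ultimately show ?thesis using Z by blast
  qed
  show ?thesis
  proof (rule that[of Z z s V])
    show "0 \<le> Z" unfolding Z_def by (intro sum_nonneg) simp
  qed (use main in blast)+
qed

section \<open>Fibre products with abelian quotient\<close>

lemma (in group) commutators_derived:
  assumes "derived G (carrier G) \<subseteq> N"
  shows "commutators G (carrier G) (carrier G) \<subseteq> N"
proof
  fix c assume "c \<in> commutators G (carrier G) (carrier G)"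
  then have "c \<in> derived_set G (carrier G)" by (auto simp: commutators_def)
  then show "c \<in> N" using assms unfolding derived_def by (blast intro: generate.incl)
qed

locale abelian_fibre_product = G1: group G1 + G2: group G2
  for G1 :: "('a, 'c) monoid_scheme" and G2 :: "('b, 'd) monoid_scheme" +
  fixes N1 :: "'a set" and N2 :: "'b set" and \<mu> :: "'a set \<Rightarrow> 'b set"
  assumes N1: "subgroup N1 G1" and N2: "subgroup N2 G2"
    and comm1: "commutators G1 (carrier G1) (carrier G1) \<subseteq> N1"
    and comm2: "commutators G2 (carrier G2) (carrier G2) \<subseteq> N2"
    and \<mu>: "\<mu> \<in> iso (G1 Mod N1) (G2 Mod N2)"
begin

sublocale N1: normal N1 G1 by (rule G1.normal_if_commutators[OF N1 comm1])
sublocale N2: normal N2 G2 by (rule G2.normal_if_commutators[OF N2 comm2])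

definition H where "H = fibre_product G1 G2 N1 N2 \<mu>"

abbreviation G where "G \<equiv> G1 \<times>\<times> G2"
abbreviation HG where "HG \<equiv> G\<lparr>carrier := H\<rparr>"

sublocale G: group G by (rule DirProd_group[OF G1.is_group G2.is_group])
sublocale q1: group_hom G1 "G1 Mod N1" "\<lambda>x. N1 #>\<^bsub>G1\<^esub> x" by (rule N1.Mod_hom)
sublocale q2: group_hom G2 "G2 Mod N2" "\<lambda>x. N2 #>\<^bsub>G2\<^esub> x" by (rule N2.Mod_hom)
sublocale \<mu>: group_hom "G1 Mod N1" "G2 Mod N2" \<mu>
  using \<mu> by unfold_locales (simp add: iso_def)

lemma mem_H: "(x, y) \<in> H \<longleftrightarrow> x \<in> carrier G1 \<and> y \<in> carrier G2 \<and> \<mu> (N1 #>\<^bsub>G1\<^esub> x) = N2 #>\<^bsub>G2\<^esub> y"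
  by (auto simp: H_def fibre_product_def)

lemma mem_H_left: "(x, \<one>\<^bsub>G2\<^esub>) \<in> H \<longleftrightarrow> x \<in> N1"
proof -
  have "\<mu> (N1 #>\<^bsub>G1\<^esub> x) = N2 #>\<^bsub>G2\<^esub> \<one>\<^bsub>G2\<^esub> \<longleftrightarrow> x \<in> N1" if x: "x \<in> carrier G1"
  proof -
    have inj: "inj_on \<mu> (carrier (G1 Mod N1))" using \<mu> by (simp add: iso_def bij_betw_def)
    have "\<mu> (N1 #>\<^bsub>G1\<^esub> x) = \<mu> \<one>\<^bsub>G1 Mod N1\<^esub> \<longleftrightarrow> N1 #>\<^bsub>G1\<^esub> x = \<one>\<^bsub>G1 Mod N1\<^esub>"
      by (rule inj_on_eq_iff[OF inj q1.hom_closed[OF x] q1.H.one_closed])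
    then have "\<mu> (N1 #>\<^bsub>G1\<^esub> x) = \<one>\<^bsub>G2 Mod N2\<^esub> \<longleftrightarrow> N1 #>\<^bsub>G1\<^esub> x = \<one>\<^bsub>G1 Mod N1\<^esub>"
      unfolding \<mu>.hom_one .
    then show ?thesis using N1.Mod_eq_one_iff[OF x] q2.hom_one by simp
  qed
  then show ?thesis unfolding mem_H using N1.mem_carrier by auto
qed

lemma mem_H_right: "(\<one>\<^bsub>G1\<^esub>, y) \<in> H \<longleftrightarrow> y \<in> N2"
proof -
  have "\<mu> (N1 #>\<^bsub>G1\<^esub> \<one>\<^bsub>G1\<^esub>) = \<one>\<^bsub>G2 Mod N2\<^esub>" unfolding q1.hom_one by (rule \<mu>.hom_one)
  then have "(\<one>\<^bsub>G1\<^esub>, y) \<in> H \<longleftrightarrow> y \<in> carrier G2 \<and> N2 #>\<^bsub>G2\<^esub> y = \<one>\<^bsub>G2 Mod N2\<^esub>"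
    unfolding mem_H by auto
  then show ?thesis using N2.Mod_eq_one_iff[of y] N2.mem_carrier[of y] by blast
qed

lemma H_subgroup: "subgroup H G"
proof
  show "H \<subseteq> carrier G" by (auto simp: H_def fibre_product_def)
  show "\<one>\<^bsub>G\<^esub> \<in> H" using mem_H_left N1.one_closed by simp
  fix p assume p: "p \<in> H"
  obtain x y where xy: "p = (x, y)" by (cases p)
  then have x: "x \<in> carrier G1" and y: "y \<in> carrier G2" and e: "\<mu> (N1 #>\<^bsub>G1\<^esub> x) = N2 #>\<^bsub>G2\<^esub> y"
    using p mem_H by auto
  have "\<mu> (N1 #>\<^bsub>G1\<^esub> inv\<^bsub>G1\<^esub> x) = N2 #>\<^bsub>G2\<^esub> inv\<^bsub>G2\<^esub> y"
    unfolding q1.hom_inv[OF x] q2.hom_inv[OF y] \<mu>.hom_inv[OF q1.hom_closed[OF x]] e ..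
  then show "inv\<^bsub>G\<^esub> p \<in> H"
    unfolding xy using inv_DirProd[OF G1.is_group G2.is_group x y] mem_H x y by simp
  fix p' assume p': "p' \<in> H"
  obtain x' y' where xy': "p' = (x', y')" by (cases p')
  then have x': "x' \<in> carrier G1" and y': "y' \<in> carrier G2" and e': "\<mu> (N1 #>\<^bsub>G1\<^esub> x') = N2 #>\<^bsub>G2\<^esub> y'"
    using p' mem_H by auto
  have "\<mu> (N1 #>\<^bsub>G1\<^esub> (x \<otimes>\<^bsub>G1\<^esub> x')) = N2 #>\<^bsub>G2\<^esub> (y \<otimes>\<^bsub>G2\<^esub> y')"
    unfolding q1.hom_mult[OF x x'] q2.hom_mult[OF y y'] \<mu>.hom_mult[OF q1.hom_closed[OF x] q1.hom_closed[OF x']] e e' ..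
  then show "p \<otimes>\<^bsub>G\<^esub> p' \<in> H" unfolding xy xy' using mem_H x y x' y' by simp
qed

lemma N1_N2_H: "x \<in> N1 \<Longrightarrow> y \<in> N2 \<Longrightarrow> (x, y) \<in> H"
proof -
  assume xy: "x \<in> N1" "y \<in> N2"
  have "(x, \<one>\<^bsub>G2\<^esub>) \<otimes>\<^bsub>G\<^esub> (\<one>\<^bsub>G1\<^esub>, y) \<in> H"
    by (rule subgroup.m_closed[OF H_subgroup]) (use xy mem_H_left mem_H_right in auto)
  then show "(x, y) \<in> H" using xy by simp
qed

text \<open>A commutator in the product has its components in \<open>N1\<close> and
  \<open>N2\<close>, and \<open>H\<close> contains all such pairs.\<close>

lemma H_normal: "H \<lhd> G"
proof (rule G.normal_if_commutators[OF H_subgroup], rule subsetI)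
  fix c assume "c \<in> commutators G (carrier G) (carrier G)"
  then obtain p p' where p: "p \<in> carrier G" "p' \<in> carrier G"
    "c = p \<otimes>\<^bsub>G\<^esub> p' \<otimes>\<^bsub>G\<^esub> inv\<^bsub>G\<^esub> p \<otimes>\<^bsub>G\<^esub> inv\<^bsub>G\<^esub> p'" by (auto simp: commutators_def)
  obtain x y x' y' where xy: "p = (x, y)" "p' = (x', y')" by (cases p, cases p')
  have car: "x \<in> carrier G1" "y \<in> carrier G2" "x' \<in> carrier G1" "y' \<in> carrier G2" using p xy by auto
  have "c = (x \<otimes>\<^bsub>G1\<^esub> x' \<otimes>\<^bsub>G1\<^esub> inv\<^bsub>G1\<^esub> x \<otimes>\<^bsub>G1\<^esub> inv\<^bsub>G1\<^esub> x', y \<otimes>\<^bsub>G2\<^esub> y' \<otimes>\<^bsub>G2\<^esub> inv\<^bsub>G2\<^esub> y \<otimes>\<^bsub>G2\<^esub> inv\<^bsub>G2\<^esub> y')"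
    unfolding p(3) xy using car inv_DirProd[OF G1.is_group G2.is_group] by simp
  moreover have "x \<otimes>\<^bsub>G1\<^esub> x' \<otimes>\<^bsub>G1\<^esub> inv\<^bsub>G1\<^esub> x \<otimes>\<^bsub>G1\<^esub> inv\<^bsub>G1\<^esub> x' \<in> N1"
    using comm1 car unfolding commutators_def by blast
  moreover have "y \<otimes>\<^bsub>G2\<^esub> y' \<otimes>\<^bsub>G2\<^esub> inv\<^bsub>G2\<^esub> y \<otimes>\<^bsub>G2\<^esub> inv\<^bsub>G2\<^esub> y' \<in> N2"
    using comm2 car unfolding commutators_def by blast
  ultimately show "c \<in> H" using N1_N2_H by simp
qed

lemma H_left: "x \<in> carrier G1 \<Longrightarrow> \<exists>y. (x, y) \<in> H"
proof -
  assume x: "x \<in> carrier G1"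
  have "\<mu> (N1 #>\<^bsub>G1\<^esub> x) \<in> carrier (G2 Mod N2)" by (rule \<mu>.hom_closed[OF q1.hom_closed[OF x]])
  then obtain y where "y \<in> carrier G2" "\<mu> (N1 #>\<^bsub>G1\<^esub> x) = N2 #>\<^bsub>G2\<^esub> y" unfolding N2.Mod_surj[symmetric] by (elim imageE)
  then show ?thesis using x mem_H by blast
qed

lemma H_right: "y \<in> carrier G2 \<Longrightarrow> \<exists>x. (x, y) \<in> H"
proof -
  assume y: "y \<in> carrier G2"
  have "N2 #>\<^bsub>G2\<^esub> y \<in> \<mu> ` carrier (G1 Mod N1)"
    using \<mu> q2.hom_closed[OF y] by (simp add: iso_def bij_betw_def)
  then obtain x where "x \<in> carrier G1" "N2 #>\<^bsub>G2\<^esub> y = \<mu> (N1 #>\<^bsub>G1\<^esub> x)" unfolding N1.Mod_surj[symmetric] by (elim imageE) simp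
  then have "(x, y) \<in> H" using y mem_H by simp
  then show ?thesis by blast
qed

lemma HG_group: "group HG" by (rule G.subgroup_imp_group[OF H_subgroup])

lemma fst_hom: "group_hom HG G1 fst" and snd_hom: "group_hom HG G2 snd"
  using HG_group H_subgroup[THEN subgroup.subset] G1.is_group G2.is_group
  by (auto simp: group_hom_def group_hom_axioms_def hom_def mult_DirProd')

lemma fst_surj: "fst ` H = carrier G1"
proof
  show "fst ` H \<subseteq> carrier G1" by (auto simp: mem_H)
  show "carrier G1 \<subseteq> fst ` H"
  proof
    fix x assume "x \<in> carrier G1"
    from H_left[OF this] obtain y where "(x, y) \<in> H" by (elim exE)
    then show "x \<in> fst ` H" by (rule rev_image_eqI) simp
  qed
qed

lemma snd_surj: "snd ` H = carrier G2"
proof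
  show "snd ` H \<subseteq> carrier G2" by (auto simp: mem_H)
  show "carrier G2 \<subseteq> snd ` H"
  proof
    fix y assume "y \<in> carrier G2"
    from H_right[OF this] obtain x where "(x, y) \<in> H" by (elim exE)
    then show "y \<in> snd ` H" by (rule rev_image_eqI) simp
  qed
qed

text \<open>Lifts of generators of both factors make \<open>?W\<close> project onto both. Hence its
  intersections with the factors are normal in them, and including normal generators of
  \<open>N1\<close> and \<open>N2\<close> puts these subgroups into \<open>?W\<close>. Every element
  of \<open>H\<close> then agrees with one of \<open>?W\<close> up to \<open>N2\<close>.\<close>

lemma HG_finitely_generated:
  assumes "finitely_generated G1" "finitely_generated G2"
  shows "finitely_generated HG"
proof -
  interpret f: group_hom HG G1 fst by (rule fst_hom)
  interpret s: group_hom HG G2 snd by (rule snd_hom)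
  obtain S1 where S1: "finite S1" "S1 \<subseteq> carrier G1" "generate G1 S1 = carrier G1"
    using assms(1) unfolding finitely_generated_def by blast
  obtain S2 where S2: "finite S2" "S2 \<subseteq> carrier G2" "generate G2 S2 = carrier G2"
    using assms(2) unfolding finitely_generated_def by blast
  obtain T1 where T1: "finite T1" "T1 \<subseteq> N1" "N1 = normal_closure G1 T1"
    by (rule G1.abelian_quotient_kernel[OF assms(1) N1.normal_axioms comm1])
  obtain T2 where T2: "finite T2" "T2 \<subseteq> N2" "N2 = normal_closure G2 T2"
    by (rule G2.abelian_quotient_kernel[OF assms(2) N2.normal_axioms comm2])
  obtain L1 L2 where L: "L1 \<subseteq> H" "finite L1" "S1 = fst ` L1" "L2 \<subseteq> H" "finite L2" "S2 = snd ` L2"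
    using finite_subset_image[OF S1(1) S1(2)[folded fst_surj]] finite_subset_image[OF S2(1) S2(2)[folded snd_surj]]
    by (elim exE conjE)
  define U where "U = L1 \<union> L2 \<union> (\<lambda>x. (x, \<one>\<^bsub>G2\<^esub>)) ` T1 \<union> (\<lambda>y. (\<one>\<^bsub>G1\<^esub>, y)) ` T2"
  have U: "finite U" "U \<subseteq> H" using L T1 T2 mem_H_left mem_H_right by (auto simp: U_def)
  then have Uc: "U \<subseteq> carrier HG" by simp
  let ?W = "generate HG U"
  have W: "subgroup ?W HG" by (rule f.G.generate_is_subgroup[OF Uc])
  have WH: "?W \<subseteq> H" using subgroup.subset[OF W] by simp
  have fstW: "fst ` ?W = carrier G1"
  proof -
    have "carrier G1 \<subseteq> generate G1 (fst ` U)" unfolding S1(3)[symmetric] by (rule G1.mono_generate) (auto simp: U_def L(3))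
    moreover have "fst ` ?W \<subseteq> carrier G1" unfolding fst_surj[symmetric] by (rule image_mono[OF WH])
    ultimately show ?thesis using f.generate_img[OF Uc] by (intro equalityI) simp_all
  qed
  have sndW: "snd ` ?W = carrier G2"
  proof -
    have "carrier G2 \<subseteq> generate G2 (snd ` U)" unfolding S2(3)[symmetric] by (rule G2.mono_generate) (auto simp: U_def L(6))
    moreover have "snd ` ?W \<subseteq> carrier G2" unfolding snd_surj[symmetric] by (rule image_mono[OF WH])
    ultimately show ?thesis using s.generate_img[OF Uc] by (intro equalityI) simp_all
  qed
  have mult: "p \<otimes>\<^bsub>HG\<^esub> p' = (fst p \<otimes>\<^bsub>G1\<^esub> fst p', snd p \<otimes>\<^bsub>G2\<^esub> snd p')" for p p' by (simp add: mult_DirProd')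
  have inv: "inv\<^bsub>HG\<^esub> p = (inv\<^bsub>G1\<^esub> fst p, inv\<^bsub>G2\<^esub> snd p)" if "p \<in> H" for p
    using f.hom_inv[of p] s.hom_inv[of p] that by (simp add: prod_eq_iff)
  let ?HW = "HG\<lparr>carrier := ?W\<rparr>"
  have HW: "group ?HW" by (rule f.G.subgroup_imp_group[OF W])
  interpret fW: group_hom ?HW G1 fst
    by (intro group_hom.intro group_hom_axioms.intro HW G1.is_group homI)
      (use subsetD[OF WH] f.hom_closed f.hom_mult in simp_all)
  interpret sW: group_hom ?HW G2 snd
    by (intro group_hom.intro group_hom_axioms.intro HW G2.is_group homI)
      (use subsetD[OF WH] s.hom_closed s.hom_mult in simp_all)
  have "normal_closure G1 T1 \<subseteq> fst ` kernel ?HW G2 snd"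
    by (rule G1.normal_closure_min[OF fW.img_normal[OF _ sW.normal_kernel]])
      (use fstW in \<open>force simp: kernel_def U_def intro: generate.incl\<close>)+
  then have N1W: "(x, \<one>\<^bsub>G2\<^esub>) \<in> ?W" if "x \<in> N1" for x using that T1(3) by (force simp: kernel_def)
  have "normal_closure G2 T2 \<subseteq> snd ` kernel ?HW G1 fst"
    by (rule G2.normal_closure_min[OF sW.img_normal[OF _ fW.normal_kernel]])
      (use sndW in \<open>force simp: kernel_def U_def intro: generate.incl\<close>)+
  then have N2W: "(\<one>\<^bsub>G1\<^esub>, y) \<in> ?W" if "y \<in> N2" for y using that T2(3) by (force simp: kernel_def)
  have "H \<subseteq> ?W"
  proof
    fix p assume p: "p \<in> H"
    then have "fst p \<in> fst ` ?W" unfolding fstW using fst_surj by blast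
    then obtain w where w: "w \<in> ?W" "fst w = fst p" by force
    have wH: "w \<in> H" using w(1) WH by blast
    have car: "fst p \<in> carrier G1" "snd p \<in> carrier G2" "fst w \<in> carrier G1" "snd w \<in> carrier G2"
      using p wH fst_surj snd_surj by blast+
    let ?y = "inv\<^bsub>G2\<^esub> snd w \<otimes>\<^bsub>G2\<^esub> snd p"
    have "inv\<^bsub>HG\<^esub> w \<otimes>\<^bsub>HG\<^esub> p \<in> H"
      using f.G.m_closed[OF f.G.inv_closed, of w p] wH p by simp
    then have "(\<one>\<^bsub>G1\<^esub>, ?y) \<in> H" unfolding inv[OF wH] mult using w(2) car by simp
    then have "(\<one>\<^bsub>G1\<^esub>, ?y) \<in> ?W" using mem_H_right N2W by blast
    then have "w \<otimes>\<^bsub>HG\<^esub> (\<one>\<^bsub>G1\<^esub>, ?y) \<in> ?W" by (rule subgroup.m_closed[OF W w(1)])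
    moreover have "w \<otimes>\<^bsub>HG\<^esub> (\<one>\<^bsub>G1\<^esub>, ?y) = p" unfolding mult using car w(2) by (simp add: prod_eq_iff)
    ultimately show "p \<in> ?W" by simp
  qed
  then have "generate HG U = carrier HG" using WH by auto
  then show ?thesis unfolding finitely_generated_def using U(1) Uc by blast
qed

end

lemma finitely_presented_imp_finitely_generated:
  assumes "group G" "finitely_presented G"
  shows "finitely_generated G"
proof -
  obtain n :: nat and \<pi> R where \<pi>: "\<pi> \<in> hom (free_group {..<n}) G"
    "\<pi> ` carrier (free_group {..<n}) = carrier G" "finite R" "R \<subseteq> carrier (free_group {..<n})"
    "kernel (free_group {..<n}) G \<pi> = normal_closure (free_group {..<n}) R"
    by (rule finitely_presented_presentation[OF assms])
  interpret group_hom "free_group {..<n}" G \<pi>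
    using assms(1) \<pi>(1) by (simp add: group_hom_def group_hom_axioms_def group_free_group)
  show ?thesis by (rule finitely_generated_img[OF finitely_generated_free_group \<pi>(2)]) simp
qed

text \<open>\<open>E1\<close> and \<open>E2\<close> are one system of coordinates on
  \<open>H\<close>, seen from either factor. Letters with index in \<open>P1\<close> are lifted from
  \<open>G1\<close>, as they measure depth in \<open>N1\<close>, and those with index in
  \<open>P2\<close> from \<open>G2\<close>; in the common coordinates all of them are unit
  vectors.\<close>

theorem (in abelian_fibre_product) finitely_presented_HG:
  fixes E1 :: "nat \<Rightarrow> 'a \<Rightarrow> int" and E2 :: "nat \<Rightarrow> 'b \<Rightarrow> int" and z :: "(nat \<Rightarrow> bool) \<Rightarrow> nat \<Rightarrow> int"
    and n :: nat
  assumes fp: "finitely_presented G1" "finitely_presented G2"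
    and E1: "\<And>i. i < n \<Longrightarrow> int_hom G1 (E1 i)" and E2: "\<And>i. i < n \<Longrightarrow> int_hom G2 (E2 i)"
    and E12: "\<And>i x y. i < n \<Longrightarrow> (x, y) \<in> H \<Longrightarrow> E1 i x = E2 i y"
    and P: "P1 \<union> P2 = {..<n}" "P1 \<inter> P2 = {}"
    and e1: "\<And>j. j \<in> P1 \<Longrightarrow> e1 j \<in> carrier G1" "\<And>i j. i < n \<Longrightarrow> j \<in> P1 \<Longrightarrow> E1 i (e1 j) = (if i = j then 1 else 0)"
    and e2: "\<And>j. j \<in> P2 \<Longrightarrow> e2 j \<in> carrier G2" "\<And>i j. i < n \<Longrightarrow> j \<in> P2 \<Longrightarrow> E2 i (e2 j) = (if i = j then 1 else 0)"
    and D1: "\<And>r. \<exists>B. finite B \<and> B \<subseteq> N1 \<and> D1 r = generate G1 B"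
      "\<And>r s. r \<le> s \<Longrightarrow> D1 r \<subseteq> D1 s" "(\<Union>r. D1 r) = N1"
      "\<And>r d x. x \<in> D1 (r + d) \<Longrightarrow>
        x \<in> generate G1 (\<Union>b\<in>short_words P1 d. conj_by G1 (word_val G1 e1 b) ` D1 r)"
    and D2: "\<And>r. \<exists>A. finite A \<and> A \<subseteq> N2 \<and> D2 r = generate G2 A"
      "\<And>r s. r \<le> s \<Longrightarrow> D2 r \<subseteq> D2 s" "(\<Union>r. D2 r) = N2"
      "\<And>r d x. x \<in> D2 (r + d) \<Longrightarrow>
        x \<in> generate G2 (\<Union>b\<in>short_words P2 d. conj_by G2 (word_val G2 e2 b) ` D2 r)"
    and torsion1: "\<And>t. t \<in> carrier G1 \<Longrightarrow> \<forall>i<n. E1 i t = 0 \<Longrightarrow> \<exists>r0. \<forall>r\<ge>r0. \<forall>x\<in>D1 r. conj_by G1 t x \<in> D1 r"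
    and torsion2: "\<And>t. t \<in> carrier G2 \<Longrightarrow> \<forall>i<n. E2 i t = 0 \<Longrightarrow> \<exists>r0. \<forall>r\<ge>r0. \<forall>x\<in>D2 r. conj_by G2 t x \<in> D2 r"
    and z: "\<And>\<epsilon> c. c < n \<Longrightarrow> z \<epsilon> c \<noteq> 0 \<and> (z \<epsilon> c > 0 \<longleftrightarrow> \<epsilon> c) \<and> \<bar>z \<epsilon> c\<bar> \<le> Z" and Z: "0 \<le> Z"
    and move: "\<And>\<epsilon>.
      (\<forall>g\<in>carrier G1. (\<forall>c<n. E1 c g = z \<epsilon> c) \<longrightarrow>
        (\<exists>d. (\<forall>c\<in>P1. int d < \<bar>z \<epsilon> c\<bar>) \<and> (\<exists>r0. \<forall>r\<ge>r0. \<forall>x\<in>D1 r. conj_by G1 g x \<in> D1 (r + d)))) \<or>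
      (\<forall>g\<in>carrier G2. (\<forall>c<n. E2 c g = - z \<epsilon> c) \<longrightarrow>
        (\<exists>d. (\<forall>c\<in>P2. int d < \<bar>z \<epsilon> c\<bar>) \<and> (\<exists>r0. \<forall>r\<ge>r0. \<forall>x\<in>D2 r. conj_by G2 g x \<in> D2 (r + d))))"
  shows "finitely_presented HG"
proof -
  have fg: "finitely_generated G1" "finitely_generated G2"
    by (rule finitely_presented_imp_finitely_generated[OF G1.is_group fp(1)])
      (rule finitely_presented_imp_finitely_generated[OF G2.is_group fp(2)])
  obtain N :: nat and \<pi> where \<pi>: "\<pi> \<in> hom (free_group {..<N}) HG"
    and \<pi>_surj: "\<pi> ` carrier (free_group {..<N}) = carrier HG"
    by (rule finitely_generated_cover[OF HG_group HG_finitely_generated[OF fg]])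
  define F where "F = free_group {..<N}"
  interpret F: group F unfolding F_def by (rule group_free_group)
  interpret \<pi>: group_hom F HG \<pi>
    using \<pi> HG_group F.is_group by (simp add: F_def group_hom_def group_hom_axioms_def)
  interpret f: group_hom HG G1 fst by (rule fst_hom)
  interpret s: group_hom HG G2 snd by (rule snd_hom)
  have \<pi>_surj: "\<pi> ` carrier F = H" using \<pi>_surj by (simp add: F_def)
  have \<pi>H: "\<pi> x \<in> H" if "x \<in> carrier F" for x using \<pi>_surj that by blast
  have fgF: "finitely_generated F" unfolding F_def by (rule finitely_generated_free_group) simp
  define \<phi>1 where "\<phi>1 x = fst (\<pi> x)" for x
  define \<phi>2 where "\<phi>2 x = snd (\<pi> x)" for x
  have \<pi>_eq: "\<pi> x = (\<phi>1 x, \<phi>2 x)" for x by (simp add: \<phi>1_def \<phi>2_def)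
  interpret \<phi>1: group_hom F G1 \<phi>1
  proof (unfold_locales, rule homI)
    show "\<phi>1 x \<in> carrier G1" if "x \<in> carrier F" for x
      unfolding \<phi>1_def by (rule f.hom_closed[OF \<pi>.hom_closed[OF that]])
    show "\<phi>1 (x \<otimes>\<^bsub>F\<^esub> y) = \<phi>1 x \<otimes>\<^bsub>G1\<^esub> \<phi>1 y" if "x \<in> carrier F" "y \<in> carrier F" for x y
      unfolding \<phi>1_def \<pi>.hom_mult[OF that] by (rule f.hom_mult[OF \<pi>.hom_closed[OF that(1)] \<pi>.hom_closed[OF that(2)]])
  qed
  interpret \<phi>2: group_hom F G2 \<phi>2
  proof (unfold_locales, rule homI)
    show "\<phi>2 x \<in> carrier G2" if "x \<in> carrier F" for x
      unfolding \<phi>2_def by (rule s.hom_closed[OF \<pi>.hom_closed[OF that]])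
    show "\<phi>2 (x \<otimes>\<^bsub>F\<^esub> y) = \<phi>2 x \<otimes>\<^bsub>G2\<^esub> \<phi>2 y" if "x \<in> carrier F" "y \<in> carrier F" for x y
      unfolding \<phi>2_def \<pi>.hom_mult[OF that] by (rule s.hom_mult[OF \<pi>.hom_closed[OF that(1)] \<pi>.hom_closed[OF that(2)]])
  qed
  have lift: "\<exists>f\<in>carrier F. \<phi>1 f = x \<and> \<phi>2 f = y" if "(x, y) \<in> H" for x y
  proof -
    have "(x, y) \<in> \<pi> ` carrier F" using that \<pi>_surj by simp
    then obtain f where f: "(x, y) = \<pi> f" "f \<in> carrier F" by (elim imageE)
    then show ?thesis unfolding \<pi>_eq by (intro bexI[of _ f]) simp_all
  qed
  have \<phi>1_surj: "\<phi>1 ` carrier F = carrier G1"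
    unfolding \<phi>1_def fst_surj[symmetric] \<pi>_surj[symmetric] by (simp add: image_image)
  have \<phi>2_surj: "\<phi>2 ` carrier F = carrier G2"
    unfolding \<phi>2_def snd_surj[symmetric] \<pi>_surj[symmetric] by (simp add: image_image)
  define A where "A = kernel F G2 \<phi>2"
  define B where "B = kernel F G1 \<phi>1"
  have An: "A \<lhd> F" unfolding A_def by (rule \<phi>2.normal_kernel)
  have Bn: "B \<lhd> F" unfolding B_def by (rule \<phi>1.normal_kernel)
  obtain TA where TA: "finite TA" "TA \<subseteq> carrier F" "A = normal_closure F TA"
    unfolding A_def
    by (rule finitely_presented_kernel[OF F.is_group fgF G2.is_group fp(2) \<phi>2.homh \<phi>2_surj])
  obtain TB where TB: "finite TB" "TB \<subseteq> carrier F" "B = normal_closure F TB"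
    unfolding B_def
    by (rule finitely_presented_kernel[OF F.is_group fgF G1.is_group fp(1) \<phi>1.homh \<phi>1_surj])
  have A_iff: "x \<in> A \<longleftrightarrow> x \<in> carrier F \<and> \<phi>2 x = \<one>\<^bsub>G2\<^esub>" for x by (simp add: A_def kernel_def)
  have B_iff: "x \<in> B \<longleftrightarrow> x \<in> carrier F \<and> \<phi>1 x = \<one>\<^bsub>G1\<^esub>" for x by (simp add: B_def kernel_def)
  have \<phi>1A: "\<phi>1 ` A = N1"
  proof
    show "\<phi>1 ` A \<subseteq> N1"
    proof
      fix y assume "y \<in> \<phi>1 ` A"
      then obtain x where x: "x \<in> carrier F" "\<phi>2 x = \<one>\<^bsub>G2\<^esub>" "y = \<phi>1 x" using A_iff by blast
      then have "(y, \<one>\<^bsub>G2\<^esub>) \<in> H" using \<pi>H[OF x(1)] unfolding \<pi>_eq by simp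
      then show "y \<in> N1" using mem_H_left by blast
    qed
    show "N1 \<subseteq> \<phi>1 ` A"
    proof
      fix y assume "y \<in> N1"
      then obtain x where "x \<in> carrier F" "\<phi>1 x = y" "\<phi>2 x = \<one>\<^bsub>G2\<^esub>" using lift mem_H_left by blast
      then show "y \<in> \<phi>1 ` A" using A_iff by blast
    qed
  qed
  have \<phi>2B: "\<phi>2 ` B = N2"
  proof
    show "\<phi>2 ` B \<subseteq> N2"
    proof
      fix y assume "y \<in> \<phi>2 ` B"
      then obtain x where x: "x \<in> carrier F" "\<phi>1 x = \<one>\<^bsub>G1\<^esub>" "y = \<phi>2 x" using B_iff by blast
      then have "(\<one>\<^bsub>G1\<^esub>, y) \<in> H" using \<pi>H[OF x(1)] unfolding \<pi>_eq by simp
      then show "y \<in> N2" using mem_H_right by blast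
    qed
    show "N2 \<subseteq> \<phi>2 ` B"
    proof
      fix y assume "y \<in> N2"
      then obtain x where "x \<in> carrier F" "\<phi>1 x = \<one>\<^bsub>G1\<^esub>" "\<phi>2 x = y" using lift mem_H_right by blast
      then show "y \<in> \<phi>2 ` B" using B_iff by blast
    qed
  qed
  have comm: "commutators F (carrier F) (carrier F) \<subseteq> A <#>\<^bsub>F\<^esub> B"
  proof
    fix c assume "c \<in> commutators F (carrier F) (carrier F)"
    then obtain x y where xy: "x \<in> carrier F" "y \<in> carrier F"
      "c = x \<otimes>\<^bsub>F\<^esub> y \<otimes>\<^bsub>F\<^esub> inv\<^bsub>F\<^esub> x \<otimes>\<^bsub>F\<^esub> inv\<^bsub>F\<^esub> y" by (auto simp: commutators_def)
    have cc: "c \<in> carrier F" using xy by simp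
    have "\<phi>1 c = \<phi>1 x \<otimes>\<^bsub>G1\<^esub> \<phi>1 y \<otimes>\<^bsub>G1\<^esub> inv\<^bsub>G1\<^esub> \<phi>1 x \<otimes>\<^bsub>G1\<^esub> inv\<^bsub>G1\<^esub> \<phi>1 y" using xy by simp
    moreover have "\<phi>1 x \<in> carrier G1" "\<phi>1 y \<in> carrier G1" using xy by simp_all
    ultimately have "\<phi>1 c \<in> commutators G1 (carrier G1) (carrier G1)" unfolding commutators_def by blast
    then have "\<phi>1 c \<in> \<phi>1 ` A" using comm1 unfolding \<phi>1A by blast
    then obtain a where a: "\<phi>1 c = \<phi>1 a" "a \<in> A" by (elim imageE)
    have ac: "a \<in> carrier F" using a(2) A_iff by blast
    have "inv\<^bsub>F\<^esub> a \<otimes>\<^bsub>F\<^esub> c \<in> B" unfolding B_iff using ac cc a(1) by simp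
    moreover have "c = a \<otimes>\<^bsub>F\<^esub> (inv\<^bsub>F\<^esub> a \<otimes>\<^bsub>F\<^esub> c)" using ac cc by simp
    ultimately show "c \<in> A <#>\<^bsub>F\<^esub> B" using a(2) unfolding set_mult_def by blast
  qed
  have EH: "E1 i (\<phi>1 x) = E2 i (\<phi>2 x)" if "i < n" "x \<in> carrier F" for i x
    using E12[OF that(1)] \<pi>H[OF that(2)] unfolding \<pi>_eq by blast
  define E where "E i x = E1 i (\<phi>1 x)" for i x
  have E: "int_hom F (E i)" if "i < n" for i
    unfolding int_hom_def E_def using G1.int_hom_mult[OF E1[OF that]] by simp
  have "\<forall>j\<in>{..<n}. \<exists>x. x \<in> carrier F \<and> (j \<in> P1 \<longrightarrow> \<phi>1 x = e1 j) \<and> (j \<in> P2 \<longrightarrow> \<phi>2 x = e2 j)"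
  proof
    fix j assume j: "j \<in> {..<n}"
    show "\<exists>x. x \<in> carrier F \<and> (j \<in> P1 \<longrightarrow> \<phi>1 x = e1 j) \<and> (j \<in> P2 \<longrightarrow> \<phi>2 x = e2 j)"
    proof (cases "j \<in> P1")
      case True
      then have "e1 j \<in> \<phi>1 ` carrier F" using e1(1) \<phi>1_surj by simp
      then obtain x where "e1 j = \<phi>1 x" "x \<in> carrier F" by (elim imageE)
      then show ?thesis using True P(2) by (intro exI[of _ x]) auto
    next
      case False
      then have "e2 j \<in> \<phi>2 ` carrier F" using e2(1) \<phi>2_surj j P(1) by auto
      then obtain x where "e2 j = \<phi>2 x" "x \<in> carrier F" by (elim imageE)
      then show ?thesis using False by (intro exI[of _ x]) auto
    qed
  qed
  from bchoice[OF this] obtain e where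
    e: "\<forall>j\<in>{..<n}. e j \<in> carrier F \<and> (j \<in> P1 \<longrightarrow> \<phi>1 (e j) = e1 j) \<and> (j \<in> P2 \<longrightarrow> \<phi>2 (e j) = e2 j)" by (elim exE)
  have ec: "e j \<in> carrier F" if "j < n" for j using e that by blast
  have Ee: "E i (e j) = (if i = j then 1 else 0)" if "i < n" "j < n" for i j
  proof (cases "j \<in> P1")
    case True
    then show ?thesis using e1(2)[OF that(1) True] e that(2) by (simp add: E_def)
  next
    case False
    then have "j \<in> P2" using that(2) P(1) by blast
    then show ?thesis using e2(2)[OF that(1), of j] e that(2) EH[OF that(1) ec[OF that(2)]] by (simp add: E_def)
  qed
  interpret L: letters F e "{..<n}" using ec by unfold_locales auto
  let ?W = "lists ({..<n} \<times> (UNIV :: bool set))"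
  let ?ev = "word_val F e"
  have val: "E i (?ev w) = exp_sum (proj i w)" if "i < n" "w \<in> ?W" for i w
    unfolding L.int_hom_word_val[OF E[OF that(1)] that(2)] exp_sum_proj
    using that by (intro arg_cong[of _ _ sum_list] map_cong refl) (auto simp: Ee)
  let ?b = "\<lambda>i. [(i, True)] :: nat letter list"
  let ?w = "\<lambda>i. monomial [0..<n] (\<lambda>c. E c (?b i))"
  \<comment> \<open>A free generator differs from the monomial with the same coordinates by an
    element without coordinates. These corrections and their inverses form \<open>\<Theta>\<close>,
    which completes the letters to generators of \<open>F\<close>.\<close>
  define t where "t i = inv\<^bsub>F\<^esub> (?ev (?w i)) \<otimes>\<^bsub>F\<^esub> ?b i" for i
  have w: "?w i \<in> ?W" for i by (rule monomial_in_lists) auto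
  have bc: "?b i \<in> carrier F" if "i < N" for i using that by (simp add: F_def free_group_def)
  have tc: "t i \<in> carrier F" if "i < N" for i
    unfolding t_def using bc[OF that] L.word_val_closed[OF w[of i]] by simp
  have Et: "E c (t i) = 0" if "c < n" "i < N" for c i
  proof -
    have "E c (?ev (?w i)) = E c (?b i)" unfolding val[OF that(1) w] using that(1) by (simp add: proj_monomial)
    then show ?thesis
      unfolding t_def
      using F.int_hom_mult[OF E[OF that(1)] F.inv_closed[OF L.word_val_closed[OF w[of i]]] bc[OF that(2)]]
        F.int_hom_inv[OF E[OF that(1)] L.word_val_closed[OF w[of i]]] by simp
  qed
  define \<Theta> where "\<Theta> = t ` {..<N} \<union> m_inv F ` t ` {..<N}"
  have \<Theta>: "finite \<Theta>" "\<Theta> \<subseteq> carrier F" "\<And>t. t \<in> \<Theta> \<Longrightarrow> inv\<^bsub>F\<^esub> t \<in> \<Theta>"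
    using tc by (auto simp: \<Theta>_def)
  have E\<Theta>: "E c u = 0" if "c < n" "u \<in> \<Theta>" for c u
    using that(2) Et[OF that(1)] F.int_hom_inv[OF E[OF that(1)] tc] by (auto simp: \<Theta>_def)
  have gen: "generate F (e ` {..<n} \<union> \<Theta>) = carrier F"
  proof
    have sub: "e ` {..<n} \<union> \<Theta> \<subseteq> carrier F" using ec \<Theta>(2) by auto
    note W = F.generate_is_subgroup[OF sub]
    show "generate F (e ` {..<n} \<union> \<Theta>) \<subseteq> carrier F" by (rule F.generate_incl[OF sub])
    have "?b ` {..<N} \<subseteq> generate F (e ` {..<n} \<union> \<Theta>)"
    proof (rule image_subsetI)
      fix i assume i: "i \<in> {..<N}"
      have "?ev (?w i) \<in> generate F (e ` {..<n} \<union> \<Theta>)"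
        using L.word_val_in_generate[OF w[of i]] F.mono_generate[of "e ` {..<n}" "e ` {..<n} \<union> \<Theta>"] by blast
      moreover have "t i \<in> generate F (e ` {..<n} \<union> \<Theta>)" using i by (intro generate.incl) (simp add: \<Theta>_def)
      ultimately have "?ev (?w i) \<otimes>\<^bsub>F\<^esub> t i \<in> generate F (e ` {..<n} \<union> \<Theta>)" by (rule subgroup.m_closed[OF W])
      moreover have "?ev (?w i) \<otimes>\<^bsub>F\<^esub> t i = ?b i"
        unfolding t_def using bc[of i] L.word_val_closed[OF w[of i]] i by simp
      ultimately show "?b i \<in> generate F (e ` {..<n} \<union> \<Theta>)" by simp
    qed
    from F.generate_subgroup_incl[OF this W]
    show "carrier F \<subseteq> generate F (e ` {..<n} \<union> \<Theta>)" using generate_free_group[of "{..<N}"] by (simp add: F_def)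
  qed
  have wv1: "word_val G1 (\<phi>1 \<circ> e) b = word_val G1 e1 b" if "b \<in> short_words P1 d" for b d
    by (rule word_val_cong[of _ P1]) (use that e P(1) in auto)
  have wv2: "word_val G2 (\<phi>2 \<circ> e) b = word_val G2 e2 b" if "b \<in> short_words P2 d" for b d
    by (rule word_val_cong[of _ P2]) (use that e P(1) in auto)
  have split1: "x \<in> generate G1 (\<Union>b\<in>short_words P1 d. conj_by G1 (word_val G1 (\<phi>1 \<circ> e) b) ` D1 r)"
    if "x \<in> D1 (r + d)" for x r d
  proof -
    have "(\<Union>b\<in>short_words P1 d. conj_by G1 (word_val G1 (\<phi>1 \<circ> e) b) ` D1 r) =
        (\<Union>b\<in>short_words P1 d. conj_by G1 (word_val G1 e1 b) ` D1 r)"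
      by (rule SUP_cong[OF refl]) (simp only: wv1)
    then show ?thesis using D1(4)[OF that] by simp
  qed
  have split2: "x \<in> generate G2 (\<Union>b\<in>short_words P2 d. conj_by G2 (word_val G2 (\<phi>2 \<circ> e) b) ` D2 r)"
    if "x \<in> D2 (r + d)" for x r d
  proof -
    have "(\<Union>b\<in>short_words P2 d. conj_by G2 (word_val G2 (\<phi>2 \<circ> e) b) ` D2 r) =
        (\<Union>b\<in>short_words P2 d. conj_by G2 (word_val G2 e2 b) ` D2 r)"
      by (rule SUP_cong[OF refl]) (simp only: wv2)
    then show ?thesis using D2(4)[OF that] by simp
  qed
  have move': "(\<forall>h. has_exponents n (z \<epsilon>) h \<longrightarrow>
        (\<exists>d. (\<forall>c\<in>P1. int d < \<bar>z \<epsilon> c\<bar>) \<and>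
          (\<exists>r0. \<forall>r\<ge>r0. \<forall>x\<in>D1 r. conj_by G1 (\<phi>1 (?ev h)) x \<in> D1 (r + d)))) \<or>
      (\<forall>h. has_exponents n (z \<epsilon>) h \<longrightarrow>
        (\<exists>d. (\<forall>c\<in>P2. int d < \<bar>z \<epsilon> c\<bar>) \<and>
          (\<exists>r0. \<forall>r\<ge>r0. \<forall>x\<in>D2 r. conj_by G2 (\<phi>2 (inv\<^bsub>F\<^esub> ?ev h)) x \<in> D2 (r + d))))" for \<epsilon>
  proof -
    have hW: "h \<in> ?W" if "has_exponents n (z \<epsilon>) h" for h using that by (simp add: has_exponents_def)
    have hc: "?ev h \<in> carrier F" if "has_exponents n (z \<epsilon>) h" for h by (rule L.word_val_closed[OF hW[OF that]])
    have Eh: "E c (?ev h) = z \<epsilon> c" if "has_exponents n (z \<epsilon>) h" "c < n" for h c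
      using val[OF that(2) hW[OF that(1)]] that by (simp add: has_exponents_def)
    have 1: "\<forall>c<n. E1 c (\<phi>1 (?ev h)) = z \<epsilon> c" if "has_exponents n (z \<epsilon>) h" for h
      using Eh[OF that] by (simp add: E_def)
    \<comment> \<open>The sign changes because the inverse of the word acts on
      \<open>N2\<close>.\<close>
    have 2: "\<forall>c<n. E2 c (\<phi>2 (inv\<^bsub>F\<^esub> ?ev h)) = - z \<epsilon> c" if h: "has_exponents n (z \<epsilon>) h" for h
      using EH[OF _ F.inv_closed[OF hc[OF h]]] F.int_hom_inv[OF E hc[OF h]] Eh[OF h]
      by (simp add: E_def del: \<phi>1.hom_inv \<phi>2.hom_inv)
    from move[of \<epsilon>] show ?thesis
    proof (elim disjE)
      assume *: "\<forall>g\<in>carrier G1. (\<forall>c<n. E1 c g = z \<epsilon> c) \<longrightarrow>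
        (\<exists>d. (\<forall>c\<in>P1. int d < \<bar>z \<epsilon> c\<bar>) \<and> (\<exists>r0. \<forall>r\<ge>r0. \<forall>x\<in>D1 r. conj_by G1 g x \<in> D1 (r + d)))"
      show ?thesis
        by (intro disjI1 allI impI, rule *[THEN bspec, THEN mp, OF _ 1]) (simp_all add: hc)
    next
      assume *: "\<forall>g\<in>carrier G2. (\<forall>c<n. E2 c g = - z \<epsilon> c) \<longrightarrow>
        (\<exists>d. (\<forall>c\<in>P2. int d < \<bar>z \<epsilon> c\<bar>) \<and> (\<exists>r0. \<forall>r\<ge>r0. \<forall>x\<in>D2 r. conj_by G2 g x \<in> D2 (r + d)))"
      show ?thesis
        by (intro disjI2 allI impI, rule *[THEN bspec, THEN mp, OF _ 2]) (simp_all add: hc)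
    qed
  qed
  have \<Theta>D1: "\<exists>r0. \<forall>r\<ge>r0. \<forall>x\<in>D1 r. conj_by G1 (\<phi>1 u) x \<in> D1 r" if "u \<in> \<Theta>" for u
    by (rule torsion1) (use that \<Theta>(2) E\<Theta> in \<open>auto simp: E_def\<close>)
  have \<Theta>D2: "\<exists>r0. \<forall>r\<ge>r0. \<forall>x\<in>D2 r. conj_by G2 (\<phi>2 u) x \<in> D2 r" if "u \<in> \<Theta>" for u
  proof (rule torsion2)
    have uc: "u \<in> carrier F" using that \<Theta>(2) by blast
    then show "\<phi>2 u \<in> carrier G2" by simp
    show "\<forall>i<n. E2 i (\<phi>2 u) = 0" using E\<Theta>[OF _ that] EH[OF _ uc] by (simp add: E_def)
  qed
  have Psub: "P1 \<subseteq> {..<n}" "P2 \<subseteq> {..<n}" using P(1) by auto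
  obtain R where R: "finite R" "R \<subseteq> A \<inter> B" "\<And>M. M \<lhd> F \<Longrightarrow> R \<subseteq> M \<Longrightarrow> commutators F A B \<subseteq> M"
    by (rule finite_relations_commutators[OF \<phi>1.group_hom_axioms \<phi>2.group_hom_axioms A_def B_def comm TA TB ec \<Theta> gen Psub
        D1(1)[folded \<phi>1A] D1(2) D1(3)[folded \<phi>1A] split1 D2(1)[folded \<phi>2B] D2(2) D2(3)[folded \<phi>2B] split2 \<Theta>D1 \<Theta>D2 z Z move'])
      (assumption | rule that; assumption)+
  interpret FN: free_normal_pair "{..<N}" A B
    using An Bn unfolding F_def by (rule free_normal_pair.intro)
  have FN_AB: "FN.AB = A <#>\<^bsub>F\<^esub> B" by (simp add: FN.AB_def F_def)
  obtain R' where R': "finite R'" "R' \<subseteq> A \<inter> B"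
    "\<And>M. M \<lhd> F \<Longrightarrow> R' \<subseteq> M \<Longrightarrow> commutators F A B \<subseteq> M \<Longrightarrow> A \<inter> B \<subseteq> M"
    by (rule FN.inter_modulo_commutators[OF finite_lessThan comm[folded FN_AB, unfolded F_def] TA[unfolded F_def] TB[unfolded F_def], folded F_def])
      (rule that; assumption)
  let ?M = "normal_closure F (R \<union> R')"
  have AB: "A \<inter> B \<lhd> F" by (rule F.normal_subgroup_intersect[OF An Bn])
  have RR: "R \<union> R' \<subseteq> A \<inter> B" using R(2) R'(2) by blast
  have RRc: "R \<union> R' \<subseteq> carrier F" using RR A_iff by blast
  have M: "?M \<lhd> F" by (rule F.normal_closure_normal[OF RRc])
  have incl: "R \<subseteq> ?M" "R' \<subseteq> ?M" using F.normal_closure_incl[of "R \<union> R'"] by auto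
  have "A \<inter> B \<subseteq> ?M" by (rule R'(3)[OF M incl(2) R(3)[OF M incl(1)]])
  moreover have "?M \<subseteq> A \<inter> B" by (rule F.normal_closure_min[OF AB RR])
  moreover have "kernel F HG \<pi> = A \<inter> B"
    unfolding kernel_def using A_iff B_iff \<pi>_eq by auto
  ultimately have ker: "kernel F HG \<pi> = ?M" by blast
  show ?thesis
    by (rule finitely_presentedI[OF HG_group, of \<pi> N "R \<union> R'"])
      (use \<pi> \<pi>_surj R(1) R'(1) RRc ker in \<open>simp_all add: F_def\<close>)
qed

theorem theoremD:
  fixes G1 :: "('a, 'c) monoid_scheme" and G2 :: "('b, 'd) monoid_scheme"
    and N1 K1 :: "'a set" and N2 K2 :: "'b set" and m k :: nat
  assumes "group G1" and "group G2"
    and "finitely_presented G1" and "finitely_presented G2"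
    and "subgroup N1 G1" and "derived G1 (carrier G1) \<subseteq> N1"
    and "subgroup N2 G2" and "derived G2 (carrier G2) \<subseteq> N2"
    and "G1 Mod N1 \<cong> G2 Mod N2"
    and "subgroup K1 G1" and "N1 \<subseteq> K1"
    and "subgroup K2 G2" and "N2 \<subseteq> K2"
    and "finitely_generated (G1\<lparr>carrier := K1\<rparr>)"
    and "finitely_generated (G2\<lparr>carrier := K2\<rparr>)"
    and "co_rank G1 K1 = m" and "co_rank G2 K2 = k"
    and "k + m = torsion_free_rank (G1 Mod N1)"
    and "torsion_free_rank (G1 Mod N1) = torsion_free_rank (G2 Mod N2)"
  shows "\<exists>H. is_fibre_product G1 G2 H \<and> H \<lhd> G1 \<times>\<times> G2 \<and>
      finitely_presented ((G1 \<times>\<times> G2)\<lparr>carrier := H\<rparr>) \<and>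
      H \<inter> (carrier G1 \<times> {\<one>\<^bsub>G2\<^esub>}) = N1 \<times> {\<one>\<^bsub>G2\<^esub>} \<and>
      H \<inter> ({\<one>\<^bsub>G1\<^esub>} \<times> carrier G2) = {\<one>\<^bsub>G1\<^esub>} \<times> N2"
proof -
  interpret G1: group G1 by fact
  interpret G2: group G2 by fact
  have fg1: "finitely_generated G1" by (rule finitely_presented_imp_finitely_generated[OF assms(1,3)])
  have fg2: "finitely_generated G2" by (rule finitely_presented_imp_finitely_generated[OF assms(2,4)])
  have comm1: "commutators G1 (carrier G1) (carrier G1) \<subseteq> N1" by (rule G1.commutators_derived[OF assms(6)])
  have comm2: "commutators G2 (carrier G2) (carrier G2) \<subseteq> N2" by (rule G2.commutators_derived[OF assms(8)])
  define n where "n = m + k"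
  have rank1: "torsion_free_rank (G1 Mod N1) = n" and rank2: "torsion_free_rank (G2 Mod N2) = n"
    using assms(18,19) by (simp_all add: n_def)
  obtain \<kappa>1 where \<kappa>1: "coordinates_mod G1 N1 n \<kappa>1"
    and K1: "finitely_generated (G1\<lparr>carrier := {x \<in> carrier G1. \<forall>i<m. \<kappa>1 i x = 0}\<rparr>)"
    using G1.ex_coordinates_co_rank[OF fg1 assms(5) comm1 assms(10,11,14)] unfolding rank1 assms(16) by blast
  obtain \<nu>2 where \<nu>2: "coordinates_mod G2 N2 n \<nu>2"
    and K2: "finitely_generated (G2\<lparr>carrier := {x \<in> carrier G2. \<forall>i<k. \<nu>2 i x = 0}\<rparr>)"
    using G2.ex_coordinates_co_rank[OF fg2 assms(7) comm2 assms(12,13,15)] unfolding rank2 assms(17) by blast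
  \<comment> \<open>The coordinates that vanish on \<open>K2\<close> are moved to the end: indices
    below \<open>m\<close> belong to \<open>K1\<close> and the \<open>k\<close> remaining ones to
    \<open>K2\<close>. The two blocks are complementary since \<open>n\<close> is
    \<open>m + k\<close>.\<close>
  define \<kappa>2 where "\<kappa>2 j = (if j < m then \<nu>2 (k + j) else \<nu>2 (j - m))" for j
  have hom1: "int_hom G1 (\<kappa>1 i)" if "i < n" for i using \<kappa>1 that by (simp add: coordinates_mod_def coordinates_def)
  have hom2: "int_hom G2 (\<kappa>2 i)" if "i < n" for i
    using \<nu>2 that by (simp add: \<kappa>2_def n_def coordinates_mod_def coordinates_def)
  have \<kappa>2: "coordinates_mod G2 N2 n \<kappa>2"
  proof (rule G2.coordinates_mod_change[OF \<nu>2 assms(7) hom2])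
    fix x
    have "\<nu>2 i x = 0" if "\<forall>i<n. \<kappa>2 i x = 0" "i < n" for i
    proof (cases "i < k")
      case True
      then show ?thesis using that(1)[rule_format, of "m + i"] by (simp add: \<kappa>2_def n_def)
    next
      case False
      then have "i - k < m" "k + (i - k) = i" using that(2) by (simp_all add: n_def)
      then show ?thesis using that(1)[rule_format, of "i - k"] by (simp add: \<kappa>2_def n_def)
    qed
    moreover have "\<kappa>2 i x = 0" if "\<forall>i<n. \<nu>2 i x = 0" "i < n" for i using that by (simp add: \<kappa>2_def n_def)
    ultimately show "(\<forall>i<n. \<kappa>2 i x = 0) \<longleftrightarrow> (\<forall>i<n. \<nu>2 i x = 0)" by blast
  next
    fix z :: "nat \<Rightarrow> int"
    show "\<exists>w. \<forall>x\<in>carrier G2. (\<forall>i<n. \<nu>2 i x = w i) \<longrightarrow> (\<forall>i<n. \<kappa>2 i x = z i)"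
      by (intro exI[of _ "\<lambda>j. if j < k then z (m + j) else z (j - k)"]) (auto simp: \<kappa>2_def n_def)
  qed
  have "{x \<in> carrier G2. \<forall>i<k. \<nu>2 i x = 0} = {x \<in> carrier G2. \<forall>i\<in>{m..<n}. \<kappa>2 i x = 0}"
  proof (intro Collect_cong conj_cong refl)
    fix x show "(\<forall>i<k. \<nu>2 i x = 0) \<longleftrightarrow> (\<forall>i\<in>{m..<n}. \<kappa>2 i x = 0)"
    proof
      assume *: "\<forall>i\<in>{m..<n}. \<kappa>2 i x = 0"
      show "\<forall>i<k. \<nu>2 i x = 0"
      proof (intro allI impI)
        fix i assume "i < k"
        then show "\<nu>2 i x = 0" using *[rule_format, of "m + i"] by (simp add: \<kappa>2_def n_def)
      qed
    qed (auto simp: \<kappa>2_def n_def)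
  qed
  then have K2: "finitely_generated (G2\<lparr>carrier := {x \<in> carrier G2. \<forall>i\<in>{m..<n}. \<kappa>2 i x = 0}\<rparr>)" using K2 by simp
  have K1: "finitely_generated (G1\<lparr>carrier := {x \<in> carrier G1. \<forall>i\<in>{..<m}. \<kappa>1 i x = 0}\<rparr>)"
    using K1 by (simp add: Ball_def)
  obtain e1 where e1: "\<And>j. e1 j \<in> carrier G1" "\<And>i j. i < n \<Longrightarrow> \<kappa>1 i (e1 j) = (if i = j then 1 else 0)"
    by (rule G1.coordinates_units[OF \<kappa>1[unfolded coordinates_mod_def, THEN conjunct1]]) (rule that; assumption)
  obtain e2 where e2: "\<And>j. e2 j \<in> carrier G2" "\<And>i j. i < n \<Longrightarrow> \<kappa>2 i (e2 j) = (if i = j then 1 else 0)"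
    by (rule G2.coordinates_units[OF \<kappa>2[unfolded coordinates_mod_def, THEN conjunct1]]) (rule that; assumption)
  have P1: "{..<n} - {..<m} = {m..<n}" and P2: "{..<n} - {m..<n} = {..<m}" by (auto simp: n_def)
  have I: "{..<m} \<subseteq> {..<n}" "{m..<n} \<subseteq> {..<n}" by (auto simp: n_def)
  obtain C1 D1 where D1: "\<And>r. \<exists>A. finite A \<and> A \<subseteq> N1 \<and> D1 r = generate G1 A"
    "\<And>r s. r \<le> s \<Longrightarrow> D1 r \<subseteq> D1 s" "(\<Union>r. D1 r) = N1"
    "\<And>r d x. x \<in> D1 (r + d) \<Longrightarrow>
      x \<in> generate G1 (\<Union>b\<in>short_words {m..<n} d. conj_by G1 (word_val G1 e1 b) ` D1 r)"
    and conj1: "\<And>g. g \<in> carrier G1 \<Longrightarrow> \<forall>i<n. i \<notin> {..<m} \<longrightarrow> \<kappa>1 i g = 0 \<Longrightarrow>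
      \<exists>r0. \<forall>r\<ge>r0. \<forall>x\<in>D1 r. conj_by G1 g x \<in> D1 (r + nat (\<Sum>i\<in>{..<m}. \<bar>\<kappa>1 i g\<bar>) * C1)"
    by (rule G1.depth_filtration_coordinates[OF assms(5) comm1 \<kappa>1 I(1) K1 e1(1) e1(2), unfolded P1])
      (assumption | rule that; assumption)+
  obtain C2 D2 where D2: "\<And>r. \<exists>A. finite A \<and> A \<subseteq> N2 \<and> D2 r = generate G2 A"
    "\<And>r s. r \<le> s \<Longrightarrow> D2 r \<subseteq> D2 s" "(\<Union>r. D2 r) = N2"
    "\<And>r d x. x \<in> D2 (r + d) \<Longrightarrow>
      x \<in> generate G2 (\<Union>b\<in>short_words {..<m} d. conj_by G2 (word_val G2 e2 b) ` D2 r)"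
    and conj2: "\<And>g. g \<in> carrier G2 \<Longrightarrow> \<forall>i<n. i \<notin> {m..<n} \<longrightarrow> \<kappa>2 i g = 0 \<Longrightarrow>
      \<exists>r0. \<forall>r\<ge>r0. \<forall>x\<in>D2 r. conj_by G2 g x \<in> D2 (r + nat (\<Sum>i\<in>{m..<n}. \<bar>\<kappa>2 i g\<bar>) * C2)"
    by (rule G2.depth_filtration_coordinates[OF assms(7) comm2 \<kappa>2 I(2) K2 e2(1) e2(2), unfolded P2])
      (assumption | rule that; assumption)+
  obtain V s z Z where Z: "0 \<le> Z"
    and z: "\<And>\<epsilon> j. j < m + k \<Longrightarrow> z \<epsilon> j \<noteq> 0 \<and> (z \<epsilon> j > 0 \<longleftrightarrow> \<epsilon> j) \<and> \<bar>z \<epsilon> j\<bar> \<le> Z"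
    and types: "\<And>\<epsilon>. (\<forall>c<k. z \<epsilon> (m + c) = s * (\<Sum>i<m. V i c * z \<epsilon> i) \<and>
            int (nat (\<Sum>i<m. \<bar>z \<epsilon> i\<bar>) * C1) < \<bar>z \<epsilon> (m + c)\<bar>) \<or>
         (\<forall>i<m. z \<epsilon> i = - s * (\<Sum>c<k. V i c * z \<epsilon> (m + c)) \<and>
            int (nat (\<Sum>c<k. \<bar>z \<epsilon> (m + c)\<bar>) * C2) < \<bar>z \<epsilon> i\<bar>)"
    by (rule ex_exponents[of m k C1 C2]) (rule that; assumption)
  text \<open>Coordinates for the common basis \<open>e\<close>.\<close>
  define E1 where "E1 j x = (if j < m then \<kappa>1 j x else \<kappa>1 j x + s * (\<Sum>i<m. V i (j - m) * \<kappa>1 i x))" for j x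
  define E2 where "E2 j x = (if j < m then \<kappa>2 j x - s * (\<Sum>c<k. V j c * \<kappa>2 (m + c) x) else \<kappa>2 j x)" for j x
  \<comment> \<open>The change of coordinates is a shear. It is inverted over the integers by
    reversing the sign, as the coordinates that are added are themselves unchanged.\<close>
  have E1_inv: "\<kappa>1 j x = (if j < m then E1 j x else E1 j x - s * (\<Sum>i<m. V i (j - m) * E1 i x))" for j x
    by (simp add: E1_def)
  have E2_inv: "\<kappa>2 j x = (if j < m then E2 j x + s * (\<Sum>c<k. V j c * E2 (m + c) x) else E2 j x)" for j x
    by (simp add: E2_def)
  have E1_hom: "int_hom G1 (E1 j)" if j: "j < n" for j
    unfolding int_hom_def
  proof (intro ballI)
    fix x y assume xy: "x \<in> carrier G1" "y \<in> carrier G1"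
    have "\<kappa>1 i (x \<otimes>\<^bsub>G1\<^esub> y) = \<kappa>1 i x + \<kappa>1 i y" if "i < n" for i by (rule G1.int_hom_mult[OF hom1[OF that] xy])
    then show "E1 j (x \<otimes>\<^bsub>G1\<^esub> y) = E1 j x + E1 j y"
      using j by (simp add: E1_def n_def distrib_left sum.distrib)
  qed
  have E2_hom: "int_hom G2 (E2 j)" if j: "j < n" for j
    unfolding int_hom_def
  proof (intro ballI)
    fix x y assume xy: "x \<in> carrier G2" "y \<in> carrier G2"
    have "\<kappa>2 i (x \<otimes>\<^bsub>G2\<^esub> y) = \<kappa>2 i x + \<kappa>2 i y" if "i < n" for i by (rule G2.int_hom_mult[OF hom2[OF that] xy])
    then show "E2 j (x \<otimes>\<^bsub>G2\<^esub> y) = E2 j x + E2 j y"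
      using j by (simp add: E2_def n_def distrib_left sum.distrib)
  qed
  have E1_zero: "\<forall>i<n. \<kappa>1 i x = 0" if "\<forall>i<n. E1 i x = 0" for x
    using that by (simp add: E1_inv n_def)
  have E2_zero: "\<forall>i<n. \<kappa>2 i x = 0" if "\<forall>i<n. E2 i x = 0" for x
    using that by (simp add: E2_inv n_def)
  have E1_coord: "coordinates_mod G1 N1 n E1"
  proof (rule G1.coordinates_mod_change[OF \<kappa>1 assms(5) E1_hom])
    fix x
    have "\<forall>i<n. E1 i x = 0" if "\<forall>i<n. \<kappa>1 i x = 0" using that by (simp add: E1_def n_def)
    then show "(\<forall>i<n. E1 i x = 0) \<longleftrightarrow> (\<forall>i<n. \<kappa>1 i x = 0)" using E1_zero by blast
  next
    fix w :: "nat \<Rightarrow> int"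
    show "\<exists>v. \<forall>x\<in>carrier G1. (\<forall>i<n. \<kappa>1 i x = v i) \<longrightarrow> (\<forall>i<n. E1 i x = w i)"
      by (intro exI[of _ "\<lambda>j. if j < m then w j else w j - s * (\<Sum>i<m. V i (j - m) * w i)"])
        (simp add: E1_def n_def)
  qed
  have E2_coord: "coordinates_mod G2 N2 n E2"
  proof (rule G2.coordinates_mod_change[OF \<kappa>2 assms(7) E2_hom])
    fix x
    have "\<forall>i<n. E2 i x = 0" if "\<forall>i<n. \<kappa>2 i x = 0" using that by (simp add: E2_def n_def)
    then show "(\<forall>i<n. E2 i x = 0) \<longleftrightarrow> (\<forall>i<n. \<kappa>2 i x = 0)" using E2_zero by blast
  next
    fix w :: "nat \<Rightarrow> int"
    show "\<exists>v. \<forall>x\<in>carrier G2. (\<forall>i<n. \<kappa>2 i x = v i) \<longrightarrow> (\<forall>i<n. E2 i x = w i)"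
      by (intro exI[of _ "\<lambda>j. if j < m then w j + s * (\<Sum>c<k. V j c * w (m + c)) else w j"])
        (simp add: E2_def n_def)
  qed
  interpret N1: normal N1 G1 by (rule G1.normal_if_commutators[OF assms(5) comm1])
  interpret N2: normal N2 G2 by (rule G2.normal_if_commutators[OF assms(7) comm2])
  obtain F1 where F1: "coordinates (G1 Mod N1) n F1" "\<And>i x. i < n \<Longrightarrow> x \<in> carrier G1 \<Longrightarrow> F1 i (N1 #>\<^bsub>G1\<^esub> x) = E1 i x"
    "finite {x \<in> carrier (G1 Mod N1). \<forall>i<n. F1 i x = 0}"
    using N1.coordinates_mod_Mod[OF E1_coord] by blast
  obtain F2 where F2: "coordinates (G2 Mod N2) n F2" "\<And>i x. i < n \<Longrightarrow> x \<in> carrier G2 \<Longrightarrow> F2 i (N2 #>\<^bsub>G2\<^esub> x) = E2 i x"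
    "finite {x \<in> carrier (G2 Mod N2). \<forall>i<n. F2 i x = 0}"
    using N2.coordinates_mod_Mod[OF E2_coord] by blast
  obtain \<iota> where \<iota>: "\<iota> \<in> iso (G1 Mod N1) (G2 Mod N2)" using assms(9) by (auto simp: is_iso_def)
  obtain \<mu> where \<mu>: "\<mu> \<in> iso (G1 Mod N1) (G2 Mod N2)"
    "\<And>x i. x \<in> carrier (G1 Mod N1) \<Longrightarrow> i < n \<Longrightarrow> F2 i (\<mu> x) = F1 i x"
    by (rule iso_matching_coordinates[OF N1.comm_group_Mod[OF comm1] N2.comm_group_Mod[OF comm2] \<iota> F1(1,3) F2(1,3)])
      (rule that; assumption)
  interpret afp: abelian_fibre_product G1 G2 N1 N2 \<mu>
    by (intro abelian_fibre_product.intro abelian_fibre_product_axioms.intro assms(1,2,5,7) comm1 comm2 \<mu>(1))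
  have E12: "E1 i x = E2 i y" if "i < n" "(x, y) \<in> afp.H" for i x y
  proof -
    have xy: "x \<in> carrier G1" "y \<in> carrier G2" "\<mu> (N1 #>\<^bsub>G1\<^esub> x) = N2 #>\<^bsub>G2\<^esub> y"
      using that(2) afp.mem_H by auto
    have "E1 i x = F2 i (\<mu> (N1 #>\<^bsub>G1\<^esub> x))"
      using \<mu>(2)[OF afp.q1.hom_closed[OF xy(1)] that(1)] F1(2)[OF that(1) xy(1)] by simp
    also have "\<dots> = E2 i y" unfolding xy(3) by (rule F2(2)[OF that(1) xy(2)])
    finally show ?thesis .
  qed
  have shift: "(\<Sum>i\<in>{m..<n}. f i) = (\<Sum>c<k. f (m + c))" for f :: "nat \<Rightarrow> int"
    using sum.shift_bounds_nat_ivl[of f 0 m k] by (simp add: n_def lessThan_atLeast0 add.commute)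
  have "finitely_presented afp.HG"
  proof (rule afp.finitely_presented_HG[where ?E1.0 = E1 and ?E2.0 = E2 and n = n and ?P1.0 = "{m..<n}" and ?P2.0 = "{..<m}"
        and ?e1.0 = e1 and ?e2.0 = e2 and ?D1.0 = D1 and ?D2.0 = D2 and z = z and Z = Z])
    show "finitely_presented G1" "finitely_presented G2" by (rule assms(3), rule assms(4))
    show "int_hom G1 (E1 i)" "int_hom G2 (E2 i)" if "i < n" for i by (rule E1_hom[OF that], rule E2_hom[OF that])
    show "E1 i x = E2 i y" if "i < n" "(x, y) \<in> afp.H" for i x y by (rule E12[OF that])
    show "{m..<n} \<union> {..<m} = {..<n}" "{m..<n} \<inter> {..<m} = {}" by (auto simp: n_def)
    show "e1 j \<in> carrier G1" "e2 j \<in> carrier G2" for j by (rule e1(1), rule e2(1))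
    \<comment> \<open>For \<open>j < m\<close> the element \<open>e1 j\<close> is a \<open>q\<close>
      of the overview and has further coordinates; only the others serve as letters of
      \<open>G1\<close>.\<close>
    show "E1 i (e1 j) = (if i = j then 1 else 0)" if "i < n" "j \<in> {m..<n}" for i j
      using that e1(2) by (simp add: E1_def n_def)
    show "E2 i (e2 j) = (if i = j then 1 else 0)" if "i < n" "j \<in> {..<m}" for i j
      using that e2(2) by (simp add: E2_def n_def)
    show "0 \<le> Z" by (rule Z)
    show "z \<epsilon> c \<noteq> 0 \<and> (z \<epsilon> c > 0 \<longleftrightarrow> \<epsilon> c) \<and> \<bar>z \<epsilon> c\<bar> \<le> Z" if "c < n" for \<epsilon> c
      by (rule z) (use that in \<open>simp add: n_def\<close>)
    show "\<exists>r0. \<forall>r\<ge>r0. \<forall>x\<in>D1 r. conj_by G1 t x \<in> D1 r" if "t \<in> carrier G1" "\<forall>i<n. E1 i t = 0" for t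
      using conj1[OF that(1)] E1_zero[OF that(2)] by (simp add: n_def)
    show "\<exists>r0. \<forall>r\<ge>r0. \<forall>x\<in>D2 r. conj_by G2 t x \<in> D2 r" if "t \<in> carrier G2" "\<forall>i<n. E2 i t = 0" for t
      using conj2[OF that(1)] E2_zero[OF that(2)] by simp
  next
    fix \<epsilon>
    show "(\<forall>g\<in>carrier G1. (\<forall>c<n. E1 c g = z \<epsilon> c) \<longrightarrow>
        (\<exists>d. (\<forall>c\<in>{m..<n}. int d < \<bar>z \<epsilon> c\<bar>) \<and> (\<exists>r0. \<forall>r\<ge>r0. \<forall>x\<in>D1 r. conj_by G1 g x \<in> D1 (r + d)))) \<or>
      (\<forall>g\<in>carrier G2. (\<forall>c<n. E2 c g = - z \<epsilon> c) \<longrightarrow>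
        (\<exists>d. (\<forall>c\<in>{..<m}. int d < \<bar>z \<epsilon> c\<bar>) \<and> (\<exists>r0. \<forall>r\<ge>r0. \<forall>x\<in>D2 r. conj_by G2 g x \<in> D2 (r + d))))"
      using types[of \<epsilon>]
    proof (elim disjE)
      assume *: "\<forall>c<k. z \<epsilon> (m + c) = s * (\<Sum>i<m. V i c * z \<epsilon> i) \<and>
        int (nat (\<Sum>i<m. \<bar>z \<epsilon> i\<bar>) * C1) < \<bar>z \<epsilon> (m + c)\<bar>"
      show ?thesis
      proof (intro disjI1 ballI impI)
        fix g assume g: "g \<in> carrier G1" and Eg: "\<forall>c<n. E1 c g = z \<epsilon> c"
        \<comment> \<open>The shear takes \<open>z \<epsilon>\<close> to a vector supported on the
          first \<open>m\<close> coordinates. So \<open>g\<close> is a combination of the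
          \<open>q\<close> up to torsion and \<open>N1\<close>, and \<open>conj1\<close> bounds its
          shift.\<close>
        have small: "\<kappa>1 i g = z \<epsilon> i" if "i < m" for i using Eg that by (simp add: E1_inv n_def)
        have "\<forall>j<n. j \<notin> {..<m} \<longrightarrow> \<kappa>1 j g = 0"
        proof (intro allI impI)
          fix j assume j: "j < n" "j \<notin> {..<m}"
          obtain c where c: "j = m + c" "c < k" using j le_Suc_ex[of m j] by (auto simp: n_def)
          have "\<kappa>1 j g = z \<epsilon> j - s * (\<Sum>i<m. V i c * z \<epsilon> i)"
            unfolding c(1) using Eg c(2) by (simp add: E1_inv[of "m + c"] n_def)
          then show "\<kappa>1 j g = 0" using * c by simp
        qed
        from conj1[OF g this]
        have "\<exists>r0. \<forall>r\<ge>r0. \<forall>x\<in>D1 r. conj_by G1 g x \<in> D1 (r + nat (\<Sum>i<m. \<bar>z \<epsilon> i\<bar>) * C1)" using small by simp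
        moreover have "int (nat (\<Sum>i<m. \<bar>z \<epsilon> i\<bar>) * C1) < \<bar>z \<epsilon> j\<bar>" if "j \<in> {m..<n}" for j
        proof -
          have "j - m < k" "m + (j - m) = j" using that by (auto simp: n_def)
          then show ?thesis using *[THEN spec, THEN mp, THEN conjunct2, of "j - m"] by simp
        qed
        ultimately show "\<exists>d. (\<forall>c\<in>{m..<n}. int d < \<bar>z \<epsilon> c\<bar>) \<and> (\<exists>r0. \<forall>r\<ge>r0. \<forall>x\<in>D1 r. conj_by G1 g x \<in> D1 (r + d))"
          by blast
      qed
    next
      assume *: "\<forall>i<m. z \<epsilon> i = - s * (\<Sum>c<k. V i c * z \<epsilon> (m + c)) \<and>
        int (nat (\<Sum>c<k. \<bar>z \<epsilon> (m + c)\<bar>) * C2) < \<bar>z \<epsilon> i\<bar>"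
      show ?thesis
      proof (intro disjI2 ballI impI)
        fix g assume g: "g \<in> carrier G2" and Eg: "\<forall>c<n. E2 c g = - z \<epsilon> c"
        \<comment> \<open>The same for \<open>G2\<close> with the blocks exchanged: \<open>g\<close>
          is a combination of the \<open>p'\<close>, with coefficients
          \<open>- z \<epsilon> (m + c)\<close>.\<close>
        have large: "\<kappa>2 (m + c) g = - z \<epsilon> (m + c)" if "c < k" for c using Eg that by (simp add: E2_inv[of "m + c"] n_def)
        have "\<forall>j<n. j \<notin> {m..<n} \<longrightarrow> \<kappa>2 j g = 0"
        proof (intro allI impI)
          fix j assume j: "j < n" "j \<notin> {m..<n}"
          have jm: "j < m" using j by simp
          have "\<kappa>2 j g = - z \<epsilon> j + s * (\<Sum>c<k. V j c * - z \<epsilon> (m + c))"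
            using Eg jm by (simp add: E2_inv[of j] n_def)
          then show "\<kappa>2 j g = 0" using *[rule_format, OF jm] by (simp add: sum_negf)
        qed
        from conj2[OF g this]
        have "\<exists>r0. \<forall>r\<ge>r0. \<forall>x\<in>D2 r. conj_by G2 g x \<in> D2 (r + nat (\<Sum>c<k. \<bar>z \<epsilon> (m + c)\<bar>) * C2)"
          unfolding shift using large by simp
        then show "\<exists>d. (\<forall>c\<in>{..<m}. int d < \<bar>z \<epsilon> c\<bar>) \<and> (\<exists>r0. \<forall>r\<ge>r0. \<forall>x\<in>D2 r. conj_by G2 g x \<in> D2 (r + d))"
          using * by blast
      qed
    qed
  qed (rule D1 D2, assumption?)+
  moreover have "is_fibre_product G1 G2 afp.H"
    unfolding is_fibre_product_def using N1.normal_axioms N2.normal_axioms \<mu>(1) afp.H_def by blast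
  moreover have "afp.H \<inter> (carrier G1 \<times> {\<one>\<^bsub>G2\<^esub>}) = N1 \<times> {\<one>\<^bsub>G2\<^esub>}"
    using afp.mem_H_left N1.mem_carrier by auto
  moreover have "afp.H \<inter> ({\<one>\<^bsub>G1\<^esub>} \<times> carrier G2) = {\<one>\<^bsub>G1\<^esub>} \<times> N2"
    using afp.mem_H_right N2.mem_carrier by auto
  ultimately show ?thesis using afp.H_normal by blast
qed

end
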